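(* Let $1<p<\infty$, $p-2<\alpha<p-1$ and let $\{z_n\}$ be a Carleson-Newman sequence. Then $\{z_n\}$ is a zero set of $\mathcal{B}^{p,p}_\alpha$ if and only if there exists an outer function $O_\phi\in\mathcal{B}^{p,p}_\alpha$ such that $$\sum_n|O_\phi(z_n)|^p\,(1-|z_n|)^{\alpha+2-p}<\infty.$$
   Context: $\mathbb{D}$ is the open unit disc of $\mathbb{C}$, $\mathbb{T}$ its boundary, and $\mathcal{H}(\mathbb{D})$ the set of analytic functions in $\mathbb{D}$. For $f\in\mathcal{H}(\mathbb{D})$, $0<p<\infty$ and $0\le r<1$ let $M_p(r,f)=\left(\frac1{2\pi}\int_0^{2\pi}|f(re^{i\theta})|^p\,d\theta\right)^{1/p}$. The Hardy space $H^p$ consists of $f\in\mathcal{H}(\mathbb{D})$ with $\sup_{0\le r<1}M_p(r,f)<\infty$. For $-1<\alpha<\infty$, the space $\mathcal{B}^{p,p}_\alpha$ consists of those $f\in H^p$ with $\int_0^1M_p(r,f')^p\,(1-r)^\alpha\,dr<\infty$. An outer function for $H^p$ is a function of the form $O_\phi(z)=\exp\left(\frac1{2\pi}\int_0^{2\pi}\frac{e^{i\theta}+z}{e^{i\theta}-z}\log\phi(e^{i\theta})\,d\theta\right)$, $z\in\mathbb{D}$, where $\phi$ is a non-negative function in $L^p(\mathbb{T})$ with $\log\phi\in L^1(\mathbb{T})$. A sequence $\{z_n\}\subset\mathbb{D}$ is a zero set of $\mathcal{B}^{p,p}_\alpha$ if there is $f\in\mathcal{B}^{p,p}_\alpha$,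 not identically zero, such that $\{z:f(z)=0\}=\{z_n\}$, where each zero is repeated according to its multiplicity. A sequence $\{z_n\}\subset\mathbb{D}$ is uniformly separated if $\inf_{n}\prod_{k\ne n}\left|\frac{z_k-z_n}{1-\overline{z}_kz_n}\right|>0$; a finite union of uniformly separated sequences is called a Carleson-Newman sequence. *)

theory Defs
  imports "HOL-Complex_Analysis.Complex_Analysis"
begin

abbreviation unit_disc :: "complex set" where
  "unit_disc \<equiv> ball 0 1"

definition integral_mean :: "real \<Rightarrow> real \<Rightarrow> (complex \<Rightarrow> complex) \<Rightarrow> real" where
  "integral_mean p r f =
     (1 / (2 * pi) * (LINT \<theta>:{0..2*pi}|lborel. norm (f (of_real r * cis \<theta>)) powr p)) powr (1 / p)"

definition Hardy_space :: "real \<Rightarrow> (complex \<Rightarrow> complex) set" where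
  "Hardy_space p =
     {f. f holomorphic_on unit_disc \<and> bdd_above ((\<lambda>r. integral_mean p r f) ` {0..<1})}"

definition Besov_Hardy_space :: "real \<Rightarrow> real \<Rightarrow> (complex \<Rightarrow> complex) set" where
  "Besov_Hardy_space p \<alpha> =
     {f \<in> Hardy_space p.
       (\<integral>\<^sup>+ r \<in> {0..<1}.
          ennreal (integral_mean p r (deriv f) powr p * (1 - r) powr \<alpha>) \<partial>lborel) < \<infinity>}"

(* Since ln 0 = 0 in HOL, integrability of ln phi alone would let phi vanish on a set of
   positive measure; with the convention log 0 = -infinity, log phi in L^1 includes phi > 0 a.e. *)
definition outer_weight :: "real \<Rightarrow> (complex \<Rightarrow> real) \<Rightarrow> bool" where
  "outer_weight p \<phi> \<longleftrightarrow>
     (\<forall>w \<in> sphere 0 1. 0 \<le> \<phi> w) \<and>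
     set_borel_measurable lebesgue {0..2*pi} (\<lambda>\<theta>. \<phi> (cis \<theta>)) \<and>
     set_integrable lebesgue {0..2*pi} (\<lambda>\<theta>. \<phi> (cis \<theta>) powr p) \<and>
     (AE \<theta> in lebesgue. \<theta> \<in> {0..2*pi} \<longrightarrow> 0 < \<phi> (cis \<theta>)) \<and>
     set_integrable lebesgue {0..2*pi} (\<lambda>\<theta>. ln (\<phi> (cis \<theta>)))"

definition outer_fun :: "(complex \<Rightarrow> real) \<Rightarrow> complex \<Rightarrow> complex" where
  "outer_fun \<phi> z =
     exp (1 / (2 * of_real pi) *
       (LINT \<theta>:{0..2*pi}|lebesgue. (cis \<theta> + z) / (cis \<theta> - z) * of_real (ln (\<phi> (cis \<theta>)))))"

(* A finite or infinite sequence, possibly with repetitions, is a family z indexed by a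
   set I of naturals; the number of times a point w occurs is card {n \<in> I. z n = w}. *)

definition zero_sequence_of :: "nat set \<Rightarrow> (nat \<Rightarrow> complex) \<Rightarrow> (complex \<Rightarrow> complex) \<Rightarrow> bool" where
  "zero_sequence_of I z f \<longleftrightarrow>
     {w \<in> unit_disc. f w = 0} = z ` I \<and>
     (\<forall>w \<in> z ` I. finite {n \<in> I. z n = w} \<and> zorder f w = int (card {n \<in> I. z n = w}))"

definition zero_set_of_space :: "(complex \<Rightarrow> complex) set \<Rightarrow> nat set \<Rightarrow> (nat \<Rightarrow> complex) \<Rightarrow> bool" where
  "zero_set_of_space X I z \<longleftrightarrow>
     (\<exists>f \<in> X. (\<exists>w \<in> unit_disc. f w \<noteq> 0) \<and> zero_sequence_of I z f)"

(* The library's prodinf is unspecified for products diverging to 0. All factors lie in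
   [0, 1], so the partial products decrease and their limit always exists. *)
definition separation_product :: "nat set \<Rightarrow> (nat \<Rightarrow> complex) \<Rightarrow> nat \<Rightarrow> real" where
  "separation_product I z n =
     lim (\<lambda>N. \<Prod>k \<in> {k \<in> I. k < N \<and> k \<noteq> n}. norm ((z k - z n) / (1 - cnj (z k) * z n)))"

(* inf > 0 is spelled out by a lower bound, which also covers the empty index set. *)
definition uniformly_separated :: "nat set \<Rightarrow> (nat \<Rightarrow> complex) \<Rightarrow> bool" where
  "uniformly_separated I z \<longleftrightarrow>
     z ` I \<subseteq> unit_disc \<and> (\<exists>\<delta>>0. \<forall>n \<in> I. \<delta> \<le> separation_product I z n)"

definition Carleson_Newman :: "nat set \<Rightarrow> (nat \<Rightarrow> complex) \<Rightarrow> bool" where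
  "Carleson_Newman I z \<longleftrightarrow>
     (\<exists>m::nat. \<exists>J. I = (\<Union>j<m. J j) \<and> (\<forall>j<m. uniformly_separated (J j) z))"

end

(* Put sigma(a, w) = 1 - |(a - w) / (1 - conj(a) w)|^2. For a Carleson-Newman
   sequence, sum_n sigma(z_n, w) is bounded on the disc. Write P_w for the Poisson mean at w. In
   both directions a function f of the space is compared with its boundary values through the estimate

     int_D P_w[ |f - f(w)|^p ] (1 - |w|)^(alpha - p) dA(w)  <=  C int_D |f'|^p (1 - |w|)^alpha dA(w),

   valid for p - 2 < alpha < p - 1.

   Necessity. Let O be the outer function with |O| = |f| on the circle, so |f| <= |O| <= P[|f|].
   Applying the Schwarz-Pick lemma to functions of nonnegative real part gives
   |O'(w)| <= 8 / (1 - |w|) P_w[ |f - f(w)| ], so O lies in the space. If f(z_n) = 0 then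
   |O(z_n)|^p is at most a constant times P_w[ |f - f(w)|^p ] for all w in a disc of radius
   comparable to 1 - |z_n| around z_n, where sigma(z_n, w) >= 1/2. Averaging over these discs and
   summing with the bound on sum_n sigma(z_n, w) gives the convergence of the series.

   Sufficiency. For the Blaschke product B of the sequence, (1 - |w|) |B'(w)| is bounded by a
   constant and by a multiple of sum_n sigma(z_n, w). Splitting O(w) = (O(w) - O(z_n)) + O(z_n),
   the second term is controlled by the series, and the first by the Carleson embedding theorem
   for the measures sum_n sigma(z_n, w) delta_(z_n), which leads back to the estimate above. *)
theory Submission
  imports Defs
begin

text \<open>Both ends of the range of \<alpha> act through t = \<alpha> - p + 1, which lies strictly
  between -1 and 0: t > -1 makes the weights integrable at the circle, t < 0 makes the far part of
  the integrals decay. Moreover \<alpha> < p - 1 makes the variation of f along radii integrable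
  over the circle, so boundary values arise as dominated limits of dilates. The double integral is
  estimated for functions holomorphic beyond the closed disc, with a constant independent of the
  function, and the estimate is carried to f by Fatou's lemma along dilates.

  The Carleson embedding comes from a Littlewood-Paley inequality applied to h times every
  subproduct of the Blaschke factors: all these have the same modulus on the circle, while their
  derivatives together see every point of the sequence. This argument is quadratic; |G|^p becomes a
  square through a zero-free majorant exp(q). The bound on the sums of sigma is first found at the
  points of the sequence and then moved to the whole disc by positivity of the kernel 1 / (1 -
  conj(a) b).\<close>

section \<open>Lebesgue measure on intervals, and Jensen's inequality\<close>

text \<open>A density instead of a restricted space: the sigma-algebra stays \<open>borel\<close> on
  the whole line for every \<open>S\<close>, so a single measurability proof serves all intervals
  and both orders of integration.\<close>

definition lint :: "real set \<Rightarrow> real measure" where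
  "lint S = density lborel (\<lambda>x. ennreal (indicator S x))"

lemma sets_lint [simp, measurable_cong]: "sets (lint S) = sets borel"
  and space_lint [simp]: "space (lint S) = UNIV"
  by (simp_all add: lint_def)

lemma nn_integral_lint:
  assumes [measurable]: "S \<in> sets borel" "f \<in> borel_measurable borel"
  shows "(\<integral>\<^sup>+x. f x \<partial>lint S) = (\<integral>\<^sup>+x. f x * indicator S x \<partial>lborel)"
  unfolding lint_def by (subst nn_integral_density) (auto simp: mult.commute ennreal_indicator)

lemma AE_lint:
  assumes [measurable]: "S \<in> sets borel"
  shows "(AE x in lint S. P x) \<longleftrightarrow> (AE x in lborel. x \<in> S \<longrightarrow> P x)"
  unfolding lint_def by (subst AE_density) (auto simp: indicator_def)

lemma emeasure_lint:
  assumes [measurable]: "S \<in> sets borel" "A \<in> sets borel"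
  shows "emeasure (lint S) A = emeasure lborel (S \<inter> A)"
  unfolding lint_def
  by (subst emeasure_density) (auto simp: ennreal_indicator simp flip: indicator_inter_arith)

lemma integrable_lint:
  fixes f :: "real \<Rightarrow> 'b::{banach, second_countable_topology}"
  assumes [measurable]: "S \<in> sets borel" "f \<in> borel_measurable borel"
  shows "integrable (lint S) f \<longleftrightarrow> set_integrable lborel S f"
  unfolding lint_def set_integrable_def
  by (subst integrable_density) auto

lemma integral_lint:
  fixes f :: "real \<Rightarrow> 'b::{banach, second_countable_topology}"
  assumes [measurable]: "S \<in> sets borel" "f \<in> borel_measurable borel"
  shows "integral\<^sup>L (lint S) f = (LINT x:S|lborel. f x)"
  unfolding lint_def set_lebesgue_integral_def
  by (subst integral_density) auto

lemma sigma_finite_lint: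
  assumes [measurable]: "S \<in> sets borel"
  shows "sigma_finite_measure (lint S)"
  unfolding lint_def
  by (subst sigma_finite_measure.sigma_finite_iff_density_finite[OF sigma_finite_lborel]) auto

lemma finite_measure_lint:
  assumes [measurable]: "S \<in> sets borel" and "bounded S"
  shows "finite_measure (lint S)"
proof (rule finite_measureI)
  have "emeasure (lint S) (space (lint S)) = emeasure lborel S" by (simp add: emeasure_lint)
  then show "emeasure (lint S) (space (lint S)) \<noteq> \<infinity>"
    using emeasure_bounded_finite[OF assms(2)] by (metis infinity_ennreal_def less_irrefl)
qed

lemma integrable_lint_continuous:
  fixes f :: "real \<Rightarrow> 'b::euclidean_space"
  assumes "continuous_on {a..b} f" "f \<in> borel_measurable borel"
  shows "integrable (lint {a..b}) f"
  using assms by (subst integrable_lint) (auto intro: borel_integrable_compact simp: set_integrable_def)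

lemma integral_lint_has_integral:
  fixes f :: "real \<Rightarrow> 'b::euclidean_space"
  assumes c: "continuous_on {a..b} f" and m: "f \<in> borel_measurable borel" and h: "(f has_integral I) {a..b}"
  shows "integral\<^sup>L (lint {a..b}) f = I"
proof -
  have "set_integrable lborel {a..b} f"
    using integrable_lint_continuous[OF c m] integrable_lint[OF _ m, of "{a..b}"] by simp
  then have "(LINT x:{a..b}|lborel. f x) = integral {a..b} f"
    by (rule set_borel_integral_eq_integral)
  also have "\<dots> = I" using h by (rule integral_unique)
  finally show ?thesis using integral_lint[OF _ m, of "{a..b}"] by simp
qed

definition circ :: "real measure" where "circ = lint {0..2*pi}"
definition rad :: "real measure" where "rad = lint {0..<1}"

lemma sets_circ [simp, measurable_cong]: "sets circ = sets borel"
  and space_circ [simp]: "space circ = UNIV"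
  and sets_rad [simp, measurable_cong]: "sets rad = sets borel"
  and space_rad [simp]: "space rad = UNIV"
  by (simp_all add: circ_def rad_def)

lemma finite_measure_circ: "finite_measure circ" unfolding circ_def by (rule finite_measure_lint) auto

lemma sigma_finite_circ: "sigma_finite_measure circ"
  and sigma_finite_rad: "sigma_finite_measure rad"
  by (auto simp: circ_def rad_def intro!: sigma_finite_lint)

lemma Fubini_borel:
  assumes "sigma_finite_measure M" "sigma_finite_measure N" and sM: "sets M = sets borel" and sN: "sets N = sets borel"
    and f: "(\<lambda>(x,y). f x y) \<in> borel_measurable (borel \<Otimes>\<^sub>M borel)"
  shows "(\<integral>\<^sup>+x. \<integral>\<^sup>+y. f x y \<partial>N \<partial>M) = (\<integral>\<^sup>+y. \<integral>\<^sup>+x. f x y \<partial>M \<partial>N)"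
proof -
  interpret pair_sigma_finite M N
    unfolding pair_sigma_finite_def using assms by auto
  have "sets (M \<Otimes>\<^sub>M N) = sets (borel \<Otimes>\<^sub>M borel)" by (intro sets_pair_measure_cong sM sN)
  then have "(\<lambda>(x,y). f x y) \<in> borel_measurable (M \<Otimes>\<^sub>M N)"
    using f measurable_cong_sets by blast
  from Fubini'[OF this] show ?thesis by simp
qed

lemmas Fubini_circ = Fubini_borel[OF sigma_finite_circ sigma_finite_circ sets_circ sets_circ]

lemma measurable_cis [measurable]: "cis \<in> borel_measurable borel"
  by (intro borel_measurable_continuous_onI continuous_intros)

lemma borel_measurable_nn_integral_lint [measurable (raw)]:
  assumes S: "S \<in> sets borel"
    and f: "case_prod f \<in> borel_measurable (N \<Otimes>\<^sub>M borel)"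
  shows "(\<lambda>x. \<integral>\<^sup>+y. f x y \<partial>lint S) \<in> borel_measurable N"
proof -
  interpret sigma_finite_measure "lint S" using S by (rule sigma_finite_lint)
  have "sets (N \<Otimes>\<^sub>M lint S) = sets (N \<Otimes>\<^sub>M borel)" by (intro sets_pair_measure_cong) auto
  then have "case_prod f \<in> borel_measurable (N \<Otimes>\<^sub>M lint S)"
    using f measurable_cong_sets by blast
  then show ?thesis by (rule borel_measurable_nn_integral)
qed

lemma borel_measurable_nn_integral_circ [measurable (raw)]:
  "case_prod f \<in> borel_measurable (N \<Otimes>\<^sub>M borel) \<Longrightarrow> (\<lambda>x. \<integral>\<^sup>+y. f x y \<partial>circ) \<in> borel_measurable N"
  and borel_measurable_nn_integral_rad [measurable (raw)]:
  "case_prod f \<in> borel_measurable (N \<Otimes>\<^sub>M borel) \<Longrightarrow> (\<lambda>x. \<integral>\<^sup>+y. f x y \<partial>rad) \<in> borel_measurable N"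
  unfolding circ_def rad_def by (intro borel_measurable_nn_integral_lint; simp)+

text \<open>Jensen's inequality for the finite measure with density \<open>k\<close>, not
  normalised: the tangent of v |-> \<open>v powr p\<close> at the mean \<open>c = G / K\<close> is
  integrated against \<open>k\<close>. If \<open>h * k\<close> is not integrable, its Bochner
  integral is 0 and the case \<open>G = 0\<close> applies.\<close>

lemma power_mean:
  fixes h k :: "'a \<Rightarrow> real"
  assumes p: "p \<ge> 1" and [measurable]: "h \<in> borel_measurable M" "k \<in> borel_measurable M"
    and h: "\<And>x. h x \<ge> 0" and k: "\<And>x. k x \<ge> 0" and ik: "integrable M k"
  shows "ennreal ((\<integral>x. h x * k x \<partial>M) powr p)
    \<le> ennreal ((\<integral>x. k x \<partial>M) powr (p - 1)) * (\<integral>\<^sup>+x. ennreal (h x powr p * k x) \<partial>M)"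
proof -
  define G where "G = (\<integral>x. h x * k x \<partial>M)"
  define K where "K = (\<integral>x. k x \<partial>M)"
  have G0: "G \<ge> 0" and K0: "K \<ge> 0" unfolding G_def K_def by (simp_all add: h k)
  show ?thesis
  proof (cases "G = 0 \<or> (\<integral>\<^sup>+x. ennreal (h x powr p * k x) \<partial>M) = \<infinity>")
    case True
    then show ?thesis
    proof
      assume "G = 0" then show ?thesis unfolding G_def by simp
    next
      assume inf: "(\<integral>\<^sup>+x. ennreal (h x powr p * k x) \<partial>M) = \<infinity>"
      \<comment> \<open>In \<open>ennreal\<close>, 0 times infinity is 0, so the infinite right
        factor settles the claim only once \<open>K\<close> is known to be positive.\<close>
      have "K \<noteq> 0"
      proof
        assume "K = 0"
        then have "AE x in M. k x = 0" unfolding K_def using ik k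
          by (simp add: integral_nonneg_eq_0_iff_AE)
        then have "AE x in M. ennreal (h x powr p * k x) = 0" by auto
        then have "(\<integral>\<^sup>+x. ennreal (h x powr p * k x) \<partial>M) = 0"
          by (subst nn_integral_0_iff_AE) auto
        then show False using inf by simp
      qed
      then have "K powr (p-1) > 0" using K0 by simp
      then show ?thesis using inf unfolding K_def by (simp add: ennreal_mult_top)
    qed
  next
    case False
    then have Gpos: "G > 0" and fin: "(\<integral>\<^sup>+x. ennreal (h x powr p * k x) \<partial>M) < \<infinity>"
      using G0 by (auto simp: less_top)
    have ihk: "integrable M (\<lambda>x. h x * k x)"
      using Gpos not_integrable_integral_eq unfolding G_def by force
    have ip: "integrable M (\<lambda>x. h x powr p * k x)"
      by (rule integrableI_nonneg) (use fin k in auto)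
    have Kpos: "K > 0"
    proof (rule ccontr)
      assume "\<not> K > 0"
      then have "K = 0" using K0 by simp
      then have "AE x in M. k x = 0" unfolding K_def using ik k
        by (simp add: integral_nonneg_eq_0_iff_AE)
      then have "AE x in M. h x * k x = 0" by auto
      then have "G = 0" unfolding G_def by (simp add: integral_eq_zero_AE)
      then show False using Gpos by simp
    qed
    define c where "c = G / K"
    have c: "c > 0" unfolding c_def using Gpos Kpos by simp
    have tangent: "p * c powr (p-1) * v - (p-1) * c powr p \<le> v powr p" if "v \<ge> 0" for v
    proof (cases "v = 0")
      case True then show ?thesis using p c by simp
    next
      case False
      define y where "y = v / c"
      have y: "y > 0" "v = c * y" using False that c by (auto simp: y_def)
      \<comment> \<open>Bernoulli's inequality, obtained as the weighted arithmetic-geometric mean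
        inequality for \<open>y powr p\<close> and 1 with weights 1/p and 1 - 1/p.\<close>
      have "1 + p * (y - 1) \<le> y powr p"
      proof -
        have "(y powr p) powr (1/p) * 1 powr (1 - 1/p) \<le> 1/p * y powr p + (1 - 1/p) * 1"
          using Youngs_inequality_0[of "1/p" "1 - 1/p" "y powr p" 1] y p by auto
        then have "y \<le> 1/p * y powr p + (1 - 1/p)" using y p by (simp add: powr_powr)
        then have "p * y \<le> p * (1/p * y powr p + (1 - 1/p))" using p by (intro mult_left_mono) auto
        also have "\<dots> = y powr p + p - 1" using p by (simp add: distrib_left right_diff_distrib)
        finally show ?thesis by (simp add: right_diff_distrib)
      qed
      then have "c powr p * (1 + p * (y-1)) \<le> c powr p * y powr p" by (simp add: mult_left_mono)
      moreover have "c powr p = c * c powr (p-1)" using c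
        by (metis powr_mult_base less_eq_real_def add.commute diff_add_cancel)
      ultimately show ?thesis using y c by (simp add: powr_mult algebra_simps)
    qed
    have "(\<integral>x. p * c powr (p-1) * (h x * k x) - (p-1) * c powr p * k x \<partial>M)
        \<le> (\<integral>x. h x powr p * k x \<partial>M)"
    proof (rule integral_mono)
      fix x
      have "(p * c powr (p-1) * h x - (p-1) * c powr p) * k x \<le> h x powr p * k x"
        by (rule mult_right_mono[OF tangent]) (auto simp: h k)
      then show "p * c powr (p-1) * (h x * k x) - (p-1) * c powr p * k x \<le> h x powr p * k x"
        by (simp add: algebra_simps)
    qed (use ihk ik ip in auto)
    then have "p * c powr (p-1) * G - (p-1) * c powr p * K \<le> (\<integral>x. h x powr p * k x \<partial>M)"
      using ihk ik by (simp add: G_def K_def)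
    moreover have "c powr p * K = c powr (p-1) * G"
    proof -
      have "c powr p = c powr (p-1) * c" using c
        by (metis powr_mult_base less_eq_real_def add.commute diff_add_cancel mult.commute)
      then show ?thesis using Kpos by (simp add: c_def)
    qed
    then have "(p-1) * c powr p * K = (p-1) * (c powr (p-1) * G)" by (simp add: mult.assoc)
    ultimately have "c powr (p-1) * G \<le> (\<integral>x. h x powr p * k x \<partial>M)" by (simp add: algebra_simps)
    then have "K powr (p-1) * (c powr (p-1) * G) \<le> K powr (p-1) * (\<integral>x. h x powr p * k x \<partial>M)"
      by (intro mult_left_mono) auto
    moreover have "K powr (p-1) * (c powr (p-1) * G) = G powr p"
    proof -
      have "K powr (p-1) * c powr (p-1) = G powr (p-1)"
        using Kpos Gpos by (simp add: c_def flip: powr_mult)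
      then show ?thesis using Gpos
        by (metis powr_mult_base less_eq_real_def add.commute diff_add_cancel mult.commute mult.assoc)
    qed
    ultimately have "G powr p \<le> K powr (p-1) * (\<integral>x. h x powr p * k x \<partial>M)" by simp
    moreover have "ennreal (\<integral>x. h x powr p * k x \<partial>M) = (\<integral>\<^sup>+x. ennreal (h x powr p * k x) \<partial>M)"
      using ip k by (simp add: nn_integral_eq_integral)
    ultimately show ?thesis unfolding G_def K_def
      by (metis ennreal_leI ennreal_mult' powr_ge_zero)
  qed
qed

section \<open>Poisson integrals\<close>

text \<open>The Poisson kernel without the factor 1/(2 pi): its mass over the circle is
  \<open>2 * pi\<close>, and every mean below divides by that number explicitly.\<close>

definition pk :: "complex \<Rightarrow> real \<Rightarrow> real" where
  "pk z \<tau> = (1 - (norm z)\<^sup>2) / (norm (cis \<tau> - z))\<^sup>2"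

lemma measurable_pk [measurable (raw)]:
  assumes [measurable]: "f \<in> borel_measurable M" "g \<in> borel_measurable M"
  shows "(\<lambda>x. pk (f x) (g x)) \<in> borel_measurable M"
  unfolding pk_def by measurable

lemma cis_neq: "norm z < 1 \<Longrightarrow> cis \<tau> \<noteq> z"
  using norm_cis by fastforce

lemma norm_cis_diff_ge: "norm (cis \<tau> - z) \<ge> 1 - norm z"
  using norm_triangle_ineq2[of "cis \<tau>" z] by simp

lemma pk_nonneg: "norm z \<le> 1 \<Longrightarrow> pk z \<tau> \<ge> 0"
  unfolding pk_def by (simp add: abs_square_le_1)

lemma pk_pos: "norm z < 1 \<Longrightarrow> pk z \<tau> > 0"
  unfolding pk_def using cis_neq[of z \<tau>] by (simp add: abs_square_less_1)

lemma continuous_pk: "norm z < 1 \<Longrightarrow> continuous_on A (pk z)"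
  unfolding pk_def[abs_def] by (intro continuous_intros) (auto simp: cis_neq)

lemma pk_le: "norm z < 1 \<Longrightarrow> pk z \<tau> \<le> 2 / (1 - norm z)"
proof -
  assume z: "norm z < 1"
  have "pk z \<tau> \<le> (1 - (norm z)\<^sup>2) / (1 - norm z)\<^sup>2"
    unfolding pk_def using z norm_cis_diff_ge[of z \<tau>]
    by (intro divide_left_mono power_mono) (auto simp: abs_square_le_1 cis_neq)
  also have "\<dots> = (1 + norm z) / (1 - norm z)"
  proof -
    have "1 - (norm z)\<^sup>2 = (1 - norm z) * (1 + norm z)" by (simp add: power2_eq_square algebra_simps)
    then show ?thesis using z by (simp add: power2_eq_square)
  qed
  also have "\<dots> \<le> 2 / (1 - norm z)" using z by (intro divide_right_mono) auto
  finally show ?thesis .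
qed

text \<open>For a fixed radius the kernel is an even function of the difference of the angles. This
  is what gives it mass \<open>2 * pi\<close> in the angle of the interior point too, as needed
  after Fubini.\<close>

lemma pk_symmetric: "0 \<le> r \<Longrightarrow> pk (of_real r * cis \<theta>) \<tau> = pk (of_real r * cis \<tau>) \<theta>"
proof -
  assume "0 \<le> r"
  have "norm (cis \<tau> - of_real r * cis \<theta>) = norm (cis (\<tau> - \<theta>) - of_real r)"
  proof -
    have "cis \<tau> - of_real r * cis \<theta> = cis \<theta> * (cis (\<tau> - \<theta>) - of_real r)"
      by (simp add: algebra_simps cis_mult)
    then show ?thesis by (simp add: norm_mult)
  qed
  also have "\<dots> = norm (cnj (cis (\<tau> - \<theta>) - of_real r))" by (simp only: complex_mod_cnj)
  also have "\<dots> = norm (cis (\<theta> - \<tau>) - of_real r)" by (simp add: cis_cnj)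
  also have "\<dots> = norm (cis \<theta> - of_real r * cis \<tau>)"
  proof -
    have "cis \<theta> - of_real r * cis \<tau> = cis \<tau> * (cis (\<theta> - \<tau>) - of_real r)"
      by (simp add: algebra_simps cis_mult)
    then show ?thesis by (simp add: norm_mult)
  qed
  finally show ?thesis by (simp add: pk_def norm_mult)
qed

text \<open>Cauchy's formula at \<open>z\<close> for \<open>G\<close>, which is \<open>F\<close>
  times a factor holomorphic in the disc and equal to 1 at \<open>z\<close>. On the circle this
  factor turns the Cauchy kernel into the Poisson kernel.\<close>

lemma Poisson_formula:
  fixes F :: "complex \<Rightarrow> complex"
  assumes cont: "continuous_on (cball 0 1) F" and hol: "F holomorphic_on ball 0 1" and z: "norm z < 1"
  shows "((\<lambda>t. of_real (pk z t) * F (cis t)) has_integral (2 * pi * F z)) {0..2*pi}"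
proof -
  define G where "G = (\<lambda>w. F w * of_real (1 - (norm z)\<^sup>2) / (1 - cnj z * w))"
  have nz: "1 - cnj z * w \<noteq> 0" if "norm w \<le> 1" for w
  proof
    assume "1 - cnj z * w = 0"
    then have "norm (cnj z * w) = 1" by (metis norm_one eq_iff_diff_eq_0)
    moreover have "norm (cnj z * w) \<le> norm z * 1"
      unfolding norm_mult complex_mod_cnj by (intro mult_left_mono that) auto
    ultimately show False using z by simp
  qed
  have "((\<lambda>u. G u / (u - z)) has_contour_integral (2 * of_real pi * \<i> * G z)) (circlepath 0 1)"
  proof (rule Cauchy_integral_circlepath)
    show "continuous_on (cball 0 1) G" unfolding G_def
      by (intro continuous_intros cont) (use nz in auto)
    show "G holomorphic_on ball 0 1" unfolding G_def
      by (intro holomorphic_intros hol) (use nz in \<open>auto simp: less_imp_le\<close>)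
    show "norm (z - 0) < 1" using z by simp
  qed
  moreover have "G z = F z"
  proof -
    have "1 - cnj z * z = of_real (1 - (norm z)\<^sup>2)" by (metis complex_norm_square mult.commute of_real_1 of_real_diff)
    moreover have "of_real (1 - (norm z)\<^sup>2) \<noteq> (0::complex)"
      using z nz[of z] calculation by auto
    ultimately show ?thesis unfolding G_def by simp
  qed
  ultimately have "((\<lambda>u. G u / (u - z)) has_contour_integral (2 * of_real pi * \<i> * F z))
     (part_circlepath 0 1 0 (2*pi))" by (simp add: circlepath_def)
  then have *: "((\<lambda>t. G (cis t) / (cis t - z) * \<i> * cis t) has_integral (2 * of_real pi * \<i> * F z)) {0..2*pi}"
    by (subst (asm) has_contour_integral_part_circlepath_iff) (auto)
  have **: "G (cis t) / (cis t - z) * \<i> * cis t = \<i> * (of_real (pk z t) * F (cis t))" for t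
  proof -
    have 1: "cis t * cnj (cis t) = 1" by (simp add: cis_cnj cis_mult)
    have "of_real ((norm (cis t - z))\<^sup>2) = (cis t - z) * (cnj (cis t) - cnj z)"
      by (simp add: complex_norm_square del: of_real_power)
    moreover have "(cnj (cis t) - cnj z) * cis t = 1 - cnj z * cis t" using 1 by (simp add: algebra_simps)
    ultimately have "of_real ((norm (cis t - z))\<^sup>2) * cis t = (cis t - z) * (1 - cnj z * cis t)"
      by (simp add: mult.assoc)
    moreover have "(cis t - z) \<noteq> 0" "1 - cnj z * cis t \<noteq> 0" "of_real ((norm (cis t - z))\<^sup>2) \<noteq> (0::complex)"
      using cis_neq[OF z, of t] nz[of "cis t"] by auto
    ultimately have "cis t / ((cis t - z) * (1 - cnj z * cis t)) = 1 / of_real ((norm (cis t - z))\<^sup>2)"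
      by (simp add: divide_simps mult.commute)
    moreover have "G (cis t) / (cis t - z) * \<i> * cis t = \<i> * (F (cis t) * of_real (1 - (norm z)\<^sup>2) *
        (cis t / ((cis t - z) * (1 - cnj z * cis t))))"
      unfolding G_def by (simp add: mult_ac)
    ultimately show ?thesis unfolding pk_def by simp
  qed
  have "((\<lambda>t. \<i> * (of_real (pk z t) * F (cis t))) has_integral (\<i> * (2 * pi * F z))) {0..2*pi}"
    using * unfolding ** by (simp add: mult_ac)
  from has_integral_mult_right[OF this, of "-\<i>"] show ?thesis by (simp add: mult.assoc[symmetric])
qed

lemma Poisson_integral:
  fixes F :: "complex \<Rightarrow> complex"
  assumes cont: "continuous_on (cball 0 1) F" and hol: "F holomorphic_on ball 0 1" and z: "norm z < 1"
  shows "integrable circ (\<lambda>t. of_real (pk z t) * F (cis t))"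
    "(\<integral>t. of_real (pk z t) * F (cis t) \<partial>circ) = 2 * pi * F z"
proof -
  have "continuous_on UNIV (\<lambda>t. F (cis t))"
    by (rule continuous_on_compose2[OF cont]) (auto intro!: continuous_intros)
  then have c: "continuous_on UNIV (\<lambda>t. of_real (pk z t) * F (cis t))"
    by (intro continuous_intros continuous_pk z)
  then have m: "(\<lambda>t. of_real (pk z t) * F (cis t)) \<in> borel_measurable borel"
    by (rule borel_measurable_continuous_onI)
  show "integrable circ (\<lambda>t. of_real (pk z t) * F (cis t))"
    unfolding circ_def by (rule integrable_lint_continuous[OF continuous_on_subset[OF c] m]) auto
  show "(\<integral>t. of_real (pk z t) * F (cis t) \<partial>circ) = 2 * pi * F z"
    unfolding circ_def by (rule integral_lint_has_integral[OF continuous_on_subset[OF c] m Poisson_formula[OF assms]]) auto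
qed

lemma pk_integral:
  assumes z: "norm z < 1"
  shows "integrable circ (pk z)" "(\<integral>t. pk z t \<partial>circ) = 2 * pi"
proof -
  have "integrable circ (\<lambda>t. of_real (pk z t) * (1::complex))"
    and "(\<integral>t. of_real (pk z t) * (1::complex) \<partial>circ) = 2 * pi"
    using Poisson_integral[of "\<lambda>_. 1" z] z by auto
  then have i: "complex_integrable circ (\<lambda>t. of_real (pk z t))"
    and e: "(\<integral>t. complex_of_real (pk z t) \<partial>circ) = of_real (2 * pi)" by simp_all
  show "integrable circ (pk z)" using i by (simp only: complex_of_real_integrable_eq)
  show "(\<integral>t. pk z t \<partial>circ) = 2 * pi" using e by (simp only: integral_complex_of_real of_real_eq_iff)
qed

lemma pk_nn_integral: "norm z < 1 \<Longrightarrow> (\<integral>\<^sup>+t. ennreal (pk z t) \<partial>circ) = ennreal (2 * pi)"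
  using pk_integral[of z] by (subst nn_integral_eq_integral) (auto simp: pk_nonneg less_imp_le)

lemma pk_nn_integral_center:
  assumes "0 \<le> r" "r < 1"
  shows "(\<integral>\<^sup>+\<theta>. ennreal (pk (of_real r * cis \<theta>) \<tau>) \<partial>circ) = ennreal (2 * pi)"
  using pk_nn_integral[of "of_real r * cis \<tau>"] assms by (simp add: pk_symmetric norm_mult)

lemma Poisson_power_mean:
  assumes p: "p \<ge> 1" and [measurable]: "h \<in> borel_measurable borel" and h: "\<And>x. 0 \<le> h x" and z: "norm z < 1"
  shows "ennreal (((\<integral>t. pk z t * h t \<partial>circ) / (2*pi)) powr p) \<le>
     ennreal (1/(2*pi)) * (\<integral>\<^sup>+t. ennreal (pk z t * h t powr p) \<partial>circ)"
proof -
  have "ennreal ((\<integral>t. h t * pk z t \<partial>circ) powr p)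
      \<le> ennreal ((\<integral>t. pk z t \<partial>circ) powr (p - 1)) * (\<integral>\<^sup>+t. ennreal (h t powr p * pk z t) \<partial>circ)"
    by (rule power_mean[OF p]) (use h z pk_integral in \<open>auto simp: pk_nonneg\<close>)
  then have "ennreal ((\<integral>t. pk z t * h t \<partial>circ) powr p)
      \<le> ennreal ((2*pi) powr (p - 1)) * (\<integral>\<^sup>+t. ennreal (pk z t * h t powr p) \<partial>circ)" (is "_ \<le> _ * ?I")
    using z by (simp add: mult.commute pk_integral)
  then have "ennreal ((2*pi) powr (-p)) * ennreal ((\<integral>t. pk z t * h t \<partial>circ) powr p)
      \<le> ennreal ((2*pi) powr (-p)) * (ennreal ((2*pi) powr (p - 1)) * ?I)"
    by (intro mult_left_mono) auto
  also have "\<dots> = ennreal ((2*pi) powr (-p) * (2*pi) powr (p - 1)) * ?I"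
    by (simp add: ennreal_mult mult.assoc)
  also have "(2*pi) powr (-p) * (2*pi) powr (p - 1) = 1/(2*pi)"
    unfolding powr_add[symmetric] by (simp add: powr_neg_one)
  also have "ennreal ((2*pi) powr (-p)) * ennreal ((\<integral>t. pk z t * h t \<partial>circ) powr p)
     = ennreal (((\<integral>t. pk z t * h t \<partial>circ) / (2*pi)) powr p)"
  proof -
    have "(\<integral>t. pk z t * h t \<partial>circ) \<ge> 0" by (simp add: pk_nonneg h z less_imp_le)
    then show ?thesis by (simp add: powr_divide powr_minus field_simps flip: ennreal_mult)
  qed
  finally show ?thesis .
qed

text \<open>The Poisson formula gives the case of exponent 1 after taking norms inside; Jensen's
  inequality raises it to the power \<open>p\<close>.\<close>

lemma Poisson_subharmonic:
  fixes F :: "complex \<Rightarrow> complex"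
  assumes cont: "continuous_on (cball 0 1) F" and hol: "F holomorphic_on ball 0 1" and z: "norm z < 1"
    and p: "p \<ge> 1"
  shows "ennreal (norm (F z) powr p) \<le> ennreal (1/(2*pi)) * (\<integral>\<^sup>+t. ennreal (pk z t * norm (F (cis t)) powr p) \<partial>circ)"
proof -
  have "continuous_on UNIV (\<lambda>t. F (cis t))"
    by (rule continuous_on_compose2[OF cont]) (auto intro!: continuous_intros)
  then have m [measurable]: "(\<lambda>t. F (cis t)) \<in> borel_measurable borel"
    by (rule borel_measurable_continuous_onI)
  have "2 * pi * norm (F z) = norm (\<integral>t. of_real (pk z t) * F (cis t) \<partial>circ)"
    by (simp add: Poisson_integral[OF cont hol z] norm_mult)
  also have "\<dots> \<le> (\<integral>t. norm (of_real (pk z t) * F (cis t)) \<partial>circ)"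
    by (rule integral_norm_bound)
  also have "\<dots> = (\<integral>t. pk z t * norm (F (cis t)) \<partial>circ)"
    using z by (simp add: norm_mult pk_nonneg)
  finally have "norm (F z) \<le> (\<integral>t. pk z t * norm (F (cis t)) \<partial>circ) / (2*pi)" by (simp add: field_simps)
  then have "norm (F z) powr p \<le> ((\<integral>t. pk z t * norm (F (cis t)) \<partial>circ) / (2*pi)) powr p"
    using p by (intro powr_mono2) auto
  then have "ennreal (norm (F z) powr p) \<le> ennreal (((\<integral>t. pk z t * norm (F (cis t)) \<partial>circ) / (2*pi)) powr p)"
    by (rule ennreal_leI)
  also have "\<dots> \<le> ennreal (1/(2*pi)) * (\<integral>\<^sup>+t. ennreal (pk z t * norm (F (cis t)) powr p) \<partial>circ)"
    by (rule Poisson_power_mean[OF p]) (use z in auto)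
  finally show ?thesis .
qed

text \<open>The sub-mean-value inequality is integrated over the angle of the interior point; after
  Fubini the kernel integrates to \<open>2 * pi\<close> by \<open>pk_nn_integral_center\<close>,
  which cancels the normalisation.\<close>

lemma circle_mean_mono_unit:
  fixes F :: "complex \<Rightarrow> complex"
  assumes cont: "continuous_on (cball 0 1) F" and hol: "F holomorphic_on ball 0 1" and r: "0 \<le> r" "r < 1"
    and p: "p \<ge> 1" and [measurable]: "F \<in> borel_measurable borel"
  shows "(\<integral>\<^sup>+\<theta>. ennreal (norm (F (of_real r * cis \<theta>)) powr p) \<partial>circ) \<le> (\<integral>\<^sup>+\<theta>. ennreal (norm (F (cis \<theta>)) powr p) \<partial>circ)"
proof -
  have pkn: "pk (of_real r * cis \<theta>) t \<ge> 0" for \<theta> t using r by (intro pk_nonneg) (auto simp: norm_mult)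
  have "(\<integral>\<^sup>+\<theta>. ennreal (norm (F (of_real r * cis \<theta>)) powr p) \<partial>circ) \<le>
    (\<integral>\<^sup>+\<theta>. ennreal (1/(2*pi)) * (\<integral>\<^sup>+t. ennreal (pk (of_real r * cis \<theta>) t * norm (F (cis t)) powr p) \<partial>circ) \<partial>circ)"
    by (intro nn_integral_mono Poisson_subharmonic[OF cont hol _ p]) (use r in \<open>auto simp: norm_mult\<close>)
  also have "\<dots> = ennreal (1/(2*pi)) * (\<integral>\<^sup>+\<theta>. (\<integral>\<^sup>+t. ennreal (pk (of_real r * cis \<theta>) t * norm (F (cis t)) powr p) \<partial>circ) \<partial>circ)"
    by (rule nn_integral_cmult) measurable
  also have "(\<integral>\<^sup>+\<theta>. (\<integral>\<^sup>+t. ennreal (pk (of_real r * cis \<theta>) t * norm (F (cis t)) powr p) \<partial>circ) \<partial>circ)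
    = (\<integral>\<^sup>+t. (\<integral>\<^sup>+\<theta>. ennreal (pk (of_real r * cis \<theta>) t * norm (F (cis t)) powr p) \<partial>circ) \<partial>circ)"
    by (rule Fubini_circ) measurable
  also have "\<dots> = (\<integral>\<^sup>+t. ennreal (2*pi) * ennreal (norm (F (cis t)) powr p) \<partial>circ)"
    by (intro nn_integral_cong) (simp add: ennreal_mult pkn nn_integral_multc pk_nn_integral_center r)
  also have "\<dots> = ennreal (2*pi) * (\<integral>\<^sup>+t. ennreal (norm (F (cis t)) powr p) \<partial>circ)"
    by (rule nn_integral_cmult) measurable
  finally show ?thesis
    by (simp flip: ennreal_mult mult.assoc)
qed

section \<open>Differences against boundary values\<close>

lemma nn_integral_powr_0:
  assumes "a > -1" "c \<ge> 0"
  shows "(\<integral>\<^sup>+y. ennreal (y powr a) \<partial>lint {0..c}) = ennreal (c powr (a+1) / (a+1))"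
  by (subst nn_integral_lint, simp, simp)
     (rule nn_integral_has_integral_lebesgue'[OF _ has_integral_powr_from_0[OF assms]], simp)

lemma nn_integral_powr_inf:
  assumes "e < -1" "c > 0"
  shows "(\<integral>\<^sup>+y. ennreal (y powr e) \<partial>lint {c..}) = ennreal (c powr (e+1) / (- e - 1))"
proof -
  have "- (c powr (e+1)) / (e+1) = c powr (e+1) / (- e - 1)"
    by (metis minus_add_distrib minus_divide_left minus_divide_right uminus_add_conv_diff add.commute)
  then show ?thesis
    by (subst nn_integral_lint, simp, simp)
     (use nn_integral_has_integral_lebesgue'[OF _ has_integral_powr_to_inf[OF assms]] in simp)
qed

lemma integrable_powr_0:
  assumes "a > -1" "c \<ge> 0"
  shows "integrable (lint {0..c}) (\<lambda>y. y powr a)" "(\<integral>y. y powr a \<partial>lint {0..c}) = c powr (a+1) / (a+1)"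
proof -
  show i: "integrable (lint {0..c}) (\<lambda>y. y powr a)"
    by (rule integrableI_nonneg) (auto simp: nn_integral_powr_0 assms)
  have "ennreal (\<integral>y. y powr a \<partial>lint {0..c}) = ennreal (c powr (a+1) / (a+1))"
    using nn_integral_powr_0[OF assms] by (subst nn_integral_eq_integral[OF i, symmetric]) auto
  then show "(\<integral>y. y powr a \<partial>lint {0..c}) = c powr (a+1) / (a+1)"
    using assms by (subst (asm) ennreal_inj) auto
qed

lemma nn_integral_lint_mono_set:
  assumes "S \<in> sets borel" "S' \<in> sets borel" "S \<subseteq> S'" "f \<in> borel_measurable borel"
  shows "(\<integral>\<^sup>+x. f x \<partial>lint S) \<le> (\<integral>\<^sup>+x. f x \<partial>lint S')"
  using assms by (simp add: nn_integral_lint) (intro nn_integral_mono, auto simp: indicator_def)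

lemma nn_integral_lint_mono:
  assumes "S \<in> sets borel" "\<And>x. x \<in> S \<Longrightarrow> f x \<le> g x"
  shows "(\<integral>\<^sup>+x. f x \<partial>lint S) \<le> (\<integral>\<^sup>+x. g x \<partial>lint S)"
  using assms by (intro nn_integral_mono_AE) (auto simp: AE_lint)

lemma nn_integral_circ_mono:
  "(\<And>x. f x \<le> g x) \<Longrightarrow> (\<integral>\<^sup>+x. f x \<partial>circ) \<le> (\<integral>\<^sup>+x. g x \<partial>circ)"
  by (rule nn_integral_mono) auto

lemma nn_integral_rad_mono:
  "(\<And>x. 0 \<le> x \<Longrightarrow> x < 1 \<Longrightarrow> f x \<le> g x) \<Longrightarrow> (\<integral>\<^sup>+x. f x \<partial>rad) \<le> (\<integral>\<^sup>+x. g x \<partial>rad)"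
  unfolding rad_def by (rule nn_integral_lint_mono) auto

text \<open>Translations and reflections in one substitution: \<open>c\<close> is 1 or -1, so
  \<open>c * c = 1\<close> makes the map its own kind of inverse and no Jacobian appears.\<close>

lemma nn_integral_affine_lint:
  assumes [measurable]: "f \<in> borel_measurable borel" "S \<in> sets borel" and c: "\<bar>c\<bar> = 1"
  shows "(\<integral>\<^sup>+x. f (t + c * x) \<partial>lint S) = (\<integral>\<^sup>+x. f x \<partial>lint ((\<lambda>x. t + c * x) ` S))"
proof -
  have cc: "c * c = 1" using c by (metis abs_mult_self_eq mult_1)
  have im: "(\<lambda>x. t + c * x) ` S = (\<lambda>x. c * (x - t)) -` S"
  proof (auto simp: image_iff)
    fix x assume "x \<in> S" then show "c * (c * x) \<in> S" using cc by (simp add: mult.assoc[symmetric])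
  next
    fix x assume "c * (x - t) \<in> S" then show "\<exists>y\<in>S. x = t + c * y"
      using cc by (intro bexI[of _ "c * (x - t)"]) (auto simp: mult.assoc[symmetric])
  qed
  have m: "(\<lambda>x. t + c * x) ` S \<in> sets borel" unfolding im
    by (rule measurable_sets_borel[OF _ assms(2)]) measurable
  note [measurable] = m
  have ind: "indicator ((\<lambda>x. t + c * x) ` S) (t + c * x) = (indicator S x :: ennreal)" for x
    unfolding im using cc by (simp add: indicator_def mult.assoc[symmetric])
  have "(\<integral>\<^sup>+x. f x \<partial>lint ((\<lambda>x. t + c * x) ` S)) = (\<integral>\<^sup>+x. f x * indicator ((\<lambda>x. t + c * x) ` S) x \<partial>lborel)"
    by (rule nn_integral_lint) auto
  also have "\<dots> = \<bar>c\<bar> * (\<integral>\<^sup>+x. f (t + c * x) * indicator ((\<lambda>x. t + c * x) ` S) (t + c * x) \<partial>lborel)"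
    by (rule nn_integral_real_affine) (use c in auto)
  also have "\<dots> = (\<integral>\<^sup>+x. f (t + c * x) * indicator S x \<partial>lborel)" using c by (simp add: ind)
  also have "\<dots> = (\<integral>\<^sup>+x. f (t + c * x) \<partial>lint S)" by (subst nn_integral_lint) auto
  finally show ?thesis by simp
qed

lemma nn_integral_lint_shift:
  assumes [measurable]: "f \<in> borel_measurable borel"
  shows "(\<integral>\<^sup>+x. f (t + x) \<partial>lint {a..b}) = (\<integral>\<^sup>+x. f x \<partial>lint {a+t..b+t})"
  using nn_integral_affine_lint[of f "{a..b}" 1 t] by (simp add: add.commute)

lemma nn_integral_rad_reflect:
  assumes [measurable]: "f \<in> borel_measurable borel"
  shows "(\<integral>\<^sup>+r. f (1 - r) \<partial>rad) = (\<integral>\<^sup>+u. f u \<partial>lint {0<..1})"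
proof -
  have "(\<lambda>x. 1 + (-1) * x) ` {0..<1} = {0<..(1::real)}"
    by (auto simp: image_iff intro!: bexI[of _ "1 - x" for x])
  then show ?thesis using nn_integral_affine_lint[of f "{0..<1}" "-1" 1] by (simp add: rad_def)
qed

lemma nn_integral_lint_union:
  assumes [measurable]: "f \<in> borel_measurable borel" and "a \<le> b" "b \<le> c"
  shows "(\<integral>\<^sup>+x. f x \<partial>lint {a..c}) = (\<integral>\<^sup>+x. f x \<partial>lint {a..b}) + (\<integral>\<^sup>+x. f x \<partial>lint {b..c})"
proof -
  have "AE x in lborel. x \<noteq> b" by (rule AE_lborel_singleton)
  then have "(\<integral>\<^sup>+x. f x * indicator {a..c} x \<partial>lborel) = (\<integral>\<^sup>+x. f x * indicator {a..b} x + f x * indicator {b..c} x \<partial>lborel)"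
    using assms(2,3) by (intro nn_integral_cong_AE) (auto simp: indicator_def)
  also have "\<dots> = (\<integral>\<^sup>+x. f x * indicator {a..b} x \<partial>lborel) + (\<integral>\<^sup>+x. f x * indicator {b..c} x \<partial>lborel)"
    by (rule nn_integral_add) measurable
  finally show ?thesis by (simp add: nn_integral_lint)
qed

lemma nn_integral_periodic:
  fixes g :: "complex \<Rightarrow> ennreal"
  assumes [measurable]: "g \<in> borel_measurable borel"
  shows "(\<integral>\<^sup>+\<theta>. g (cis \<theta>) \<partial>lint {a..a+2*pi}) = (\<integral>\<^sup>+\<theta>. g (cis \<theta>) \<partial>circ)"
proof -
  \<comment> \<open>Moving the window by at most one period trades the piece lost on the left for
    its translate by \<open>2 * pi\<close> on the right. The integer \<open>k\<close> below then
    reduces an arbitrary window to one starting at a multiple of the period.\<close>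
  have step: "(\<integral>\<^sup>+\<theta>. g (cis \<theta>) \<partial>lint {b..b+2*pi}) = (\<integral>\<^sup>+\<theta>. g (cis \<theta>) \<partial>lint {a..a+2*pi})"
    if ab: "a \<le> b" "b \<le> a + 2*pi" for a b
  proof -
    have "(\<integral>\<^sup>+\<theta>. g (cis \<theta>) \<partial>lint {b..b+2*pi}) = (\<integral>\<^sup>+\<theta>. g (cis \<theta>) \<partial>lint {b..a+2*pi}) + (\<integral>\<^sup>+\<theta>. g (cis \<theta>) \<partial>lint {a+2*pi..b+2*pi})"
      using ab by (intro nn_integral_lint_union) auto
    also have "(\<integral>\<^sup>+\<theta>. g (cis \<theta>) \<partial>lint {a+2*pi..b+2*pi}) = (\<integral>\<^sup>+\<theta>. g (cis (2*pi+\<theta>)) \<partial>lint {a..b})"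
      by (rule nn_integral_lint_shift[symmetric]) measurable
    also have "\<dots> = (\<integral>\<^sup>+\<theta>. g (cis \<theta>) \<partial>lint {a..b})" by (simp flip: cis_mult)
    also have "(\<integral>\<^sup>+\<theta>. g (cis \<theta>) \<partial>lint {b..a+2*pi}) + \<dots> = (\<integral>\<^sup>+\<theta>. g (cis \<theta>) \<partial>lint {a..a+2*pi})"
      using ab by (subst nn_integral_lint_union[of _ a b]) (auto simp: add.commute)
    finally show ?thesis .
  qed
  define k where "k = \<lfloor>a / (2*pi)\<rfloor>"
  have k: "2*pi* of_int k \<le> a" "a \<le> 2*pi* of_int k + 2*pi"
  proof -
    have "of_int k \<le> a/(2*pi)" "a/(2*pi) \<le> of_int k + 1" unfolding k_def by linarith+
    then show "2*pi* of_int k \<le> a" "a \<le> 2*pi* of_int k + 2*pi" by (auto simp: field_simps)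
  qed
  have "(\<integral>\<^sup>+\<theta>. g (cis \<theta>) \<partial>lint {a..a+2*pi}) = (\<integral>\<^sup>+\<theta>. g (cis \<theta>) \<partial>lint {2*pi* of_int k..2*pi* of_int k+2*pi})"
    by (rule step) (use k in auto)
  also have "\<dots> = (\<integral>\<^sup>+\<theta>. g (cis (2*pi* of_int k + \<theta>)) \<partial>lint {0..2*pi})"
    by (subst nn_integral_lint_shift[of "\<lambda>\<theta>. g (cis \<theta>)"]) (auto simp: add.commute)
  also have "\<dots> = (\<integral>\<^sup>+\<theta>. g (cis \<theta>) \<partial>circ)"
    by (simp add: circ_def cis_multiple_2pi flip: cis_mult)
  finally show ?thesis .
qed

lemma nn_integral_circ_rotate:
  fixes g :: "complex \<Rightarrow> ennreal"
  assumes [measurable]: "g \<in> borel_measurable borel"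
  shows "(\<integral>\<^sup>+\<theta>. g (cis (s + \<theta>)) \<partial>circ) = (\<integral>\<^sup>+\<theta>. g (cis \<theta>) \<partial>circ)"
proof -
  have "(\<integral>\<^sup>+\<theta>. g (cis (s + \<theta>)) \<partial>circ) = (\<integral>\<^sup>+\<theta>. g (cis \<theta>) \<partial>lint {s..s+2*pi})"
    unfolding circ_def by (subst nn_integral_lint_shift[of "\<lambda>\<theta>. g (cis \<theta>)"]) (auto simp: add.commute)
  then show ?thesis by (simp add: nn_integral_periodic)
qed

text \<open>Centres the window at \<theta>. On \<open>{-pi..pi}\<close> the distance from
  \<open>cis s\<close> to 1 is comparable to the absolute value of \<open>s\<close>; on
  \<open>{0..2*pi}\<close> that fails near the right end.\<close>

lemma nn_integral_circ_symmetric: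
  fixes g :: "complex \<Rightarrow> ennreal"
  assumes [measurable]: "g \<in> borel_measurable borel"
  shows "(\<integral>\<^sup>+\<tau>. g (cis \<tau>) \<partial>circ) = (\<integral>\<^sup>+s. g (cis (\<theta> + s)) \<partial>lint {-pi..pi})"
proof -
  have "(\<integral>\<^sup>+s. g (cis (\<theta> + s)) \<partial>lint {-pi..pi}) = (\<integral>\<^sup>+s. g (cis s) \<partial>lint {\<theta>-pi..(\<theta>-pi)+2*pi})"
    by (subst nn_integral_lint_shift[of "\<lambda>\<theta>. g (cis \<theta>)"]) (auto simp: algebra_simps)
  also have "\<dots> = (\<integral>\<^sup>+\<tau>. g (cis \<tau>) \<partial>circ)" by (rule nn_integral_periodic) measurable
  finally show ?thesis by simp
qed

text \<open>The sum is at most three times its largest term, and the power of the largest term is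
  among the summands. This crude form holds for all exponents at once, and the constant 3 reappears
  in the estimates below.\<close>

lemma powr_triangle:
  fixes a b c :: "'a::real_normed_vector"
  assumes "p \<ge> 0"
  shows "norm (a + b + c) powr p \<le> 3 powr p * (norm a powr p + norm b powr p + norm c powr p)"
proof -
  define m where "m = max (norm a) (max (norm b) (norm c))"
  have "norm (a + b + c) \<le> norm a + norm b + norm c" by (meson add_right_mono norm_triangle_ineq order_trans)
  also have "\<dots> \<le> 3 * m" unfolding m_def by auto
  finally have "norm (a + b + c) powr p \<le> (3 * m) powr p" using assms by (intro powr_mono2) auto
  also have "\<dots> = 3 powr p * m powr p" by (rule powr_mult)
  also have "m powr p \<le> norm a powr p + norm b powr p + norm c powr p" unfolding m_def max_def by auto
  finally show ?thesis by (simp add: mult_left_mono)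
qed

lemma powr_triangle2:
  fixes a b :: "'a::real_normed_vector"
  assumes "p \<ge> 0"
  shows "norm (a + b) powr p \<le> 3 powr p * (norm a powr p + norm b powr p)"
  using powr_triangle[OF assms, of a b 0] by simp

section \<open>Increments of functions holomorphic beyond the closed disc\<close>

text \<open>The derivative is a parameter of its own, since \<open>F\<close> is arbitrary outside
  the disc of radius \<open>R\<close> while Fubini needs both functions Borel on the whole
  plane.\<close>

locale disc_pair =
  fixes F F' :: "complex \<Rightarrow> complex" and R :: real
  assumes R: "R > 1" and mF [measurable]: "F \<in> borel_measurable borel" and mF' [measurable]: "F' \<in> borel_measurable borel"
    and deriv: "\<And>z. norm z < R \<Longrightarrow> (F has_field_derivative F' z) (at z)"
begin

lemma holF: "F holomorphic_on ball 0 R"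
  using deriv field_differentiable_at_within holomorphic_onI field_differentiable_def by (metis mem_ball_0)

lemma holF': "F' holomorphic_on ball 0 R"
proof -
  have "deriv F holomorphic_on ball 0 R" by (intro holomorphic_deriv holF) auto
  moreover have "deriv F z = F' z" if "z \<in> ball 0 R" for z using deriv[of z] that by (auto intro: DERIV_imp_deriv)
  ultimately show ?thesis by (rule holomorphic_transform)
qed

lemma contF: "continuous_on (cball 0 1) F"
  and contF': "continuous_on (cball 0 1) F'"
  using R by (auto intro!: continuous_on_subset[OF holomorphic_on_imp_continuous_on[OF holF]]
      continuous_on_subset[OF holomorphic_on_imp_continuous_on[OF holF']])

text \<open>A Hardy-type estimate. The increment is the integral of \<open>F'\<close> along the
  radius, written in the distance \<open>u\<close> to the circle; the integrand is multiplied and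
  divided by a power of \<open>u\<close>, and Jensen is applied to the measure with density
  \<open>u powr (-b')\<close>. The condition \<open>b < p - 1\<close> says that this density is
  integrable at 0.\<close>

lemma radial_increment:
  assumes p: "p > 1" and b: "b < p - 1" and r: "0 \<le> \<rho>" "\<rho> \<le> r" "r \<le> 1" "\<rho> < 1"
  shows "ennreal (norm (F (of_real r * cis \<theta>) - F (of_real \<rho> * cis \<theta>)) powr p) \<le>
    ennreal ((1 / (1 - b/(p-1))) powr (p-1) * (1 - \<rho>) powr (p - 1 - b)) *
      (\<integral>\<^sup>+u. ennreal (norm (F' (of_real (1 - u) * cis \<theta>)) powr p * u powr b) \<partial>lint {0..1-\<rho>})"
proof -
  define x where "x = 1 - \<rho>"
  \<comment> \<open>Chosen so that \<open>b' * p - b' = b\<close>: Jensen then produces exactly the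
    weight \<open>u powr b\<close>.\<close>
  define b' where "b' = b / (p - 1)"
  have b': "b' < 1" using b p by (simp add: b'_def)
  have x: "x > 0" "x \<le> 1" using r by (auto simp: x_def)
  define g where "g = (\<lambda>u. norm (F' (of_real (1 - u) * cis \<theta>)))"
  have [measurable]: "g \<in> borel_measurable borel" unfolding g_def by measurable
  have contg: "continuous_on {0..x} (\<lambda>u. F' (of_real (1 - u) * cis \<theta>))"
    by (rule continuous_on_compose2[OF contF']) (use x in \<open>auto intro!: continuous_intros simp: norm_mult simp del: of_real_diff\<close>)
  have "((\<lambda>u. - cis \<theta> * F' (of_real (1 - u) * cis \<theta>)) has_integral
      (F (of_real (1 - x) * cis \<theta>) - F (of_real (1 - (1 - r)) * cis \<theta>))) {1 - r..x}"
  proof (rule fundamental_theorem_of_calculus)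
    fix u assume u: "u \<in> {1 - r..x}"
    have "norm (of_real (1 - u) * cis \<theta>) < R" using u r R x by (simp add: norm_mult x_def del: of_real_diff)
    from deriv[OF this] have "(F has_field_derivative F' (of_real (1 - u) * cis \<theta>)) (at (of_real (1 - u) * cis \<theta>))" .
    moreover have "((\<lambda>u. of_real (1 - u) * cis \<theta>) has_vector_derivative - cis \<theta>) (at u within {1 - r..x})"
      by (auto intro!: derivative_eq_intros simp: has_vector_derivative_def scaleR_conv_of_real)
    ultimately have "((F \<circ> (\<lambda>u. of_real (1 - u) * cis \<theta>)) has_vector_derivative
        (- cis \<theta> * F' (of_real (1 - u) * cis \<theta>))) (at u within {1 - r..x})"
      by (intro field_vector_diff_chain_within) (auto intro: DERIV_subset)
    then show "((\<lambda>u. F (of_real (1 - u) * cis \<theta>)) has_vector_derivative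
        (- cis \<theta> * F' (of_real (1 - u) * cis \<theta>))) (at u within {1 - r..x})" by (simp add: o_def)
  qed (use r in \<open>auto simp: x_def\<close>)
  then have hi: "((\<lambda>u. - cis \<theta> * F' (of_real (1 - u) * cis \<theta>)) has_integral
      (F (of_real \<rho> * cis \<theta>) - F (of_real r * cis \<theta>))) {1 - r..x}"
    by (simp add: x_def)
  have int: "F (of_real \<rho> * cis \<theta>) - F (of_real r * cis \<theta>)
     = integral {1-r..x} (\<lambda>u. - cis \<theta> * F' (of_real (1 - u) * cis \<theta>))"
    by (rule integral_unique[OF hi, symmetric])
  have "norm (F (of_real r * cis \<theta>) - F (of_real \<rho> * cis \<theta>)) \<le> integral {1-r..x} g"
    unfolding norm_minus_commute[of "F (of_real r * cis \<theta>)"] int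
  proof (rule integral_norm_bound_integral)
    show "(\<lambda>u. - cis \<theta> * F' (of_real (1 - u) * cis \<theta>)) integrable_on {1 - r..x}"
      by (intro integrable_continuous_real continuous_intros continuous_on_subset[OF contg]) (use r in auto)
    show "g integrable_on {1 - r..x}" unfolding g_def
      by (intro integrable_continuous_real continuous_intros continuous_on_subset[OF contg]) (use r in auto)
  qed (auto simp: g_def norm_mult)
  \<comment> \<open>Extending the range down to distance 0 makes the bound independent of the upper
    radius \<open>r\<close>, which may be 1.\<close>
  also have "\<dots> \<le> integral {0..x} g"
  proof (rule integral_subset_le)
    have ig: "g integrable_on {a..x}" if "a \<ge> 0" for a unfolding g_def
      by (intro integrable_continuous_real continuous_on_norm continuous_on_subset[OF contg]) (use that in auto)
    show "g integrable_on {1 - r..x}" "g integrable_on {0..x}" by (rule ig, use r in auto)+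
  qed (use r in \<open>auto simp: g_def\<close>)
  also have "\<dots> = (\<integral>u. g u \<partial>lint {0..x})"
    by (rule integral_lint_has_integral[symmetric])
       (auto intro!: integrable_integral integrable_continuous_real continuous_on_norm contg simp: g_def simp del: of_real_diff)
  also have "\<dots> = (\<integral>u. (g u * u powr b') * u powr (-b') \<partial>lint {0..x})"
  proof (rule integral_cong_AE)
    have "AE u in lborel. u \<noteq> (0::real)" by (rule AE_lborel_singleton)
    then show "AE u in lint {0..x}. g u = g u * u powr b' * u powr - b'"
      by (auto simp: AE_lint powr_minus)
  qed measurable
  finally have *: "norm (F (of_real r * cis \<theta>) - F (of_real \<rho> * cis \<theta>)) \<le> \<dots>" .
  have k: "integrable (lint {0..x}) (\<lambda>u. u powr (-b'))" "(\<integral>u. u powr (-b') \<partial>lint {0..x}) = x powr (1-b') / (1-b')"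
    using integrable_powr_0[of "-b'" x] b' x by auto
  have "ennreal (norm (F (of_real r * cis \<theta>) - F (of_real \<rho> * cis \<theta>)) powr p) \<le>
     ennreal ((\<integral>u. (g u * u powr b') * u powr (-b') \<partial>lint {0..x}) powr p)"
    using * p by (intro ennreal_leI powr_mono2) auto
  also have "\<dots> \<le> ennreal ((\<integral>u. u powr (-b') \<partial>lint {0..x}) powr (p-1)) *
      (\<integral>\<^sup>+u. ennreal ((g u * u powr b') powr p * u powr (-b')) \<partial>lint {0..x})"
    by (rule power_mean) (use p k in \<open>auto simp: g_def\<close>)
  also have "(\<integral>\<^sup>+u. ennreal ((g u * u powr b') powr p * u powr (-b')) \<partial>lint {0..x}) =
     (\<integral>\<^sup>+u. ennreal (g u powr p * u powr b) \<partial>lint {0..x})"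
  proof (rule nn_integral_cong_AE)
    have "AE u in lborel. u \<noteq> (0::real)" by (rule AE_lborel_singleton)
    moreover have "(g u * u powr b') powr p * u powr (-b') = g u powr p * u powr b" for u
    proof -
      have "b' * p - b' = b' * (p - 1)" by (simp add: algebra_simps)
      also have "\<dots> = b" using p by (simp add: b'_def)
      finally have "b' * p - b' = b" .
      then have "u powr (b' * p) * u powr (-b') = u powr b" by (simp flip: powr_add)
      then show ?thesis by (simp add: powr_mult powr_powr mult.assoc)
    qed
    ultimately show "AE u in lint {0..x}. ennreal ((g u * u powr b') powr p * u powr - b') = ennreal (g u powr p * u powr b)"
      by (auto simp: AE_lint)
  qed
  also have "(\<integral>u. u powr (-b') \<partial>lint {0..x}) powr (p-1) = (1 / (1 - b/(p-1))) powr (p-1) * x powr (p - 1 - b)"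
  proof -
    have "b' * (p - 1) = b" using p by (simp add: b'_def)
    then have "(1 - b') * (p - 1) = p - 1 - b" by (simp add: algebra_simps)
    then have "(x powr (1-b') / (1-b')) powr (p-1) = x powr (p - 1 - b) * (1 / (1 - b')) powr (p-1)"
      using b' x by (simp add: powr_divide powr_powr)
    then show ?thesis unfolding k(2) b'_def[symmetric] by (simp add: mult.commute)
  qed
  finally show ?thesis by (simp add: x_def g_def)
qed

text \<open>The arc is parametrised over the unit interval, so its speed is at most the absolute
  value of \<open>s\<close> and Jensen is applied to a probability measure.\<close>

lemma arc_increment:
  assumes p: "p > 1" and r: "0 \<le> \<rho>" "\<rho> \<le> 1"
  shows "ennreal (norm (F (of_real \<rho> * cis (\<theta> + s)) - F (of_real \<rho> * cis \<theta>)) powr p) \<le>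
    ennreal (\<bar>s\<bar> powr p) * (\<integral>\<^sup>+\<tau>. ennreal (norm (F' (of_real \<rho> * cis (\<theta> + \<tau> * s))) powr p) \<partial>lint {0..1})"
proof -
  define g where "g = (\<lambda>\<tau>. norm (F' (of_real \<rho> * cis (\<theta> + \<tau> * s))))"
  have [measurable]: "g \<in> borel_measurable borel" unfolding g_def by measurable
  have contg: "continuous_on UNIV (\<lambda>\<tau>. F' (of_real \<rho> * cis (\<theta> + \<tau> * s)))"
    by (rule continuous_on_compose2[OF contF']) (use r in \<open>auto intro!: continuous_intros simp: norm_mult\<close>)
  have "((\<lambda>\<tau>. (\<i> * of_real (\<rho> * s) * cis (\<theta> + \<tau> * s)) * F' (of_real \<rho> * cis (\<theta> + \<tau> * s))) has_integral
      (F (of_real \<rho> * cis (\<theta> + 1 * s)) - F (of_real \<rho> * cis (\<theta> + 0 * s)))) {0..1}"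
  proof (rule fundamental_theorem_of_calculus)
    fix u :: real assume u: "u \<in> {0..1}"
    have "norm (of_real \<rho> * cis (\<theta> + u * s)) < R" using r R by (simp add: norm_mult)
    from deriv[OF this] have "(F has_field_derivative F' (of_real \<rho> * cis (\<theta> + u * s))) (at (of_real \<rho> * cis (\<theta> + u * s)))" .
    moreover have "((\<lambda>u. of_real \<rho> * cis (\<theta> + u * s)) has_vector_derivative \<i> * of_real (\<rho> * s) * cis (\<theta> + u * s)) (at u within {0..1})"
    proof -
      have "((\<lambda>w. of_real \<rho> * exp (\<i> * (of_real \<theta> + w * of_real s))) has_field_derivative
          \<i> * of_real (\<rho> * s) * exp (\<i> * (of_real \<theta> + of_real u * of_real s))) (at (of_real u))"
        by (auto intro!: derivative_eq_intros simp: algebra_simps)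
      from has_vector_derivative_real_field[OF this] show ?thesis
        by (simp add: cis_conv_exp)
    qed
    ultimately have "((F \<circ> (\<lambda>u. of_real \<rho> * cis (\<theta> + u * s))) has_vector_derivative
        (\<i> * of_real (\<rho> * s) * cis (\<theta> + u * s)) * F' (of_real \<rho> * cis (\<theta> + u * s))) (at u within {0..1})"
      by (intro field_vector_diff_chain_within) (auto intro: DERIV_subset)
    then show "((\<lambda>u. F (of_real \<rho> * cis (\<theta> + u * s))) has_vector_derivative
        (\<i> * of_real (\<rho> * s) * cis (\<theta> + u * s)) * F' (of_real \<rho> * cis (\<theta> + u * s))) (at u within {0..1})"
      by (simp add: o_def)
  qed auto
  then have int: "F (of_real \<rho> * cis (\<theta> + s)) - F (of_real \<rho> * cis \<theta>)
     = integral {0..1} (\<lambda>\<tau>. (\<i> * of_real (\<rho> * s) * cis (\<theta> + \<tau> * s)) * F' (of_real \<rho> * cis (\<theta> + \<tau> * s)))"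
    by (simp add: integral_unique)
  have "norm (F (of_real \<rho> * cis (\<theta> + s)) - F (of_real \<rho> * cis \<theta>)) \<le> integral {0..1} (\<lambda>\<tau>. \<bar>s\<bar> * g \<tau>)"
    unfolding int
  proof (rule integral_norm_bound_integral)
    show "(\<lambda>\<tau>. (\<i> * of_real (\<rho> * s) * cis (\<theta> + \<tau> * s)) * F' (of_real \<rho> * cis (\<theta> + \<tau> * s))) integrable_on {0..1}"
      by (intro integrable_continuous_real continuous_intros continuous_on_subset[OF contg]) auto
    show "(\<lambda>\<tau>. \<bar>s\<bar> * g \<tau>) integrable_on {0..1}" unfolding g_def
      by (intro integrable_continuous_real continuous_intros continuous_on_subset[OF contg]) auto
    show "norm ((\<i> * of_real (\<rho> * s) * cis (\<theta> + \<tau> * s)) * F' (of_real \<rho> * cis (\<theta> + \<tau> * s))) \<le> \<bar>s\<bar> * g \<tau>" for \<tau>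
      using r mult_right_mono[of \<rho> 1 "\<bar>s\<bar> * g \<tau>"] by (simp add: norm_mult g_def abs_mult mult.assoc)
  qed
  also have "\<dots> = \<bar>s\<bar> * integral {0..1} g" by simp
  also have "integral {0..1} g = (\<integral>\<tau>. g \<tau> * 1 \<partial>lint {0..1})"
    unfolding mult_1_right by (rule integral_lint_has_integral[symmetric])
       (auto intro!: integrable_integral integrable_continuous_real continuous_on_norm continuous_on_subset[OF contg] simp: g_def)
  finally have *: "norm (F (of_real \<rho> * cis (\<theta> + s)) - F (of_real \<rho> * cis \<theta>)) \<le> \<bar>s\<bar> * (\<integral>\<tau>. g \<tau> * 1 \<partial>lint {0..1})" .
  have one: "integrable (lint {0..1}) (\<lambda>_. 1::real)" "(\<integral>\<tau>. (1::real) \<partial>lint {0..1}) = 1"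
    using finite_measure.integrable_const[OF finite_measure_lint, of "{0..1}"]
    by (simp_all add: measure_def emeasure_lint)
  have "ennreal (norm (F (of_real \<rho> * cis (\<theta> + s)) - F (of_real \<rho> * cis \<theta>)) powr p) \<le>
      ennreal ((\<bar>s\<bar> * (\<integral>\<tau>. g \<tau> * 1 \<partial>lint {0..1})) powr p)"
    using * p by (intro ennreal_leI powr_mono2) auto
  also have "\<dots> = ennreal (\<bar>s\<bar> powr p) * ennreal ((\<integral>\<tau>. g \<tau> * 1 \<partial>lint {0..1}) powr p)"
    by (subst powr_mult) (auto simp: g_def ennreal_mult)
  also have "\<dots> \<le> ennreal (\<bar>s\<bar> powr p) * (ennreal ((\<integral>\<tau>. (1::real) \<partial>lint {0..1}) powr (p-1)) * (\<integral>\<^sup>+\<tau>. ennreal (g \<tau> powr p * 1) \<partial>lint {0..1}))"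
    by (intro mult_left_mono power_mean) (use p one in \<open>auto simp: g_def\<close>)
  finally show ?thesis by (simp only: one(2) powr_one_eq_one ennreal_1 mult_1_left mult_1_right g_def)
qed

definition circle_mean :: "real \<Rightarrow> real \<Rightarrow> ennreal" where
  "circle_mean p r = (\<integral>\<^sup>+\<theta>. ennreal (norm (F' (of_real r * cis \<theta>)) powr p) \<partial>circ)"

lemma measurable_circle_mean [measurable]: "circle_mean p \<in> borel_measurable borel"
  unfolding circle_mean_def[abs_def] by measurable

text \<open>Rescaling by \<open>r2\<close> reduces the claim to the unit circle and the radius
  \<open>r1 / r2\<close>.\<close>

lemma circle_mean_mono:
  assumes p: "p \<ge> 1" and r: "0 \<le> r1" "r1 \<le> r2" "r2 \<le> 1"
  shows "circle_mean p r1 \<le> circle_mean p r2"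
proof (cases "r1 = r2")
  case False
  then have r2: "r2 > 0" "r1 / r2 < 1" using r by auto
  have "(\<integral>\<^sup>+\<theta>. ennreal (norm (F' (of_real r2 * (of_real (r1/r2) * cis \<theta>))) powr p) \<partial>circ) \<le>
     (\<integral>\<^sup>+\<theta>. ennreal (norm (F' (of_real r2 * cis \<theta>)) powr p) \<partial>circ)"
  proof (rule circle_mean_mono_unit)
    show "continuous_on (cball 0 1) (\<lambda>w. F' (of_real r2 * w))"
      by (rule continuous_on_compose2[OF contF'])
         (use r in \<open>auto intro!: continuous_intros mult_le_one simp: norm_mult\<close>)
    have "(F' \<circ> (\<lambda>w. of_real r2 * w)) holomorphic_on ball 0 1"
    proof (rule holomorphic_on_compose_gen[OF _ holF'])
      show "(*) (complex_of_real r2) ` ball 0 1 \<subseteq> ball 0 R"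
      proof (auto simp: norm_mult)
        fix x :: complex assume "norm x < 1"
        then have "\<bar>r2\<bar> * norm x \<le> 1 * 1" using r by (intro mult_mono) auto
        then show "\<bar>r2\<bar> * norm x < R" using R by simp
      qed
    qed (auto intro!: holomorphic_intros)
    then show "(\<lambda>w. F' (of_real r2 * w)) holomorphic_on ball 0 1" by (simp add: o_def)
  qed (use p r r2 in auto)
  moreover have "of_real r2 * (of_real (r1/r2) * cis \<theta>) = of_real r1 * cis \<theta>" for \<theta>
    using r2 by simp
  ultimately show ?thesis by (simp only: circle_mean_def)
qed simp

text \<open>The boundary point and the interior point are joined by going inwards radially to depth
  \<open>x\<close>, along an arc, and outwards again; \<open>x\<close> is comparable to the distance
  of the two points. In the constant, \<open>3 powr p\<close> comes from splitting into three legs,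
  the doubled power from the two radial legs, and \<open>b + 1\<close> from the arc.\<close>

lemma increment_mean:
  assumes p: "p > 1" and b: "-1 < b" "b < p - 1" and r: "0 \<le> r" "r < 1"
    and x_def: "x = min 1 (1 - r + \<bar>s\<bar>)"
  shows "(\<integral>\<^sup>+\<theta>. ennreal (norm (F (cis (\<theta> + s)) - F (of_real r * cis \<theta>)) powr p) \<partial>circ) \<le>
     ennreal (3 powr p * (2 * (1 / (1 - b/(p-1))) powr (p-1) + (b + 1)) * x powr (p - 1 - b)) *
     (\<integral>\<^sup>+u. ennreal (u powr b) * circle_mean p (1 - u) \<partial>lint {0..x})"
proof -
  define \<rho> where "\<rho> = 1 - x"
  define C0 where "C0 = (1 / (1 - b/(p-1))) powr (p-1)"
  define W where "W = (\<integral>\<^sup>+u. ennreal (u powr b) * circle_mean p (1 - u) \<partial>lint {0..x})"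
  have x: "0 < x" "x \<le> 1" and \<rho>: "0 \<le> \<rho>" "\<rho> \<le> r" "\<rho> < 1" "\<rho> \<le> 1" "1 - \<rho> = x" using r by (auto simp: x_def \<rho>_def)
  have radial: "(\<integral>\<^sup>+\<theta>. ennreal (norm (F (of_real r' * cis (\<theta> + s')) - F (of_real \<rho> * cis (\<theta> + s'))) powr p) \<partial>circ)
      \<le> ennreal (C0 * x powr (p-1-b)) * W" if r': "\<rho> \<le> r'" "r' \<le> 1" for r' s'
  proof -
    have "(\<integral>\<^sup>+\<theta>. ennreal (norm (F (of_real r' * cis (\<theta> + s')) - F (of_real \<rho> * cis (\<theta> + s'))) powr p) \<partial>circ)
      \<le> (\<integral>\<^sup>+\<theta>. ennreal (C0 * x powr (p-1-b)) * (\<integral>\<^sup>+u. ennreal (norm (F' (of_real (1 - u) * cis (\<theta> + s'))) powr p * u powr b) \<partial>lint {0..x}) \<partial>circ)"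
      by (rule nn_integral_circ_mono) (use radial_increment[OF p b(2) \<rho>(1) r' \<rho>(3)] in \<open>simp add: C0_def \<rho> del: of_real_diff\<close>)
    also have "\<dots> = ennreal (C0 * x powr (p-1-b)) * (\<integral>\<^sup>+\<theta>. (\<integral>\<^sup>+u. ennreal (norm (F' (of_real (1 - u) * cis (\<theta> + s'))) powr p * u powr b) \<partial>lint {0..x}) \<partial>circ)"
      by (rule nn_integral_cmult) measurable
    also have "(\<integral>\<^sup>+\<theta>. (\<integral>\<^sup>+u. ennreal (norm (F' (of_real (1 - u) * cis (\<theta> + s'))) powr p * u powr b) \<partial>lint {0..x}) \<partial>circ)
      = (\<integral>\<^sup>+u. (\<integral>\<^sup>+\<theta>. ennreal (norm (F' (of_real (1 - u) * cis (\<theta> + s'))) powr p * u powr b) \<partial>circ) \<partial>lint {0..x})"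
      by (rule Fubini_borel[OF sigma_finite_circ sigma_finite_lint]) (simp_all, measurable)
    also have "\<dots> = W" unfolding W_def
    proof (rule nn_integral_cong)
      fix u :: real
      have "(\<integral>\<^sup>+\<theta>. ennreal (norm (F' (of_real (1 - u) * cis (\<theta> + s'))) powr p * u powr b) \<partial>circ)
        = (\<integral>\<^sup>+\<theta>. ennreal (norm (F' (of_real (1 - u) * cis (s' + \<theta>))) powr p * u powr b) \<partial>circ)" by (simp add: add.commute)
      also have "\<dots> = (\<integral>\<^sup>+\<theta>. ennreal (norm (F' (of_real (1 - u) * cis \<theta>)) powr p * u powr b) \<partial>circ)"
        by (rule nn_integral_circ_rotate[where g = "\<lambda>w. ennreal (norm (F' (of_real (1 - u) * w)) powr p * u powr b)"]) measurable
      also have "\<dots> = ennreal (u powr b) * circle_mean p (1 - u)"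
        unfolding circle_mean_def by (subst nn_integral_cmult[symmetric]) (auto simp: ennreal_mult mult.commute)
      finally show "(\<integral>\<^sup>+\<theta>. ennreal (norm (F' (of_real (1 - u) * cis (\<theta> + s'))) powr p * u powr b) \<partial>circ) = ennreal (u powr b) * circle_mean p (1 - u)" .
    qed
    finally show ?thesis .
  qed
  have arc: "(\<integral>\<^sup>+\<theta>. ennreal (norm (F (of_real \<rho> * cis (\<theta> + s)) - F (of_real \<rho> * cis \<theta>)) powr p) \<partial>circ)
      \<le> ennreal ((b+1) * x powr (p-1-b)) * W"
  \<comment> \<open>At full depth the path runs through the centre and the arc is a single point.
    Otherwise the minimum defining \<open>x\<close> is not 1, and the angle \<open>s\<close> is at
    most \<open>x\<close>.\<close>
  proof (cases "x = 1")
    case True then have "\<rho> = 0" by (simp add: \<rho>_def)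
    then show ?thesis by simp
  next
    case False
    then have s: "\<bar>s\<bar> \<le> x" using r by (auto simp: x_def)
    have "(\<integral>\<^sup>+\<theta>. ennreal (norm (F (of_real \<rho> * cis (\<theta> + s)) - F (of_real \<rho> * cis \<theta>)) powr p) \<partial>circ) \<le>
      (\<integral>\<^sup>+\<theta>. ennreal (\<bar>s\<bar> powr p) * (\<integral>\<^sup>+\<tau>. ennreal (norm (F' (of_real \<rho> * cis (\<theta> + \<tau> * s))) powr p) \<partial>lint {0..1}) \<partial>circ)"
      by (rule nn_integral_circ_mono) (rule arc_increment[OF p \<rho>(1,4)])
    also have "\<dots> = ennreal (\<bar>s\<bar> powr p) * (\<integral>\<^sup>+\<theta>. (\<integral>\<^sup>+\<tau>. ennreal (norm (F' (of_real \<rho> * cis (\<theta> + \<tau> * s))) powr p) \<partial>lint {0..1}) \<partial>circ)"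
      by (rule nn_integral_cmult) measurable
    also have "(\<integral>\<^sup>+\<theta>. (\<integral>\<^sup>+\<tau>. ennreal (norm (F' (of_real \<rho> * cis (\<theta> + \<tau> * s))) powr p) \<partial>lint {0..1}) \<partial>circ)
      = (\<integral>\<^sup>+\<tau>. (\<integral>\<^sup>+\<theta>. ennreal (norm (F' (of_real \<rho> * cis (\<theta> + \<tau> * s))) powr p) \<partial>circ) \<partial>lint {0..1})"
      by (rule Fubini_borel[OF sigma_finite_circ sigma_finite_lint]) (simp_all, measurable)
    also have "\<dots> = (\<integral>\<^sup>+\<tau>. circle_mean p \<rho> \<partial>lint {0..1})"
    proof (rule nn_integral_cong)
      fix \<tau> :: real
      have "(\<integral>\<^sup>+\<theta>. ennreal (norm (F' (of_real \<rho> * cis (\<tau> * s + \<theta>))) powr p) \<partial>circ) = circle_mean p \<rho>"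
        unfolding circle_mean_def
        by (rule nn_integral_circ_rotate[where g = "\<lambda>w. ennreal (norm (F' (of_real \<rho> * w)) powr p)"]) measurable
      then show "(\<integral>\<^sup>+\<theta>. ennreal (norm (F' (of_real \<rho> * cis (\<theta> + \<tau> * s))) powr p) \<partial>circ) = circle_mean p \<rho>"
        by (simp add: add.commute)
    qed
    also have "\<dots> = circle_mean p \<rho>" by (simp add: emeasure_lint)
    also have "ennreal (\<bar>s\<bar> powr p) * circle_mean p \<rho> \<le> ennreal (x powr p) * circle_mean p \<rho>"
      using s p by (intro mult_right_mono ennreal_leI powr_mono2) auto
    \<comment> \<open>The factor \<open>x powr (b+1)/(b+1)\<close> is the integral of
      \<open>u powr b\<close> over \<open>{0..x}\<close>. The mean at the smallest radius \<rho> can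
      thus be replaced by an average of the larger means at the radii \<open>1 - u\<close>, the form
      of the radial legs.\<close>
    also have "\<dots> = ennreal ((b+1) * x powr (p-1-b)) * (ennreal (x powr (b+1)/(b+1)) * circle_mean p \<rho>)"
    proof -
      have "x powr p = x powr (p-1-b) * x powr (b+1)" by (simp flip: powr_add)
      then have "x powr p = ((b+1) * x powr (p-1-b)) * (x powr (b+1)/(b+1))" using b by simp
      then have "ennreal (x powr p) = ennreal ((b+1) * x powr (p-1-b)) * ennreal (x powr (b+1)/(b+1))"
      proof -
        have "x powr (b+1)/(b+1) \<ge> 0" using b by (intro divide_nonneg_nonneg) auto
        then show ?thesis using \<open>x powr p = ((b+1) * x powr (p-1-b)) * (x powr (b+1)/(b+1))\<close>
          by (simp only: ennreal_mult'')
      qed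
      then show ?thesis by (simp add: mult.assoc)
    qed
    also have "ennreal (x powr (b+1)/(b+1)) * circle_mean p \<rho> = (\<integral>\<^sup>+u. ennreal (u powr b) * circle_mean p \<rho> \<partial>lint {0..x})"
      using x b by (subst nn_integral_multc) (auto simp: nn_integral_powr_0)
    also have "\<dots> \<le> W" unfolding W_def
      by (rule nn_integral_lint_mono) (use x p \<rho> in \<open>auto intro!: mult_left_mono circle_mean_mono\<close>)
    finally show ?thesis by (simp add: mult_left_mono)
  qed
  have "(\<integral>\<^sup>+\<theta>. ennreal (norm (F (cis (\<theta> + s)) - F (of_real r * cis \<theta>)) powr p) \<partial>circ) \<le>
    (\<integral>\<^sup>+\<theta>. ennreal (3 powr p) * ((ennreal (norm (F (of_real 1 * cis (\<theta> + s)) - F (of_real \<rho> * cis (\<theta> + s))) powr p) +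
        ennreal (norm (F (of_real \<rho> * cis (\<theta> + s)) - F (of_real \<rho> * cis \<theta>)) powr p)) +
        ennreal (norm (F (of_real r * cis (\<theta> + 0)) - F (of_real \<rho> * cis (\<theta> + 0))) powr p)) \<partial>circ)"
  proof (rule nn_integral_circ_mono)
    fix \<theta> :: real
    have "norm ((F (cis (\<theta> + s)) - F (of_real \<rho> * cis (\<theta> + s))) + (F (of_real \<rho> * cis (\<theta> + s)) - F (of_real \<rho> * cis \<theta>))
          + (F (of_real \<rho> * cis \<theta>) - F (of_real r * cis \<theta>))) powr p \<le> 3 powr p *
       (norm (F (cis (\<theta> + s)) - F (of_real \<rho> * cis (\<theta> + s))) powr p + norm (F (of_real \<rho> * cis (\<theta> + s)) - F (of_real \<rho> * cis \<theta>)) powr p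
          + norm (F (of_real \<rho> * cis \<theta>) - F (of_real r * cis \<theta>)) powr p)"
      by (rule powr_triangle) (use p in auto)
    then show "ennreal (norm (F (cis (\<theta> + s)) - F (of_real r * cis \<theta>)) powr p) \<le> ennreal (3 powr p) * ((ennreal (norm (F (of_real 1 * cis (\<theta> + s)) - F (of_real \<rho> * cis (\<theta> + s))) powr p) +
        ennreal (norm (F (of_real \<rho> * cis (\<theta> + s)) - F (of_real \<rho> * cis \<theta>)) powr p)) +
        ennreal (norm (F (of_real r * cis (\<theta> + 0)) - F (of_real \<rho> * cis (\<theta> + 0))) powr p))"
      by (simp add: norm_minus_commute[of "F (of_real r * cis \<theta>)"] ennreal_leI flip: ennreal_plus ennreal_mult)
  qed
  also have "\<dots> = ennreal (3 powr p) * (((\<integral>\<^sup>+\<theta>. ennreal (norm (F (of_real 1 * cis (\<theta> + s)) - F (of_real \<rho> * cis (\<theta> + s))) powr p) \<partial>circ) +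
        (\<integral>\<^sup>+\<theta>. ennreal (norm (F (of_real \<rho> * cis (\<theta> + s)) - F (of_real \<rho> * cis \<theta>)) powr p) \<partial>circ)) +
        (\<integral>\<^sup>+\<theta>. ennreal (norm (F (of_real r * cis (\<theta> + 0)) - F (of_real \<rho> * cis (\<theta> + 0))) powr p) \<partial>circ))"
    by (subst nn_integral_cmult nn_integral_add, measurable)+
  also have "\<dots> \<le> ennreal (3 powr p) * ((ennreal (C0 * x powr (p-1-b)) * W + ennreal ((b+1) * x powr (p-1-b)) * W) + ennreal (C0 * x powr (p-1-b)) * W)"
    by (intro mult_left_mono add_mono radial arc) (use \<rho> r in auto)
  also have "\<dots> = ennreal (3 powr p * (2 * C0 + (b + 1)) * x powr (p - 1 - b)) * W"
  proof -
    define a where "a = C0 * x powr (p-1-b)"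
    define d where "d = (b+1) * x powr (p-1-b)"
    have ad: "a \<ge> 0" "d \<ge> 0" using b by (auto simp: a_def d_def C0_def)
    have "3 powr p * (2 * C0 + (b + 1)) * x powr (p - 1 - b) = 3 powr p * ((a + d) + a)"
      by (simp add: a_def d_def algebra_simps)
    then have "ennreal (3 powr p * (2 * C0 + (b + 1)) * x powr (p - 1 - b)) =
       ennreal (3 powr p) * (ennreal a + ennreal d + ennreal a)"
      using ad by (simp only: ennreal_mult ennreal_plus powr_ge_zero add_nonneg_nonneg)
    then show ?thesis unfolding a_def[symmetric] d_def[symmetric] by (simp add: algebra_simps)
  qed
  finally show ?thesis by (simp add: C0_def W_def)
qed

end

section \<open>The weighted double integral of boundary differences\<close>

text \<open>The power of \<open>u\<close> is dictated by scaling. The three sign conditions are the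
  convergence conditions: \<open>t > -1\<close> for \<open>y\<close> near 0, \<open>e < -1\<close>
  for large \<open>s\<close>, and \<open>t + e + 2 < 0\<close> for \<open>y\<close> above
  \<open>u\<close>.\<close>

lemma kernel_integral_bound:
  assumes t: "t > -1" and e: "e < -1" and te: "t + e + 2 < 0" and u: "u > 0"
  shows "(\<integral>\<^sup>+y. \<integral>\<^sup>+s. ennreal (y powr t * (min 1 (y + \<bar>s\<bar>)) powr e) * (if u \<le> min 1 (y + \<bar>s\<bar>) then 1 else 0) \<partial>lint {-pi..pi} \<partial>lint {0<..1})
    \<le> ennreal ((5 powr (-e) * 2 / (-(e+1)) * (1/(t+1) + 1/(-(t+e+2)))) * u powr (t + e + 2))"
proof -
  \<comment> \<open>Removes the cut-off at 1: as \<open>y + \<bar>s\<bar>\<close> is at most 1 + pi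
    < 5, the minimum is at least one fifth of it. The exponent \<open>e\<close> is negative, hence
    the factor \<open>5 powr (-e)\<close>.\<close>
  have pw: "(min 1 (y + \<bar>s\<bar>)) powr e * (if u \<le> min 1 (y + \<bar>s\<bar>) then 1 else 0) \<le>
      5 powr (-e) * ((y + \<bar>s\<bar>) powr e * (if u \<le> y + \<bar>s\<bar> then 1 else 0))" if "0 < y" "y \<le> 1" "\<bar>s\<bar> \<le> pi" for y s :: real
  proof -
    have "y + \<bar>s\<bar> \<le> 5" using that pi_less_4 by linarith
    then have *: "(y + \<bar>s\<bar>) / 5 \<le> min 1 (y + \<bar>s\<bar>)" using that by auto
    have "(min 1 (y + \<bar>s\<bar>)) powr e \<le> ((y + \<bar>s\<bar>) / 5) powr e"
      by (rule powr_mono2') (use * that e in auto)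
    also have "\<dots> = 5 powr (-e) * (y + \<bar>s\<bar>) powr e" using that by (simp add: powr_divide powr_minus field_simps)
    finally show ?thesis by auto
  qed
  have inner: "(\<integral>\<^sup>+s. ennreal ((y + \<bar>s\<bar>) powr e * (if u \<le> y + \<bar>s\<bar> then 1 else 0)) \<partial>lint {-pi..pi})
      \<le> ennreal (2 / (-(e+1)) * max y u powr (e+1))" if y: "0 < y" for y
  proof -
    define g where "g = (\<lambda>s. ennreal ((y + s) powr e * (if u \<le> y + s then 1 else 0)))"
    have [measurable]: "g \<in> borel_measurable borel" unfolding g_def by measurable
    have "(\<integral>\<^sup>+s. g \<bar>s\<bar> \<partial>lint {-pi..pi}) = (\<integral>\<^sup>+s. g \<bar>s\<bar> \<partial>lint {-pi..0}) + (\<integral>\<^sup>+s. g \<bar>s\<bar> \<partial>lint {0..pi})"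
      by (rule nn_integral_lint_union) auto
    also have "(\<integral>\<^sup>+s. g \<bar>s\<bar> \<partial>lint {-pi..0}) = (\<integral>\<^sup>+s. g \<bar>s\<bar> \<partial>lint {0..pi})"
      using nn_integral_affine_lint[of "\<lambda>s. g \<bar>s\<bar>" "{0..pi}" "-1" 0] by simp
    also have "(\<integral>\<^sup>+s. g \<bar>s\<bar> \<partial>lint {0..pi}) \<le> (\<integral>\<^sup>+s. g s \<partial>lint {0..pi})"
      by (rule nn_integral_lint_mono) auto
    also have "\<dots> \<le> (\<integral>\<^sup>+s. g s \<partial>lint {0..})" by (rule nn_integral_lint_mono_set) auto
    also have "\<dots> = (\<integral>\<^sup>+s. ennreal ((y + 1 * s) powr e * (if u \<le> y + 1 * s then 1 else 0)) \<partial>lint {0..})" by (simp add: g_def)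
    also have "\<dots> = (\<integral>\<^sup>+v. ennreal (v powr e * (if u \<le> v then 1 else 0)) \<partial>lint ((\<lambda>x. y + 1 * x) ` {0..}))"
      by (rule nn_integral_affine_lint[where f = "\<lambda>v. ennreal (v powr e * (if u \<le> v then 1 else 0))"]) auto
    also have "(\<lambda>x. y + 1 * x) ` {0..} = {y..}" by (auto simp: image_iff intro: bexI[of _ "x - y" for x])
    also have "(\<integral>\<^sup>+v. ennreal (v powr e * (if u \<le> v then 1 else 0)) \<partial>lint {y..}) = (\<integral>\<^sup>+v. ennreal (v powr e) \<partial>lint {max y u..})"
      by (simp add: nn_integral_lint) (intro nn_integral_cong, auto simp: indicator_def)
    also have "\<dots> = ennreal (max y u powr (e+1) / (-(e+1)))"
      using y by (subst nn_integral_powr_inf) (auto simp: e)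
    finally have "(\<integral>\<^sup>+s. g \<bar>s\<bar> \<partial>lint {-pi..pi}) \<le> ennreal (max y u powr (e+1) / (-(e+1))) + ennreal (max y u powr (e+1) / (-(e+1)))"
      by (simp add: add_mono)
    also have "\<dots> = ennreal (2 / (-(e+1)) * max y u powr (e+1))"
    proof -
      have "max y u powr (e+1) / (-(e+1)) \<ge> 0" using e by (intro divide_nonneg_nonneg) auto
      then show ?thesis by (subst ennreal_plus[symmetric]) auto
    qed
    finally show ?thesis by (simp add: g_def)
  qed
  define C where "C = 5 powr (-e) * 2 / (-(e+1))"
  have C: "C \<ge> 0" using e unfolding C_def by (intro divide_nonneg_nonneg mult_nonneg_nonneg) auto
  have "(\<integral>\<^sup>+y. \<integral>\<^sup>+s. ennreal (y powr t * (min 1 (y + \<bar>s\<bar>)) powr e) * (if u \<le> min 1 (y + \<bar>s\<bar>) then 1 else 0) \<partial>lint {-pi..pi} \<partial>lint {0<..1})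
    \<le> (\<integral>\<^sup>+y. ennreal C * (ennreal (y powr t * u powr (e+1)) * indicator {0..u} y + ennreal (y powr (t+e+1)) * indicator {u..} y) \<partial>lint {0<..1})"
  proof (rule nn_integral_lint_mono)
    fix y :: real assume y: "y \<in> {0<..1}"
    have "(\<integral>\<^sup>+s. ennreal (y powr t * (min 1 (y + \<bar>s\<bar>)) powr e) * (if u \<le> min 1 (y + \<bar>s\<bar>) then 1 else 0) \<partial>lint {-pi..pi})
      \<le> (\<integral>\<^sup>+s. ennreal (y powr t * 5 powr (-e)) * ennreal ((y + \<bar>s\<bar>) powr e * (if u \<le> y + \<bar>s\<bar> then 1 else 0)) \<partial>lint {-pi..pi})"
    proof (rule nn_integral_lint_mono)
      fix s :: real assume "s \<in> {-pi..pi}"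
      then have "\<bar>s\<bar> \<le> pi" by auto
      from mult_left_mono[OF pw[OF _ _ this, of y], of "y powr t"] y
      have "y powr t * (min 1 (y + \<bar>s\<bar>)) powr e * (if u \<le> min 1 (y + \<bar>s\<bar>) then 1 else 0) \<le>
        y powr t * 5 powr (-e) * ((y + \<bar>s\<bar>) powr e * (if u \<le> y + \<bar>s\<bar> then 1 else 0))" by (simp add: mult.assoc)
      then have "ennreal (y powr t * (min 1 (y + \<bar>s\<bar>)) powr e * (if u \<le> min 1 (y + \<bar>s\<bar>) then 1 else 0)) \<le>
        ennreal (y powr t * 5 powr (-e)) * ennreal ((y + \<bar>s\<bar>) powr e * (if u \<le> y + \<bar>s\<bar> then 1 else 0))"
        by (subst ennreal_mult[symmetric]) (auto intro!: ennreal_leI)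
      then show "ennreal (y powr t * (min 1 (y + \<bar>s\<bar>)) powr e) * (if u \<le> min 1 (y + \<bar>s\<bar>) then 1 else 0) \<le>
        ennreal (y powr t * 5 powr (-e)) * ennreal ((y + \<bar>s\<bar>) powr e * (if u \<le> y + \<bar>s\<bar> then 1 else 0))"
        by (auto split: if_splits)
    qed simp
    also have "\<dots> = ennreal (y powr t * 5 powr (-e)) * (\<integral>\<^sup>+s. ennreal ((y + \<bar>s\<bar>) powr e * (if u \<le> y + \<bar>s\<bar> then 1 else 0)) \<partial>lint {-pi..pi})"
      by (rule nn_integral_cmult) measurable
    also have "\<dots> \<le> ennreal (y powr t * 5 powr (-e)) * ennreal (2 / (-(e+1)) * max y u powr (e+1))"
      by (intro mult_left_mono inner) (use y in auto)
    also have "\<dots> = ennreal (C * (y powr t * max y u powr (e+1)))"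
      by (subst ennreal_mult'[symmetric]) (auto simp: C_def mult_ac)
    also have "\<dots> = ennreal C * ennreal (y powr t * max y u powr (e+1))" by (rule ennreal_mult'[OF C])
    \<comment> \<open>Split at \<open>y = u\<close>: below it the weight \<open>y powr t\<close> is
      integrated up to \<open>u\<close>, above it a pure power remains that is integrable at
      infinity.\<close>
    also have "ennreal (y powr t * max y u powr (e+1)) \<le>
       ennreal (y powr t * u powr (e+1)) * indicator {0..u} y + ennreal (y powr (t+e+1)) * indicator {u..} y"
    proof (cases "y \<le> u")
      case True then show ?thesis using y by (simp add: max_def add_increasing2)
    next
      case False
      then have "y powr t * max y u powr (e+1) = y powr (t+e+1)" using y by (simp add: max_def add.assoc flip: powr_add)
      then show ?thesis using False by (simp add: indicator_def)
    qed
    finally show "(\<integral>\<^sup>+s. ennreal (y powr t * (min 1 (y + \<bar>s\<bar>)) powr e) * (if u \<le> min 1 (y + \<bar>s\<bar>) then 1 else 0) \<partial>lint {-pi..pi})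
       \<le> ennreal C * (ennreal (y powr t * u powr (e+1)) * indicator {0..u} y + ennreal (y powr (t+e+1)) * indicator {u..} y)"
      by (simp add: mult_left_mono)
  qed simp
  also have "\<dots> \<le> (\<integral>\<^sup>+y. ennreal C * (ennreal (y powr t * u powr (e+1)) * indicator {0..u} y + ennreal (y powr (t+e+1)) * indicator {u..} y) \<partial>lborel)"
    by (subst nn_integral_lint, simp, measurable, intro nn_integral_mono) (auto simp: indicator_def)
  also have "\<dots> = ennreal C * ((\<integral>\<^sup>+y. ennreal (y powr t * u powr (e+1)) * indicator {0..u} y \<partial>lborel) + (\<integral>\<^sup>+y. ennreal (y powr (t+e+1)) * indicator {u..} y \<partial>lborel))"
    by (subst nn_integral_cmult nn_integral_add, measurable)+
  also have "(\<integral>\<^sup>+y. ennreal (y powr t * u powr (e+1)) * indicator {0..u} y \<partial>lborel) = (\<integral>\<^sup>+y. ennreal (y powr t) * ennreal (u powr (e+1)) \<partial>lint {0..u})"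
    by (subst nn_integral_lint) (auto simp: ennreal_mult mult_ac)
  also have "\<dots> = ennreal (u powr (t+1) / (t+1)) * ennreal (u powr (e+1))"
    using u t by (subst nn_integral_multc) (auto simp: nn_integral_powr_0)
  also have "\<dots> = ennreal (u powr (t + e + 2) * (1/(t+1)))"
    using u t by (subst ennreal_mult[symmetric]) (auto simp: algebra_simps simp flip: powr_add)
  also have "(\<integral>\<^sup>+y. ennreal (y powr (t+e+1)) * indicator {u..} y \<partial>lborel) = ennreal (u powr (t+e+2) * (1/(-(t+e+2))))"
    using nn_integral_powr_inf[of "t+e+1" u] u te by (subst nn_integral_lint[symmetric]) (auto simp: algebra_simps)
  also have "ennreal C * (ennreal (u powr (t + e + 2) * (1/(t+1))) + ennreal (u powr (t+e+2) * (1/(-(t+e+2)))))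
      = ennreal ((C * (1/(t+1) + 1/(-(t+e+2)))) * u powr (t + e + 2))"
  proof -
    have "u powr (t + e + 2) * (1/(t+1)) \<ge> 0" "u powr (t+e+2) * (1/(-(t+e+2))) \<ge> 0"
      using t te by (auto intro!: mult_nonneg_nonneg divide_nonneg_nonpos)
    then show ?thesis using C by (subst ennreal_plus[symmetric], simp, simp, subst ennreal_mult'[symmetric], simp) (simp add: algebra_simps)
  qed
  finally show ?thesis unfolding C_def .
qed

text \<open>Let D be the distance. Then 1 - r is at most D, and concavity of the sine gives that the
  absolute value of \<open>s\<close> is at most pi D, so their sum is at most 5 D. The constant 8
  leaves room; its square is the 64 used next.\<close>

lemma norm_cis_diff_lower:
  assumes r: "0 \<le> r" "r < 1" and s: "\<bar>s\<bar> \<le> pi"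
  shows "norm (cis (\<theta> + s) - of_real r * cis \<theta>) \<ge> min 1 (1 - r + \<bar>s\<bar>) / 8"
proof -
  define D where "D = norm (cis s - of_real r)"
  have "cis (\<theta> + s) - of_real r * cis \<theta> = cis \<theta> * (cis s - of_real r)"
    by (simp add: algebra_simps flip: cis_mult)
  then have D: "norm (cis (\<theta> + s) - of_real r * cis \<theta>) = D" by (simp add: norm_mult D_def)
  have 1: "D \<ge> 1 - r" using norm_triangle_ineq2[of "cis s" "of_real r"] r by (simp add: D_def)
  have "norm (1 - cis s) \<le> norm (1 - complex_of_real r) + D"
    unfolding D_def norm_minus_commute[of "cis s"] by (rule norm_triangle_ineq[of "1 - complex_of_real r" "of_real r - cis s", simplified])
  also have "norm (1 - complex_of_real r) = 1 - r" using r by (metis abs_of_pos diff_gt_0_iff_gt norm_of_real of_real_1 of_real_diff)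
  finally have 2: "norm (1 - cis s) \<le> 2 * D" using 1 by simp
  have "\<bar>s\<bar> / pi \<le> \<bar>sin (s/2)\<bar>"
  proof -
    have "\<bar>s\<bar>/2 / (pi/2) \<le> sin (\<bar>s\<bar>/2)"
    proof -
      have "concave_on {0..pi} sin"
      proof (rule f''_le0_imp_concave)
        show "((sin) has_real_derivative cos x) (at x)" for x :: real by (rule DERIV_sin)
        show "((cos) has_real_derivative - sin x) (at x)" for x :: real by (rule DERIV_cos)
      qed (auto simp: sin_ge_zero)
      from concave_onD[OF this, of "\<bar>s\<bar>/pi" 0 "pi/2"] s show ?thesis by (auto simp: field_simps)
    qed
    moreover have "sin (\<bar>s\<bar>/2) \<le> \<bar>sin (s/2)\<bar>" by (auto simp: abs_if)
    ultimately show ?thesis by simp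
  qed
  moreover have "norm (1 - cis s) = 2 * \<bar>sin (s/2)\<bar>"
    using dist_exp_i_1[of s] by (simp add: cis_conv_exp norm_minus_commute)
  ultimately have "\<bar>s\<bar> / pi \<le> D" using 2 by simp
  then have "\<bar>s\<bar> \<le> pi * D" by (simp add: field_simps)
  moreover have "pi * D \<le> 4 * D" using pi_less_4 1 r by (intro mult_right_mono) auto
  ultimately have "1 - r + \<bar>s\<bar> \<le> 5 * D" using 1 by linarith
  then show ?thesis unfolding D using 1 r by (simp add: min_def)
qed

text \<open>\<open>increment_mean\<close> bounds the integral over \<theta> for each fixed angle
  \<open>s\<close>. Exchanging the remaining integrals leaves, for each depth \<open>u\<close> of
  the derivative, the kernel integral computed above. The constant precedes the function because it
  is later applied to all dilates at once.\<close>

lemma Besov_double_integral: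
  assumes p: "1 < p" and \<alpha>: "p - 2 < \<alpha>" "\<alpha> < p - 1"
  obtains C where "C \<ge> 0"
    "\<And>F F' R. disc_pair F F' R \<Longrightarrow>
      (\<integral>\<^sup>+r. \<integral>\<^sup>+\<theta>. \<integral>\<^sup>+\<tau>. ennreal (norm (F (cis \<tau>) - F (of_real r * cis \<theta>)) powr p * (1 - r) powr (\<alpha> - p + 1) / (norm (cis \<tau> - of_real r * cis \<theta>))\<^sup>2)
          \<partial>circ \<partial>circ \<partial>rad)
      \<le> ennreal C * (\<integral>\<^sup>+r. \<integral>\<^sup>+\<theta>. ennreal (norm (F' (of_real r * cis \<theta>)) powr p * (1 - r) powr \<alpha>) \<partial>circ \<partial>rad)"
proof -
  \<comment> \<open>The midpoint of \<alpha> and p - 1: \<open>b < p - 1\<close> is required by the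
    radial increments, while \<open>b > \<alpha>\<close> is the condition
    \<open>t + e + 2 < 0\<close>. The exponent \<open>e\<close> combines the power p - 1 - b of
    \<open>increment_mean\<close> with the squared distance in the denominator.\<close>
  define b where "b = (\<alpha> + p - 1) / 2"
  define t where "t = \<alpha> - p + 1"
  define e where "e = p - 3 - b"
  have b: "-1 < b" "b < p - 1" using p \<alpha> by (auto simp: b_def)
  have t: "t > -1" "t < 0" using \<alpha> by (auto simp: t_def)
  have e: "e < -1" "t + e + 2 < 0" "b + (t + e + 2) = \<alpha>" using p \<alpha> by (auto simp: e_def b_def t_def field_simps)
  define C1 where "C1 = 3 powr p * (2 * (1 / (1 - b/(p-1))) powr (p-1) + (b + 1))"
  define C2 where "C2 = 5 powr (-e) * 2 / (-(e+1)) * (1/(t+1) + 1/(-(t+e+2)))"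
  have C1: "C1 \<ge> 0" using b by (simp add: C1_def)
  have "0 \<le> -(e+1)" "0 \<le> t + 1" "0 \<le> -(t+e+2)" using e t by linarith+
  then have "0 \<le> 5 powr (-e) * 2 / (-(e+1))" "0 \<le> 1/(t+1)" "0 \<le> 1/(-(t+e+2))"
    by (intro divide_nonneg_nonneg; simp)+
  then have C2: "C2 \<ge> 0" unfolding C2_def by (intro mult_nonneg_nonneg add_nonneg_nonneg)
  show ?thesis
  proof (rule that[of "64 * C1 * C2"])
    show "64 * C1 * C2 \<ge> 0" using C1 C2 by simp
    fix F F' R assume "disc_pair F F' R"
    then interpret disc_pair F F' R .
    define x where "x = (\<lambda>y s. min 1 (y + \<bar>s\<bar>) :: real)"
    define g where "g = (\<lambda>u. ennreal (u powr b) * circle_mean p (1 - u))"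
    have [measurable]: "g \<in> borel_measurable borel" unfolding g_def by measurable
    define K where "K = (\<lambda>y s u. ennreal (64 * C1) * (ennreal (y powr t * x y s powr e) * (if u \<le> x y s then 1 else 0)) * g u)"
    have K1 [measurable]: "(\<lambda>w. K (f w) (h w) (k w)) \<in> borel_measurable M"
      if [measurable]: "f \<in> borel_measurable M" "h \<in> borel_measurable M" "k \<in> borel_measurable M" for f h k and M :: "'z measure"
      unfolding K_def x_def by measurable
    have "(\<integral>\<^sup>+r. \<integral>\<^sup>+\<theta>. \<integral>\<^sup>+\<tau>. ennreal (norm (F (cis \<tau>) - F (of_real r * cis \<theta>)) powr p * (1 - r) powr t / (norm (cis \<tau> - of_real r * cis \<theta>))\<^sup>2)
          \<partial>circ \<partial>circ \<partial>rad) \<le> (\<integral>\<^sup>+r. \<integral>\<^sup>+s. \<integral>\<^sup>+u. K (1 - r) s u \<partial>lint {0..1} \<partial>lint {-pi..pi} \<partial>rad)"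
    proof (rule nn_integral_rad_mono)
      fix r :: real assume r: "0 \<le> r" "r < 1"
      have "(\<integral>\<^sup>+\<theta>. \<integral>\<^sup>+\<tau>. ennreal (norm (F (cis \<tau>) - F (of_real r * cis \<theta>)) powr p * (1 - r) powr t / (norm (cis \<tau> - of_real r * cis \<theta>))\<^sup>2) \<partial>circ \<partial>circ)
        = (\<integral>\<^sup>+\<theta>. \<integral>\<^sup>+s. ennreal (norm (F (cis (\<theta> + s)) - F (of_real r * cis \<theta>)) powr p * (1 - r) powr t / (norm (cis (\<theta> + s) - of_real r * cis \<theta>))\<^sup>2) \<partial>lint {-pi..pi} \<partial>circ)"
        by (intro nn_integral_cong nn_integral_circ_symmetric[where g = "\<lambda>w. ennreal (norm (F w - F (of_real r * cis _)) powr p * (1 - r) powr t / (norm (w - of_real r * cis _))\<^sup>2)"]) measurable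
      also have "\<dots> = (\<integral>\<^sup>+s. \<integral>\<^sup>+\<theta>. ennreal (norm (F (cis (\<theta> + s)) - F (of_real r * cis \<theta>)) powr p * (1 - r) powr t / (norm (cis (\<theta> + s) - of_real r * cis \<theta>))\<^sup>2) \<partial>circ \<partial>lint {-pi..pi})"
        by (rule Fubini_borel[OF sigma_finite_circ sigma_finite_lint]) (simp_all, measurable)
      also have "\<dots> \<le> (\<integral>\<^sup>+s. \<integral>\<^sup>+u. K (1 - r) s u \<partial>lint {0..1} \<partial>lint {-pi..pi})"
      proof (rule nn_integral_lint_mono)
        fix s :: real assume "s \<in> {-pi..pi}"
        then have s: "\<bar>s\<bar> \<le> pi" by auto
        define X where "X = x (1 - r) s"
        have X: "0 < X" "X \<le> 1" "X = min 1 (1 - r + \<bar>s\<bar>)" using r by (auto simp: X_def x_def)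
        have "(\<integral>\<^sup>+\<theta>. ennreal (norm (F (cis (\<theta> + s)) - F (of_real r * cis \<theta>)) powr p * (1 - r) powr t / (norm (cis (\<theta> + s) - of_real r * cis \<theta>))\<^sup>2) \<partial>circ)
          \<le> (\<integral>\<^sup>+\<theta>. ennreal (64 * (1 - r) powr t / X\<^sup>2) * ennreal (norm (F (cis (\<theta> + s)) - F (of_real r * cis \<theta>)) powr p) \<partial>circ)"
        proof (rule nn_integral_circ_mono)
          fix \<theta> :: real
          have "X / 8 \<le> norm (cis (\<theta> + s) - of_real r * cis \<theta>)" using norm_cis_diff_lower[OF r s] X by simp
          then have "(X/8)\<^sup>2 \<le> (norm (cis (\<theta> + s) - of_real r * cis \<theta>))\<^sup>2" using X by (intro power_mono) auto
          then have "(norm (F (cis (\<theta> + s)) - F (of_real r * cis \<theta>)) powr p * (1 - r) powr t) / (norm (cis (\<theta> + s) - of_real r * cis \<theta>))\<^sup>2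
             \<le> (norm (F (cis (\<theta> + s)) - F (of_real r * cis \<theta>)) powr p * (1 - r) powr t) / (X/8)\<^sup>2"
            using X by (intro frac_le) auto
          also have "\<dots> = (64 * (1 - r) powr t / X\<^sup>2) * norm (F (cis (\<theta> + s)) - F (of_real r * cis \<theta>)) powr p"
            using X by (simp add: power_divide)
          finally show "ennreal (norm (F (cis (\<theta> + s)) - F (of_real r * cis \<theta>)) powr p * (1 - r) powr t / (norm (cis (\<theta> + s) - of_real r * cis \<theta>))\<^sup>2)
            \<le> ennreal (64 * (1 - r) powr t / X\<^sup>2) * ennreal (norm (F (cis (\<theta> + s)) - F (of_real r * cis \<theta>)) powr p)"
            by (simp add: ennreal_leI flip: ennreal_mult)
        qed
        also have "\<dots> = ennreal (64 * (1 - r) powr t / X\<^sup>2) * (\<integral>\<^sup>+\<theta>. ennreal (norm (F (cis (\<theta> + s)) - F (of_real r * cis \<theta>)) powr p) \<partial>circ)"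
          by (rule nn_integral_cmult) measurable
        also have "\<dots> \<le> ennreal (64 * (1 - r) powr t / X\<^sup>2) * (ennreal (C1 * X powr (p - 1 - b)) * (\<integral>\<^sup>+u. g u \<partial>lint {0..X}))"
          unfolding C1_def g_def by (intro mult_left_mono increment_mean[OF p b r X(3)]) auto
        also have "\<dots> = ennreal (64 * C1 * ((1 - r) powr t * X powr e)) * (\<integral>\<^sup>+u. g u \<partial>lint {0..X})"
        proof -
          have "X powr (p - 1 - b) = X powr e * X\<^sup>2"
          proof -
            have "X\<^sup>2 = X powr 2" using X by simp
            moreover have "p - 1 - b = e + 2" by (simp add: e_def)
            ultimately show ?thesis by (simp only: powr_add)
          qed
          then have "64 * (1 - r) powr t / X\<^sup>2 * (C1 * X powr (p - 1 - b)) = 64 * C1 * ((1 - r) powr t * X powr e)"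
            using X by simp
          then show ?thesis using C1 by (simp add: mult.assoc[symmetric] flip: ennreal_mult)
        qed
        also have "\<dots> = (\<integral>\<^sup>+u. ennreal (64 * C1 * ((1 - r) powr t * X powr e)) * g u \<partial>lint {0..X})"
          by (rule nn_integral_cmult[symmetric]) measurable
        also have "\<dots> = (\<integral>\<^sup>+u. K (1 - r) s u \<partial>lint {0..1})"
          using X C1 by (simp add: nn_integral_lint) (intro nn_integral_cong, auto simp: indicator_def K_def X_def[symmetric] ennreal_mult)
        finally show "(\<integral>\<^sup>+\<theta>. ennreal (norm (F (cis (\<theta> + s)) - F (of_real r * cis \<theta>)) powr p * (1 - r) powr t / (norm (cis (\<theta> + s) - of_real r * cis \<theta>))\<^sup>2) \<partial>circ)
          \<le> (\<integral>\<^sup>+u. K (1 - r) s u \<partial>lint {0..1})" .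
      qed simp
      finally show "(\<integral>\<^sup>+\<theta>. \<integral>\<^sup>+\<tau>. ennreal (norm (F (cis \<tau>) - F (of_real r * cis \<theta>)) powr p * (1 - r) powr t / (norm (cis \<tau> - of_real r * cis \<theta>))\<^sup>2) \<partial>circ \<partial>circ)
        \<le> (\<integral>\<^sup>+s. \<integral>\<^sup>+u. K (1 - r) s u \<partial>lint {0..1} \<partial>lint {-pi..pi})" .
    qed
    also have "\<dots> = (\<integral>\<^sup>+y. \<integral>\<^sup>+s. \<integral>\<^sup>+u. K y s u \<partial>lint {0..1} \<partial>lint {-pi..pi} \<partial>lint {0<..1})"
      by (rule nn_integral_rad_reflect[where f = "\<lambda>y. \<integral>\<^sup>+s. \<integral>\<^sup>+u. K y s u \<partial>lint {0..1} \<partial>lint {-pi..pi}"]) measurable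
    \<comment> \<open>Two exchanges make \<open>u\<close> the outermost variable, so that
      \<open>kernel_integral_bound\<close> applies for each fixed \<open>u\<close> and its power
      combines with \<open>u powr b\<close> to \<open>u powr \<alpha>\<close>.\<close>
    also have "\<dots> = (\<integral>\<^sup>+y. \<integral>\<^sup>+u. \<integral>\<^sup>+s. K y s u \<partial>lint {-pi..pi} \<partial>lint {0..1} \<partial>lint {0<..1})"
      by (intro nn_integral_cong Fubini_borel[OF sigma_finite_lint sigma_finite_lint]) (simp_all, measurable)
    also have "\<dots> = (\<integral>\<^sup>+u. \<integral>\<^sup>+y. \<integral>\<^sup>+s. K y s u \<partial>lint {-pi..pi} \<partial>lint {0<..1} \<partial>lint {0..1})"
      by (rule Fubini_borel[OF sigma_finite_lint sigma_finite_lint]) (simp_all, measurable)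
    also have "\<dots> \<le> (\<integral>\<^sup>+u. ennreal (64 * C1 * C2) * (ennreal (u powr \<alpha>) * circle_mean p (1 - u)) \<partial>lint {0..1})"
    proof (rule nn_integral_mono_AE)
      have ae: "AE u in lborel. u \<noteq> (0::real)" by (rule AE_lborel_singleton)
      have *: "(\<integral>\<^sup>+y. \<integral>\<^sup>+s. K y s u \<partial>lint {-pi..pi} \<partial>lint {0<..1}) \<le> ennreal (64 * C1 * C2) * (ennreal (u powr \<alpha>) * circle_mean p (1 - u))"
        if u: "u > 0" for u
      proof -
        have "(\<integral>\<^sup>+y. \<integral>\<^sup>+s. K y s u \<partial>lint {-pi..pi} \<partial>lint {0<..1}) =
          ennreal (64 * C1) * (\<integral>\<^sup>+y. \<integral>\<^sup>+s. ennreal (y powr t * x y s powr e) * (if u \<le> x y s then 1 else 0) \<partial>lint {-pi..pi} \<partial>lint {0<..1}) * g u"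
          unfolding K_def x_def
          by (simp add: nn_integral_cmult nn_integral_multc)
        also have "\<dots> \<le> ennreal (64 * C1) * ennreal (C2 * u powr (t + e + 2)) * g u"
          unfolding C2_def x_def by (intro mult_left_mono mult_right_mono kernel_integral_bound t e u) auto
        also have "\<dots> = ennreal (64 * C1 * C2) * (ennreal (u powr \<alpha>) * circle_mean p (1 - u))"
        proof -
          have "u powr (t + e + 2) * u powr b = u powr \<alpha>" using e(3) by (simp add: add.commute flip: powr_add)
          then have "ennreal (64 * C1) * ennreal (C2 * u powr (t + e + 2)) * ennreal (u powr b) = ennreal (64 * C1 * C2) * ennreal (u powr \<alpha>)"
            using C1 C2 by (simp add: mult.assoc flip: ennreal_mult)
          then show ?thesis by (simp add: g_def mult.assoc[symmetric])
        qed
        finally show ?thesis .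
      qed
      show "AE u in lint {0..1}. (\<integral>\<^sup>+y. \<integral>\<^sup>+s. K y s u \<partial>lint {-pi..pi} \<partial>lint {0<..1}) \<le> ennreal (64 * C1 * C2) * (ennreal (u powr \<alpha>) * circle_mean p (1 - u))"
        using ae * by (subst AE_lint) auto
    qed
    also have "\<dots> = ennreal (64 * C1 * C2) * (\<integral>\<^sup>+u. ennreal (u powr \<alpha>) * circle_mean p (1 - u) \<partial>lint {0..1})"
      by (rule nn_integral_cmult) measurable
    also have "(\<integral>\<^sup>+u. ennreal (u powr \<alpha>) * circle_mean p (1 - u) \<partial>lint {0..1}) = (\<integral>\<^sup>+u. ennreal (u powr \<alpha>) * circle_mean p (1 - u) \<partial>lint {0<..1})"
    proof -
      have ae: "AE u in lborel. u \<noteq> (0::real)" by (rule AE_lborel_singleton)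
      show ?thesis unfolding nn_integral_lint[OF borel_closed[OF closed_atLeastAtMost]]
        by (simp add: nn_integral_lint, intro nn_integral_cong_AE) (use ae in \<open>auto simp: indicator_def\<close>)
    qed
    also have "\<dots> = (\<integral>\<^sup>+r. ennreal ((1 - r) powr \<alpha>) * circle_mean p (1 - (1 - r)) \<partial>rad)"
      by (rule nn_integral_rad_reflect[symmetric, where f = "\<lambda>u. ennreal (u powr \<alpha>) * circle_mean p (1 - u)"]) measurable
    also have "\<dots> = (\<integral>\<^sup>+r. \<integral>\<^sup>+\<theta>. ennreal (norm (F' (of_real r * cis \<theta>)) powr p * (1 - r) powr \<alpha>) \<partial>circ \<partial>rad)"
      unfolding circle_mean_def by (intro nn_integral_cong, subst nn_integral_cmult[symmetric]) (auto simp: ennreal_mult mult.commute)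
    finally show "(\<integral>\<^sup>+r. \<integral>\<^sup>+\<theta>. \<integral>\<^sup>+\<tau>. ennreal (norm (F (cis \<tau>) - F (of_real r * cis \<theta>)) powr p * (1 - r) powr (\<alpha> - p + 1) / (norm (cis \<tau> - of_real r * cis \<theta>))\<^sup>2)
          \<partial>circ \<partial>circ \<partial>rad)
      \<le> ennreal (64 * C1 * C2) * (\<integral>\<^sup>+r. \<integral>\<^sup>+\<theta>. ennreal (norm (F' (of_real r * cis \<theta>)) powr p * (1 - r) powr \<alpha>) \<partial>circ \<partial>rad)"
      unfolding t_def .
  qed
qed

section \<open>Zero-free majorants, and a derivative bound in the half-plane\<close>

text \<open>Stone-Weierstrass for real trigonometric polynomials. The algebra \<open>A\<close>
  describes them without negative powers: after multiplication by a power of z they agree on the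
  circle with an ordinary polynomial.\<close>

lemma circle_trig_approx:
  fixes u :: "complex \<Rightarrow> real"
  assumes u: "continuous_on (sphere 0 1) u" and e: "e > 0"
  obtains q where "q holomorphic_on UNIV" "\<And>z. norm z = 1 \<Longrightarrow> \<bar>u z - Re (q z)\<bar> < e"
proof -
  define A :: "(complex \<Rightarrow> real) set" where
    "A = {f. continuous_on (sphere 0 1) f \<and> (\<exists>P N. \<forall>z\<in>sphere 0 1. complex_of_real (f z) * z ^ N = poly P z)}"
  have re: "(complex_of_real (Re z)) * z ^ 1 = poly [:1/2, 0, 1/2:] z"
    and im: "(complex_of_real (Im z)) * z ^ 1 = poly [:\<i>/2, 0, -\<i>/2:] z" if "z \<in> sphere 0 1" for z
  proof -
    have z: "z * cnj z = 1" using that by (simp add: complex_norm_square[symmetric])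
    have r: "of_real (Re z) = (z + cnj z) / 2" by (simp add: complex_eq_iff)
    have i: "of_real (Im z) = - \<i> * (z - cnj z) / 2" by (simp add: complex_eq_iff)
    show "(complex_of_real (Re z)) * z ^ 1 = poly [:1/2, 0, 1/2:] z"
      unfolding r using z by (simp add: algebra_simps)
    show "(complex_of_real (Im z)) * z ^ 1 = poly [:\<i>/2, 0, -\<i>/2:] z"
    proof -
      have "- \<i> * (z - cnj z) / 2 * z = \<i>/2 * (z * cnj z) - \<i>/2 * z * z" by (simp add: field_simps)
      then show ?thesis unfolding i using z by (simp add: algebra_simps)
    qed
  qed
  interpret function_ring_on A "sphere 0 1"
  proof
    show "compact (sphere (0::complex) 1)" by simp
    show "continuous_on (sphere 0 1) f" if "f \<in> A" for f using that by (simp add: A_def)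
    show "(\<lambda>_. c) \<in> A" for c
    proof -
      have "\<forall>z\<in>sphere 0 1. complex_of_real c * z ^ 0 = poly [:of_real c:] z" by simp
      then show ?thesis unfolding A_def by (blast intro: continuous_on_const)
    qed
    fix f g assume f: "f \<in> A" and g: "g \<in> A"
    obtain P N where P: "\<And>z. z\<in>sphere 0 1 \<Longrightarrow> complex_of_real (f z) * z ^ N = poly P z" using f unfolding A_def by blast
    obtain Q M where Q: "\<And>z. z\<in>sphere 0 1 \<Longrightarrow> complex_of_real (g z) * z ^ M = poly Q z" using g unfolding A_def by blast
    have "complex_of_real (f z + g z) * z ^ (N + M) = poly (P * monom 1 M + Q * monom 1 N) z" if "z \<in> sphere 0 1" for z
      by (simp add: poly_monom P[OF that, symmetric] Q[OF that, symmetric] power_add algebra_simps)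
    then have "\<exists>P N. \<forall>z\<in>sphere 0 1. complex_of_real (f z + g z) * z ^ N = poly P z" by blast
    moreover have "continuous_on (sphere 0 1) (\<lambda>x. f x + g x)" using f g unfolding A_def by (auto intro!: continuous_intros)
    ultimately show "(\<lambda>x. f x + g x) \<in> A" unfolding A_def by blast
    have "complex_of_real (f z * g z) * z ^ (N + M) = poly (P * Q) z" if "z \<in> sphere 0 1" for z
      by (simp add: P[OF that, symmetric] Q[OF that, symmetric] power_add algebra_simps)
    then have "\<exists>P N. \<forall>z\<in>sphere 0 1. complex_of_real (f z * g z) * z ^ N = poly P z" by blast
    moreover have "continuous_on (sphere 0 1) (\<lambda>x. f x * g x)" using f g unfolding A_def by (auto intro!: continuous_intros)
    ultimately show "(\<lambda>x. f x * g x) \<in> A" unfolding A_def by blast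
  next
    fix x y :: complex assume "x \<noteq> y"
    then have "Re x \<noteq> Re y \<or> Im x \<noteq> Im y" by (auto simp: complex_eq_iff)
    moreover have "Re \<in> A"
    proof -
      have "\<forall>z\<in>sphere 0 1. (complex_of_real (Re z)) * z ^ 1 = poly [:1/2, 0, 1/2:] z" using re by blast
      moreover have "continuous_on (sphere 0 1) Re" by (simp add: continuous_on_Re)
      ultimately show ?thesis unfolding A_def by blast
    qed
    moreover have "Im \<in> A"
    proof -
      have "\<forall>z\<in>sphere 0 1. (complex_of_real (Im z)) * z ^ 1 = poly [:\<i>/2, 0, -\<i>/2:] z" using im by blast
      moreover have "continuous_on (sphere 0 1) Im" by (simp add: continuous_on_Im)
      ultimately show ?thesis unfolding A_def by blast
    qed
    ultimately show "\<exists>f\<in>A. f x \<noteq> f y" by auto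
  qed
  obtain g where g: "g \<in> A" "\<And>x. x \<in> sphere 0 1 \<Longrightarrow> \<bar>u x - g x\<bar> < e"
    using Stone_Weierstrass_basic[OF u e] by blast
  obtain P N where P: "\<And>z. z\<in>sphere 0 1 \<Longrightarrow> complex_of_real (g z) * z ^ N = poly P z" using g(1) unfolding A_def by blast
  \<comment> \<open>On the circle a negative power of z is the conjugate of a positive one.
    Conjugating the whole term keeps its real part and leaves only nonnegative powers, so
    \<open>q\<close> is entire.\<close>
  define q where "q = (\<lambda>z. \<Sum>j\<le>degree P. if N \<le> j then coeff P j * z ^ (j - N) else cnj (coeff P j) * z ^ (N - j))"
  have "Re (q z) = g z" if z: "norm z = 1" for z
  proof -
    have zc: "z * cnj z = 1" using z by (simp add: complex_norm_square[symmetric])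
    have zk: "z ^ k * cnj z ^ k = 1" for k by (metis zc power_mult_distrib power_one)
    have "complex_of_real (g z) = complex_of_real (g z) * (z ^ N * cnj z ^ N)" by (simp add: zk)
    also have "\<dots> = poly P z * cnj z ^ N" using P[of z] z by (simp add: mult.assoc[symmetric])
    also have "\<dots> = (\<Sum>j\<le>degree P. coeff P j * z ^ j * cnj z ^ N)" by (simp add: poly_altdef sum_distrib_right)
    finally have "g z = (\<Sum>j\<le>degree P. Re (coeff P j * z ^ j * cnj z ^ N))"
      by (metis Re_complex_of_real Re_sum)
    also have "\<dots> = (\<Sum>j\<le>degree P. Re (if N \<le> j then coeff P j * z ^ (j - N) else cnj (coeff P j) * z ^ (N - j)))"
    proof (rule sum.cong)
      fix j
      show "Re (coeff P j * z ^ j * cnj z ^ N) = Re (if N \<le> j then coeff P j * z ^ (j - N) else cnj (coeff P j) * z ^ (N - j))"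
      proof (cases "N \<le> j")
        case True
        then have "z ^ j = z ^ (j - N) * z ^ N" by (simp flip: power_add)
        then have "z ^ j * cnj z ^ N = z ^ (j - N)" by (simp add: zk mult.assoc)
        then show ?thesis using True by (simp add: mult.assoc)
      next
        case False
        then have "cnj z ^ N = cnj z ^ j * cnj z ^ (N - j)" by (simp flip: power_add)
        then have "z ^ j * cnj z ^ N = cnj z ^ (N - j)" by (simp add: zk mult.assoc[symmetric])
        then have "coeff P j * z ^ j * cnj z ^ N = cnj (cnj (coeff P j) * z ^ (N - j))" by (simp add: mult.assoc)
        then show ?thesis using False by (simp only: complex_cnj(1) if_False cnj.sel)
      qed
    qed simp
    also have "\<dots> = Re (q z)" by (simp add: q_def Re_sum)
    finally show ?thesis by simp
  qed
  moreover have "q holomorphic_on UNIV" unfolding q_def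
  proof (rule holomorphic_on_sum)
    fix j
    show "(\<lambda>z. if N \<le> j then coeff P j * z ^ (j - N) else cnj (coeff P j) * z ^ (N - j)) holomorphic_on UNIV"
      by (cases "N \<le> j") (auto intro!: holomorphic_intros)
  qed
  ultimately show ?thesis using g that by auto
qed

text \<open>A harmonic function is fitted on the circle to the logarithm of the modulus; adding
  \<open>e\<close> keeps that logarithm finite at zeros of \<open>F\<close>. Aiming at the middle of
  a band of width \<open>e\<close> puts \<open>Re (q z)\<close> above the lower edge, and the
  maximum principle for \<open>F * exp (- q)\<close> carries the bound inside.\<close>

lemma exp_majorant:
  fixes F :: "complex \<Rightarrow> complex"
  assumes cont: "continuous_on (cball 0 1) F" and hol: "F holomorphic_on ball 0 1" and e: "e > 0"
  obtains q where "q holomorphic_on UNIV" "\<And>z. norm z \<le> 1 \<Longrightarrow> norm (F z) \<le> exp (Re (q z))"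
    "\<And>z. norm z = 1 \<Longrightarrow> Re (q z) \<le> ln (norm (F z) + e) + e"
proof -
  have pos: "norm (F z) + e > 0" for z using e by (simp add: add_nonneg_pos)
  have "continuous_on (sphere 0 1) (\<lambda>z. ln (norm (F z) + e) + e/2)"
    using pos by (intro continuous_intros continuous_on_subset[OF cont]) (auto simp: less_imp_neq[THEN not_sym])
  then obtain q where q: "q holomorphic_on UNIV" "\<And>z. norm z = 1 \<Longrightarrow> \<bar>ln (norm (F z) + e) + e/2 - Re (q z)\<bar> < e/2"
    using e by (elim circle_trig_approx[where e = "e/2"]) auto
  have "norm (F z * exp (- q z)) \<le> 1" if "norm z \<le> 1" for z
  proof (rule maximum_modulus_frontier[where S = "cball 0 1" and f = "\<lambda>z. F z * exp (- q z)"])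
    show "(\<lambda>z. F z * exp (- q z)) holomorphic_on interior (cball 0 1)"
      using hol q by (auto intro!: holomorphic_intros intro: holomorphic_on_subset)
    show "continuous_on (closure (cball 0 1)) (\<lambda>z. F z * exp (- q z))"
      using cont q by (auto intro!: continuous_intros intro: holomorphic_on_imp_continuous_on holomorphic_on_subset)
    show "norm (F z * exp (- q z)) \<le> 1" if "z \<in> frontier (cball 0 1)" for z
    proof -
      have "norm z = 1" using that by (auto simp: frontier_cball)
      from q(2)[OF this] have "ln (norm (F z) + e) \<le> Re (q z)" by (simp add: abs_if split: if_splits)
      then have "norm (F z) + e \<le> exp (Re (q z))" using pos[of z] by (metis exp_le_cancel_iff exp_ln)
      then have "norm (F z) \<le> exp (Re (q z))" using e by simp
      then show ?thesis by (simp add: norm_mult exp_minus field_simps norm_divide)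
    qed
  qed (use that in auto)
  then have "norm (F z) \<le> exp (Re (q z))" if "norm z \<le> 1" for z
    using that by (simp add: norm_mult exp_minus field_simps norm_divide)
  moreover have "Re (q z) \<le> ln (norm (F z) + e) + e" if "norm z = 1" for z
    using q(2)[OF that] by (simp add: abs_if split: if_splits)
  ultimately show ?thesis using q that by blast
qed

text \<open>Schwarz-Pick for the half-plane: a Cayley transform sends \<open>K z\<close> to 0 and
  the half-plane into the disc, and Cauchy's inequality on the circle of radius \<open>d/2\<close>
  bounds its derivative by 2/d. The sharp constant is 2; the radius \<open>d/2\<close> costs the
  other factor 2.\<close>

lemma deriv_bound_Re_nonneg:
  fixes K :: "complex \<Rightarrow> complex"
  assumes hol: "K holomorphic_on ball z d" and d: "d > 0" and re: "\<And>w. w \<in> ball z d \<Longrightarrow> Re (K w) \<ge> 0"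
  shows "norm (deriv K z) \<le> 4 * Re (K z) / d"
proof -
  \<comment> \<open>The shift by \<open>e\<close> keeps the Cayley transform defined when the real
    part of \<open>K\<close> vanishes.\<close>
  have *: "norm (deriv K z) \<le> 4 * (Re (K z) + e) / d" if e: "e > 0" for e
  proof -
    define a where "a = K z + of_real e"
    have a: "Re a > 0" using re[of z] d e by (simp add: a_def)
    define g where "g = (\<lambda>w. (K w + of_real e - a) / (K w + of_real e + cnj a))"
    have nz: "K w + of_real e + cnj a \<noteq> 0" if "w \<in> ball z d" for w
      using re[OF that] e a by (auto simp: complex_eq_iff)
    have holg: "g holomorphic_on ball z d" unfolding g_def
      by (intro holomorphic_intros hol) (use nz in auto)
    have gb: "norm (g w) \<le> 1" if w: "w \<in> ball z d" for w
    proof -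
      define b where "b = K w + of_real e"
      have b: "Re b \<ge> 0" using re[OF w] e by (simp add: b_def)
      have "(norm (b - a))\<^sup>2 \<le> (norm (b + cnj a))\<^sup>2"
      proof -
        have "0 \<le> Re a * Re b" using a b by simp
        moreover have "(Re b - Re a)\<^sup>2 + 4 * (Re a * Re b) = (Re b + Re a)\<^sup>2" by (simp add: power2_eq_square algebra_simps)
        ultimately show ?thesis unfolding cmod_power2 by simp
      qed
      then have "norm (b - a) \<le> norm (b + cnj a)" by (rule power2_le_imp_le) simp
      then show ?thesis using nz[OF w] unfolding g_def b_def by (simp add: norm_divide)
    qed
    have "norm ((deriv ^^ 1) g z) \<le> fact 1 * 1 / (d/2) ^ 1"
    proof (rule Cauchy_inequality)
      show "g holomorphic_on ball z (d/2)" by (rule holomorphic_on_subset[OF holg]) (use d in auto)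
      show "continuous_on (cball z (d/2)) g"
        by (rule continuous_on_subset[OF holomorphic_on_imp_continuous_on[OF holg]]) (use d in auto)
      show "norm (g x) \<le> 1" if "norm (z - x) = d/2" for x using that d by (intro gb) (auto simp: dist_norm)
    qed (use d in auto)
    then have dg: "norm (deriv g z) \<le> 2 / d" by simp
    have "(K has_field_derivative deriv K z) (at z)" using hol d by (intro holomorphic_derivI[of K "ball z d"]) auto
    then have "(g has_field_derivative deriv K z / (a + cnj a)) (at z)"
      unfolding g_def using nz[of z] d
      by (auto intro!: derivative_eq_intros simp: a_def)
    then have "deriv g z = deriv K z / (a + cnj a)" by (rule DERIV_imp_deriv)
    also have "a + cnj a = of_real (2 * Re a)" by (rule complex_add_cnj)
    finally have "norm (deriv g z) = norm (deriv K z) / (2 * Re a)" using a by (simp add: norm_divide)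
    then have "norm (deriv K z) = norm (deriv g z) * (2 * Re a)" using a by simp
    also have "\<dots> \<le> 2 / d * (2 * Re a)" using dg a by (intro mult_right_mono) auto
    finally have "norm (deriv K z) \<le> 2 / d * (2 * Re a)" .
    then show ?thesis by (simp add: a_def)
  qed
  have "norm (deriv K z) * d / 4 \<le> Re (K z) + e" if "e > 0" for e
    using *[OF that] d by (simp add: field_simps)
  then have "norm (deriv K z) * d / 4 \<le> Re (K z)" by (rule field_le_epsilon)
  then show ?thesis using d by (simp add: field_simps)
qed

section \<open>Carleson-Newman sequences\<close>

text \<open>One minus the squared pseudohyperbolic distance (\<open>sig_bl\<close>). In this closed
  form the symmetry is visible, and on a circle about 0 it is a multiple of a Poisson
  kernel.\<close>

definition sig :: "complex \<Rightarrow> complex \<Rightarrow> real" where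
  "sig a z = (1 - (norm a)\<^sup>2) * (1 - (norm z)\<^sup>2) / (norm (1 - cnj a * z))\<^sup>2"

lemma one_minus_norm_sq_pos: "norm (z::complex) < 1 \<Longrightarrow> 0 < 1 - (norm z)\<^sup>2"
  by (simp add: abs_square_less_1)

lemma one_minus_cnj_mult_neq: "norm a < 1 \<Longrightarrow> norm z \<le> 1 \<Longrightarrow> 1 - cnj a * z \<noteq> 0"
proof
  assume a: "norm a < 1" "norm z \<le> 1" and "1 - cnj a * z = 0"
  then have "norm (cnj a * z) = 1" by (metis norm_one eq_iff_diff_eq_0)
  moreover have "norm (cnj a * z) \<le> norm a * 1"
    unfolding norm_mult complex_mod_cnj by (intro mult_left_mono a) auto
  ultimately show False using a by simp
qed

lemma sig_nonneg: "norm a < 1 \<Longrightarrow> norm z \<le> 1 \<Longrightarrow> sig a z \<ge> 0"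
  unfolding sig_def using abs_square_le_1[of "norm z"] abs_square_le_1[of "norm a"]
  by (intro divide_nonneg_nonneg mult_nonneg_nonneg) auto

lemma sig_commute: "sig a z = sig z a"
proof -
  have "norm (1 - cnj a * z) = norm (cnj (1 - cnj a * z))" by (simp only: complex_mod_cnj)
  then show ?thesis by (simp add: sig_def mult.commute)
qed

definition bl :: "complex \<Rightarrow> complex \<Rightarrow> complex" where
  "bl a z = (z - a) / (1 - cnj a * z)"

lemma norm_one_minus_cnj_mult_sq:
  "(norm (1 - cnj a * z))\<^sup>2 = (norm (z - a))\<^sup>2 + (1 - (norm a)\<^sup>2) * (1 - (norm z)\<^sup>2)"
proof -
  have "complex_of_real ((norm (1 - cnj a * z))\<^sup>2) = of_real ((norm (z - a))\<^sup>2 + (1 - (norm a)\<^sup>2) * (1 - (norm z)\<^sup>2))"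
    by (simp only: of_real_add of_real_mult of_real_diff of_real_1 complex_norm_square) (simp add: algebra_simps)
  then show ?thesis by (simp only: of_real_eq_iff)
qed

lemma sig_bl:
  assumes "norm a < 1" "norm z \<le> 1"
  shows "sig a z = 1 - (norm (bl a z))\<^sup>2"
proof -
  have "(norm (1 - cnj a * z))\<^sup>2 \<noteq> 0" using one_minus_cnj_mult_neq[OF assms] by simp
  then show ?thesis unfolding sig_def bl_def norm_divide power_divide
    using norm_one_minus_cnj_mult_sq[of a z] by (simp add: field_simps)
qed

lemma sig_le_1: "norm a < 1 \<Longrightarrow> norm z \<le> 1 \<Longrightarrow> sig a z \<le> 1"
  by (simp add: sig_bl)

lemma norm_bl_le_1: "norm a < 1 \<Longrightarrow> norm z \<le> 1 \<Longrightarrow> norm (bl a z) \<le> 1"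
  using sig_nonneg[of a z] by (simp add: sig_bl abs_square_le_1)

lemma norm_bl_less_1:
  assumes "norm a < 1" "norm z < 1" shows "norm (bl a z) < 1"
proof -
  have "sig a z > 0" unfolding sig_def using assms one_minus_cnj_mult_neq[of a z]
    by (intro divide_pos_pos mult_pos_pos one_minus_norm_sq_pos) auto
  then show ?thesis using assms by (simp add: sig_bl abs_square_less_1)
qed

text \<open>Invariance under the disc automorphism \<open>bl z\<close>, by direct computation of the
  three factors. It allows an arbitrary point of the disc to be moved to the origin.\<close>

lemma sig_bl_bl:
  assumes a: "norm a < 1" "norm b < 1" "norm z < 1"
  shows "sig (bl z a) (bl z b) = sig a b"
proof -
  have nz: "1 - cnj z * a \<noteq> 0" "1 - cnj z * b \<noteq> 0" "1 - cnj a * b \<noteq> 0" "1 - z * cnj a \<noteq> 0"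
    using one_minus_cnj_mult_neq[of z a] one_minus_cnj_mult_neq[of z b] one_minus_cnj_mult_neq[of a b]
      one_minus_cnj_mult_neq[of a z] a by (auto simp: mult.commute)
  have "1 - cnj (bl z a) * bl z b = of_real (1 - (norm z)\<^sup>2) * (1 - cnj a * b) / ((1 - z * cnj a) * (1 - cnj z * b))"
  proof -
    have "1 - cnj (bl z a) * bl z b = ((1 - z * cnj a) * (1 - cnj z * b) - (cnj a - cnj z) * (b - z)) / ((1 - z * cnj a) * (1 - cnj z * b))"
    proof -
      have "1 - p / X * (q / Y) = (X * Y - p * q) / (X * Y)" if "X \<noteq> 0" "Y \<noteq> 0" for p q X Y :: complex
        using that by (simp add: field_simps)
      from this[OF nz(4) nz(2)] show ?thesis by (simp only: bl_def complex_cnj_divide complex_cnj_diff complex_cnj_one complex_cnj_mult complex_cnj_cnj)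
    qed
    also have "(1 - z * cnj a) * (1 - cnj z * b) - (cnj a - cnj z) * (b - z) = of_real (1 - (norm z)\<^sup>2) * (1 - cnj a * b)"
      by (simp only: of_real_diff of_real_1 complex_norm_square) (simp add: algebra_simps)
    finally show ?thesis .
  qed
  moreover have "norm (1 - z * cnj a) = norm (1 - cnj z * a)"
    by (metis complex_cnj_cnj complex_cnj_diff complex_cnj_mult complex_cnj_one complex_mod_cnj)
  ultimately have n: "norm (1 - cnj (bl z a) * bl z b) = (1 - (norm z)\<^sup>2) * norm (1 - cnj a * b) / (norm (1 - cnj z * a) * norm (1 - cnj z * b))"
    using one_minus_norm_sq_pos[OF a(3)] by (simp add: norm_divide norm_mult del: of_real_diff)
  define A where "A = norm (1 - cnj z * a)"
  define B where "B = norm (1 - cnj z * b)"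
  define D where "D = norm (1 - cnj a * b)"
  define Z where "Z = 1 - (norm z)\<^sup>2"
  have pos: "A \<noteq> 0" "B \<noteq> 0" "D \<noteq> 0" "Z \<noteq> 0" using nz one_minus_norm_sq_pos[OF a(3)] by (auto simp: A_def B_def D_def Z_def)
  have s: "1 - (norm (bl z a))\<^sup>2 = Z * (1 - (norm a)\<^sup>2) / A\<^sup>2" "1 - (norm (bl z b))\<^sup>2 = Z * (1 - (norm b)\<^sup>2) / B\<^sup>2"
    using sig_bl[of z a] sig_bl[of z b] a by (auto simp: sig_def A_def B_def Z_def)
  show ?thesis unfolding sig_def[of "bl z a"] s n A_def[symmetric] B_def[symmetric] D_def[symmetric] Z_def[symmetric] sig_def[of a b]
    using pos by (simp add: power2_eq_square field_simps)
qed

text \<open>The hypothesis bounds the sums of \<open>sig\<close> at the points themselves, the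
  conclusion is the bound at the origin. Let T be the sum in question and S the quadratic form of
  the kernel 1 / (1 - cnj(w_n) w_k) with weights a_n. Expanding geometrically, S is a sum of squares
  whose term of index 0 is T^2, so T^2 <= S; the hypothesis yields 2 S - T^2 <= 2 A T, and together
  T <= 2 A.\<close>

lemma Bergman_sum_bound:
  fixes w :: "'a \<Rightarrow> complex"
  assumes fin: "finite F" and w: "\<And>n. n \<in> F \<Longrightarrow> norm (w n) < 1"
    and A: "\<And>k. k \<in> F \<Longrightarrow> (\<Sum>n\<in>F. sig (w n) (w k)) \<le> A" and A0: "A \<ge> 0"
  shows "(\<Sum>n\<in>F. 1 - (norm (w n))\<^sup>2) \<le> 2 * A"
proof (cases "F = {}")
  case False
  define a where "a n = 1 - (norm (w n))\<^sup>2" for n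
  have a: "a n > 0" if "n \<in> F" for n using one_minus_norm_sq_pos[OF w[OF that]] by (simp only: a_def)
  define T where "T = (\<Sum>n\<in>F. a n)"
  define x where "x n k = cnj (w n) * w k" for n k
  have x: "norm (x n k) < 1" if "n \<in> F" "k \<in> F" for n k
  proof -
    have "norm (w n) * norm (w k) \<le> norm (w n) * 1" using w[OF that(2)] by (intro mult_left_mono) auto
    then show ?thesis using w[OF that(1)] by (simp add: x_def norm_mult)
  qed
  have T: "T > 0" unfolding T_def using a fin False by (intro sum_pos) auto
  define S where "S = (\<Sum>n\<in>F. \<Sum>k\<in>F. a n * a k * Re (1 / (1 - x n k)))"
  have sums: "(\<lambda>j. \<Sum>n\<in>F. \<Sum>k\<in>F. a n * a k * Re (x n k ^ j)) sums S"
    unfolding S_def by (intro sums_sum sums_mult sums_Re geometric_sums x)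
  have trm: "(\<Sum>n\<in>F. \<Sum>k\<in>F. a n * a k * Re (x n k ^ j)) = (norm (\<Sum>k\<in>F. of_real (a k) * w k ^ j))\<^sup>2" for j
  proof -
    have "complex_of_real ((norm (\<Sum>k\<in>F. of_real (a k) * w k ^ j))\<^sup>2) = (\<Sum>k\<in>F. of_real (a k) * w k ^ j) * cnj (\<Sum>k\<in>F. of_real (a k) * w k ^ j)"
      by (rule complex_norm_square)
    also have "\<dots> = (\<Sum>n\<in>F. \<Sum>k\<in>F. of_real (a n * a k) * x n k ^ j)"
      by (simp add: cnj_sum sum_product x_def power_mult_distrib mult_ac) (rule sum.swap[THEN trans], intro sum.cong refl, simp add: mult_ac)
    finally have "(norm (\<Sum>k\<in>F. of_real (a k) * w k ^ j))\<^sup>2 = Re (\<Sum>n\<in>F. \<Sum>k\<in>F. of_real (a n * a k) * x n k ^ j)"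
      by (metis Re_complex_of_real)
    then show ?thesis by (simp add: Re_sum)
  qed
  have "T\<^sup>2 \<le> S"
  proof -
    have "(\<Sum>j\<in>{0}. \<Sum>n\<in>F. \<Sum>k\<in>F. a n * a k * Re (x n k ^ j)) \<le> S"
      unfolding sums_unique[OF sums] by (rule sum_le_suminf) (use sums in \<open>auto simp: trm sums_iff\<close>)
    then show ?thesis by (simp add: T_def power2_eq_square sum_product)
  qed
  \<comment> \<open>Doubling the real part of the kernel and subtracting 1 gives the quotient with
    numerator 1 - |y|^2. Here |y|^2 is (1 - a_n)(1 - a_k), so the numerator is at most a_n + a_k,
    and \<open>sig\<close> appears with this sum as weight.\<close>
  moreover have "2 * S - T\<^sup>2 \<le> (\<Sum>n\<in>F. \<Sum>k\<in>F. sig (w n) (w k) * (a n + a k))"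
  proof -
    have "2 * S - T\<^sup>2 = (\<Sum>n\<in>F. \<Sum>k\<in>F. a n * a k * (2 * Re (1 / (1 - x n k)) - 1))"
      by (simp add: S_def T_def power2_eq_square sum_product sum_distrib_left sum_subtractf right_diff_distrib mult_ac)
    also have "\<dots> \<le> (\<Sum>n\<in>F. \<Sum>k\<in>F. sig (w n) (w k) * (a n + a k))"
    proof (intro sum_mono)
      fix n k assume nk: "n \<in> F" "k \<in> F"
      define y where "y = x n k"
      have y: "norm y < 1" "1 - y \<noteq> 0" using x[OF nk] by (auto simp: y_def)
      have "2 * Re (1 / (1 - y)) - 1 = (1 - (norm y)\<^sup>2) / (norm (1 - y))\<^sup>2"
      proof -
        have "Re (1 / (1 - y)) = (1 - Re y) / (norm (1 - y))\<^sup>2" by (simp add: Re_divide cmod_power2)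
        moreover have "(norm (1 - y))\<^sup>2 = 1 - 2 * Re y + (norm y)\<^sup>2" unfolding cmod_power2 by (simp add: power2_eq_square algebra_simps)
        then have "2 * (1 - Re y) - (norm (1 - y))\<^sup>2 = 1 - (norm y)\<^sup>2" by simp
        moreover have "2 * ((1 - Re y) / (norm (1 - y))\<^sup>2) - 1 = (2 * (1 - Re y) - (norm (1 - y))\<^sup>2) / (norm (1 - y))\<^sup>2"
          using y by (simp add: diff_divide_distrib)
        ultimately show ?thesis by simp
      qed
      also have "\<dots> \<le> (a n + a k) / (norm (1 - y))\<^sup>2"
      proof (rule divide_right_mono)
        have "(norm y)\<^sup>2 = (1 - a n) * (1 - a k)" by (simp add: y_def x_def a_def norm_mult power_mult_distrib)
        then show "1 - (norm y)\<^sup>2 \<le> a n + a k" using a[OF nk(1)] a[OF nk(2)] by (simp add: algebra_simps)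
      qed simp
      finally have "a n * a k * (2 * Re (1 / (1 - y)) - 1) \<le> a n * a k * ((a n + a k) / (norm (1 - y))\<^sup>2)"
        using a[OF nk(1)] a[OF nk(2)] by (intro mult_left_mono) auto
      then show "a n * a k * (2 * Re (1 / (1 - x n k)) - 1) \<le> sig (w n) (w k) * (a n + a k)"
        by (simp add: y_def sig_def a_def x_def)
    qed
    finally show ?thesis .
  qed
  moreover have "(\<Sum>n\<in>F. \<Sum>k\<in>F. sig (w n) (w k) * (a n + a k)) \<le> 2 * A * T"
  proof -
    have 1: "(\<Sum>n\<in>F. \<Sum>k\<in>F. sig (w n) (w k) * a k) \<le> A * T"
    proof -
      have "(\<Sum>n\<in>F. \<Sum>k\<in>F. sig (w n) (w k) * a k) = (\<Sum>k\<in>F. (\<Sum>n\<in>F. sig (w n) (w k)) * a k)"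
        by (subst sum.swap) (simp add: sum_distrib_right)
      also have "\<dots> \<le> (\<Sum>k\<in>F. A * a k)" by (intro sum_mono mult_right_mono A) (auto intro: less_imp_le a)
      finally show ?thesis by (simp add: T_def sum_distrib_left)
    qed
    have "(\<Sum>n\<in>F. \<Sum>k\<in>F. sig (w n) (w k) * a n) = (\<Sum>n\<in>F. \<Sum>k\<in>F. sig (w n) (w k) * a k)"
      by (subst sum.swap) (simp add: sig_commute)
    with 1 show ?thesis by (simp add: distrib_left sum.distrib)
  qed
  ultimately have "T\<^sup>2 \<le> 2 * A * T" by linarith
  then have "T \<le> 2 * A" using T by (simp add: power2_eq_square)
  then show ?thesis by (simp add: T_def a_def)
qed (use A0 in simp)

text \<open>With r the pseudohyperbolic distance, 1 - r^2 <= -2 ln r turns the lower bound on the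
  products into a bound on the sums of \<open>sig\<close> at the points of the sequence.
  \<open>Bergman_sum_bound\<close>, after moving \<open>w\<close> to the origin, extends it to every
  \<open>w\<close>.\<close>

lemma separated_imp_sig_bound:
  assumes us: "uniformly_separated J z"
  obtains C where "C \<ge> 0" "\<And>F w. finite F \<Longrightarrow> F \<subseteq> J \<Longrightarrow> norm w < 1 \<Longrightarrow> (\<Sum>n\<in>F. sig (z n) w) \<le> C"
proof -
  obtain \<delta> where \<delta>: "\<delta> > 0" "\<And>n. n \<in> J \<Longrightarrow> \<delta> \<le> separation_product J z n" and zJ: "\<And>n. n \<in> J \<Longrightarrow> norm (z n) < 1"
    using us unfolding uniformly_separated_def by (auto simp: image_subset_iff)
  have f01: "norm ((z k - z n) / (1 - cnj (z k) * z n)) \<in> {0..1}" if "k \<in> J" "n \<in> J" for k n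
    using norm_bl_le_1[of "z k" "z n"] zJ[OF that(1)] zJ[OF that(2)] by (simp add: bl_def norm_divide norm_minus_commute)
  \<comment> \<open>All factors lie in [0, 1], so the partial products decrease and their limit
    bounds every finite subproduct from below.\<close>
  have prod_ge: "\<delta> \<le> (\<Prod>k\<in>F-{n}. norm ((z k - z n) / (1 - cnj (z k) * z n)))" if F: "finite F" "F \<subseteq> J" "n \<in> J" for F n
  proof -
    define P where "P N = (\<Prod>k \<in> {k \<in> J. k < N \<and> k \<noteq> n}. norm ((z k - z n) / (1 - cnj (z k) * z n)))" for N :: nat
    have P0: "P N \<ge> 0" for N unfolding P_def by (intro prod_nonneg) auto
    have anti: "(\<Prod>k\<in>B. norm ((z k - z n) / (1 - cnj (z k) * z n))) \<le> (\<Prod>k\<in>A. norm ((z k - z n) / (1 - cnj (z k) * z n)))"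
      if "finite B" "A \<subseteq> B" "B \<subseteq> J" for A B
    proof -
      have "(\<Prod>k\<in>B. norm ((z k - z n) / (1 - cnj (z k) * z n))) = (\<Prod>k\<in>B-A. norm ((z k - z n) / (1 - cnj (z k) * z n))) * (\<Prod>k\<in>A. norm ((z k - z n) / (1 - cnj (z k) * z n)))"
        by (rule prod.subset_diff) (use that in auto)
      also have "\<dots> \<le> 1 * (\<Prod>k\<in>A. norm ((z k - z n) / (1 - cnj (z k) * z n)))"
      proof (intro mult_right_mono prod_le_1 conjI)
        fix k assume "k \<in> B - A"
        then show "norm ((z k - z n) / (1 - cnj (z k) * z n)) \<le> 1" "0 \<le> norm ((z k - z n) / (1 - cnj (z k) * z n))"
          using f01[of k n] that F by auto
      qed (auto intro!: prod_nonneg)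
      finally show ?thesis by simp
    qed
    have dec: "decseq P" unfolding P_def by (intro decseq_SucI anti) auto
    then obtain L where "P \<longlonglongrightarrow> L" "\<forall>i. L \<le> P i" using decseq_convergent[OF dec, of 0] P0 by blast
    then have lim_le: "lim P \<le> P N" for N by (simp add: limI)
    have sp: "separation_product J z n = lim P" unfolding separation_product_def P_def ..
    obtain N where N: "\<forall>k\<in>F. k < N" using F(1) finite_nat_set_iff_bounded by blast
    have "\<delta> \<le> lim P" using \<delta>(2)[OF F(3)] sp by simp
    also have "\<dots> \<le> P N" by (rule lim_le)
    also have "\<dots> \<le> (\<Prod>k\<in>F-{n}. norm ((z k - z n) / (1 - cnj (z k) * z n)))"
      unfolding P_def
    proof (rule anti)
      show "F - {n} \<subseteq> {k \<in> J. k < N \<and> k \<noteq> n}" using F(2) N by blast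
      show "finite {k \<in> J. k < N \<and> k \<noteq> n}" by simp
      show "{k \<in> J. k < N \<and> k \<noteq> n} \<subseteq> J" by blast
    qed
    finally show ?thesis .
  qed
  \<comment> \<open>The 1 pays for the term of the point itself, which the product omits. The
    maximum keeps \<open>A\<close> nonnegative also for empty \<open>J\<close>, where \<delta> may
    exceed 1.\<close>
  define A where "A = 1 + max 0 (- 2 * ln \<delta>)"
  have A: "(\<Sum>n\<in>F. sig (z n) (z k)) \<le> A" if F: "finite F" "F \<subseteq> J" "k \<in> F" for F k
  proof -
    define r where "r n = norm ((z n - z k) / (1 - cnj (z n) * z k))" for n
    have kJ: "k \<in> J" using F by blast
    have pr: "\<delta> \<le> (\<Prod>n\<in>F-{k}. r n)" unfolding r_def by (rule prod_ge[OF F(1,2) kJ])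
    then have prpos: "(\<Prod>n\<in>F-{k}. r n) > 0" using \<delta>(1) by (rule less_le_trans[rotated])
    have rpos: "r n > 0" if n: "n \<in> F - {k}" for n
    proof (rule ccontr)
      assume "\<not> r n > 0"
      then have "r n = 0" unfolding r_def by simp
      then have "(\<Prod>n\<in>F-{k}. r n) = 0" using n F(1) by (intro prod_zero) auto
      then show False using prpos by simp
    qed
    have "(\<Sum>n\<in>F-{k}. sig (z n) (z k)) \<le> (\<Sum>n\<in>F-{k}. - 2 * ln (r n))"
    proof (rule sum_mono)
      fix n assume n: "n \<in> F - {k}"
      have nJ: "n \<in> J" using n F(2) by blast
      have "sig (z n) (z k) = 1 - (norm (bl (z n) (z k)))\<^sup>2"
        using zJ[OF nJ] zJ[OF kJ] by (intro sig_bl) auto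
      also have "norm (bl (z n) (z k)) = r n" by (simp add: bl_def r_def norm_divide norm_minus_commute)
      also have "1 - (r n)\<^sup>2 \<le> - ln ((r n)\<^sup>2)" using ln_le_minus_one[of "(r n)\<^sup>2"] rpos[OF n] by simp
      also have "ln ((r n)\<^sup>2) = 2 * ln (r n)" using rpos[OF n] by (simp add: ln_realpow)
      finally show "sig (z n) (z k) \<le> - 2 * ln (r n)" by simp
    qed
    also have "\<dots> = - 2 * (\<Sum>n\<in>F-{k}. ln (r n))" by (simp add: sum_distrib_left sum_negf)
    also have "(\<Sum>n\<in>F-{k}. ln (r n)) = ln (\<Prod>n\<in>F-{k}. r n)"
    proof (rule ln_prod[symmetric])
      fix i assume "i \<in> F - {k}" from rpos[OF this] show "r i \<noteq> 0" by simp
    qed (use F in simp)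
    also have "- 2 * ln (\<Prod>n\<in>F-{k}. r n) \<le> - 2 * ln \<delta>" using pr prpos \<delta>(1) by simp
    finally have "(\<Sum>n\<in>F-{k}. sig (z n) (z k)) \<le> max 0 (- 2 * ln \<delta>)" by simp
    moreover have "sig (z k) (z k) \<le> 1" using zJ[OF kJ] by (intro sig_le_1) auto
    ultimately show ?thesis unfolding A_def using F by (subst sum.remove[of F k]) auto
  qed
  show ?thesis
  proof (rule that[of "2 * A"])
    show "2 * A \<ge> 0" unfolding A_def by simp
    fix F and w :: complex assume F: "finite F" "F \<subseteq> J" and w: "norm w < 1"
    have le: "(\<Sum>n\<in>F. 1 - (norm (bl w (z n)))\<^sup>2) \<le> 2 * A"
    proof (rule Bergman_sum_bound[OF F(1)])
      show "norm (bl w (z n)) < 1" if "n \<in> F" for n using zJ that F w by (intro norm_bl_less_1) auto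
      show "(\<Sum>n\<in>F. sig (bl w (z n)) (bl w (z k))) \<le> A" if "k \<in> F" for k
      proof -
        have "(\<Sum>n\<in>F. sig (bl w (z n)) (bl w (z k))) = (\<Sum>n\<in>F. sig (z n) (z k))"
        proof (intro sum.cong refl sig_bl_bl w)
          fix n assume "n \<in> F" then show "norm (z n) < 1" "norm (z k) < 1" using zJ F(2) that by blast+
        qed
        then show ?thesis using A[OF F that] by simp
      qed
    qed (simp add: A_def)
    have eq: "(\<Sum>n\<in>F. 1 - (norm (bl w (z n)))\<^sup>2) = (\<Sum>n\<in>F. sig (z n) w)"
    proof (rule sum.cong)
      fix n assume "n \<in> F"
      then have "norm (z n) \<le> 1" using zJ F(2) by (metis subsetD less_imp_le)
      from sig_bl[OF w this] show "1 - (norm (bl w (z n)))\<^sup>2 = sig (z n) w" using sig_commute[of w "z n"] by simp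
    qed simp
    show "(\<Sum>n\<in>F. sig (z n) w) \<le> 2 * A" using le unfolding eq .
  qed
qed

lemma Carleson_Newman_sig_bound:
  assumes cn: "Carleson_Newman I z"
  obtains C where "C \<ge> 0" "\<And>F w. finite F \<Longrightarrow> F \<subseteq> I \<Longrightarrow> norm w < 1 \<Longrightarrow> (\<Sum>n\<in>F. sig (z n) w) \<le> C"
    "\<And>n. n \<in> I \<Longrightarrow> norm (z n) < 1"
proof -
  obtain m :: nat and J :: "nat \<Rightarrow> nat set" where I: "I = (\<Union>j<m. J j)" and us: "\<And>j. j < m \<Longrightarrow> uniformly_separated (J j) z"
    using cn unfolding Carleson_Newman_def by blast
  have zI: "norm (z n) < 1" if nI: "n \<in> I" for n
  proof -
    obtain j where "j < m" "n \<in> J j" using nI unfolding I by blast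
    moreover from us[OF this(1)] have "z ` J j \<subseteq> unit_disc" unfolding uniformly_separated_def by (rule conjunct1)
    ultimately have "z n \<in> unit_disc" by blast
    then show ?thesis by simp
  qed
  have ex: "\<exists>C\<ge>0. \<forall>F w. finite F \<longrightarrow> F \<subseteq> J j \<longrightarrow> norm w < 1 \<longrightarrow> (\<Sum>n\<in>F. sig (z n) w) \<le> C" if j: "j < m" for j
  proof (rule separated_imp_sig_bound[OF us[OF j]])
    fix C assume C: "C \<ge> 0" "\<And>F w. finite F \<Longrightarrow> F \<subseteq> J j \<Longrightarrow> norm w < 1 \<Longrightarrow> (\<Sum>n\<in>F. sig (z n) w) \<le> C"
    show ?thesis by (intro exI[of _ C] conjI allI impI C)
  qed
  define C where "C j = (SOME C. C \<ge> 0 \<and> (\<forall>F w. finite F \<longrightarrow> F \<subseteq> J j \<longrightarrow> norm w < 1 \<longrightarrow> (\<Sum>n\<in>F. sig (z n) w) \<le> C))" for j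
  have Cj: "C j \<ge> 0 \<and> (\<forall>F w. finite F \<longrightarrow> F \<subseteq> J j \<longrightarrow> norm w < 1 \<longrightarrow> (\<Sum>n\<in>F. sig (z n) w) \<le> C j)" if "j < m" for j
    unfolding C_def by (rule someI_ex[OF ex[OF that]])
  have C: "\<And>j. j < m \<Longrightarrow> C j \<ge> 0"
    "\<And>j F w. j < m \<Longrightarrow> finite F \<Longrightarrow> F \<subseteq> J j \<Longrightarrow> norm w < 1 \<Longrightarrow> (\<Sum>n\<in>F. sig (z n) w) \<le> C j"
    using Cj by blast+
  show ?thesis
  proof (rule that[OF _ _ zI])
    show "(\<Sum>j<m. C j) \<ge> 0" using C by (intro sum_nonneg) auto
    fix F and w :: complex assume F: "finite F" "F \<subseteq> I" and w: "norm w < 1"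
    have "(\<Sum>n\<in>F. sig (z n) w) \<le> (\<Sum>j<m. \<Sum>n\<in>F \<inter> J j. sig (z n) w)"
    proof -
      have nn: "sig (z n) w \<ge> 0" if nF: "n \<in> F" for n
      proof -
        have "n \<in> I" using nF F by blast
        from sig_nonneg[OF zI[OF this]] w show ?thesis by simp
      qed
      \<comment> \<open>The pieces \<open>J j\<close> may overlap, so an index can be counted
        several times; nonnegativity of \<open>sig\<close> makes this an inequality in the right
        direction.\<close>
      have "(\<Sum>n\<in>F. sig (z n) w) \<le> (\<Sum>n\<in>F. \<Sum>j<m. if n \<in> J j then sig (z n) w else 0)"
      proof (rule sum_mono)
        fix n assume n: "n \<in> F"
        then have "n \<in> (\<Union>j<m. J j)" using F I by blast
        then obtain j where j: "j < m" "n \<in> J j" by blast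
        have "sig (z n) w = (\<Sum>i\<in>{j}. if n \<in> J i then sig (z n) w else 0)" using j by simp
        also have "\<dots> \<le> (\<Sum>j<m. if n \<in> J j then sig (z n) w else 0)"
          by (rule sum_mono2) (use j nn[OF n] in auto)
        finally show "sig (z n) w \<le> (\<Sum>j<m. if n \<in> J j then sig (z n) w else 0)" .
      qed
      also have "\<dots> = (\<Sum>j<m. \<Sum>n\<in>F. if n \<in> J j then sig (z n) w else 0)" by (rule sum.swap)
      also have "\<dots> = (\<Sum>j<m. \<Sum>n\<in>F \<inter> J j. sig (z n) w)" using F by (simp add: sum.inter_restrict)
      finally show ?thesis .
    qed
    also have "\<dots> \<le> (\<Sum>j<m. C j)"
    proof (rule sum_mono)
      fix j assume "j \<in> {..<m}" then show "(\<Sum>n\<in>F \<inter> J j. sig (z n) w) \<le> C j" using F(1) w by (intro C(2)) auto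
    qed
    finally show "(\<Sum>n\<in>F. sig (z n) w) \<le> (\<Sum>j<m. C j)" .
  qed
qed

section \<open>The Carleson embedding\<close>

lemma circ_integrable_continuous:
  fixes f :: "real \<Rightarrow> 'b::euclidean_space"
  assumes "continuous_on UNIV f"
  shows "integrable circ f"
  unfolding circ_def
  by (rule integrable_lint_continuous[OF continuous_on_subset[OF assms] borel_measurable_continuous_onI[OF assms]]) simp

lemma measure_circ: "measure circ UNIV = 2 * pi"
  by (simp add: circ_def measure_def emeasure_lint)

lemma circle_mean_value:
  fixes F :: "complex \<Rightarrow> complex"
  assumes "F holomorphic_on UNIV"
  shows "(\<integral>t. F (cis t) \<partial>circ) = 2 * pi * F 0"
proof -
  have "continuous_on (cball 0 1) F" using assms by (meson holomorphic_on_imp_continuous_on continuous_on_subset subset_UNIV)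
  moreover have "F holomorphic_on ball 0 1" using assms by (meson holomorphic_on_subset subset_UNIV)
  ultimately have "(\<integral>t. of_real (pk 0 t) * F (cis t) \<partial>circ) = 2 * pi * F 0" by (rule Poisson_integral) simp
  then show ?thesis by (simp add: pk_def)
qed

text \<open>Induction by splitting off the constant coefficient: the rest \<open>b\<close> has the
  factor z, hence mean 0 on the circle, and the cross term vanishes. The remaining coefficients are
  shifted, which is why \<open>g\<close> is arbitrary in the induction.\<close>

lemma Parseval_polynomial:
  fixes g :: "nat \<Rightarrow> complex"
  shows "(\<integral>\<theta>. (norm (\<Sum>k<N. g k * (of_real r * cis \<theta>) ^ k))\<^sup>2 \<partial>circ) = 2 * pi * (\<Sum>k<N. (norm (g k))\<^sup>2 * r ^ (2*k))"
proof (induction N arbitrary: g)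
  case 0
  show ?case by simp
next
  case (Suc N)
  define S where "S \<theta> = (\<Sum>k<N. g (Suc k) * (of_real r * cis \<theta>) ^ k)" for \<theta>
  define b where "b \<theta> = of_real r * cis \<theta> * S \<theta>" for \<theta>
  have contS: "continuous_on UNIV S" unfolding S_def[abs_def] by (intro continuous_intros)
  have contb: "continuous_on UNIV b" unfolding b_def[abs_def] by (intro continuous_intros contS)
  have "(\<integral>t. b t \<partial>circ) = 2 * pi * 0"
    using circle_mean_value[of "\<lambda>w. of_real r * w * (\<Sum>k<N. g (Suc k) * (of_real r * w) ^ k)"]
    by (simp add: b_def S_def holomorphic_intros)
  then have b0: "(\<integral>t. b t \<partial>circ) = 0" by simp
  have bi: "integrable circ b" by (rule circ_integrable_continuous[OF contb])
  have eq: "(\<Sum>k<Suc N. g k * (of_real r * cis \<theta>) ^ k) = g 0 + b \<theta>" for \<theta>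
    unfolding b_def S_def by (subst sum.lessThan_Suc_shift) (simp add: sum_distrib_left mult_ac)
  have sq: "(norm (g 0 + b \<theta>))\<^sup>2 = (norm (g 0))\<^sup>2 + (r\<^sup>2 * (norm (S \<theta>))\<^sup>2 + 2 * Re (cnj (g 0) * b \<theta>))" for \<theta>
  proof -
    have "(norm (b \<theta>))\<^sup>2 = r\<^sup>2 * (norm (S \<theta>))\<^sup>2" by (simp add: b_def norm_mult power_mult_distrib)
    moreover have "(norm (g 0 + b \<theta>))\<^sup>2 = (norm (g 0))\<^sup>2 + (norm (b \<theta>))\<^sup>2 + 2 * Re (cnj (g 0) * b \<theta>)"
      unfolding cmod_power2 by (simp add: power2_eq_square algebra_simps)
    ultimately show ?thesis by simp
  qed
  have re: "integrable circ (\<lambda>\<theta>. 2 * Re (cnj (g 0) * b \<theta>))" "(\<integral>\<theta>. 2 * Re (cnj (g 0) * b \<theta>) \<partial>circ) = 0"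
  proof -
    have i: "integrable circ (\<lambda>\<theta>. cnj (g 0) * b \<theta>)" using bi by simp
    show "integrable circ (\<lambda>\<theta>. 2 * Re (cnj (g 0) * b \<theta>))" by (rule integrable_mult_right[OF integrable_Re[OF i]])
    have "(\<integral>\<theta>. Re (cnj (g 0) * b \<theta>) \<partial>circ) = Re (\<integral>\<theta>. cnj (g 0) * b \<theta> \<partial>circ)" by (rule integral_Re[OF i])
    also have "\<dots> = 0" using b0 by simp
    finally have z: "(\<integral>\<theta>. Re (cnj (g 0) * b \<theta>) \<partial>circ) = 0" .
    have "(\<integral>\<theta>. 2 * Re (cnj (g 0) * b \<theta>) \<partial>circ) = 2 * (\<integral>\<theta>. Re (cnj (g 0) * b \<theta>) \<partial>circ)" by (rule integral_mult_right_zero)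
    then show "(\<integral>\<theta>. 2 * Re (cnj (g 0) * b \<theta>) \<partial>circ) = 0" unfolding z by simp
  qed
  have s: "integrable circ (\<lambda>\<theta>. r\<^sup>2 * (norm (S \<theta>))\<^sup>2)"
    by (intro circ_integrable_continuous continuous_intros contS)
  have c: "integrable circ (\<lambda>\<theta>. (norm (g 0))\<^sup>2)" by (intro circ_integrable_continuous continuous_intros)
  have "(\<integral>\<theta>. (norm (\<Sum>k<Suc N. g k * (of_real r * cis \<theta>) ^ k))\<^sup>2 \<partial>circ)
     = (\<integral>\<theta>. (norm (g 0))\<^sup>2 + (r\<^sup>2 * (norm (S \<theta>))\<^sup>2 + 2 * Re (cnj (g 0) * b \<theta>)) \<partial>circ)"
    unfolding eq sq ..
  also have "\<dots> = (\<integral>\<theta>. (norm (g 0))\<^sup>2 \<partial>circ) + ((\<integral>\<theta>. r\<^sup>2 * (norm (S \<theta>))\<^sup>2 \<partial>circ) + (\<integral>\<theta>. 2 * Re (cnj (g 0) * b \<theta>) \<partial>circ))"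
    by (subst Bochner_Integration.integral_add[OF c Bochner_Integration.integrable_add[OF s re(1)]], subst Bochner_Integration.integral_add[OF s re(1)]) (rule refl)
  also have "\<dots> = 2 * pi * (norm (g 0))\<^sup>2 + r\<^sup>2 * (2 * pi * (\<Sum>k<N. (norm (g (Suc k)))\<^sup>2 * r ^ (2*k)))"
    unfolding re(2) using Suc.IH[of "\<lambda>k. g (Suc k)"] by (simp add: measure_circ S_def)
  also have "\<dots> = 2 * pi * (\<Sum>k<Suc N. (norm (g k))\<^sup>2 * r ^ (2*k))"
    by (subst sum.lessThan_Suc_shift) (simp add: sum_distrib_left algebra_simps power2_eq_square)
  finally show ?case .
qed

lemma Parseval_power_series:
  fixes g :: "nat \<Rightarrow> complex"
  assumes sums: "\<And>z. norm z < R \<Longrightarrow> (\<lambda>k. g k * z ^ k) sums G z" and r: "0 \<le> r" "r < R"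
    and mG [measurable]: "G \<in> borel_measurable borel"
  shows "(\<lambda>k. 2 * pi * ((norm (g k))\<^sup>2 * r ^ (2*k))) sums (\<integral>\<theta>. (norm (G (of_real r * cis \<theta>)))\<^sup>2 \<partial>circ)"
proof -
  \<comment> \<open>Convergence at a radius strictly beyond \<open>r\<close> gives absolute
    convergence at \<open>r\<close>, hence the constant \<open>B\<close> dominating all partial sums
    on the circle.\<close>
  define x where "x = (r + R) / 2"
  have x: "r < x" "x < R" using r by (auto simp: x_def)
  have "summable (\<lambda>k. g k * of_real x ^ k)" using sums[of "of_real x"] x r by (auto simp: sums_iff)
  then have "summable (\<lambda>k. norm (g k * of_real r ^ k))"
    by (rule powser_insidea) (use x r in auto)
  then have summ: "summable (\<lambda>k. norm (g k) * r ^ k)" using r by (simp add: norm_mult norm_power)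
  define B where "B = (\<Sum>k. norm (g k) * r ^ k)"
  have Sb: "norm (\<Sum>k<N. g k * (of_real r * cis \<theta>) ^ k) \<le> B" for N \<theta>
  proof -
    have "norm (\<Sum>k<N. g k * (of_real r * cis \<theta>) ^ k) \<le> (\<Sum>k<N. norm (g k * (of_real r * cis \<theta>) ^ k))" by (rule norm_sum)
    also have "\<dots> = (\<Sum>k<N. norm (g k) * r ^ k)" using r by (simp add: norm_mult norm_power)
    also have "\<dots> \<le> B" unfolding B_def by (rule sum_le_suminf[OF summ]) (use r in auto)
    finally show ?thesis .
  qed
  have "(\<lambda>N. \<integral>\<theta>. (norm (\<Sum>k<N. g k * (of_real r * cis \<theta>) ^ k))\<^sup>2 \<partial>circ) \<longlonglongrightarrow> (\<integral>\<theta>. (norm (G (of_real r * cis \<theta>)))\<^sup>2 \<partial>circ)"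
  proof (rule integral_dominated_convergence[where w = "\<lambda>_. B\<^sup>2"])
    show "integrable circ (\<lambda>_. B\<^sup>2)" by (intro circ_integrable_continuous continuous_intros)
    show "AE \<theta> in circ. (\<lambda>N. (norm (\<Sum>k<N. g k * (of_real r * cis \<theta>) ^ k))\<^sup>2) \<longlonglongrightarrow> (norm (G (of_real r * cis \<theta>)))\<^sup>2"
    proof (rule AE_I2)
      fix \<theta> :: real
      have "norm (of_real r * cis \<theta>) < R" using r by (simp add: norm_mult)
      from sums[OF this] have "(\<lambda>N. \<Sum>k<N. g k * (of_real r * cis \<theta>) ^ k) \<longlonglongrightarrow> G (of_real r * cis \<theta>)" by (simp add: sums_def)
      then show "(\<lambda>N. (norm (\<Sum>k<N. g k * (of_real r * cis \<theta>) ^ k))\<^sup>2) \<longlonglongrightarrow> (norm (G (of_real r * cis \<theta>)))\<^sup>2"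
        by (intro tendsto_power tendsto_norm)
    qed
    show "AE \<theta> in circ. norm ((norm (\<Sum>k<N. g k * (of_real r * cis \<theta>) ^ k))\<^sup>2) \<le> B\<^sup>2" for N
    proof (rule AE_I2)
      fix \<theta> :: real
      have "(norm (\<Sum>k<N. g k * (of_real r * cis \<theta>) ^ k))\<^sup>2 \<le> B\<^sup>2" by (rule power_mono[OF Sb]) simp
      then show "norm ((norm (\<Sum>k<N. g k * (of_real r * cis \<theta>) ^ k))\<^sup>2) \<le> B\<^sup>2" by simp
    qed
  qed measurable
  then show ?thesis unfolding Parseval_polynomial sums_def by (simp add: sum_distrib_left)
qed

lemma radial_weight_integral:
  "(\<integral>\<^sup>+r. ennreal (r ^ (2*k) * (1 - r)) \<partial>rad) \<le> ennreal (1 / ((2*real k+1) * (2*real k+2)))"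
proof -
  have "(\<integral>\<^sup>+r. ennreal (r ^ (2*k) * (1 - r)) \<partial>rad) \<le> (\<integral>\<^sup>+r. ennreal (r ^ (2*k) * (1 - r)) \<partial>lint {0..1})"
    unfolding rad_def by (rule nn_integral_lint_mono_set) auto
  also have "\<dots> = (\<integral>\<^sup>+r. ennreal (r ^ (2*k) * (1 - r)) * indicator {0..1} r \<partial>lborel)"
    by (rule nn_integral_lint) auto
  also have "\<dots> = ennreal ((\<lambda>r. r ^ (2*k+1) / (2*k+1) - r ^ (2*k+2) / (2*k+2)) 1 - (\<lambda>r. r ^ (2*k+1) / (2*k+1) - r ^ (2*k+2) / (2*k+2)) 0)"
  proof (rule nn_integral_FTC_Icc)
    fix x :: real assume x: "x \<in> {0..1}"
    have 1: "((\<lambda>r. r ^ (2*k+1) / real (2*k+1)) has_real_derivative (x ^ (2*k))) (at x)"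
      using DERIV_cdivide[OF DERIV_pow[of "2*k+1" x UNIV], of "real (2*k+1)"] by simp
    have 2: "((\<lambda>r. r ^ (2*k+2) / real (2*k+2)) has_real_derivative (x ^ (2*k+1))) (at x)"
      using DERIV_cdivide[OF DERIV_pow[of "2*k+2" x UNIV], of "real (2*k+2)"] by simp
    have "x ^ (2*k) - x ^ (2*k+1) = x ^ (2*k) * (1 - x)" by (simp add: algebra_simps)
    then show "((\<lambda>r. r ^ (2*k+1) / (2*k+1) - r ^ (2*k+2) / (2*k+2)) has_real_derivative (x ^ (2*k) * (1 - x))) (at x)"
      using DERIV_diff[OF 1 2] by simp
    show "0 \<le> x ^ (2*k) * (1 - x)" using x by simp
  qed auto
  also have "(\<lambda>r. r ^ (2*k+1) / (2*k+1) - r ^ (2*k+2) / (2*k+2)) 1 - (\<lambda>r. r ^ (2*k+1) / (2*k+1) - r ^ (2*k+2) / (2*k+2)) (0::real) = 1 / ((2*real k+1) * (2*real k+2))"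
  proof -
    have "2 * real k + 1 \<noteq> 0" "2 * real k + 2 \<noteq> 0" by linarith+
    then show ?thesis by (simp add: diff_frac_eq, simp add: algebra_simps)
  qed
  finally show ?thesis .
qed

text \<open>Parseval on both sides. The coefficient of index k + 1 enters the left side with (k+1)^2
  / ((2k+1)(2k+2)), where the denominator comes from \<open>radial_weight_integral\<close>; this
  ratio is at most 1/2.\<close>

lemma (in disc_pair) Littlewood_Paley:
  "(\<integral>\<^sup>+r. \<integral>\<^sup>+\<theta>. ennreal ((norm (F' (of_real r * cis \<theta>)))\<^sup>2 * (1 - r)) \<partial>circ \<partial>rad)
    \<le> ennreal (1/2) * (\<integral>\<^sup>+\<theta>. ennreal ((norm (F (cis \<theta>)))\<^sup>2) \<partial>circ)"
proof -
  define c where "c k = (deriv ^^ k) F 0 / fact k" for k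
  have sF: "(\<lambda>k. c k * z ^ k) sums F z" if "norm z < R" for z
    using holomorphic_power_series[OF holF, of z] that by (simp add: c_def)
  define g where "g k = of_nat (Suc k) * c (Suc k)" for k
  have sF': "(\<lambda>k. g k * z ^ k) sums F' z" if z: "norm z < R" for z
  proof -
    have "deriv F holomorphic_on ball 0 R" by (rule holomorphic_deriv[OF holF]) simp
    from holomorphic_power_series[OF this, of z] z
    have "(\<lambda>n. (deriv ^^ n) (deriv F) 0 / fact n * z ^ n) sums deriv F z" by simp
    moreover have "(deriv ^^ n) (deriv F) 0 / fact n = g n" for n
      by (simp add: g_def c_def funpow_swap1 fact_Suc del: of_nat_Suc)
    moreover have "deriv F z = F' z" by (rule DERIV_imp_deriv[OF deriv[OF z]])
    ultimately show ?thesis by simp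
  qed
  have mean: "(\<integral>\<^sup>+\<theta>. ennreal ((norm (F' (of_real r * cis \<theta>)))\<^sup>2 * (1 - r)) \<partial>circ) = (\<Sum>k. ennreal (2 * pi * (norm (g k))\<^sup>2) * ennreal (r ^ (2*k) * (1 - r)))"
    if r: "0 \<le> r" "r < 1" for r
  proof -
    have cont: "continuous_on UNIV (\<lambda>\<theta>. F' (of_real r * cis \<theta>))"
      by (rule continuous_on_compose2[OF contF']) (use r in \<open>auto intro!: continuous_intros simp: norm_mult\<close>)
    have int: "integrable circ (\<lambda>\<theta>. (norm (F' (of_real r * cis \<theta>)))\<^sup>2)"
      by (intro circ_integrable_continuous continuous_intros cont)
    have "(\<integral>\<^sup>+\<theta>. ennreal ((norm (F' (of_real r * cis \<theta>)))\<^sup>2 * (1 - r)) \<partial>circ) = ennreal (\<integral>\<theta>. (norm (F' (of_real r * cis \<theta>)))\<^sup>2 * (1 - r) \<partial>circ)"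
      by (rule nn_integral_eq_integral) (use int r in auto)
    also have "(\<integral>\<theta>. (norm (F' (of_real r * cis \<theta>)))\<^sup>2 * (1 - r) \<partial>circ) = (\<integral>\<theta>. (norm (F' (of_real r * cis \<theta>)))\<^sup>2 \<partial>circ) * (1 - r)" by simp
    also have "ennreal \<dots> = (\<Sum>k. ennreal (2 * pi * ((norm (g k))\<^sup>2 * r ^ (2*k)) * (1 - r)))"
    proof (rule suminf_ennreal_eq[symmetric])
      show "(\<lambda>k. 2 * pi * ((norm (g k))\<^sup>2 * r ^ (2*k)) * (1 - r)) sums ((\<integral>\<theta>. (norm (F' (of_real r * cis \<theta>)))\<^sup>2 \<partial>circ) * (1 - r))"
        by (rule sums_mult2[OF Parseval_power_series[OF sF' r(1) _ mF']]) (use r R in auto)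
      show "0 \<le> 2 * pi * ((norm (g k))\<^sup>2 * r ^ (2*k)) * (1 - r)" for k using r by simp
    qed
    also have "\<dots> = (\<Sum>k. ennreal (2 * pi * (norm (g k))\<^sup>2) * ennreal (r ^ (2*k) * (1 - r)))"
      using r by (intro suminf_cong, subst ennreal_mult[symmetric]) (auto simp: mult_ac)
    finally show ?thesis .
  qed
  have "(\<integral>\<^sup>+r. \<integral>\<^sup>+\<theta>. ennreal ((norm (F' (of_real r * cis \<theta>)))\<^sup>2 * (1 - r)) \<partial>circ \<partial>rad)
     \<le> (\<integral>\<^sup>+r. (\<Sum>k. ennreal (2 * pi * (norm (g k))\<^sup>2) * ennreal (r ^ (2*k) * (1 - r))) \<partial>rad)"
    by (rule nn_integral_rad_mono) (simp only: mean order_refl)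
  also have "\<dots> = (\<Sum>k. (\<integral>\<^sup>+r. ennreal (2 * pi * (norm (g k))\<^sup>2) * ennreal (r ^ (2*k) * (1 - r)) \<partial>rad))"
    by (rule nn_integral_suminf) measurable
  also have "\<dots> = (\<Sum>k. ennreal (2 * pi * (norm (g k))\<^sup>2) * (\<integral>\<^sup>+r. ennreal (r ^ (2*k) * (1 - r)) \<partial>rad))"
    by (intro suminf_cong nn_integral_cmult) measurable
  also have "\<dots> \<le> (\<Sum>k. ennreal (1/2 * (2 * pi * ((norm (c (Suc k)))\<^sup>2 * 1 ^ (2 * Suc k)))))"
  proof (rule suminf_le)
    fix k
    define A where "A = 1 / ((2*real k+1) * (2*real k+2))"
    have A: "A \<ge> 0" "(real (Suc k))\<^sup>2 * A \<le> 1/2"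
    proof -
      show "A \<ge> 0" by (simp add: A_def)
      have "(real (Suc k))\<^sup>2 * 2 \<le> (2*real k+1) * (2*real k+2)" by (simp add: power2_eq_square algebra_simps)
      moreover have "0 < (2*real k+1) * (2*real k+2)" by (intro mult_pos_pos) auto
      ultimately show "(real (Suc k))\<^sup>2 * A \<le> 1/2" unfolding A_def by (simp only: times_divide_eq_right mult_1_right pos_divide_le_eq)
    qed
    have "ennreal (2 * pi * (norm (g k))\<^sup>2) * (\<integral>\<^sup>+r. ennreal (r ^ (2*k) * (1 - r)) \<partial>rad) \<le> ennreal (2 * pi * (norm (g k))\<^sup>2) * ennreal A"
      unfolding A_def by (intro mult_left_mono radial_weight_integral) simp
    also have "\<dots> = ennreal (2 * pi * (norm (g k))\<^sup>2 * A)"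
      using A by (subst ennreal_mult[symmetric]) auto
    also have "\<dots> \<le> ennreal (1/2 * (2 * pi * ((norm (c (Suc k)))\<^sup>2 * 1 ^ (2 * Suc k))))"
    proof (rule ennreal_leI)
      define B where "B = (norm (c (Suc k)))\<^sup>2"
      have "B * ((real (Suc k))\<^sup>2 * A) \<le> B * (1/2)"
        by (rule mult_left_mono[OF A(2)]) (simp add: B_def)
      moreover have gk: "(norm (g k))\<^sup>2 = (real (Suc k))\<^sup>2 * B"
        unfolding g_def norm_mult power_mult_distrib norm_of_nat B_def ..
      ultimately have le: "(norm (g k))\<^sup>2 * A \<le> B * (1/2)" by (simp only: mult_ac)
      have "2 * pi * ((norm (g k))\<^sup>2 * A) \<le> 2 * pi * (B * (1/2))" by (rule mult_left_mono[OF le]) simp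
      then show "2 * pi * (norm (g k))\<^sup>2 * A \<le> 1/2 * (2 * pi * ((norm (c (Suc k)))\<^sup>2 * 1 ^ (2 * Suc k)))"
        unfolding B_def by (simp add: mult_ac)
    qed
    finally show "ennreal (2 * pi * (norm (g k))\<^sup>2) * (\<integral>\<^sup>+r. ennreal (r ^ (2*k) * (1 - r)) \<partial>rad) \<le> ennreal (1/2 * (2 * pi * ((norm (c (Suc k)))\<^sup>2 * 1 ^ (2 * Suc k))))" .
  qed auto
  \<comment> \<open>The derivative does not see the constant coefficient, so the Parseval sum of
    \<open>F\<close> appears without its first term, which is then discarded.\<close>
  also have "\<dots> = ennreal (1/2 * ((\<integral>\<theta>. (norm (F (of_real 1 * cis \<theta>)))\<^sup>2 \<partial>circ) - 2 * pi * ((norm (c 0))\<^sup>2 * 1 ^ (2 * 0))))"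
  proof (rule suminf_ennreal_eq)
    have "(\<lambda>k. 2 * pi * ((norm (c k))\<^sup>2 * 1 ^ (2*k))) sums (\<integral>\<theta>. (norm (F (of_real 1 * cis \<theta>)))\<^sup>2 \<partial>circ)"
      by (rule Parseval_power_series[OF sF _ _ mF]) (use R in auto)
    then have "(\<lambda>k. 2 * pi * ((norm (c (Suc k)))\<^sup>2 * 1 ^ (2*Suc k))) sums ((\<integral>\<theta>. (norm (F (of_real 1 * cis \<theta>)))\<^sup>2 \<partial>circ) - 2 * pi * ((norm (c 0))\<^sup>2 * 1 ^ (2 * 0)))"
      by (subst sums_Suc_iff) simp
    then show "(\<lambda>k. 1/2 * (2 * pi * ((norm (c (Suc k)))\<^sup>2 * 1 ^ (2*Suc k)))) sums (1/2 * ((\<integral>\<theta>. (norm (F (of_real 1 * cis \<theta>)))\<^sup>2 \<partial>circ) - 2 * pi * ((norm (c 0))\<^sup>2 * 1 ^ (2 * 0))))"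
      by (rule sums_mult)
  qed simp
  also have "\<dots> \<le> ennreal (1/2 * (\<integral>\<theta>. (norm (F (cis \<theta>)))\<^sup>2 \<partial>circ))" by (intro ennreal_leI) simp
  also have "\<dots> = ennreal (1/2) * ennreal (\<integral>\<theta>. (norm (F (cis \<theta>)))\<^sup>2 \<partial>circ)" by (rule ennreal_mult') simp
  also have "ennreal (\<integral>\<theta>. (norm (F (cis \<theta>)))\<^sup>2 \<partial>circ) = (\<integral>\<^sup>+\<theta>. ennreal ((norm (F (cis \<theta>)))\<^sup>2) \<partial>circ)"
  proof (rule nn_integral_eq_integral[symmetric])
    have cont: "continuous_on UNIV (\<lambda>\<theta>. F (cis \<theta>))"
      by (rule continuous_on_compose2[OF contF]) (auto intro!: continuous_intros)
    show "integrable circ (\<lambda>\<theta>. (norm (F (cis \<theta>)))\<^sup>2)"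
      by (intro circ_integrable_continuous continuous_intros cont)
  qed simp
  finally show ?thesis .
qed

section \<open>Subproducts of Blaschke factors\<close>

definition bld :: "complex \<Rightarrow> complex \<Rightarrow> complex" where
  "bld a z = of_real (1 - (norm a)\<^sup>2) / (1 - cnj a * z)\<^sup>2"

lemma DERIV_bl: "1 - cnj a * z \<noteq> 0 \<Longrightarrow> (bl a has_field_derivative bld a z) (at z)"
proof -
  assume nz: "1 - cnj a * z \<noteq> 0"
  have "((\<lambda>z. (z - a) / (1 - cnj a * z)) has_field_derivative (1 * (1 - cnj a * z) - (z - a) * (0 - cnj a)) / ((1 - cnj a * z) * (1 - cnj a * z))) (at z)"
    by (rule DERIV_divide) (use nz in \<open>auto intro!: derivative_eq_intros\<close>)
  moreover have "1 * (1 - cnj a * z) - (z - a) * (0 - cnj a) = of_real (1 - (norm a)\<^sup>2)"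
    by (simp only: of_real_diff of_real_1 complex_norm_square) (simp add: algebra_simps)
  ultimately show ?thesis unfolding bl_def[abs_def] bld_def power2_eq_square[of "1 - cnj a * z"] by (simp only:)
qed

lemma measurable_bl [measurable]: "bl a \<in> borel_measurable borel"
  unfolding bl_def[abs_def] by measurable

lemma measurable_bld [measurable]: "bld a \<in> borel_measurable borel"
  unfolding bld_def[abs_def] by measurable

text \<open>The product rule on pairs of a function and its derivative, the form in which
  \<open>disc_pair\<close> takes them.\<close>

definition bmul :: "complex \<Rightarrow> (complex \<Rightarrow> complex) \<times> (complex \<Rightarrow> complex) \<Rightarrow> (complex \<Rightarrow> complex) \<times> (complex \<Rightarrow> complex)" where
  "bmul a p = ((\<lambda>z. bl a z * fst p z), (\<lambda>z. bl a z * snd p z + bld a z * fst p z))"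

text \<open>All \<open>2 ^ length as\<close> products of \<open>p\<close> with subsets of the
  Blaschke factors, each with its derivative. Repeated zeros count as separate factors, hence a
  list.\<close>

fun bfam :: "complex list \<Rightarrow> (complex \<Rightarrow> complex) \<times> (complex \<Rightarrow> complex) \<Rightarrow> ((complex \<Rightarrow> complex) \<times> (complex \<Rightarrow> complex)) list" where
  "bfam [] p = [p]"
| "bfam (a # as) p = bfam as p @ map (bmul a) (bfam as p)"

lemma length_bfam: "length (bfam as p) = 2 ^ length as"
  by (induction as) auto

lemma disc_pair_bmul:
  assumes p: "disc_pair (fst p) (snd p) R" and a: "R * norm a < 1"
  shows "disc_pair (fst (bmul a p)) (snd (bmul a p)) R"
proof -
  interpret disc_pair "fst p" "snd p" R by (rule p)
  show ?thesis
  proof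
    fix z :: complex assume z: "norm z < R"
    have "1 - cnj a * z \<noteq> 0"
    proof
      assume "1 - cnj a * z = 0"
      then have "norm (cnj a * z) = 1" by (metis norm_one eq_iff_diff_eq_0)
      moreover have "norm (cnj a * z) \<le> norm a * R"
        unfolding norm_mult complex_mod_cnj using z by (intro mult_left_mono) auto
      ultimately show False using a by (simp add: mult.commute)
    qed
    from DERIV_mult[OF DERIV_bl[OF this] deriv[OF z]]
    show "(fst (bmul a p) has_field_derivative snd (bmul a p) z) (at z)"
      by (simp add: bmul_def algebra_simps)
  qed (use R in \<open>simp_all add: bmul_def\<close>)
qed

lemma disc_pair_bfam:
  assumes "disc_pair (fst p) (snd p) R" and "\<And>a. a \<in> set as \<Longrightarrow> R * norm a < 1" and "q \<in> set (bfam as p)"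
  shows "disc_pair (fst q) (snd q) R"
  using assms(2,3)
proof (induction as arbitrary: q)
  case Nil then show ?case using assms(1) by simp
next
  case (Cons a as)
  have IH: "disc_pair (fst q) (snd q) R" if "q \<in> set (bfam as p)" for q
    using Cons.IH[OF _ that] Cons.prems(1) by simp
  from Cons.prems(2) consider "q \<in> set (bfam as p)" | q' where "q' \<in> set (bfam as p)" "q = bmul a q'" by auto
  then show ?case
  proof cases
    case 1 then show ?thesis by (rule IH)
  next
    case 2 show ?thesis unfolding 2(2) by (rule disc_pair_bmul[OF IH[OF 2(1)]]) (simp add: Cons.prems)
  qed
qed

lemma norm_bl_circle:
  assumes "norm a < 1" shows "norm (bl a (cis \<theta>)) = 1"
proof -
  have "sig a (cis \<theta>) = 0" by (simp add: sig_def)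
  then have "(norm (bl a (cis \<theta>)))\<^sup>2 = 1" using sig_bl[of a "cis \<theta>"] assms by simp
  then show ?thesis by (simp add: power2_eq_1_iff) (metis norm_ge_zero not_one_le_zero neg_0_le_iff_le)
qed

lemma bfam_circle:
  assumes "\<And>a. a \<in> set as \<Longrightarrow> norm a < 1" and "q \<in> set (bfam as p)"
  shows "norm (fst q (cis \<theta>)) = norm (fst p (cis \<theta>))"
  using assms
proof (induction as arbitrary: q)
  case Nil then show ?case by simp
next
  case (Cons a as)
  have IH: "norm (fst q (cis \<theta>)) = norm (fst p (cis \<theta>))" if "q \<in> set (bfam as p)" for q
    using Cons.IH[OF _ that] Cons.prems(1) by simp
  from Cons.prems(2) consider "q \<in> set (bfam as p)" | q' where "q' \<in> set (bfam as p)" "q = bmul a q'" by auto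
  then show ?case
  proof cases
    case 1 then show ?thesis by (rule IH)
  next
    case 2 show ?thesis unfolding 2(2) using IH[OF 2(1)] norm_bl_circle[of a \<theta>] Cons.prems(1)
      by (simp add: bmul_def norm_mult)
  qed
qed

text \<open>Completes the square in \<open>Z\<close> for a pair consisting of a function and its
  product with one more factor \<open>b\<close>. The shift \<open>d\<close> absorbs the cross term,
  and the remainder proportional to the squared norm of \<open>b'\<close> is the gain from that
  factor.\<close>

lemma completed_square:
  fixes Z y b b' :: complex
  defines "d \<equiv> cnj b * b' / of_real (1 + (norm b)\<^sup>2)"
  shows "(norm Z)\<^sup>2 + (norm (b * Z + b' * y))\<^sup>2 = (1 + (norm b)\<^sup>2) * (norm (Z + d * y))\<^sup>2 + (norm b')\<^sup>2 / (1 + (norm b)\<^sup>2) * (norm y)\<^sup>2"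
proof -
  define k where "k = 1 + (norm b)\<^sup>2"
  have k: "k > 0" unfolding k_def by (simp add: add_pos_nonneg)
  have exp: "(norm (u + v))\<^sup>2 = (norm u)\<^sup>2 + (norm v)\<^sup>2 + 2 * Re (u * cnj v)" for u v :: complex
    unfolding cmod_power2 by (simp add: power2_eq_square algebra_simps)
  have dy: "(norm (d * y))\<^sup>2 = (norm b)\<^sup>2 * (norm b')\<^sup>2 / k\<^sup>2 * (norm y)\<^sup>2"
    using k unfolding d_def k_def[symmetric] by (simp add: norm_mult norm_divide power_mult_distrib power_divide)
  have kT: "k * Re (Z * cnj (d * y)) = Re (b * Z * cnj (b' * y))"
  proof -
    have "of_real k * (Z * cnj (d * y)) = b * Z * cnj (b' * y)" using k unfolding d_def k_def[symmetric] by simp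
    moreover have "k * Re w = Re (of_real k * w)" for w by simp
    ultimately show ?thesis by (simp only:)
  qed
  have "k * (A + B / k\<^sup>2 * Y + 2 * T) = k * A + B / k * Y + 2 * (k * T)" for A B Y T :: real
    using k by (simp add: power2_eq_square distrib_left)
  then have "k * (norm (Z + d * y))\<^sup>2 = k * (norm Z)\<^sup>2 + (norm b)\<^sup>2 * (norm b')\<^sup>2 / k * (norm y)\<^sup>2 + 2 * Re (b * Z * cnj (b' * y))"
    unfolding exp[of Z "d * y"] dy kT[symmetric] .
  moreover have "(norm b)\<^sup>2 * (norm b')\<^sup>2 / k * (norm y)\<^sup>2 + (norm b')\<^sup>2 / k * (norm y)\<^sup>2 = (norm b')\<^sup>2 * (norm y)\<^sup>2"
  proof -
    have "B * P / k * Y + P / k * Y = (1 + B) * (P / k * Y)" for B P Y :: real by (simp add: algebra_simps add_divide_distrib)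
    from this[of "(norm b)\<^sup>2" "(norm b')\<^sup>2" "(norm y)\<^sup>2"]
    have "(norm b)\<^sup>2 * (norm b')\<^sup>2 / k * (norm y)\<^sup>2 + (norm b')\<^sup>2 / k * (norm y)\<^sup>2 = k * ((norm b')\<^sup>2 / k * (norm y)\<^sup>2)"
      by (simp only: k_def)
    then show ?thesis using k by simp
  qed
  moreover have "(norm (b * Z + b' * y))\<^sup>2 = (norm b)\<^sup>2 * (norm Z)\<^sup>2 + (norm b')\<^sup>2 * (norm y)\<^sup>2 + 2 * Re (b * Z * cnj (b' * y))"
    unfolding exp by (simp add: norm_mult power_mult_distrib)
  ultimately show ?thesis unfolding k_def[symmetric] by (simp add: k_def algebra_simps)
qed

text \<open>Let M be the sum of the squared moduli of the family. The sum of the squared derivatives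
  is the Laplacian of M up to a constant, hence at least M times that of ln M, and each factor
  contributes |b'|^2 / (1 + |b|^2)^2. The induction does this algebraically: splitting off a factor
  changes \<open>c\<close> into \<open>c + d\<close>, so the claim is made for all \<open>c\<close>;
  it is used with 0.\<close>

lemma bfam_pointwise:
  "(\<Sum>q\<leftarrow>bfam as p. (norm (fst q z))\<^sup>2) = (norm (fst p z))\<^sup>2 * (\<Prod>a\<leftarrow>as. 1 + (norm (bl a z))\<^sup>2)"
  "(\<Sum>q\<leftarrow>bfam as p. (norm (snd q z + c * fst q z))\<^sup>2) \<ge>
    (\<Sum>a\<leftarrow>as. (norm (bld a z))\<^sup>2 / (1 + (norm (bl a z))\<^sup>2)\<^sup>2) * (\<Sum>q\<leftarrow>bfam as p. (norm (fst q z))\<^sup>2)"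
proof -
  have N: "(\<Sum>q\<leftarrow>bfam (a # as) p. (norm (fst q z))\<^sup>2) = (1 + (norm (bl a z))\<^sup>2) * (\<Sum>q\<leftarrow>bfam as p. (norm (fst q z))\<^sup>2)" for a as
    by (simp add: o_def bmul_def norm_mult power_mult_distrib sum_list_const_mult distrib_right)
  show "(\<Sum>q\<leftarrow>bfam as p. (norm (fst q z))\<^sup>2) = (norm (fst p z))\<^sup>2 * (\<Prod>a\<leftarrow>as. 1 + (norm (bl a z))\<^sup>2)"
  proof (induction as)
    case Nil then show ?case by simp
  next
    case (Cons a as) show ?case unfolding N Cons.IH by simp
  qed
  show "(\<Sum>q\<leftarrow>bfam as p. (norm (snd q z + c * fst q z))\<^sup>2) \<ge>
    (\<Sum>a\<leftarrow>as. (norm (bld a z))\<^sup>2 / (1 + (norm (bl a z))\<^sup>2)\<^sup>2) * (\<Sum>q\<leftarrow>bfam as p. (norm (fst q z))\<^sup>2)"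
  proof (induction as arbitrary: c)
    case Nil then show ?case by simp
  next
    case (Cons a as)
    define b where "b = bl a z"
    define b' where "b' = bld a z"
    define k where "k = 1 + (norm b)\<^sup>2"
    have k: "k > 0" unfolding k_def by (simp add: add_pos_nonneg)
    define d where "d = cnj b * b' / of_real k"
    define M where "M = (\<Sum>q\<leftarrow>bfam as p. (norm (fst q z))\<^sup>2)"
    define s where "s = (\<Sum>a\<leftarrow>as. (norm (bld a z))\<^sup>2 / (1 + (norm (bl a z))\<^sup>2)\<^sup>2)"
    have "(\<Sum>q\<leftarrow>bfam (a # as) p. (norm (snd q z + c * fst q z))\<^sup>2) =
      (\<Sum>q\<leftarrow>bfam as p. (norm (snd q z + c * fst q z))\<^sup>2 + (norm (b * (snd q z + c * fst q z) + b' * fst q z))\<^sup>2)"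
      by (simp add: o_def bmul_def sum_list_addf b_def b'_def algebra_simps)
    also have "\<dots> = (\<Sum>q\<leftarrow>bfam as p. k * (norm (snd q z + (c + d) * fst q z))\<^sup>2 + (norm b')\<^sup>2 / k * (norm (fst q z))\<^sup>2)"
      unfolding completed_square k_def[symmetric] d_def[symmetric] by (simp add: algebra_simps)
    also have "\<dots> = k * (\<Sum>q\<leftarrow>bfam as p. (norm (snd q z + (c + d) * fst q z))\<^sup>2) + (norm b')\<^sup>2 / k * M"
      by (simp only: sum_list_addf sum_list_const_mult M_def)
    also have "\<dots> \<ge> k * (s * M) + (norm b')\<^sup>2 / k * M"
      using Cons.IH[of "c + d"] k unfolding s_def M_def by (intro add_right_mono mult_left_mono) auto
    also have "k * (s * M) + (norm b')\<^sup>2 / k * M = ((norm b')\<^sup>2 / k\<^sup>2 + s) * (k * M)"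
      using k by (simp add: power2_eq_square algebra_simps)
    also have "\<dots> = (\<Sum>a\<leftarrow>a # as. (norm (bld a z))\<^sup>2 / (1 + (norm (bl a z))\<^sup>2)\<^sup>2) * (\<Sum>q\<leftarrow>bfam (a # as) p. (norm (fst q z))\<^sup>2)"
      unfolding N by (simp add: M_def k_def s_def b_def b'_def)
    finally show ?case .
  qed
qed

text \<open>A finite list leaves a ring beyond the circle free of the poles of the factors. For each
  nonzero \<open>a\<close> the midpoint of 1 and its reciprocal norm is a valid radius.\<close>

lemma common_radius:
  fixes as :: "complex list"
  assumes "R > 1" and "\<And>a. a \<in> set as \<Longrightarrow> norm a < 1"
  obtains R' where "1 < R'" "R' \<le> R" "\<And>a. a \<in> set as \<Longrightarrow> R' * norm a < 1"
proof -
  have "\<exists>R'>1. R' \<le> R \<and> (\<forall>a\<in>set as. R' * norm a < 1)" using assms(2)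
  proof (induction as)
    case Nil then show ?case using assms(1) by auto
  next
    case (Cons a as)
    then obtain R1 where R1: "R1 > 1" "R1 \<le> R" "\<forall>a\<in>set as. R1 * norm a < 1" by auto
    have a: "norm a < 1" using Cons.prems by simp
    show ?case
    proof (cases "a = 0")
      case True then show ?thesis using R1 by auto
    next
      case False
      define R2 where "R2 = min R1 ((1 + 1 / norm a) / 2)"
      have "1 / norm a > 1" using a False by simp
      then have "R2 > 1" using R1 by (simp add: R2_def)
      moreover have "R2 * norm a < 1"
      proof -
        have "R2 * norm a \<le> (1 + 1 / norm a) / 2 * norm a" unfolding R2_def by (intro mult_right_mono min.cobounded2) auto
        also have "\<dots> = (norm a + 1) / 2" using False by (simp add: field_simps)
        finally show ?thesis using a by simp
      qed
      moreover have "R2 * norm b < 1" if "b \<in> set as" for b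
      proof -
        have "R2 * norm b \<le> R1 * norm b" unfolding R2_def by (intro mult_right_mono) auto
        then show ?thesis using R1(3) that by fastforce
      qed
      ultimately show ?thesis using R1(2) by (intro exI[of _ R2]) (auto simp: R2_def)
    qed
  qed
  then show ?thesis using that by auto
qed

lemma disc_pair_mono: "disc_pair F F' R \<Longrightarrow> 1 < R' \<Longrightarrow> R' \<le> R \<Longrightarrow> disc_pair F F' R'"
  unfolding disc_pair_def by auto

text \<open>Each factor is 2 - \<sigma> with \<sigma> in [0, 1], and 1 - \<sigma>/2 is at least
  exp(-\<sigma>) there because exp(\<sigma>) is at least 1 + \<sigma>.\<close>

lemma prod_list_Blaschke_ge:
  assumes "\<And>a. a \<in> set as \<Longrightarrow> norm a < 1" and z: "norm z < 1"
  shows "(\<Prod>a\<leftarrow>as. 1 + (norm (bl a z))\<^sup>2) \<ge> 2 ^ length as * exp (- (\<Sum>a\<leftarrow>as. sig a z))"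
  using assms(1)
proof (induction as)
  case Nil then show ?case by simp
next
  case (Cons a as)
  have a: "norm a < 1" using Cons.prems by simp
  define \<sigma> where "\<sigma> = sig a z"
  have \<sigma>: "0 \<le> \<sigma>" "\<sigma> \<le> 1" unfolding \<sigma>_def using sig_nonneg[OF a] sig_le_1[OF a] z by auto
  have "exp (- \<sigma>) \<le> 1 / (1 + \<sigma>)"
  proof -
    have "1 + \<sigma> \<le> exp \<sigma>" by (rule exp_ge_add_one_self)
    then show ?thesis using \<sigma> by (simp add: exp_minus divide_simps)
  qed
  also have "\<dots> \<le> 1 - \<sigma>/2"
  proof -
    have "\<sigma> * \<sigma> \<le> \<sigma> * 1" using \<sigma> by (intro mult_left_mono) auto
    then have "1 \<le> (1 - \<sigma>/2) * (1 + \<sigma>)" by (simp add: algebra_simps)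
    then show ?thesis using \<sigma> by (simp add: divide_le_eq)
  qed
  finally have e: "exp (- \<sigma>) \<le> 1 - \<sigma>/2" .
  have "(norm (bl a z))\<^sup>2 = 1 - \<sigma>" using sig_bl[OF a, of z] z by (simp add: \<sigma>_def)
  then have "2 * exp (- \<sigma>) \<le> 1 + (norm (bl a z))\<^sup>2" using e by linarith
  then have "2 * exp (- \<sigma>) * (2 ^ length as * exp (- (\<Sum>a\<leftarrow>as. sig a z))) \<le> (1 + (norm (bl a z))\<^sup>2) * (\<Prod>a\<leftarrow>as. 1 + (norm (bl a z))\<^sup>2)"
    using Cons.IH Cons.prems by (intro mult_mono) auto
  then show ?case by (simp add: \<sigma>_def exp_add[symmetric] mult_ac exp_diff exp_minus divide_simps)
qed

lemma borel_measurable_sum_list: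
  fixes f :: "'a \<Rightarrow> 'b \<Rightarrow> ennreal"
  shows "(\<And>x. x \<in> set xs \<Longrightarrow> f x \<in> borel_measurable M) \<Longrightarrow> (\<lambda>y. \<Sum>x\<leftarrow>xs. f x y) \<in> borel_measurable M"
  by (induction xs) auto

lemma nn_integral_sum_list:
  assumes "\<And>x. x \<in> set xs \<Longrightarrow> f x \<in> borel_measurable M"
  shows "(\<integral>\<^sup>+y. (\<Sum>x\<leftarrow>xs. f x y) \<partial>M) = (\<Sum>x\<leftarrow>xs. \<integral>\<^sup>+y. f x y \<partial>M)"
  using assms
proof (induction xs)
  case Nil then show ?case by simp
next
  case (Cons x xs)
  have "(\<lambda>y. \<Sum>x\<leftarrow>xs. f x y) \<in> borel_measurable M" by (rule borel_measurable_sum_list) (simp add: Cons.prems)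
  then have "(\<integral>\<^sup>+y. (\<Sum>x\<leftarrow>x # xs. f x y) \<partial>M) = (\<integral>\<^sup>+y. f x y \<partial>M) + (\<integral>\<^sup>+y. (\<Sum>x\<leftarrow>xs. f x y) \<partial>M)"
    using Cons.prems by (simp add: nn_integral_add)
  then show ?case using Cons by simp
qed

lemma sum_list_ennreal: "(\<And>x. x \<in> set xs \<Longrightarrow> f x \<ge> 0) \<Longrightarrow> (\<Sum>x\<leftarrow>xs. ennreal (f x)) = ennreal (\<Sum>x\<leftarrow>xs. f x)"
proof (induction xs)
  case (Cons a xs)
  have "f a \<ge> 0" "sum_list (map f xs) \<ge> 0" using Cons.prems by (auto intro!: sum_list_nonneg)
  then show ?case using Cons by (simp add: ennreal_plus)
qed simp

text \<open>Averaging over all subproducts of the Blaschke factors produces the weight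
  \<open>\<Prod>(1 + \<bar>b\<bar>\<^sup>2)/2\<close>, which equals 1 on the circle and is bounded below in the disc, while
  its logarithm has Laplacian comparable to \<open>\<Sum>\<bar>b'\<bar>\<^sup>2\<close>.\<close>
lemma Carleson_derivative_bound:
  assumes h: "disc_pair h h' R" and as: "\<And>a. a \<in> set as \<Longrightarrow> norm a < 1"
    and C: "\<And>w. norm w < 1 \<Longrightarrow> (\<Sum>a\<leftarrow>as. sig a w) \<le> C"
  shows "(\<integral>\<^sup>+r. \<integral>\<^sup>+\<theta>. ennreal ((\<Sum>a\<leftarrow>as. (norm (bld a (of_real r * cis \<theta>)))\<^sup>2) * (norm (h (of_real r * cis \<theta>)))\<^sup>2 * (1 - r)) \<partial>circ \<partial>rad)
    \<le> ennreal (2 * exp C) * (\<integral>\<^sup>+\<theta>. ennreal ((norm (h (cis \<theta>)))\<^sup>2) \<partial>circ)"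
proof -
  interpret disc_pair h h' R by (rule h)
  obtain R' where R': "1 < R'" "R' \<le> R" "\<And>a. a \<in> set as \<Longrightarrow> R' * norm a < 1"
    using common_radius[OF R as] by metis
  define L where "L = bfam as (h, h')"
  have dp: "disc_pair (fst q) (snd q) R'" if "q \<in> set L" for q
    using disc_pair_bfam[of "(h,h')" R' as q] disc_pair_mono[OF h R'(1,2)] R'(3) that by (simp add: L_def)
  have mq [measurable]: "fst q \<in> borel_measurable borel" "snd q \<in> borel_measurable borel" if "q \<in> set L" for q
    using dp[OF that] by (auto simp: disc_pair_def)
  \<comment> \<open>The power of 2 and the exponential are the lower bound of
    \<open>prod_list_Blaschke_ge\<close>; the 4 bounds the squared denominators in
    \<open>bfam_pointwise\<close>. The power of 2 cancels against the number of members of the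
    family at the end.\<close>
  define K where "K = 2 ^ length as * exp (- C) / 4"
  have K: "K > 0" by (simp add: K_def)
  have pw: "K * ((\<Sum>a\<leftarrow>as. (norm (bld a z))\<^sup>2) * (norm (h z))\<^sup>2) \<le> (\<Sum>q\<leftarrow>L. (norm (snd q z))\<^sup>2)" if z: "norm z < 1" for z
  proof -
    define S where "S = (\<Sum>a\<leftarrow>as. (norm (bld a z))\<^sup>2)"
    have S0: "S \<ge> 0" unfolding S_def by (rule sum_list_nonneg) auto
    define s where "s = (\<Sum>a\<leftarrow>as. (norm (bld a z))\<^sup>2 / (1 + (norm (bl a z))\<^sup>2)\<^sup>2)"
    have "S / 4 = (\<Sum>a\<leftarrow>as. (norm (bld a z))\<^sup>2 / 4)" by (simp only: divide_inverse sum_list_mult_const S_def)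
    also have "\<dots> \<le> s" unfolding s_def
    proof (rule sum_list_mono)
      fix a assume a: "a \<in> set as"
      have "(norm (bl a z))\<^sup>2 \<le> 1" using norm_bl_le_1[OF as[OF a], of z] z by (simp add: abs_square_le_1)
      then have "(1 + (norm (bl a z))\<^sup>2)\<^sup>2 \<le> 2\<^sup>2" by (intro power_mono) auto
      moreover have "0 < (1 + (norm (bl a z))\<^sup>2)\<^sup>2" by (intro zero_less_power add_pos_nonneg) auto
      ultimately show "(norm (bld a z))\<^sup>2 / 4 \<le> (norm (bld a z))\<^sup>2 / (1 + (norm (bl a z))\<^sup>2)\<^sup>2"
        by (intro divide_left_mono) auto
    qed
    finally have Ss: "S / 4 \<le> s" .
    have "2 ^ length as * exp (- C) \<le> 2 ^ length as * exp (- (\<Sum>a\<leftarrow>as. sig a z))"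
      using C[OF z] by simp
    also have "\<dots> \<le> (\<Prod>a\<leftarrow>as. 1 + (norm (bl a z))\<^sup>2)" by (rule prod_list_Blaschke_ge[OF as z])
    finally have P: "2 ^ length as * exp (- C) \<le> (\<Prod>a\<leftarrow>as. 1 + (norm (bl a z))\<^sup>2)" .
    have "K * (S * (norm (h z))\<^sup>2) = S/4 * ((norm (h z))\<^sup>2 * (2 ^ length as * exp (- C)))"
      by (simp add: K_def)
    also have "\<dots> \<le> s * ((norm (h z))\<^sup>2 * (\<Prod>a\<leftarrow>as. 1 + (norm (bl a z))\<^sup>2))"
      using P Ss S0 by (intro mult_mono) auto
    also have "\<dots> = s * (\<Sum>q\<leftarrow>L. (norm (fst q z))\<^sup>2)"
      unfolding L_def bfam_pointwise(1) by simp
    also have "\<dots> \<le> (\<Sum>q\<leftarrow>L. (norm (snd q z + 0 * fst q z))\<^sup>2)"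
      unfolding L_def s_def by (rule bfam_pointwise(2))
    finally show ?thesis by (simp add: S_def)
  qed
  define X where "X = (\<integral>\<^sup>+r. \<integral>\<^sup>+\<theta>. ennreal ((\<Sum>a\<leftarrow>as. (norm (bld a (of_real r * cis \<theta>)))\<^sup>2) * (norm (h (of_real r * cis \<theta>)))\<^sup>2 * (1 - r)) \<partial>circ \<partial>rad)"
  define Y where "Y = (\<integral>\<^sup>+\<theta>. ennreal ((norm (h (cis \<theta>)))\<^sup>2) \<partial>circ)"
  have sl [measurable]: "(\<lambda>z. \<Sum>a\<leftarrow>as. (norm (bld a z))\<^sup>2) \<in> borel_measurable borel"
    by (induction as) auto
  have "ennreal K * X = (\<integral>\<^sup>+r. \<integral>\<^sup>+\<theta>. ennreal K * ennreal ((\<Sum>a\<leftarrow>as. (norm (bld a (of_real r * cis \<theta>)))\<^sup>2) * (norm (h (of_real r * cis \<theta>)))\<^sup>2 * (1 - r)) \<partial>circ \<partial>rad)"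
    unfolding X_def by (subst nn_integral_cmult[symmetric], measurable, intro nn_integral_cong nn_integral_cmult[symmetric], measurable)
  also have "\<dots> \<le> (\<integral>\<^sup>+r. \<integral>\<^sup>+\<theta>. (\<Sum>q\<leftarrow>L. ennreal ((norm (snd q (of_real r * cis \<theta>)))\<^sup>2 * (1 - r))) \<partial>circ \<partial>rad)"
  proof (intro nn_integral_rad_mono nn_integral_circ_mono)
    fix r \<theta> :: real assume r: "0 \<le> r" "r < 1"
    define z where "z = of_real r * cis \<theta>"
    have z: "norm z < 1" using r by (simp add: z_def norm_mult)
    have "K * ((\<Sum>a\<leftarrow>as. (norm (bld a z))\<^sup>2) * (norm (h z))\<^sup>2) * (1 - r) \<le> (\<Sum>q\<leftarrow>L. (norm (snd q z))\<^sup>2) * (1 - r)"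
      using pw[OF z] r by (intro mult_right_mono) auto
    then have "ennreal (K * ((\<Sum>a\<leftarrow>as. (norm (bld a z))\<^sup>2) * (norm (h z))\<^sup>2 * (1 - r))) \<le> ennreal (\<Sum>q\<leftarrow>L. (norm (snd q z))\<^sup>2 * (1 - r))"
      by (intro ennreal_leI) (simp add: sum_list_mult_const mult.assoc)
    then show "ennreal K * ennreal ((\<Sum>a\<leftarrow>as. (norm (bld a z))\<^sup>2) * (norm (h z))\<^sup>2 * (1 - r)) \<le> (\<Sum>q\<leftarrow>L. ennreal ((norm (snd q z))\<^sup>2 * (1 - r)))"
      using r K by (simp add: sum_list_ennreal ennreal_mult'[symmetric])
  qed
  also have "\<dots> = (\<Sum>q\<leftarrow>L. \<integral>\<^sup>+r. \<integral>\<^sup>+\<theta>. ennreal ((norm (snd q (of_real r * cis \<theta>)))\<^sup>2 * (1 - r)) \<partial>circ \<partial>rad)"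
  proof -
    have "(\<integral>\<^sup>+\<theta>. (\<Sum>q\<leftarrow>L. ennreal ((norm (snd q (of_real r * cis \<theta>)))\<^sup>2 * (1 - r))) \<partial>circ) = (\<Sum>q\<leftarrow>L. \<integral>\<^sup>+\<theta>. ennreal ((norm (snd q (of_real r * cis \<theta>)))\<^sup>2 * (1 - r)) \<partial>circ)" for r
      by (rule nn_integral_sum_list) measurable
    then show ?thesis by (simp only:) (rule nn_integral_sum_list, measurable)
  qed
  \<comment> \<open>Every member has the modulus of \<open>h\<close> on the circle, so the
    Littlewood-Paley bound is the same number \<open>Y/2\<close> for each of them.\<close>
  also have "\<dots> \<le> (\<Sum>q\<leftarrow>L. ennreal (1/2) * Y)"
  proof (rule sum_list_mono)
    fix q assume q: "q \<in> set L"
    interpret q: disc_pair "fst q" "snd q" R' by (rule dp[OF q])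
    have "norm (fst q (cis \<theta>)) = norm (h (cis \<theta>))" for \<theta>
      using bfam_circle[OF as, where q = q and p = "(h,h')" and \<theta> = \<theta>] q by (simp add: L_def)
    then show "(\<integral>\<^sup>+r. \<integral>\<^sup>+\<theta>. ennreal ((norm (snd q (of_real r * cis \<theta>)))\<^sup>2 * (1 - r)) \<partial>circ \<partial>rad) \<le> ennreal (1/2) * Y"
      using q.Littlewood_Paley by (simp add: Y_def)
  qed
  also have "\<dots> = ennreal (2 ^ length as) * (ennreal (1/2) * Y)"
    by (simp add: sum_list_triv L_def length_bfam ennreal_power[symmetric])
  finally have "ennreal K * X \<le> ennreal (2 ^ length as) * (ennreal (1/2) * Y)" .
  then have "ennreal (1/K) * (ennreal K * X) \<le> ennreal (1/K) * (ennreal (2 ^ length as) * (ennreal (1/2) * Y))"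
    by (rule mult_left_mono) simp
  also have "ennreal (1/K) * (ennreal K * X) = X" using K by (simp add: mult.assoc[symmetric] ennreal_mult[symmetric])
  also have "ennreal (1/K) * (ennreal (2 ^ length as) * (ennreal (1/2) * Y)) = ennreal (1/K * (2 ^ length as * (1/2))) * Y"
    using K by (simp only: mult.assoc[symmetric]) (subst ennreal_mult[symmetric], simp, simp, subst ennreal_mult[symmetric], simp_all)
  also have "1/K * (2 ^ length as * (1/2)) = 2 * exp C" by (simp add: K_def exp_minus field_simps)
  finally show ?thesis by (simp add: X_def Y_def)
qed

lemma emeasure_rad_Icc: "0 \<le> a \<Longrightarrow> a \<le> b \<Longrightarrow> b < 1 \<Longrightarrow> emeasure rad {a..b} = ennreal (b - a)"
proof -
  assume "0 \<le> a" "a \<le> b" "b < 1"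
  moreover from this have "{0..<1} \<inter> {a..b} = {a..b}" by auto
  ultimately show ?thesis by (simp add: rad_def emeasure_lint)
qed

text \<open>The derivative of the Blaschke factor at \<open>a\<close> is large near
  \<open>a\<close>. On circles of radius between \<open>norm a\<close> and 1 the integrand is a
  multiple of the squared modulus of the holomorphic function \<open>u\<close>, and the Poisson
  sub-mean inequality recovers its value at \<open>a\<close>. Integrating over the radii restores
  the factor 1 - |a|^2.\<close>

lemma (in disc_pair) Carleson_derivative_lower:
  assumes a: "norm a < 1"
  shows "ennreal (pi / 256 * (1 - (norm a)\<^sup>2) * (norm (F a))\<^sup>2) \<le>
    (\<integral>\<^sup>+r. \<integral>\<^sup>+\<theta>. ennreal ((norm (bld a (of_real r * cis \<theta>)))\<^sup>2 * (norm (F (of_real r * cis \<theta>)))\<^sup>2 * (1 - r)) \<partial>circ \<partial>rad)"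
proof -
  define d where "d = 1 - norm a"
  define q where "q = 1 - (norm a)\<^sup>2"
  have d: "0 < d" "d \<le> 1" using a by (auto simp: d_def)
  have q: "0 < q" "q \<le> 2 * d"
  proof -
    show "0 < q" using one_minus_norm_sq_pos[OF a] by (simp add: q_def)
    have "q = d * (1 + norm a)" by (simp add: q_def d_def power2_eq_square algebra_simps)
    also have "\<dots> \<le> d * 2" using a d by (intro mult_left_mono) auto
    finally show "q \<le> 2 * d" by simp
  qed
  define A where "A = norm (F a)"
  \<comment> \<open>The squared derivative of the Blaschke factor is put into the holomorphic
    function itself, so that \<open>(norm (bld a z))\<^sup>2 * (norm (F z))\<^sup>2\<close> equals
    \<open>q\<^sup>2 * (norm (u z))\<^sup>2\<close>.\<close>
  define u where "u = (\<lambda>z. F z / (1 - cnj a * z)\<^sup>2)"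
  have mu [measurable]: "u \<in> borel_measurable borel" unfolding u_def by measurable
  have ua: "norm (u a) = A / q\<^sup>2"
  proof -
    have "1 - cnj a * a = of_real q" unfolding q_def by (metis complex_norm_square mult.commute of_real_1 of_real_diff)
    then show ?thesis using q by (simp add: u_def A_def norm_divide norm_power)
  qed
  \<comment> \<open>The middle half of the radii beyond \<open>norm a\<close>: they keep distance
    \<open>d/4\<close> both from \<open>norm a\<close>, which bounds the Poisson kernel at
    \<open>a / r\<close> by 8/d, and from 1, which bounds the weight 1 - r below.\<close>
  have lower: "ennreal (pi * d\<^sup>2 / 16 * (A / q)\<^sup>2) \<le> (\<integral>\<^sup>+\<theta>. ennreal ((norm (bld a (of_real r * cis \<theta>)))\<^sup>2 * (norm (F (of_real r * cis \<theta>)))\<^sup>2 * (1 - r)) \<partial>circ)"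
    if r: "r \<in> {norm a + d/4..norm a + 3*d/4}" for r
  proof -
    have r0: "0 < r" "norm a < r" "r < 1" "r - norm a \<ge> d/4" "1 - r \<ge> d/4"
    proof -
      have "norm a + d/4 \<le> r" "r \<le> norm a + 3*d/4" "norm a = 1 - d" "norm a \<ge> 0" using r by (auto simp: d_def)
      then show "0 < r" "norm a < r" "r < 1" "r - norm a \<ge> d/4" "1 - r \<ge> d/4" using d by linarith+
    qed
    have w: "norm (a / of_real r) < 1" using r0 by (simp add: norm_divide)
    have sub: "norm (of_real r * z) \<le> 1" if "norm z \<le> 1" for z :: complex
      using r0 that by (simp add: norm_mult mult_le_one)
    have cont: "continuous_on (cball 0 1) (\<lambda>z. u (of_real r * z))" unfolding u_def
      by (intro continuous_intros continuous_on_compose2[OF contF]) (use sub a one_minus_cnj_mult_neq[OF a] in auto)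
    have "(F \<circ> (\<lambda>z. of_real r * z)) holomorphic_on ball 0 1"
    proof (rule holomorphic_on_compose_gen[OF _ holF])
      show "(*) (complex_of_real r) ` ball 0 1 \<subseteq> ball 0 R"
      proof safe
        fix x :: complex assume "x \<in> ball 0 1"
        then show "of_real r * x \<in> ball 0 R" using sub[of x] R by simp
      qed
    qed (auto intro!: holomorphic_intros)
    then have hol: "(\<lambda>z. u (of_real r * z)) holomorphic_on ball 0 1" unfolding u_def o_def
      by (intro holomorphic_intros) (use sub one_minus_cnj_mult_neq[OF a] in auto)
    have "ennreal (norm (u (of_real r * (a / of_real r))) powr 2) \<le> ennreal (1/(2*pi)) * (\<integral>\<^sup>+t. ennreal (pk (a / of_real r) t * norm (u (of_real r * cis t)) powr 2) \<partial>circ)"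
      by (rule Poisson_subharmonic[OF cont hol w]) simp
    also have "\<dots> \<le> ennreal (1/(2*pi)) * (\<integral>\<^sup>+t. ennreal (8 / d) * ennreal ((norm (u (of_real r * cis t)))\<^sup>2) \<partial>circ)"
    proof (intro mult_left_mono nn_integral_circ_mono)
      fix t :: real
      have "pk (a / of_real r) t \<le> 2 / (1 - norm (a / of_real r))" by (rule pk_le[OF w])
      also have "\<dots> \<le> 8 / d"
      proof -
        have "1 - norm (a / of_real r) = (r - norm a) / r" using r0 by (simp add: norm_divide field_simps)
        also have "\<dots> \<ge> (r - norm a) / 1" using r0 by (intro divide_left_mono) auto
        finally have "d / 4 \<le> 1 - norm (a / of_real r)" using r0 by simp
        then have "2 / (1 - norm (a / of_real r)) \<le> 2 / (d/4)" using d by (intro divide_left_mono mult_pos_pos) auto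
        then show ?thesis by simp
      qed
      finally have "pk (a / of_real r) t \<le> 8 / d" .
      from mult_right_mono[OF this, of "(norm (u (of_real r * cis t)))\<^sup>2"]
      have "pk (a / of_real r) t * norm (u (of_real r * cis t)) powr 2 \<le> 8 / d * (norm (u (of_real r * cis t)))\<^sup>2"
        by simp
      then show "ennreal (pk (a / of_real r) t * norm (u (of_real r * cis t)) powr 2) \<le> ennreal (8 / d) * ennreal ((norm (u (of_real r * cis t)))\<^sup>2)"
        using d by (simp add: ennreal_mult'[symmetric] ennreal_leI)
    qed simp
    also have "\<dots> = ennreal (1/(2*pi)) * (ennreal (8 / d) * (\<integral>\<^sup>+t. ennreal ((norm (u (of_real r * cis t)))\<^sup>2) \<partial>circ))"
      by (subst nn_integral_cmult) measurable
    also have "\<dots> = ennreal (4 / (pi * d)) * (\<integral>\<^sup>+t. ennreal ((norm (u (of_real r * cis t)))\<^sup>2) \<partial>circ)"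
      using d by (simp add: mult.assoc[symmetric] ennreal_mult'[symmetric])
    finally have *: "ennreal (norm (u (of_real r * (a / of_real r))) powr 2) \<le> ennreal (4 / (pi * d)) * (\<integral>\<^sup>+t. ennreal ((norm (u (of_real r * cis t)))\<^sup>2) \<partial>circ)" .
    have 1: "ennreal ((A / q\<^sup>2)\<^sup>2) \<le> ennreal (4 / (pi * d)) * (\<integral>\<^sup>+t. ennreal ((norm (u (of_real r * cis t)))\<^sup>2) \<partial>circ)"
    proof -
      have "(A / q\<^sup>2) powr 2 = (A / q\<^sup>2)\<^sup>2" by (rule powr_numeral) (simp add: A_def)
      moreover have "of_real r * (a / of_real r) = a" using r0 by simp
      ultimately show ?thesis using * ua by (simp only:)
    qed
    have "ennreal (pi * d\<^sup>2 / 16 * (A / q)\<^sup>2) = ennreal (q\<^sup>2 * (d/4) * (pi * d / 4)) * ennreal ((A / q\<^sup>2)\<^sup>2)"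
    proof -
      have "pi * d\<^sup>2 / 16 * (A / q)\<^sup>2 = q\<^sup>2 * (d/4) * (pi * d / 4) * (A / q\<^sup>2)\<^sup>2"
        using q by (simp add: power2_eq_square field_simps)
      then show ?thesis using d by (simp only:) (rule ennreal_mult, auto)
    qed
    also have "\<dots> \<le> ennreal (q\<^sup>2 * (d/4) * (pi * d / 4)) * (ennreal (4 / (pi * d)) * (\<integral>\<^sup>+t. ennreal ((norm (u (of_real r * cis t)))\<^sup>2) \<partial>circ))"
      by (rule mult_left_mono[OF 1]) simp
    also have "\<dots> = ennreal (q\<^sup>2 * (d/4)) * (\<integral>\<^sup>+t. ennreal ((norm (u (of_real r * cis t)))\<^sup>2) \<partial>circ)"
    proof -
      have "q\<^sup>2 * (d/4) * (pi * d / 4) * (4 / (pi * d)) = q\<^sup>2 * (d/4)" using d by simp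
      moreover have "ennreal (q\<^sup>2 * (d/4) * (pi * d / 4)) * ennreal (4 / (pi * d)) = ennreal (q\<^sup>2 * (d/4) * (pi * d / 4) * (4 / (pi * d)))"
        using d by (intro ennreal_mult[symmetric]) auto
      ultimately show ?thesis by (simp only: mult.assoc[symmetric])
    qed
    also have "\<dots> = (\<integral>\<^sup>+t. ennreal (q\<^sup>2 * (d/4)) * ennreal ((norm (u (of_real r * cis t)))\<^sup>2) \<partial>circ)"
      by (rule nn_integral_cmult[symmetric]) measurable
    also have "\<dots> \<le> (\<integral>\<^sup>+\<theta>. ennreal ((norm (bld a (of_real r * cis \<theta>)))\<^sup>2 * (norm (F (of_real r * cis \<theta>)))\<^sup>2 * (1 - r)) \<partial>circ)"
    proof (rule nn_integral_circ_mono)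
      fix t :: real
      define z where "z = of_real r * cis t"
      have "(norm (bld a z))\<^sup>2 * (norm (F z))\<^sup>2 = q\<^sup>2 * (norm (u z))\<^sup>2"
        unfolding bld_def u_def q_def[symmetric] norm_divide norm_power norm_of_real using q by (simp add: power_divide)
      then have "q\<^sup>2 * (d/4) * (norm (u z))\<^sup>2 \<le> (norm (bld a z))\<^sup>2 * (norm (F z))\<^sup>2 * (1 - r)"
        using mult_left_mono[OF r0(5), of "q\<^sup>2 * (norm (u z))\<^sup>2"] by (simp add: mult_ac)
      then show "ennreal (q\<^sup>2 * (d/4)) * ennreal ((norm (u z))\<^sup>2) \<le> ennreal ((norm (bld a z))\<^sup>2 * (norm (F z))\<^sup>2 * (1 - r))"
        using d by (simp add: ennreal_mult'[symmetric] ennreal_leI)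
    qed
    finally show ?thesis .
  qed
  have "ennreal (pi / 256 * q * A\<^sup>2) \<le> ennreal (pi * d\<^sup>2 / 16 * (A / q)\<^sup>2) * ennreal (d/2)"
  proof -
    have "q ^ 3 \<le> (2 * d) ^ 3" using q by (intro power_mono) auto
    then have "pi / 256 * A\<^sup>2 / q\<^sup>2 * q ^ 3 \<le> pi / 256 * A\<^sup>2 / q\<^sup>2 * (2 * d) ^ 3" by (intro mult_left_mono) auto
    then have "pi / 256 * q * A\<^sup>2 \<le> pi * d\<^sup>2 / 16 * (A / q)\<^sup>2 * (d/2)"
      using q by (simp add: power2_eq_square power3_eq_cube field_simps)
    then show ?thesis using d by (simp add: ennreal_mult'[symmetric] ennreal_leI del: ennreal_mult_left_cong)
  qed
  also have "ennreal (d/2) = emeasure rad {norm a + d/4..norm a + 3*d/4}"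
  proof -
    have n: "norm a = 1 - d" by (simp add: d_def)
    have "0 \<le> norm a + d/4" "norm a + d/4 \<le> norm a + 3*d/4" "norm a + 3*d/4 < 1" using d n norm_ge_zero[of a] by linarith+
    from emeasure_rad_Icc[OF this] show ?thesis by simp
  qed
  also have "ennreal (pi * d\<^sup>2 / 16 * (A / q)\<^sup>2) * \<dots> = (\<integral>\<^sup>+r. ennreal (pi * d\<^sup>2 / 16 * (A / q)\<^sup>2) * indicator {norm a + d/4..norm a + 3*d/4} r \<partial>rad)"
    by (rule nn_integral_cmult_indicator[symmetric]) simp
  also have "\<dots> \<le> (\<integral>\<^sup>+r. \<integral>\<^sup>+\<theta>. ennreal ((norm (bld a (of_real r * cis \<theta>)))\<^sup>2 * (norm (F (of_real r * cis \<theta>)))\<^sup>2 * (1 - r)) \<partial>circ \<partial>rad)"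
    by (rule nn_integral_mono) (use lower in \<open>auto simp: indicator_def\<close>)
  finally show ?thesis by (simp add: q_def A_def)
qed

text \<open>Sums the lower bound over the points and compares it with the upper bound for the whole
  list; 512 is the 2 of the upper bound times the 256 of the lower one.\<close>

lemma Carleson_embedding_square:
  assumes h: "disc_pair h h' R" and F: "finite F" and a: "\<And>n. n \<in> F \<Longrightarrow> norm (a n) < 1"
    and C: "\<And>w. norm w < 1 \<Longrightarrow> (\<Sum>n\<in>F. sig (a n) w) \<le> C"
  shows "ennreal (\<Sum>n\<in>F. (1 - (norm (a n))\<^sup>2) * (norm (h (a n)))\<^sup>2) \<le>
    ennreal (512 * exp C / pi) * (\<integral>\<^sup>+\<theta>. ennreal ((norm (h (cis \<theta>)))\<^sup>2) \<partial>circ)"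
proof -
  interpret disc_pair h h' R by (rule h)
  obtain xs where xs: "set xs = F" "distinct xs" using finite_distinct_list[OF F] by blast
  have sl: "(\<Sum>b\<leftarrow>map a xs. f b) = (\<Sum>n\<in>F. f (a n))" for f :: "complex \<Rightarrow> real"
    using xs by (simp add: o_def sum_list_distinct_conv_sum_set)
  define T where "T = (\<Sum>n\<in>F. (1 - (norm (a n))\<^sup>2) * (norm (h (a n)))\<^sup>2)"
  have T: "T \<ge> 0" unfolding T_def by (intro sum_nonneg mult_nonneg_nonneg less_imp_le[OF one_minus_norm_sq_pos] a) auto
  define Y where "Y = (\<integral>\<^sup>+\<theta>. ennreal ((norm (h (cis \<theta>)))\<^sup>2) \<partial>circ)"
  have "ennreal (pi / 256) * ennreal T = ennreal (\<Sum>n\<in>F. pi / 256 * (1 - (norm (a n))\<^sup>2) * (norm (h (a n)))\<^sup>2)"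
    by (subst ennreal_mult'[symmetric]) (simp_all add: T_def sum_distrib_left mult.assoc)
  also have "\<dots> = (\<Sum>n\<in>F. ennreal (pi / 256 * (1 - (norm (a n))\<^sup>2) * (norm (h (a n)))\<^sup>2))"
    by (intro sum_ennreal[symmetric] mult_nonneg_nonneg less_imp_le[OF one_minus_norm_sq_pos] a) auto
  also have "\<dots> \<le> (\<Sum>n\<in>F. \<integral>\<^sup>+r. \<integral>\<^sup>+\<theta>. ennreal ((norm (bld (a n) (of_real r * cis \<theta>)))\<^sup>2 * (norm (h (of_real r * cis \<theta>)))\<^sup>2 * (1 - r)) \<partial>circ \<partial>rad)"
    by (intro sum_mono Carleson_derivative_lower a)
  also have "\<dots> = (\<integral>\<^sup>+r. \<integral>\<^sup>+\<theta>. (\<Sum>n\<in>F. ennreal ((norm (bld (a n) (of_real r * cis \<theta>)))\<^sup>2 * (norm (h (of_real r * cis \<theta>)))\<^sup>2 * (1 - r))) \<partial>circ \<partial>rad)"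
    by (subst nn_integral_sum, measurable)+
  also have "\<dots> \<le> (\<integral>\<^sup>+r. \<integral>\<^sup>+\<theta>. ennreal ((\<Sum>b\<leftarrow>map a xs. (norm (bld b (of_real r * cis \<theta>)))\<^sup>2) * (norm (h (of_real r * cis \<theta>)))\<^sup>2 * (1 - r)) \<partial>circ \<partial>rad)"
    by (intro nn_integral_rad_mono nn_integral_circ_mono) (simp only: sl, subst sum_ennreal, simp, simp add: sum_distrib_right)
  also have "\<dots> \<le> ennreal (2 * exp C) * Y" unfolding Y_def
  proof (rule Carleson_derivative_bound[OF h])
    show "norm b < 1" if "b \<in> set (map a xs)" for b using that xs a by auto
    show "(\<Sum>b\<leftarrow>map a xs. sig b w) \<le> C" if "norm w < 1" for w unfolding sl using C[OF that] .
  qed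
  finally have "ennreal (256 / pi) * (ennreal (pi / 256) * ennreal T) \<le> ennreal (256 / pi) * (ennreal (2 * exp C) * Y)"
    by (rule mult_left_mono) simp
  also have "ennreal (256 / pi) * (ennreal (pi / 256) * ennreal T) = ennreal T"
    by (simp add: mult.assoc[symmetric] ennreal_mult[symmetric])
  also have "ennreal (256 / pi) * (ennreal (2 * exp C) * Y) = ennreal (512 * exp C / pi) * Y"
    by (simp add: mult.assoc[symmetric] ennreal_mult[symmetric])
  finally show ?thesis by (simp add: T_def Y_def)
qed

lemma norm_one_minus_cnj_cis: "norm (1 - cnj z * cis \<tau>) = norm (cis \<tau> - z)"
proof -
  have "cnj (cis \<tau> - z) * cis \<tau> = 1 - cnj z * cis \<tau>" by (simp add: algebra_simps cis_cnj cis_mult)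
  then have "norm (1 - cnj z * cis \<tau>) = norm (cnj (cis \<tau> - z)) * norm (cis \<tau>)" by (metis norm_mult)
  then show ?thesis by (simp only: complex_mod_cnj norm_cis mult_1_right)
qed

text \<open>Replacing \<open>\<bar>G\<bar>\<close> by its zero-free majorant reduces all exponents to the square case.\<close>
lemma Carleson_embedding:
  assumes cont: "continuous_on (cball 0 1) G" and hol: "G holomorphic_on ball 0 1" and mG [measurable]: "G \<in> borel_measurable borel"
    and F: "finite F" and a: "\<And>n. n \<in> F \<Longrightarrow> norm (a n) < 1"
    and C: "\<And>w. norm w < 1 \<Longrightarrow> (\<Sum>n\<in>F. sig (a n) w) \<le> C"
    and z: "norm z < 1" and p: "p > 0"
  shows "ennreal (\<Sum>n\<in>F. (1 - (norm (a n))\<^sup>2) * norm (G (a n)) powr p / (norm (1 - cnj z * a n))\<^sup>2) \<le>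
    ennreal (512 * exp C / pi) * (\<integral>\<^sup>+\<tau>. ennreal (norm (G (cis \<tau>)) powr p / (norm (cis \<tau> - z))\<^sup>2) \<partial>circ)"
proof -
  obtain B where B: "\<And>w. norm w \<le> 1 \<Longrightarrow> norm (G w) \<le> B" "B \<ge> 0"
  proof -
    have "bounded (G ` cball 0 1)" by (intro compact_imp_bounded compact_continuous_image cont) simp
    then obtain b where "\<forall>x\<in>G ` cball 0 1. norm x \<le> b" by (auto simp: bounded_iff)
    then show ?thesis using that[of "max b 0"] by (metis image_eqI mem_cball_0 max.coboundedI1 max.cobounded2)
  qed
  define d where "d = 1 - norm z"
  have d: "d > 0" using z by (simp add: d_def)
  \<comment> \<open>The majorant of \<open>exp_majorant\<close> exists only with room
    \<open>e\<close>; the room is removed at the end by dominated convergence, since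
    \<open>G\<close> is bounded on the closed disc and the kernel by the distance of
    \<open>z\<close> to the circle.\<close>
  have eps: "ennreal (\<Sum>n\<in>F. (1 - (norm (a n))\<^sup>2) * norm (G (a n)) powr p / (norm (1 - cnj z * a n))\<^sup>2) \<le>
    ennreal (512 * exp C / pi) * (\<integral>\<^sup>+\<tau>. ennreal (((norm (G (cis \<tau>)) + e) * exp e) powr p / (norm (cis \<tau> - z))\<^sup>2) \<partial>circ)" if e: "e > 0" for e
  proof -
    obtain q where q: "q holomorphic_on UNIV" "\<And>z. norm z \<le> 1 \<Longrightarrow> norm (G z) \<le> exp (Re (q z))"
      "\<And>z. norm z = 1 \<Longrightarrow> Re (q z) \<le> ln (norm (G z) + e) + e"
      using exp_majorant[OF cont hol e] by metis
    have mq [measurable]: "q \<in> borel_measurable borel" "deriv q \<in> borel_measurable borel"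
      using q(1) by (auto intro!: borel_measurable_continuous_onI holomorphic_on_imp_continuous_on holomorphic_deriv)
    obtain R' where R': "1 < R'" "R' \<le> 2" "\<And>b. b \<in> set [z] \<Longrightarrow> R' * norm b < 1"
      using common_radius[of 2 "[z]"] z by (metis empty_iff empty_set list.set_intros(1) one_less_numeral_iff semiring_norm(76) set_ConsD)
    \<comment> \<open>Its squared modulus is the majorant to the power \<open>p\<close> divided by
      |1 - cnj(z) w|^2. On the circle that denominator is the squared distance to \<open>z\<close>,
      so the square case already carries the kernel.\<close>
    define h where "h = (\<lambda>w. exp (of_real (p/2) * q w) / (1 - cnj z * w))"
    define h' where "h' = (\<lambda>w. (exp (of_real (p/2) * q w) * (of_real (p/2) * deriv q w) * (1 - cnj z * w) - exp (of_real (p/2) * q w) * (- cnj z)) / ((1 - cnj z * w) * (1 - cnj z * w)))"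
    have dp: "disc_pair h h' R'"
    proof
      show "1 < R'" by (rule R')
      show "h \<in> borel_measurable borel" unfolding h_def by measurable
      show "h' \<in> borel_measurable borel" unfolding h'_def by measurable
      fix w :: complex assume w: "norm w < R'"
      have "1 - cnj z * w \<noteq> 0"
      proof
        assume "1 - cnj z * w = 0"
        then have "norm (cnj z * w) = 1" by (metis norm_one eq_iff_diff_eq_0)
        moreover have "norm (cnj z * w) \<le> norm z * R'"
          unfolding norm_mult complex_mod_cnj using w by (intro mult_left_mono) auto
        ultimately show False using R'(3)[of z] by (simp add: mult.commute)
      qed
      moreover have dq: "(q has_field_derivative deriv q w) (at w)" by (rule holomorphic_derivI[OF q(1)]) auto
      ultimately show "(h has_field_derivative h' w) (at w)" unfolding h_def h'_def
        by (intro DERIV_divide) (auto intro!: derivative_eq_intros)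
    qed
    have hsq: "(norm (h w))\<^sup>2 = exp (Re (q w)) powr p / (norm (1 - cnj z * w))\<^sup>2" for w
    proof -
      have "(exp (p / 2 * Re (q w)))\<^sup>2 = exp (Re (q w)) powr p"
        by (simp add: power2_eq_square powr_def flip: exp_add)
      then show ?thesis by (simp add: h_def norm_divide power_divide)
    qed
    have "ennreal (\<Sum>n\<in>F. (1 - (norm (a n))\<^sup>2) * norm (G (a n)) powr p / (norm (1 - cnj z * a n))\<^sup>2) \<le>
      ennreal (\<Sum>n\<in>F. (1 - (norm (a n))\<^sup>2) * (norm (h (a n)))\<^sup>2)"
    proof (intro ennreal_leI sum_mono)
      fix n assume n: "n \<in> F"
      have "norm (G (a n)) powr p \<le> exp (Re (q (a n))) powr p"
        using q(2)[of "a n"] a[OF n] p by (intro powr_mono2) auto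
      then have "(1 - (norm (a n))\<^sup>2) * (norm (G (a n)) powr p / (norm (1 - cnj z * a n))\<^sup>2) \<le> (1 - (norm (a n))\<^sup>2) * (norm (h (a n)))\<^sup>2"
        unfolding hsq by (intro mult_left_mono divide_right_mono less_imp_le[OF one_minus_norm_sq_pos] a[OF n]) auto
      then show "(1 - (norm (a n))\<^sup>2) * norm (G (a n)) powr p / (norm (1 - cnj z * a n))\<^sup>2 \<le> (1 - (norm (a n))\<^sup>2) * (norm (h (a n)))\<^sup>2" by simp
    qed
    also have "\<dots> \<le> ennreal (512 * exp C / pi) * (\<integral>\<^sup>+\<theta>. ennreal ((norm (h (cis \<theta>)))\<^sup>2) \<partial>circ)"
      by (rule Carleson_embedding_square[OF dp F a C])
    also have "\<dots> \<le> ennreal (512 * exp C / pi) * (\<integral>\<^sup>+\<tau>. ennreal (((norm (G (cis \<tau>)) + e) * exp e) powr p / (norm (cis \<tau> - z))\<^sup>2) \<partial>circ)"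
    proof (intro mult_left_mono nn_integral_circ_mono ennreal_leI)
      fix \<tau> :: real
      have pos: "norm (G (cis \<tau>)) + e > 0" using e by (simp add: add_nonneg_pos)
      have "exp (Re (q (cis \<tau>))) \<le> exp (ln (norm (G (cis \<tau>)) + e) + e)" using q(3)[of "cis \<tau>"] by simp
      also have "\<dots> = (norm (G (cis \<tau>)) + e) * exp e" using pos by (simp add: exp_add)
      finally have "exp (Re (q (cis \<tau>))) powr p \<le> ((norm (G (cis \<tau>)) + e) * exp e) powr p"
        using p by (intro powr_mono2) auto
      then show "(norm (h (cis \<tau>)))\<^sup>2 \<le> ((norm (G (cis \<tau>)) + e) * exp e) powr p / (norm (cis \<tau> - z))\<^sup>2"
        unfolding hsq norm_one_minus_cnj_cis by (rule divide_right_mono) simp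
    qed simp
    finally show ?thesis .
  qed
  define e where "e k = 1 / real (Suc k)" for k
  have e: "e k > 0" "e k \<le> 1" for k by (auto simp: e_def)
  have e0: "e \<longlonglongrightarrow> 0" unfolding e_def by (rule LIMSEQ_Suc[OF lim_1_over_n])
  have "(\<lambda>k. \<integral>\<^sup>+\<tau>. ennreal (((norm (G (cis \<tau>)) + e k) * exp (e k)) powr p / (norm (cis \<tau> - z))\<^sup>2) \<partial>circ) \<longlonglongrightarrow>
     (\<integral>\<^sup>+\<tau>. ennreal (norm (G (cis \<tau>)) powr p / (norm (cis \<tau> - z))\<^sup>2) \<partial>circ)"
  proof (rule nn_integral_dominated_convergence[where w = "\<lambda>_. ennreal (((B + 1) * exp 1) powr p / d\<^sup>2)"])
    show "AE \<tau> in circ. ennreal (((norm (G (cis \<tau>)) + e k) * exp (e k)) powr p / (norm (cis \<tau> - z))\<^sup>2) \<le> ennreal (((B + 1) * exp 1) powr p / d\<^sup>2)" for k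
    proof (intro AE_I2 ennreal_leI frac_le powr_mono2 mult_mono add_mono power_mono)
      fix \<tau> :: real
      show "norm (G (cis \<tau>)) \<le> B" using B(1)[of "cis \<tau>"] by simp
      show "d \<le> norm (cis \<tau> - z)" using norm_cis_diff_ge[of z \<tau>] by (simp add: d_def)
    qed (use e[of k] p d B in \<open>auto intro!: mult_nonneg_nonneg add_nonneg_nonneg\<close>)
    have "(\<integral>\<^sup>+\<tau>. ennreal (((B + 1) * exp 1) powr p / d\<^sup>2) \<partial>circ) = ennreal (((B + 1) * exp 1) powr p / d\<^sup>2) * emeasure circ UNIV" by simp
    also have "\<dots> < \<infinity>" using finite_measure.emeasure_finite[OF finite_measure_circ, of UNIV]
      by (simp add: ennreal_mult_less_top less_top)
    finally show "(\<integral>\<^sup>+\<tau>. ennreal (((B + 1) * exp 1) powr p / d\<^sup>2) \<partial>circ) < \<infinity>" .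
    show "AE \<tau> in circ. (\<lambda>k. ennreal (((norm (G (cis \<tau>)) + e k) * exp (e k)) powr p / (norm (cis \<tau> - z))\<^sup>2)) \<longlonglongrightarrow> ennreal (norm (G (cis \<tau>)) powr p / (norm (cis \<tau> - z))\<^sup>2)"
    proof (rule AE_I2)
      fix \<tau> :: real
      have "(\<lambda>k. (norm (G (cis \<tau>)) + e k) * exp (e k)) \<longlonglongrightarrow> (norm (G (cis \<tau>)) + 0) * exp 0"
        by (intro tendsto_intros e0)
      then have "(\<lambda>k. ((norm (G (cis \<tau>)) + e k) * exp (e k)) powr p) \<longlonglongrightarrow> ((norm (G (cis \<tau>)) + 0) * exp 0) powr p"
        by (rule tendsto_powr') (use p e in \<open>auto intro!: always_eventually simp: less_imp_le add_nonneg_nonneg\<close>)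
      then show "(\<lambda>k. ennreal (((norm (G (cis \<tau>)) + e k) * exp (e k)) powr p / (norm (cis \<tau> - z))\<^sup>2)) \<longlonglongrightarrow> ennreal (norm (G (cis \<tau>)) powr p / (norm (cis \<tau> - z))\<^sup>2)"
        using cis_neq[OF z] by (intro tendsto_ennrealI tendsto_divide tendsto_const) auto
    qed
  qed measurable
  then have "(\<lambda>k. ennreal (512 * exp C / pi) * (\<integral>\<^sup>+\<tau>. ennreal (((norm (G (cis \<tau>)) + e k) * exp (e k)) powr p / (norm (cis \<tau> - z))\<^sup>2) \<partial>circ)) \<longlonglongrightarrow>
     ennreal (512 * exp C / pi) * (\<integral>\<^sup>+\<tau>. ennreal (norm (G (cis \<tau>)) powr p / (norm (cis \<tau> - z))\<^sup>2) \<partial>circ)"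
    by (intro ennreal_tendsto_cmult) simp
  then show ?thesis by (rule LIMSEQ_le_const) (use eps[OF e(1)] in blast)
qed

section \<open>Blaschke products\<close>

text \<open>The unimodular constant makes the factor tend to 1 as \<open>norm a\<close> tends to 1,
  which the infinite product requires. The case \<open>a = 0\<close> avoids the quotient
  \<open>of_real (norm a) / a\<close>.\<close>

definition bfac :: "complex \<Rightarrow> complex \<Rightarrow> complex" where
  "bfac a w = (if a = 0 then w else - (of_real (norm a) / a) * bl a w)"

lemma norm_bfac: "norm (bfac a w) = norm (bl a w)"
  by (simp add: bfac_def bl_def norm_mult norm_divide)

lemma bfac_eq_0_iff: "norm a < 1 \<Longrightarrow> norm w < 1 \<Longrightarrow> bfac a w = 0 \<longleftrightarrow> w = a"
  using one_minus_cnj_mult_neq[of a w] by (simp add: bfac_def bl_def)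

lemma bfac_holomorphic: "norm a < 1 \<Longrightarrow> bfac a holomorphic_on ball 0 1"
  unfolding bfac_def[abs_def] bl_def
  using one_minus_cnj_mult_neq[of a] by (cases "a = 0") (auto intro!: holomorphic_intros)

text \<open>After bringing to a common denominator, the numerator of the difference splits off the
  factor 1 - |a|, because a times its conjugate is |a|^2.\<close>

lemma norm_bfac_minus_1:
  assumes a: "norm a < 1" and w: "norm w < 1"
  shows "norm (bfac a w - 1) \<le> 2 / (1 - norm w) * (1 - norm a)"
proof (cases "a = 0")
  case True
  have "norm (w - 1) \<le> 2" using norm_triangle_ineq4[of w 1] w by simp
  also have "2 \<le> 2 / (1 - norm w)" using w by (simp add: le_divide_eq)
  finally show ?thesis using True by (simp add: bfac_def)
next
  case False
  have nz: "1 - cnj a * w \<noteq> 0" using one_minus_cnj_mult_neq[OF a, of w] w by simp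
  have aa: "a * cnj a = of_real (norm a) * of_real (norm a)" by (simp add: complex_norm_square[symmetric] power2_eq_square)
  have "bfac a w - 1 = - (of_real (norm a) * (w - a) + a * (1 - cnj a * w)) / (a * (1 - cnj a * w))"
  proof -
    have "- (n / b) * (v / q) - 1 = - (n * v + b * q) / (b * q)" if "b \<noteq> 0" "q \<noteq> 0" for n v b q :: complex
      using that by (simp add: field_simps)
    from this[OF False nz, of "of_real (norm a)" "w - a"] show ?thesis using False by (simp only: bfac_def bl_def if_False)
  qed
  also have "of_real (norm a) * (w - a) + a * (1 - cnj a * w) = of_real (1 - norm a) * (a + of_real (norm a) * w)"
  proof -
    have "a * (1 - cnj a * w) = a - (a * cnj a) * w" by (simp add: algebra_simps)
    then have e: "a * (1 - cnj a * w) = a - (of_real (norm a) * of_real (norm a)) * w" unfolding aa .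
    show ?thesis unfolding e by (simp add: algebra_simps)
  qed
  finally have E: "bfac a w - 1 = - (of_real (1 - norm a) * (a + of_real (norm a) * w)) / (a * (1 - cnj a * w))" .
  have n1: "\<bar>1 - norm a\<bar> = 1 - norm a" using a by simp
  have "norm (bfac a w - 1) = (1 - norm a) * norm (a + of_real (norm a) * w) / (norm a * norm (1 - cnj a * w))"
    unfolding E norm_divide norm_minus_cancel norm_mult norm_of_real n1 ..
  also have "\<dots> \<le> (1 - norm a) * (2 * norm a) / (norm a * (1 - norm w))"
  proof (rule frac_le)
    have "norm (a + of_real (norm a) * w) \<le> norm a + norm a * norm w" using norm_triangle_ineq[of a "of_real (norm a) * w"] by (simp add: norm_mult)
    also have "\<dots> \<le> norm a + norm a * 1" using w by (intro add_left_mono mult_left_mono) auto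
    finally show "(1 - norm a) * norm (a + of_real (norm a) * w) \<le> (1 - norm a) * (2 * norm a)"
      using a by (intro mult_left_mono) auto
    have "norm (cnj a * w) \<le> 1 * norm w" unfolding norm_mult complex_mod_cnj using a by (intro mult_right_mono) auto
    then have "1 - norm w \<le> norm (1 - cnj a * w)" using norm_triangle_ineq2[of 1 "cnj a * w"] by simp
    then show "norm a * (1 - norm w) \<le> norm a * norm (1 - cnj a * w)" by (rule mult_left_mono) simp
  qed (use a w False in auto)
  also have "\<dots> = 2 / (1 - norm w) * (1 - norm a)" using False by simp
  finally show ?thesis .
qed

text \<open>Indices outside \<open>I\<close> contribute the factor 1, so finite and infinite index
  sets share one product over the naturals.\<close>

definition Blaschke :: "nat set \<Rightarrow> (nat \<Rightarrow> complex) \<Rightarrow> complex \<Rightarrow> complex" where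
  "Blaschke I z w = (\<Prod>n. if n \<in> I then bfac (z n) w else 1)"

locale blaschke_sequence =
  fixes I :: "nat set" and z :: "nat \<Rightarrow> complex"
  assumes disc: "\<And>n. n \<in> I \<Longrightarrow> norm (z n) < 1"
    and summ: "summable (\<lambda>n. if n \<in> I then 1 - norm (z n) else 0)"
begin

lemma convergent:
  assumes w: "norm w < 1"
  shows "convergent_prod (\<lambda>n. if n \<in> I then bfac (z n) w else 1)"
proof -
  have "summable (\<lambda>n. norm ((if n \<in> I then bfac (z n) w else 1) - 1))"
  proof (rule summable_comparison_test)
    show "summable (\<lambda>n. 2 / (1 - norm w) * (if n \<in> I then 1 - norm (z n) else 0))"
      by (rule summable_mult[OF summ])
    show "\<exists>N. \<forall>n\<ge>N. norm (norm ((if n \<in> I then bfac (z n) w else 1) - 1)) \<le> 2 / (1 - norm w) * (if n \<in> I then 1 - norm (z n) else 0)"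
      using norm_bfac_minus_1[OF disc w] by auto
  qed
  then have "abs_convergent_prod (\<lambda>n. if n \<in> I then bfac (z n) w else 1)"
    unfolding abs_convergent_prod_conv_summable .
  then show ?thesis by (rule abs_convergent_prod_imp_convergent_prod)
qed

lemma has_prod:
  "norm w < 1 \<Longrightarrow> (\<lambda>n. if n \<in> I then bfac (z n) w else 1) has_prod Blaschke I z w"
  unfolding Blaschke_def by (rule convergent_prod_has_prod[OF convergent])

lemma zero_iff:
  assumes "norm w < 1" shows "Blaschke I z w = 0 \<longleftrightarrow> w \<in> z ` I"
proof -
  have "Blaschke I z w = 0 \<longleftrightarrow> (\<exists>n. (if n \<in> I then bfac (z n) w else 1) = 0)"
  proof -
    have gen: "0 \<in> range f \<longleftrightarrow> (\<exists>n. f n = 0)" for f :: "nat \<Rightarrow> complex" by (metis rangeE rangeI)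
    show ?thesis unfolding has_prod_eq_0_iff[OF has_prod[OF assms]] by (rule gen)
  qed
  also have "\<dots> \<longleftrightarrow> (\<exists>n\<in>I. bfac (z n) w = 0)" by (auto split: if_splits)
  also have "\<dots> \<longleftrightarrow> (\<exists>n\<in>I. w = z n)" by (intro bex_cong refl bfac_eq_0_iff disc assms)
  finally show ?thesis by blast
qed

lemma LIMSEQ:
  assumes "norm w < 1"
  shows "(\<lambda>N. \<Prod>n<N. if n \<in> I then bfac (z n) w else 1) \<longlonglongrightarrow> Blaschke I z w"
proof -
  have "(\<lambda>N. \<Prod>n\<le>N. if n \<in> I then bfac (z n) w else 1) \<longlonglongrightarrow> Blaschke I z w"
    unfolding Blaschke_def by (rule convergent_prod_LIMSEQ[OF convergent[OF assms]])
  then have "(\<lambda>N. \<Prod>n<Suc N. if n \<in> I then bfac (z n) w else 1) \<longlonglongrightarrow> Blaschke I z w"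
    by (simp only: lessThan_Suc_atMost)
  then show ?thesis by (subst (asm) filterlim_sequentially_Suc)
qed

lemma holomorphic: "Blaschke I z holomorphic_on ball 0 1"
proof (rule holomorphic_uniform_sequence[where f = "\<lambda>N w. \<Prod>n<N. if n \<in> I then bfac (z n) w else 1"])
  show "(\<lambda>w. \<Prod>n<N. if n \<in> I then bfac (z n) w else 1) holomorphic_on ball 0 1" for N
  proof (rule holomorphic_on_prod)
    fix n show "(\<lambda>w. if n \<in> I then bfac (z n) w else 1) holomorphic_on ball 0 1"
      using bfac_holomorphic[OF disc] by (cases "n \<in> I") auto
  qed
  fix x :: complex assume x: "x \<in> ball 0 1"
  define d where "d = (1 - norm x) / 2"
  have d: "d > 0" using x by (simp add: d_def)
  have sub: "cball x d \<subseteq> cball 0 (1 - d)"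
  proof
    fix w assume "w \<in> cball x d"
    then have "norm (w - x) \<le> d" by (simp add: dist_norm norm_minus_commute)
    moreover have "norm w \<le> norm x + norm (w - x)" by (metis add.commute diff_add_cancel norm_triangle_ineq)
    ultimately show "w \<in> cball 0 (1 - d)" by (simp add: d_def field_simps)
  qed
  have wb: "norm w < 1" if "w \<in> cball x d" for w using sub that d by fastforce
  have "uniformly_convergent_on (cball x d) (\<lambda>N w. \<Prod>n<N. if n \<in> I then bfac (z n) w else 1)"
  proof (rule uniformly_convergent_on_prod')
    show "uniformly_convergent_on (cball x d) (\<lambda>N w. \<Sum>n<N. norm ((if n \<in> I then bfac (z n) w else 1) - 1))"
    proof (rule Weierstrass_m_test'_ev)
      show "summable (\<lambda>n. 2 / d * (if n \<in> I then 1 - norm (z n) else 0))" by (rule summable_mult[OF summ])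
      show "\<forall>\<^sub>F n in sequentially. \<forall>w\<in>cball x d. norm (norm ((if n \<in> I then bfac (z n) w else 1) - 1)) \<le> 2 / d * (if n \<in> I then 1 - norm (z n) else 0)"
      proof (intro always_eventually allI ballI)
        fix n w assume w: "w \<in> cball x d"
        show "norm (norm ((if n \<in> I then bfac (z n) w else 1) - 1)) \<le> 2 / d * (if n \<in> I then 1 - norm (z n) else 0)"
        proof (cases "n \<in> I")
          case True
          have "norm (bfac (z n) w - 1) \<le> 2 / (1 - norm w) * (1 - norm (z n))"
            by (rule norm_bfac_minus_1[OF disc[OF True] wb[OF w]])
          also have "\<dots> \<le> 2 / d * (1 - norm (z n))"
          proof (intro mult_right_mono divide_left_mono)
            show "d \<le> 1 - norm w" using sub w by auto
          qed (use disc[OF True] d wb[OF w] in auto)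
          finally show ?thesis using True by simp
        qed simp
      qed
    qed
    show "continuous_on (cball x d) (\<lambda>w. if n \<in> I then bfac (z n) w else 1)" for n
    proof (cases "n \<in> I")
      case True
      then show ?thesis using wb
        by (auto intro!: continuous_on_subset[OF holomorphic_on_imp_continuous_on[OF bfac_holomorphic[OF disc[OF True]]]])
    qed simp
  qed auto
  then obtain g where g: "uniform_limit (cball x d) (\<lambda>N w. \<Prod>n<N. if n \<in> I then bfac (z n) w else 1) g sequentially"
    by (auto simp: uniformly_convergent_on_def)
  have "uniform_limit (cball x d) (\<lambda>N w. \<Prod>n<N. if n \<in> I then bfac (z n) w else 1) (Blaschke I z) sequentially"
  proof (rule uniform_limit_cong'[THEN iffD1, OF _ _ g])
    fix w assume w: "w \<in> cball x d"
    show "g w = Blaschke I z w"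
      by (rule LIMSEQ_unique[OF tendsto_uniform_limitI[OF g w] LIMSEQ[OF wb[OF w]]])
  qed simp
  moreover have "cball x d \<subseteq> ball 0 1" using wb by auto
  ultimately show "\<exists>d>0. cball x d \<subseteq> ball 0 1 \<and> uniform_limit (cball x d) (\<lambda>N w. \<Prod>n<N. if n \<in> I then bfac (z n) w else 1) (Blaschke I z) sequentially"
    using d by blast
qed simp

text \<open>The second bound is 1 - prod x_n <= sum (1 - x_n) for numbers in [0, 1], with 1 - x_n
  equal to \<open>sig (z n) w\<close> for indices in \<open>I\<close>. Both bounds survive the limit
  to the full product.\<close>

lemma norm_partial_le:
  assumes w: "norm w < 1"
  shows "norm (\<Prod>n<N. if n \<in> I then bfac (z n) w else 1) \<le> 1"
    and "1 - (norm (\<Prod>n<N. if n \<in> I then bfac (z n) w else 1))\<^sup>2 \<le> (\<Sum>n\<in>I \<inter> {..<N}. sig (z n) w)"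
proof -
  define x where "x n = (norm (if n \<in> I then bfac (z n) w else 1))\<^sup>2" for n
  have x: "0 \<le> x n" "x n \<le> 1" "1 - x n = (if n \<in> I then sig (z n) w else 0)" for n
    using norm_bl_le_1[OF disc, of n w] sig_bl[OF disc, of n w] w by (auto simp: x_def norm_bfac abs_square_le_1)
  have P: "(norm (\<Prod>n<N. if n \<in> I then bfac (z n) w else 1))\<^sup>2 = (\<Prod>n<N. x n)"
    unfolding x_def by (simp add: prod_norm[symmetric] prod_power_distrib)
  have "(\<Prod>n<N. x n) \<le> 1" using x by (intro prod_le_1) auto
  then show "norm (\<Prod>n<N. if n \<in> I then bfac (z n) w else 1) \<le> 1" unfolding P[symmetric] by (simp add: abs_square_le_1)
  have "1 - (\<Prod>n<N. x n) \<le> (\<Sum>n<N. 1 - x n)"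
  proof (induction N)
    case (Suc N)
    have "0 \<le> (\<Prod>n<N. x n)" "(\<Prod>n<N. x n) \<le> 1" using x by (auto intro!: prod_nonneg prod_le_1)
    then have "(1 - (\<Prod>n<N. x n)) * (1 - x N) \<ge> 0" using x(2)[of N] by (intro mult_nonneg_nonneg) linarith+
    moreover have "(\<Prod>n<Suc N. x n) = (\<Prod>n<N. x n) * x N" "(\<Sum>n<Suc N. 1 - x n) = (\<Sum>n<N. 1 - x n) + (1 - x N)" by simp_all
    moreover have "(1 - (\<Prod>n<N. x n)) * (1 - x N) = 1 - (\<Prod>n<N. x n) - x N + (\<Prod>n<N. x n) * x N" by (simp only: left_diff_distrib right_diff_distrib mult_1_left mult_1_right)
    ultimately show ?case using Suc.IH by linarith
  qed simp
  also have "\<dots> = (\<Sum>n\<in>I \<inter> {..<N}. sig (z n) w)"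
    unfolding x(3) by (subst Int_commute) (simp add: sum.inter_restrict)
  finally show "1 - (norm (\<Prod>n<N. if n \<in> I then bfac (z n) w else 1))\<^sup>2 \<le> (\<Sum>n\<in>I \<inter> {..<N}. sig (z n) w)"
    unfolding P .
qed

lemma norm_le_1: "norm w < 1 \<Longrightarrow> norm (Blaschke I z w) \<le> 1"
  by (rule LIMSEQ_le_const2[OF tendsto_norm[OF LIMSEQ]]) (auto intro: norm_partial_le)

lemma one_minus_norm_le:
  assumes w: "norm w < 1"
  shows "ennreal (1 - (norm (Blaschke I z w))\<^sup>2) \<le> (\<Sum>n. if n \<in> I then ennreal (sig (z n) w) else 0)"
proof (rule LIMSEQ_le_const2)
  show "(\<lambda>N. ennreal (1 - (norm (\<Prod>n<N. if n \<in> I then bfac (z n) w else 1))\<^sup>2)) \<longlonglongrightarrow> ennreal (1 - (norm (Blaschke I z w))\<^sup>2)"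
    by (intro tendsto_ennrealI tendsto_intros LIMSEQ[OF w])
  have "ennreal (1 - (norm (\<Prod>n<N. if n \<in> I then bfac (z n) w else 1))\<^sup>2) \<le> (\<Sum>n. if n \<in> I then ennreal (sig (z n) w) else 0)" for N
  proof -
    have "ennreal (1 - (norm (\<Prod>n<N. if n \<in> I then bfac (z n) w else 1))\<^sup>2) \<le> ennreal (\<Sum>n\<in>I \<inter> {..<N}. sig (z n) w)"
      by (intro ennreal_leI norm_partial_le[OF w])
    also have "\<dots> = (\<Sum>n\<in>I \<inter> {..<N}. ennreal (sig (z n) w))"
      using disc w by (intro sum_ennreal[symmetric] sig_nonneg) auto
    also have "\<dots> = (\<Sum>n<N. if n \<in> I then ennreal (sig (z n) w) else 0)"
      by (subst Int_commute) (simp add: sum.inter_restrict)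
    also have "\<dots> \<le> (\<Sum>n. if n \<in> I then ennreal (sig (z n) w) else 0)" by (rule sum_le_suminf) auto
    finally show ?thesis .
  qed
  then show "\<exists>N. \<forall>n\<ge>N. ennreal (1 - (norm (\<Prod>n<n. if n \<in> I then bfac (z n) w else 1))\<^sup>2) \<le> (\<Sum>n. if n \<in> I then ennreal (sig (z n) w) else 0)"
    by blast
qed

text \<open>Terms of a convergent series tend to 0, whereas each occurrence of \<open>w\<close>
  contributes the fixed positive number 1 - |w|.\<close>

lemma finite_multiplicity:
  assumes w: "norm w < 1"
  shows "finite {n \<in> I. z n = w}"
proof -
  have "(\<lambda>n. if n \<in> I then 1 - norm (z n) else 0) \<longlonglongrightarrow> 0" by (rule summable_LIMSEQ_zero[OF summ])
  then have "\<forall>\<^sub>F n in sequentially. (if n \<in> I then 1 - norm (z n) else 0) < 1 - norm w"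
    by (rule order_tendstoD) (use w in simp)
  then obtain N where N: "\<And>n. n \<ge> N \<Longrightarrow> (if n \<in> I then 1 - norm (z n) else 0) < 1 - norm w"
    by (auto simp: eventually_sequentially)
  have "{n \<in> I. z n = w} \<subseteq> {..<N}"
  proof
    fix n assume n: "n \<in> {n \<in> I. z n = w}"
    show "n \<in> {..<N}"
    proof (rule ccontr)
      assume "n \<notin> {..<N}"
      then have "n \<ge> N" by simp
      from N[OF this] n show False by auto
    qed
  qed
  then show ?thesis by (rule finite_subset) simp
qed

text \<open>The finitely many factors vanishing at \<open>w\<close> are separated from the product.
  The remaining indices again form a Blaschke sequence, and \<open>w\<close> does not occur among
  their zeros.\<close>

lemma factorization:
  assumes w: "norm w < 1"
  obtains g where "g holomorphic_on ball 0 1" "g w \<noteq> 0"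
    "\<And>x. norm x < 1 \<Longrightarrow> Blaschke I z x = g x * (x - w) ^ card {n \<in> I. z n = w}"
proof -
  define A where "A = {n \<in> I. z n = w}"
  have A: "finite A" unfolding A_def by (rule finite_multiplicity[OF w])
  interpret tail: blaschke_sequence "I - A" z
  proof
    show "norm (z n) < 1" if "n \<in> I - A" for n using disc that by auto
    show "summable (\<lambda>n. if n \<in> I - A then 1 - norm (z n) else 0)"
      by (rule summable_comparison_test[OF _ summ]) (use disc in \<open>auto intro!: exI[of _ 0] simp: less_imp_le\<close>)
  qed
  define c where "c = (if w = 0 then 1 else - (of_real (norm w) / w))"
  have bf: "bfac w x = c / (1 - cnj w * x) * (x - w)" for x
    by (simp add: bfac_def bl_def c_def)
  define g where "g = (\<lambda>x. (c / (1 - cnj w * x)) ^ card A * Blaschke (I - A) z x)"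
  have nz: "1 - cnj w * x \<noteq> 0" if "norm x < 1" for x using one_minus_cnj_mult_neq[OF w, of x] that by simp
  show ?thesis
  proof (rule that[of g])
    show "g holomorphic_on ball 0 1" unfolding g_def
      by (intro holomorphic_intros tail.holomorphic) (use nz in auto)
    have "w \<notin> z ` (I - A)" by (auto simp: A_def)
    then have "Blaschke (I - A) z w \<noteq> 0" using tail.zero_iff[OF w] by simp
    moreover have "c \<noteq> 0" by (simp add: c_def)
    ultimately show "g w \<noteq> 0" using nz[OF w] by (simp add: g_def)
    fix x :: complex assume x: "norm x < 1"
    have "(\<lambda>n. if n \<in> A then bfac (z n) x else 1) has_prod (\<Prod>n\<in>A. bfac (z n) x)"
      by (rule has_prod_If_finite_set[OF A])
    from has_prod_mult[OF this tail.has_prod[OF x]]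
    have "(\<lambda>n. (if n \<in> A then bfac (z n) x else 1) * (if n \<in> I - A then bfac (z n) x else 1)) has_prod ((\<Prod>n\<in>A. bfac (z n) x) * Blaschke (I - A) z x)" .
    moreover have "(\<lambda>n. (if n \<in> A then bfac (z n) x else 1) * (if n \<in> I - A then bfac (z n) x else 1)) = (\<lambda>n. if n \<in> I then bfac (z n) x else 1)"
      by (auto simp: A_def)
    ultimately have "Blaschke I z x = (\<Prod>n\<in>A. bfac (z n) x) * Blaschke (I - A) z x"
      using has_prod[OF x] has_prod_unique2 by metis
    also have "(\<Prod>n\<in>A. bfac (z n) x) = (\<Prod>n\<in>A. bfac w x)" by (rule prod.cong) (auto simp: A_def)
    also have "\<dots> = bfac w x ^ card A" by simp
    also have "\<dots> * Blaschke (I - A) z x = g x * (x - w) ^ card A" unfolding bf power_mult_distrib g_def by simp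
    finally show "Blaschke I z x = g x * (x - w) ^ card {n \<in> I. z n = w}" by (simp add: A_def)
  qed
qed

lemma zero_sequence_mult:
  assumes h: "h holomorphic_on ball 0 1" and nz: "\<And>w. norm w < 1 \<Longrightarrow> h w \<noteq> 0"
  shows "zero_sequence_of I z (\<lambda>w. h w * Blaschke I z w)"
  unfolding zero_sequence_of_def
proof (intro conjI ballI)
  show "{w \<in> unit_disc. h w * Blaschke I z w = 0} = z ` I"
    using nz zero_iff disc by auto
  fix w assume "w \<in> z ` I"
  then have w: "norm w < 1" using disc by auto
  show "finite {n \<in> I. z n = w}" by (rule finite_multiplicity[OF w])
  show "zorder (\<lambda>w. h w * Blaschke I z w) w = int (card {n \<in> I. z n = w})"
  proof (rule factorization[OF w])
    fix g assume g: "g holomorphic_on ball 0 1" "g w \<noteq> 0"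
      "\<And>x. norm x < 1 \<Longrightarrow> Blaschke I z x = g x * (x - w) ^ card {n \<in> I. z n = w}"
    show "zorder (\<lambda>w. h w * Blaschke I z w) w = int (card {n \<in> I. z n = w})"
    proof (rule zorder_eqI[of "ball 0 1" w "\<lambda>x. h x * g x"])
    show "(\<lambda>x. h x * g x) holomorphic_on ball 0 1" by (intro holomorphic_intros h g)
    show "h w * g w \<noteq> 0" using nz[OF w] g by simp
    fix x assume "x \<in> ball (0::complex) 1" "x \<noteq> w"
    then show "h x * Blaschke I z x = h x * g x * (x - w) powi int (card {n \<in> I. z n = w})"
      using g(3)[of x] by simp
  qed (use w in auto)
  qed
qed

end

section \<open>Multiplication by Blaschke products\<close>

text \<open>Outside the disc a holomorphic function of the space is an arbitrary value; cutting it
  off by 0 makes it Borel on the plane, as Fubini and Fatou need.\<close>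

definition zext :: "(complex \<Rightarrow> complex) \<Rightarrow> complex \<Rightarrow> complex" where
  "zext f z = (if z \<in> ball 0 1 then f z else 0)"

lemma zext_eq [simp]: "norm z < 1 \<Longrightarrow> zext f z = f z"
  by (simp add: zext_def)

lemma measurable_zext: "continuous_on (ball 0 1) f \<Longrightarrow> zext f \<in> borel_measurable borel"
  unfolding zext_def[abs_def] by (rule borel_measurable_continuous_on_if) auto

lemma measurable_zext_holomorphic:
  assumes "f holomorphic_on ball 0 1"
  shows "zext f \<in> borel_measurable borel" "zext (deriv f) \<in> borel_measurable borel"
  using assms by (auto intro!: measurable_zext holomorphic_on_imp_continuous_on holomorphic_deriv)

text \<open>On a circle inside the disc the integrand is continuous, so the Bochner integral in
  \<open>integral_mean\<close> is a true value and not the default 0; the outer root is undone by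
  the power.\<close>

lemma integral_mean_powr:
  assumes g: "continuous_on (ball 0 1) g" and r: "0 \<le> r" "r < 1" and p: "p > 0"
  shows "ennreal (integral_mean p r g powr p) = ennreal (1/(2*pi)) * (\<integral>\<^sup>+\<theta>. ennreal (norm (g (of_real r * cis \<theta>)) powr p) \<partial>circ)"
proof -
  have "continuous_on UNIV (\<lambda>\<theta>. g (of_real r * cis \<theta>))"
    by (rule continuous_on_compose2[OF g]) (use r in \<open>auto intro!: continuous_intros simp: norm_mult\<close>)
  then have c: "continuous_on UNIV (\<lambda>\<theta>. norm (g (of_real r * cis \<theta>)) powr p)"
    using p by (intro continuous_on_powr' continuous_intros) auto
  then have m: "(\<lambda>\<theta>. norm (g (of_real r * cis \<theta>)) powr p) \<in> borel_measurable borel"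
    by (rule borel_measurable_continuous_onI)
  define J where "J = (\<integral>\<theta>. norm (g (of_real r * cis \<theta>)) powr p \<partial>circ)"
  have J: "J \<ge> 0" unfolding J_def by simp
  have "(LINT \<theta>:{0..2*pi}|lborel. norm (g (of_real r * cis \<theta>)) powr p) = J"
    unfolding J_def circ_def using m by (subst integral_lint) auto
  then have "integral_mean p r g powr p = 1/(2*pi) * J"
    unfolding integral_mean_def using J p by (simp add: powr_powr)
  then have "ennreal (integral_mean p r g powr p) = ennreal (1/(2*pi)) * ennreal J"
    by (simp only:) (rule ennreal_mult', simp)
  also have "ennreal J = (\<integral>\<^sup>+\<theta>. ennreal (norm (g (of_real r * cis \<theta>)) powr p) \<partial>circ)"
    unfolding J_def by (rule nn_integral_eq_integral[symmetric]) (auto intro: circ_integrable_continuous c)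
  finally show ?thesis .
qed

lemma Hardy_spaceI:
  assumes f: "f holomorphic_on ball 0 1" and p: "p > 0"
    and M: "\<And>r. 0 \<le> r \<Longrightarrow> r < 1 \<Longrightarrow> (\<integral>\<^sup>+\<theta>. ennreal (norm (f (of_real r * cis \<theta>)) powr p) \<partial>circ) \<le> ennreal M"
  shows "f \<in> Hardy_space p"
proof -
  have "integral_mean p r f \<le> (1/(2*pi) * max 0 M) powr (1/p)" if r: "r \<in> {0..<1}" for r
  proof -
    have im: "integral_mean p r f \<ge> 0" unfolding integral_mean_def by simp
    have "ennreal (integral_mean p r f powr p) \<le> ennreal (1/(2*pi)) * ennreal (max 0 M)"
      using r M[of r] p holomorphic_on_imp_continuous_on[OF f]
      by (subst integral_mean_powr) (auto intro!: mult_left_mono elim: order_trans simp: ennreal_leI)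
    also have "\<dots> = ennreal (1/(2*pi) * max 0 M)" by (rule ennreal_mult'[symmetric]) simp
    finally have "integral_mean p r f powr p \<le> 1/(2*pi) * max 0 M" by (subst (asm) ennreal_le_iff) auto
    then have "(integral_mean p r f powr p) powr (1/p) \<le> (1/(2*pi) * max 0 M) powr (1/p)"
      using p by (intro powr_mono2) auto
    then show ?thesis using p im by (simp add: powr_powr)
  qed
  then have "bdd_above ((\<lambda>r. integral_mean p r f) ` {0..<1})" by (rule bdd_aboveI2)
  then show ?thesis using f unfolding Hardy_space_def by blast
qed

lemma Hardy_spaceD:
  assumes f: "f \<in> Hardy_space p" and p: "p > 0"
  obtains M where "M \<ge> 0" "\<And>r. 0 \<le> r \<Longrightarrow> r < 1 \<Longrightarrow> (\<integral>\<^sup>+\<theta>. ennreal (norm (f (of_real r * cis \<theta>)) powr p) \<partial>circ) \<le> ennreal M"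
proof -
  have hol: "f holomorphic_on ball 0 1" and "bdd_above ((\<lambda>r. integral_mean p r f) ` {0..<1})"
    using f by (auto simp: Hardy_space_def)
  then obtain B where B: "\<forall>r\<in>{0..<1}. integral_mean p r f \<le> B" by (auto simp: bdd_above_def)
  show ?thesis
  proof (rule that[of "2 * pi * B powr p"])
    fix r :: real assume r: "0 \<le> r" "r < 1"
    have im: "integral_mean p r f \<ge> 0" unfolding integral_mean_def by simp
    have "integral_mean p r f powr p \<le> B powr p" using B r im p by (intro powr_mono2) auto
    then have "ennreal (1/(2*pi)) * (\<integral>\<^sup>+\<theta>. ennreal (norm (f (of_real r * cis \<theta>)) powr p) \<partial>circ) \<le> ennreal (B powr p)"
      using integral_mean_powr[OF holomorphic_on_imp_continuous_on[OF hol] r p] by (metis ennreal_leI)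
    then have "ennreal (2*pi) * (ennreal (1/(2*pi)) * (\<integral>\<^sup>+\<theta>. ennreal (norm (f (of_real r * cis \<theta>)) powr p) \<partial>circ)) \<le> ennreal (2*pi) * ennreal (B powr p)"
      by (rule mult_left_mono) simp
    moreover have "ennreal (2*pi) * (ennreal (1/(2*pi)) * x) = x" for x
      by (simp add: mult.assoc[symmetric] ennreal_mult[symmetric])
    moreover have "ennreal (2*pi) * ennreal (B powr p) = ennreal (2 * pi * B powr p)" by (rule ennreal_mult'[symmetric]) simp
    ultimately show "(\<integral>\<^sup>+\<theta>. ennreal (norm (f (of_real r * cis \<theta>)) powr p) \<partial>circ) \<le> ennreal (2 * pi * B powr p)" by simp
  qed simp
qed

text \<open>The defining integral of the space up to the factor 1/(2 pi), as an iterated nonnegative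
  integral, so that it may be infinite and Tonelli applies.\<close>

definition Besov_int :: "real \<Rightarrow> real \<Rightarrow> (complex \<Rightarrow> complex) \<Rightarrow> ennreal" where
  "Besov_int p \<alpha> f = (\<integral>\<^sup>+r. \<integral>\<^sup>+\<theta>. ennreal (norm (zext (deriv f) (of_real r * cis \<theta>)) powr p * (1 - r) powr \<alpha>) \<partial>circ \<partial>rad)"

lemma Besov_Hardy_space_iff:
  assumes p: "p > 0"
  shows "f \<in> Besov_Hardy_space p \<alpha> \<longleftrightarrow> f \<in> Hardy_space p \<and> Besov_int p \<alpha> f < \<infinity>"
proof -
  have eq: "(\<integral>\<^sup>+ r \<in> {0..<1}. ennreal (integral_mean p r (deriv f) powr p * (1 - r) powr \<alpha>) \<partial>lborel)
      = ennreal (1/(2*pi)) * Besov_int p \<alpha> f" if H: "f \<in> Hardy_space p"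
  proof -
    have f: "f holomorphic_on ball 0 1" using H by (simp add: Hardy_space_def)
    note [measurable] = measurable_zext_holomorphic[OF f]
    have "(\<integral>\<^sup>+ r \<in> {0..<1}. ennreal (integral_mean p r (deriv f) powr p * (1 - r) powr \<alpha>) \<partial>lborel)
      = (\<integral>\<^sup>+ r. (ennreal (1/(2*pi)) * (\<integral>\<^sup>+\<theta>. ennreal (norm (zext (deriv f) (of_real r * cis \<theta>)) powr p * (1 - r) powr \<alpha>) \<partial>circ)) * indicator {0..<1} r \<partial>lborel)"
    proof (rule nn_integral_cong)
      fix r :: real
      show "ennreal (integral_mean p r (deriv f) powr p * (1 - r) powr \<alpha>) * indicator {0..<1} r =
        (ennreal (1/(2*pi)) * (\<integral>\<^sup>+\<theta>. ennreal (norm (zext (deriv f) (of_real r * cis \<theta>)) powr p * (1 - r) powr \<alpha>) \<partial>circ)) * indicator {0..<1} r"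
      proof (cases "r \<in> {0..<1}")
        case True
        then have r: "0 \<le> r" "r < 1" by auto
        have c: "continuous_on (ball 0 1) (deriv f)" by (intro holomorphic_on_imp_continuous_on holomorphic_deriv f) simp
        have "ennreal (integral_mean p r (deriv f) powr p * (1 - r) powr \<alpha>) = ennreal (integral_mean p r (deriv f) powr p) * ennreal ((1 - r) powr \<alpha>)"
          by (rule ennreal_mult) auto
        also have "\<dots> = ennreal (1/(2*pi)) * ((\<integral>\<^sup>+\<theta>. ennreal (norm (deriv f (of_real r * cis \<theta>)) powr p) \<partial>circ) * ennreal ((1 - r) powr \<alpha>))"
          unfolding integral_mean_powr[OF c r p] by (simp add: mult.assoc)
        also have "(\<integral>\<^sup>+\<theta>. ennreal (norm (deriv f (of_real r * cis \<theta>)) powr p) \<partial>circ) = (\<integral>\<^sup>+\<theta>. ennreal (norm (zext (deriv f) (of_real r * cis \<theta>)) powr p) \<partial>circ)"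
          using r by (simp add: norm_mult)
        also have "\<dots> * ennreal ((1 - r) powr \<alpha>) = (\<integral>\<^sup>+\<theta>. ennreal (norm (zext (deriv f) (of_real r * cis \<theta>)) powr p) * ennreal ((1 - r) powr \<alpha>) \<partial>circ)"
          by (rule nn_integral_multc[symmetric]) measurable
        finally show ?thesis using True by (simp add: ennreal_mult)
      qed simp
    qed
    also have "\<dots> = (\<integral>\<^sup>+ r. ennreal (1/(2*pi)) * (\<integral>\<^sup>+\<theta>. ennreal (norm (zext (deriv f) (of_real r * cis \<theta>)) powr p * (1 - r) powr \<alpha>) \<partial>circ) \<partial>rad)"
      unfolding rad_def by (rule nn_integral_lint[symmetric]) measurable
    also have "\<dots> = ennreal (1/(2*pi)) * Besov_int p \<alpha> f"
      unfolding Besov_int_def by (rule nn_integral_cmult) measurable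
    finally show ?thesis .
  qed
  have "ennreal (1/(2*pi)) * x < \<infinity> \<longleftrightarrow> x < \<infinity>" for x
    by (cases "x = 0") (simp_all add: ennreal_mult_less_top)
  then show ?thesis unfolding Besov_Hardy_space_def mem_Collect_eq by (intro conj_cong refl) (simp only: eq)
qed

section \<open>Dilates and the passage to the limit\<close>

lemma dilate_disc_pair:
  assumes f: "f holomorphic_on ball 0 1" and \<rho>: "0 < \<rho>" "\<rho> < 1"
  shows "disc_pair (\<lambda>z. zext f (of_real \<rho> * z)) (\<lambda>z. of_real \<rho> * zext (deriv f) (of_real \<rho> * z)) (1/\<rho>)"
proof
  note [measurable] = measurable_zext_holomorphic[OF f]
  show "1 < 1/\<rho>" using \<rho> by simp
  show "(\<lambda>z. zext f (of_real \<rho> * z)) \<in> borel_measurable borel" by measurable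
  show "(\<lambda>z. of_real \<rho> * zext (deriv f) (of_real \<rho> * z)) \<in> borel_measurable borel" by measurable
  fix z :: complex assume "norm z < 1/\<rho>"
  then have z: "of_real \<rho> * z \<in> ball 0 1" using \<rho> by (simp add: norm_mult field_simps)
  have "(zext f has_field_derivative deriv f (of_real \<rho> * z)) (at (of_real \<rho> * z))"
    by (rule has_field_derivative_transform_within_open[OF holomorphic_derivI[OF f open_ball z] open_ball z]) (simp add: zext_def)
  then have "((\<lambda>z. zext f (of_real \<rho> * z)) has_field_derivative deriv f (of_real \<rho> * z) * of_real \<rho>) (at z)"
    by (rule DERIV_chain2) (auto intro!: derivative_eq_intros)
  then show "((\<lambda>z. zext f (of_real \<rho> * z)) has_field_derivative of_real \<rho> * zext (deriv f) (of_real \<rho> * z)) (at z)"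
    using z by (simp add: zext_def mult.commute)
qed

text \<open>For each radius, dilating moves the circle mean of the derivative to a smaller radius,
  where it is no larger, and multiplies by a power of \<rho> that is at most 1.\<close>

lemma dilate_Besov_int:
  assumes f: "f holomorphic_on ball 0 1" and \<rho>: "0 < \<rho>" "\<rho> < 1" and p: "p \<ge> 1"
  shows "(\<integral>\<^sup>+r. \<integral>\<^sup>+\<theta>. ennreal (norm (of_real \<rho> * zext (deriv f) (of_real \<rho> * (of_real r * cis \<theta>))) powr p * (1 - r) powr \<alpha>) \<partial>circ \<partial>rad) \<le> Besov_int p \<alpha> f"
  unfolding Besov_int_def
proof (rule nn_integral_rad_mono)
  note [measurable] = measurable_zext_holomorphic[OF f]
  fix r :: real assume r: "0 \<le> r" "r < 1"
  \<comment> \<open>The roles of the two scalings are exchanged: \<open>r\<close> is built into a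
    function continuous on the closed disc, and \<rho> becomes the radius at which it is
    evaluated.\<close>
  define G where "G = (\<lambda>z. zext (deriv f) (of_real r * z))"
  have mG [measurable]: "G \<in> borel_measurable borel" unfolding G_def by measurable
  have sub: "norm (of_real r * z) < 1" if "norm z \<le> 1" for z :: complex
  proof -
    have "r * norm z \<le> r * 1" using r that by (intro mult_left_mono) auto
    then show ?thesis using r by (simp add: norm_mult)
  qed
  have hd: "deriv f holomorphic_on ball 0 1" by (intro holomorphic_deriv f) simp
  have "(\<integral>\<^sup>+\<theta>. ennreal (norm (G (of_real \<rho> * cis \<theta>)) powr p) \<partial>circ) \<le> (\<integral>\<^sup>+\<theta>. ennreal (norm (G (cis \<theta>)) powr p) \<partial>circ)"
  proof (rule circle_mean_mono_unit)
    have "continuous_on (cball 0 1) (\<lambda>z. deriv f (of_real r * z))"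
      by (rule continuous_on_compose2[OF holomorphic_on_imp_continuous_on[OF hd]]) (use sub in \<open>auto intro!: continuous_intros\<close>)
    then show "continuous_on (cball 0 1) G" unfolding G_def
      by (rule continuous_on_eq) (use sub in simp)
    have "(deriv f \<circ> (\<lambda>z. of_real r * z)) holomorphic_on ball 0 1"
      by (rule holomorphic_on_compose_gen[OF _ hd]) (use sub in \<open>auto intro!: holomorphic_intros simp: less_imp_le\<close>)
    then show "G holomorphic_on ball 0 1"
      by (rule holomorphic_transform) (use sub in \<open>auto simp: G_def less_imp_le\<close>)
  qed (use p \<rho> in auto)
  then have le: "(\<integral>\<^sup>+\<theta>. ennreal (norm (zext (deriv f) (of_real \<rho> * (of_real r * cis \<theta>))) powr p) \<partial>circ) \<le> (\<integral>\<^sup>+\<theta>. ennreal (norm (zext (deriv f) (of_real r * cis \<theta>)) powr p) \<partial>circ)"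
    by (simp add: G_def mult.left_commute)
  have "(\<integral>\<^sup>+\<theta>. ennreal (norm (of_real \<rho> * zext (deriv f) (of_real \<rho> * (of_real r * cis \<theta>))) powr p * (1 - r) powr \<alpha>) \<partial>circ)
     \<le> (\<integral>\<^sup>+\<theta>. ennreal (norm (zext (deriv f) (of_real \<rho> * (of_real r * cis \<theta>))) powr p) * ennreal ((1 - r) powr \<alpha>) \<partial>circ)"
  proof (rule nn_integral_circ_mono)
    fix \<theta> :: real
    define N where "N = norm (zext (deriv f) (of_real \<rho> * (of_real r * cis \<theta>)))"
    have "(\<rho> * N) powr p \<le> N powr p" using \<rho> p mult_right_mono[of \<rho> 1 N] by (intro powr_mono2) (auto simp: N_def)
    then have "(\<rho> * N) powr p * (1 - r) powr \<alpha> \<le> N powr p * (1 - r) powr \<alpha>" by (rule mult_right_mono) simp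
    then show "ennreal (norm (of_real \<rho> * zext (deriv f) (of_real \<rho> * (of_real r * cis \<theta>))) powr p * (1 - r) powr \<alpha>) \<le>
      ennreal (norm (zext (deriv f) (of_real \<rho> * (of_real r * cis \<theta>))) powr p) * ennreal ((1 - r) powr \<alpha>)"
      using \<rho> by (simp add: norm_mult N_def[symmetric] ennreal_mult[symmetric] ennreal_leI)
  qed
  also have "\<dots> = (\<integral>\<^sup>+\<theta>. ennreal (norm (zext (deriv f) (of_real \<rho> * (of_real r * cis \<theta>))) powr p) \<partial>circ) * ennreal ((1 - r) powr \<alpha>)"
    by (rule nn_integral_multc) measurable
  also have "\<dots> \<le> (\<integral>\<^sup>+\<theta>. ennreal (norm (zext (deriv f) (of_real r * cis \<theta>)) powr p) \<partial>circ) * ennreal ((1 - r) powr \<alpha>)"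
    by (rule mult_right_mono[OF le]) simp
  also have "\<dots> = (\<integral>\<^sup>+\<theta>. ennreal (norm (zext (deriv f) (of_real r * cis \<theta>)) powr p) * ennreal ((1 - r) powr \<alpha>) \<partial>circ)"
    by (rule nn_integral_multc[symmetric]) measurable
  finally show "(\<integral>\<^sup>+\<theta>. ennreal (norm (of_real \<rho> * zext (deriv f) (of_real \<rho> * (of_real r * cis \<theta>))) powr p * (1 - r) powr \<alpha>) \<partial>circ)
     \<le> (\<integral>\<^sup>+\<theta>. ennreal (norm (zext (deriv f) (of_real r * cis \<theta>)) powr p * (1 - r) powr \<alpha>) \<partial>circ)"
    by (simp add: ennreal_mult)
qed

text \<open>The offset 2 makes the first term 1/2, so every dilation factor lies strictly between 0
  and 1.\<close>

definition rho :: "nat \<Rightarrow> real" where "rho k = 1 - 1 / real (k + 2)"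

lemma rho: "0 < rho k" "rho k < 1" and rho_LIMSEQ: "rho \<longlonglongrightarrow> 1"
proof -
  show "0 < rho k" "rho k < 1" by (auto simp: rho_def field_simps)
  have "(\<lambda>k. 1 - 1 / real (k + 2)) \<longlonglongrightarrow> 1 - 0"
    by (intro tendsto_intros LIMSEQ_ignore_initial_segment[OF lim_1_over_n, of 2])
  then show "rho \<longlonglongrightarrow> 1" by (simp add: rho_def[abs_def])
qed

lemma dilate_LIMSEQ:
  assumes f: "f holomorphic_on ball 0 1" and z: "norm z < 1"
  shows "(\<lambda>k. zext f (of_real (rho k) * z)) \<longlonglongrightarrow> f z"
proof -
  have "isCont f z" using f z by (metis continuous_on_eq_continuous_at holomorphic_on_imp_continuous_on mem_ball_0 open_ball)
  moreover have "(\<lambda>k. of_real (rho k) * z) \<longlonglongrightarrow> of_real 1 * z" by (intro tendsto_intros rho_LIMSEQ)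
  ultimately have "(\<lambda>k. f (of_real (rho k) * z)) \<longlonglongrightarrow> f z" by (intro isCont_tendsto_compose[of z f]) auto
  moreover have "zext f (of_real (rho k) * z) = f (of_real (rho k) * z)" for k
  proof (rule zext_eq)
    have "rho k * norm z \<le> 1 * norm z" using rho[of k] by (intro mult_right_mono) auto
    then show "norm (of_real (rho k) * z) < 1" using z rho[of k] by (simp add: norm_mult)
  qed
  ultimately show ?thesis by simp
qed

lemma Fatou_le:
  assumes "\<And>k. u k \<in> borel_measurable M" and "AE x in M. u' x \<le> liminf (\<lambda>k. u k x)"
  shows "(\<integral>\<^sup>+x. u' x \<partial>M) \<le> liminf (\<lambda>k. \<integral>\<^sup>+x. u k x \<partial>M)"
proof -
  have "(\<integral>\<^sup>+x. u' x \<partial>M) \<le> (\<integral>\<^sup>+x. liminf (\<lambda>k. u k x) \<partial>M)" by (rule nn_integral_mono_AE[OF assms(2)])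
  also have "\<dots> \<le> liminf (\<lambda>k. \<integral>\<^sup>+x. u k x \<partial>M)" by (rule nn_integral_liminf[OF assms(1)])
  finally show ?thesis .
qed

lemma liminf_le_const:
  fixes u :: "nat \<Rightarrow> ennreal"
  assumes "\<And>k. u k \<le> B" shows "liminf u \<le> B"
proof -
  have "liminf u \<le> liminf (\<lambda>k::nat. B)" by (rule Liminf_mono) (use assms in auto)
  then show ?thesis by (simp add: Liminf_const)
qed

lemma le_liminf_tendsto:
  fixes u :: "nat \<Rightarrow> ennreal"
  assumes "u \<longlonglongrightarrow> x" shows "x \<le> liminf u"
  using lim_imp_Liminf[OF _ assms] by simp

lemma borel_atLeastLessThan_sets: "{0..<1::real} \<in> sets borel" by simp

section \<open>Weighted integrals attached to the sequence\<close>

text \<open>In the angle, \<open>sig a\<close> is a multiple of the Poisson kernel of the point r a,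
  so that integral is explicit and comparable to d y / max(y, d), with y = 1 - r and d = 1 - |a|.
  The radial integral is split at y = d; \<open>t > -1\<close> makes the near part converge and
  \<open>t < 0\<close> the far part. With t = \<alpha> - p + 1 the power t + 1 is the exponent of
  the series in the theorem.\<close>

lemma sig_weight_integral:
  assumes t: "-1 < t" "t < 0" and a: "norm a < 1"
  shows "(\<integral>\<^sup>+r. \<integral>\<^sup>+\<theta>. ennreal (sig a (of_real r * cis \<theta>) * (1 - r) powr (t - 1)) \<partial>circ \<partial>rad)
    \<le> ennreal (8 * pi * (1/(t+1) + 1/(-t)) * (1 - norm a) powr (t + 1))"
proof -
  define d where "d = 1 - norm a"
  have d: "0 < d" "d \<le> 1" using a by (auto simp: d_def)
  have inner: "(\<integral>\<^sup>+\<theta>. ennreal (sig a (of_real r * cis \<theta>) * (1 - r) powr (t - 1)) \<partial>circ) \<le> ennreal (8 * pi * d) * ennreal ((1 - r) powr t / max (1 - r) d)"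
    if r: "0 \<le> r" "r < 1" for r
  proof -
    define y where "y = 1 - r"
    have y: "0 < y" "y \<le> 1" using r by (auto simp: y_def)
    define s where "s = 1 - (norm (of_real r * a))\<^sup>2"
    have ra: "norm (of_real r * a) < 1" "norm (of_real r * a) \<le> r" "norm (of_real r * a) \<le> norm a"
    proof -
      have "r * norm a \<le> r * 1" using r a by (intro mult_left_mono) auto
      then show "norm (of_real r * a) \<le> r" using r by (simp add: norm_mult)
      then show "norm (of_real r * a) < 1" using r by simp
      have "r * norm a \<le> 1 * norm a" using r by (intro mult_right_mono) auto
      then show "norm (of_real r * a) \<le> norm a" using r by (simp add: norm_mult)
    qed
    \<comment> \<open>The distance of the point r a to the circle exceeds both that of r and that of
      a; dividing by the larger of \<open>y\<close> and \<open>d\<close> gives the kernel that is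
      split below.\<close>
    have s: "s \<ge> max y d" "s > 0"
    proof -
      have "(norm (of_real r * a))\<^sup>2 \<le> norm (of_real r * a) * 1" unfolding power2_eq_square using ra(1) by (intro mult_left_mono) auto
      then have "s \<ge> 1 - norm (of_real r * a)" by (simp add: s_def)
      then show "s \<ge> max y d" using ra by (simp add: y_def d_def)
      then show "s > 0" using y by simp
    qed
    define c where "c = (1 - (norm a)\<^sup>2) * (1 - r\<^sup>2) / s * y powr (t - 1)"
    have q: "0 \<le> 1 - (norm a)\<^sup>2" "1 - (norm a)\<^sup>2 \<le> 2 * d" "0 \<le> 1 - r\<^sup>2" "1 - r\<^sup>2 \<le> 2 * y"
    proof -
      show "0 \<le> 1 - (norm a)\<^sup>2" "0 \<le> 1 - r\<^sup>2" using a r by (auto simp: abs_square_le_1)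
      have "1 - x\<^sup>2 \<le> 2 * (1 - x)" for x :: real
      proof -
        have "2 * (1 - x) - (1 - x\<^sup>2) = (1 - x)\<^sup>2" by (simp add: power2_eq_square algebra_simps)
        then show ?thesis by (metis diff_ge_0_iff_ge zero_le_power2)
      qed
      then show "1 - (norm a)\<^sup>2 \<le> 2 * d" "1 - r\<^sup>2 \<le> 2 * y" by (auto simp: d_def y_def)
    qed
    have c: "c \<ge> 0" unfolding c_def using q s by (intro mult_nonneg_nonneg divide_nonneg_nonneg) auto
    have "sig a (of_real r * cis \<theta>) * (1 - r) powr (t - 1) = c * pk (of_real r * a) \<theta>" for \<theta>
    proof -
      have "norm (1 - cnj a * (of_real r * cis \<theta>)) = norm (cis \<theta> - of_real r * a)"
        using norm_one_minus_cnj_cis[of "of_real r * a" \<theta>] by (simp add: mult_ac)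
      moreover have "norm (of_real r * cis \<theta>) = r" using r by (simp add: norm_mult)
      ultimately show ?thesis using s(2) by (simp add: sig_def c_def pk_def s_def[symmetric] y_def)
    qed
    then have "(\<integral>\<^sup>+\<theta>. ennreal (sig a (of_real r * cis \<theta>) * (1 - r) powr (t - 1)) \<partial>circ) = (\<integral>\<^sup>+\<theta>. ennreal c * ennreal (pk (of_real r * a) \<theta>) \<partial>circ)"
      using c by (simp add: ennreal_mult')
    also have "\<dots> = ennreal c * ennreal (2 * pi)"
      by (subst nn_integral_cmult) (auto simp: pk_nn_integral[OF ra(1)])
    also have "\<dots> = ennreal (c * (2 * pi))" by (rule ennreal_mult[symmetric]) (use c in auto)
    also have "\<dots> \<le> ennreal (8 * pi * d * (y powr t / max y d))"
    proof (rule ennreal_leI)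
      have "(1 - (norm a)\<^sup>2) * (1 - r\<^sup>2) / s \<le> (2 * d) * (2 * y) / max y d"
        using q s y d by (intro frac_le mult_mono) auto
      then have "c \<le> (2 * d) * (2 * y) / max y d * y powr (t - 1)" unfolding c_def by (rule mult_right_mono) simp
      also have "\<dots> = 4 * d * (y powr t / max y d)"
      proof -
        have "y * y powr (t - 1) = y powr t" using y by (simp add: powr_mult_base)
        then show ?thesis by (simp add: mult_ac)
      qed
      finally have "c * (2 * pi) \<le> 4 * d * (y powr t / max y d) * (2 * pi)" by (rule mult_right_mono) simp
      then show "c * (2 * pi) \<le> 8 * pi * d * (y powr t / max y d)" by (simp add: mult_ac)
    qed
    also have "\<dots> = ennreal (8 * pi * d) * ennreal (y powr t / max y d)" using d by (intro ennreal_mult') auto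
    finally show ?thesis by (simp add: y_def)
  qed
  have "(\<integral>\<^sup>+r. \<integral>\<^sup>+\<theta>. ennreal (sig a (of_real r * cis \<theta>) * (1 - r) powr (t - 1)) \<partial>circ \<partial>rad)
     \<le> (\<integral>\<^sup>+r. ennreal (8 * pi * d) * ennreal ((1 - r) powr t / max (1 - r) d) \<partial>rad)"
    by (rule nn_integral_rad_mono[OF inner])
  also have "\<dots> = ennreal (8 * pi * d) * (\<integral>\<^sup>+r. ennreal ((1 - r) powr t / max (1 - r) d) \<partial>rad)"
    by (rule nn_integral_cmult) measurable
  also have "(\<integral>\<^sup>+r. ennreal ((1 - r) powr t / max (1 - r) d) \<partial>rad) = (\<integral>\<^sup>+y. ennreal (y powr t / max y d) \<partial>lint {0<..1})"
    by (rule nn_integral_rad_reflect[where f = "\<lambda>y. ennreal (y powr t / max y d)"]) measurable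
  also have "\<dots> \<le> (\<integral>\<^sup>+y. ennreal (y powr t * (1/d)) * indicator {0..d} y + ennreal (y powr (t-1)) * indicator {d..} y \<partial>lborel)"
  proof (subst nn_integral_lint, simp, measurable, intro nn_integral_mono)
    fix y :: real
    show "ennreal (y powr t / max y d) * indicator {0<..1} y \<le> ennreal (y powr t * (1/d)) * indicator {0..d} y + ennreal (y powr (t-1)) * indicator {d..} y"
    proof (cases "y \<in> {0<..1}")
      case y: True
      show ?thesis
      proof (cases "y \<le> d")
        case True then show ?thesis using y d by (simp add: max_def add_increasing2)
      next
        case False
        then have "y powr t / max y d = y powr (t-1)" using y by (simp add: max_def powr_diff)
        then show ?thesis using False y by (simp add: indicator_def)
      qed
    qed simp
  qed
  also have "\<dots> = (\<integral>\<^sup>+y. ennreal (y powr t * (1/d)) * indicator {0..d} y \<partial>lborel) + (\<integral>\<^sup>+y. ennreal (y powr (t-1)) * indicator {d..} y \<partial>lborel)"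
    by (rule nn_integral_add) measurable
  also have "(\<integral>\<^sup>+y. ennreal (y powr t * (1/d)) * indicator {0..d} y \<partial>lborel) = (\<integral>\<^sup>+y. ennreal (y powr t * (1/d)) \<partial>lint {0..d})"
    by (rule nn_integral_lint[symmetric]) measurable
  also have "\<dots> = (\<integral>\<^sup>+y. ennreal (y powr t) * ennreal (1/d) \<partial>lint {0..d})" using d by (intro nn_integral_cong ennreal_mult'') auto
  also have "\<dots> = (\<integral>\<^sup>+y. ennreal (y powr t) \<partial>lint {0..d}) * ennreal (1/d)" by (rule nn_integral_multc) measurable
  also have "\<dots> = ennreal (d powr (t+1) / (t+1)) * ennreal (1/d)" using nn_integral_powr_0[of t d] t d by simp
  also have "\<dots> = ennreal (d powr (t+1) / (t+1) * (1/d))" using d by (intro ennreal_mult''[symmetric]) auto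
  also have "(\<integral>\<^sup>+y. ennreal (y powr (t-1)) * indicator {d..} y \<partial>lborel) = (\<integral>\<^sup>+y. ennreal (y powr (t-1)) \<partial>lint {d..})"
    by (rule nn_integral_lint[symmetric]) measurable
  also have "\<dots> = ennreal (d powr t / (-t))" using nn_integral_powr_inf[of "t-1" d] t d by simp
  also have "ennreal (d powr (t+1) / (t+1) * (1/d)) + ennreal (d powr t / (-t)) = ennreal (d powr (t+1) / (t+1) * (1/d) + d powr t / (-t))"
    using d t by (intro ennreal_plus[symmetric] divide_nonneg_nonneg mult_nonneg_nonneg) auto
  also have "ennreal (8 * pi * d) * \<dots> = ennreal (8 * pi * d * (d powr (t+1) / (t+1) * (1/d) + d powr t / (-t)))"
    using d by (intro ennreal_mult'[symmetric]) auto
  also have "8 * pi * d * (d powr (t+1) / (t+1) * (1/d) + d powr t / (-t)) = 8 * pi * (1/(t+1) + 1/(-t)) * d powr (t+1)"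
  proof -
    have "d powr (t+1) = d * d powr t" using d by (simp add: powr_mult_base add.commute)
    then show ?thesis using d by (simp add: algebra_simps)
  qed
  finally show ?thesis by (simp add: d_def mult_left_mono)
qed

lemma measurable_sig [measurable (raw)]:
  assumes [measurable]: "f \<in> borel_measurable M"
  shows "(\<lambda>x. sig a (f x)) \<in> borel_measurable M"
  unfolding sig_def by measurable

text \<open>Packages the constant of \<open>Besov_double_integral\<close> with its independence of
  the function, so that it can be fixed before any dilate is chosen.\<close>

definition double_integral_bound :: "real \<Rightarrow> real \<Rightarrow> real \<Rightarrow> bool" where
  "double_integral_bound p \<alpha> C \<longleftrightarrow> C \<ge> 0 \<and> (\<forall>F F' R. disc_pair F F' R \<longrightarrow>
      (\<integral>\<^sup>+r. \<integral>\<^sup>+\<theta>. \<integral>\<^sup>+\<tau>. ennreal (norm (F (cis \<tau>) - F (of_real r * cis \<theta>)) powr p * (1 - r) powr (\<alpha> - p + 1) / (norm (cis \<tau> - of_real r * cis \<theta>))\<^sup>2)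
          \<partial>circ \<partial>circ \<partial>rad)
      \<le> ennreal C * (\<integral>\<^sup>+r. \<integral>\<^sup>+\<theta>. ennreal (norm (F' (of_real r * cis \<theta>)) powr p * (1 - r) powr \<alpha>) \<partial>circ \<partial>rad))"

lemma double_integral_bound_exists:
  assumes "1 < p" and "p - 2 < \<alpha>" "\<alpha> < p - 1"
  obtains C where "double_integral_bound p \<alpha> C"
proof (rule Besov_double_integral[OF assms])
  fix C assume C: "0 \<le> C" "\<And>F F' R. disc_pair F F' R \<Longrightarrow>
      (\<integral>\<^sup>+r. \<integral>\<^sup>+\<theta>. \<integral>\<^sup>+\<tau>. ennreal (norm (F (cis \<tau>) - F (of_real r * cis \<theta>)) powr p * (1 - r) powr (\<alpha> - p + 1) / (norm (cis \<tau> - of_real r * cis \<theta>))\<^sup>2)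
          \<partial>circ \<partial>circ \<partial>rad)
      \<le> ennreal C * (\<integral>\<^sup>+r. \<integral>\<^sup>+\<theta>. ennreal (norm (F' (of_real r * cis \<theta>)) powr p * (1 - r) powr \<alpha>) \<partial>circ \<partial>rad)"
  show thesis by (rule that[of C]) (unfold double_integral_bound_def, intro conjI allI impI C)
qed

lemma dilate_double_integral:
  assumes K: "double_integral_bound p \<alpha> C" and p: "p > 1" and f: "f holomorphic_on ball 0 1" and \<rho>: "0 < \<rho>" "\<rho> < 1"
  defines "G \<equiv> (\<lambda>z. zext f (of_real \<rho> * z))"
  shows "(\<integral>\<^sup>+r. \<integral>\<^sup>+\<theta>. \<integral>\<^sup>+\<tau>. ennreal (norm (G (cis \<tau>) - G (of_real r * cis \<theta>)) powr p * (1 - r) powr (\<alpha> - p + 1) / (norm (cis \<tau> - of_real r * cis \<theta>))\<^sup>2)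
          \<partial>circ \<partial>circ \<partial>rad) \<le> ennreal C * Besov_int p \<alpha> f"
proof -
  have "(\<integral>\<^sup>+r. \<integral>\<^sup>+\<theta>. \<integral>\<^sup>+\<tau>. ennreal (norm (G (cis \<tau>) - G (of_real r * cis \<theta>)) powr p * (1 - r) powr (\<alpha> - p + 1) / (norm (cis \<tau> - of_real r * cis \<theta>))\<^sup>2)
          \<partial>circ \<partial>circ \<partial>rad) \<le> ennreal C * (\<integral>\<^sup>+r. \<integral>\<^sup>+\<theta>. ennreal (norm (of_real \<rho> * zext (deriv f) (of_real \<rho> * (of_real r * cis \<theta>))) powr p * (1 - r) powr \<alpha>) \<partial>circ \<partial>rad)"
    using K dilate_disc_pair[OF f \<rho>] unfolding double_integral_bound_def G_def by blast
  also have "\<dots> \<le> ennreal C * Besov_int p \<alpha> f"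
    by (intro mult_left_mono dilate_Besov_int f \<rho>) (use p in auto)
  finally show ?thesis .
qed

text \<open>For fixed w the sum is, up to 1 - |w|^2, the Carleson sum of f - f(w) with the kernel 1
  / |1 - cnj(w) z_n|^2. The embedding moves it to the circle, where integration over w gives the
  double integral. The argument runs for dilates and ends with Fatou; 1024 is 512 times the 2 in 1 -
  r^2 <= 2 (1 - r).\<close>

lemma Besov_difference_sum:
  assumes K: "double_integral_bound p \<alpha> C" and p: "p > 1" and f: "f holomorphic_on ball 0 1"
    and A: "finite A" and a: "\<And>n. n \<in> A \<Longrightarrow> norm (z n) < 1"
    and S: "\<And>w. norm w < 1 \<Longrightarrow> (\<Sum>n\<in>A. sig (z n) w) \<le> S"
  shows "(\<integral>\<^sup>+r. \<integral>\<^sup>+\<theta>. ennreal (\<Sum>n\<in>A. sig (z n) (of_real r * cis \<theta>) * norm (f (z n) - zext f (of_real r * cis \<theta>)) powr p * (1 - r) powr (\<alpha> - p)) \<partial>circ \<partial>rad)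
    \<le> ennreal (1024 * exp S / pi) * (ennreal C * Besov_int p \<alpha> f)"
proof -
  note [measurable] = measurable_zext_holomorphic[OF f]
  define G where "G k z = zext f (of_real (rho k) * z)" for k z
  have mG [measurable]: "G k \<in> borel_measurable borel" for k unfolding G_def[abs_def] by measurable
  define u where "u k r \<theta> = ennreal (\<Sum>n\<in>A. sig (z n) (of_real r * cis \<theta>) * norm (G k (z n) - G k (of_real r * cis \<theta>)) powr p * (1 - r) powr (\<alpha> - p))" for k r \<theta>
  have mu [measurable]: "(\<lambda>x. u k (g x) (h x)) \<in> borel_measurable M"
    if [measurable]: "g \<in> borel_measurable M" "h \<in> borel_measurable M" for k g h and M :: "'z measure"
    unfolding u_def by measurable
  have bound: "(\<integral>\<^sup>+r. \<integral>\<^sup>+\<theta>. u k r \<theta> \<partial>circ \<partial>rad) \<le> ennreal (1024 * exp S / pi) * (ennreal C * Besov_int p \<alpha> f)" for k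
  proof -
    interpret disc_pair "G k" "\<lambda>z. of_real (rho k) * zext (deriv f) (of_real (rho k) * z)" "1 / rho k"
      unfolding G_def[abs_def] by (rule dilate_disc_pair[OF f rho])
    have "(\<integral>\<^sup>+r. \<integral>\<^sup>+\<theta>. u k r \<theta> \<partial>circ \<partial>rad) \<le> (\<integral>\<^sup>+r. \<integral>\<^sup>+\<theta>. ennreal (1024 * exp S / pi) *
      (\<integral>\<^sup>+\<tau>. ennreal (norm (G k (cis \<tau>) - G k (of_real r * cis \<theta>)) powr p * (1 - r) powr (\<alpha> - p + 1) / (norm (cis \<tau> - of_real r * cis \<theta>))\<^sup>2) \<partial>circ) \<partial>circ \<partial>rad)"
    proof (intro nn_integral_rad_mono nn_integral_circ_mono)
      fix r \<theta> :: real assume r: "0 \<le> r" "r < 1"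
      define w where "w = of_real r * cis \<theta>"
      have nw: "norm w = r" using r by (simp add: w_def norm_mult)
      define H where "H v = G k v - G k w" for v
      have [measurable]: "H \<in> borel_measurable borel" unfolding H_def[abs_def] by measurable
      define T where "T = (\<Sum>n\<in>A. (1 - (norm (z n))\<^sup>2) * norm (H (z n)) powr p / (norm (1 - cnj w * z n))\<^sup>2)"
      have CE: "ennreal T \<le> ennreal (512 * exp S / pi) * (\<integral>\<^sup>+\<tau>. ennreal (norm (H (cis \<tau>)) powr p / (norm (cis \<tau> - w))\<^sup>2) \<partial>circ)"
        unfolding T_def
      proof (rule Carleson_embedding)
        show "continuous_on (cball 0 1) H" unfolding H_def[abs_def] by (intro continuous_intros contF)
        show "H holomorphic_on ball 0 1" unfolding H_def[abs_def]
          by (intro holomorphic_intros holomorphic_on_subset[OF holF]) (use R in auto)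
      qed (use A a S nw r p in auto)
      have "(\<Sum>n\<in>A. sig (z n) w * norm (G k (z n) - G k w) powr p * (1 - r) powr (\<alpha> - p)) \<le> 2 * (1 - r) powr (\<alpha> - p + 1) * T"
        unfolding T_def sum_distrib_left
      proof (rule sum_mono)
        fix n assume n: "n \<in> A"
        define X where "X = (1 - (norm (z n))\<^sup>2) * norm (H (z n)) powr p / (norm (1 - cnj w * z n))\<^sup>2"
        have X: "X \<ge> 0" unfolding X_def using one_minus_norm_sq_pos[OF a[OF n]] by (intro divide_nonneg_nonneg mult_nonneg_nonneg) auto
        have "sig (z n) w * norm (G k (z n) - G k w) powr p * (1 - r) powr (\<alpha> - p) = (1 - r\<^sup>2) * (1 - r) powr (\<alpha> - p) * X"
        proof -
          have "sig (z n) w = (1 - r\<^sup>2) * (1 - (norm (z n))\<^sup>2) / (norm (1 - cnj w * z n))\<^sup>2"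
            by (rule trans[OF sig_commute]) (simp only: sig_def nw)
          then show ?thesis by (simp add: X_def H_def mult_ac)
        qed
        also have "\<dots> \<le> (2 * (1 - r)) * (1 - r) powr (\<alpha> - p) * X"
        proof (intro mult_right_mono X)
          have "2 * (1 - r) - (1 - r\<^sup>2) = (1 - r)\<^sup>2" by (simp add: power2_eq_square algebra_simps)
          then show "1 - r\<^sup>2 \<le> 2 * (1 - r)" by (metis diff_ge_0_iff_ge zero_le_power2)
        qed auto
        also have "\<dots> = 2 * (1 - r) powr (\<alpha> - p + 1) * X"
        proof -
          have pm: "(1 - r) * (1 - r) powr (\<alpha> - p) = (1 - r) powr (\<alpha> - p + 1)"
            using r by (simp add: powr_mult_base add.commute)
          have "(2 * (1 - r)) * (1 - r) powr (\<alpha> - p) * X = 2 * ((1 - r) * (1 - r) powr (\<alpha> - p)) * X" by (simp only: mult.assoc)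
          then show ?thesis unfolding pm .
        qed
        finally show "sig (z n) w * norm (G k (z n) - G k w) powr p * (1 - r) powr (\<alpha> - p) \<le> 2 * (1 - r) powr (\<alpha> - p + 1) * X" .
      qed
      then have "u k r \<theta> \<le> ennreal (2 * (1 - r) powr (\<alpha> - p + 1) * T)"
        unfolding u_def w_def[symmetric] by (rule ennreal_leI)
      also have "\<dots> = ennreal (2 * (1 - r) powr (\<alpha> - p + 1)) * ennreal T" by (rule ennreal_mult') simp
      also have "\<dots> \<le> ennreal (2 * (1 - r) powr (\<alpha> - p + 1)) * (ennreal (512 * exp S / pi) * (\<integral>\<^sup>+\<tau>. ennreal (norm (H (cis \<tau>)) powr p / (norm (cis \<tau> - w))\<^sup>2) \<partial>circ))"
        by (rule mult_left_mono[OF CE]) simp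
      also have "\<dots> = ennreal (1024 * exp S / pi) * (ennreal ((1 - r) powr (\<alpha> - p + 1)) * (\<integral>\<^sup>+\<tau>. ennreal (norm (H (cis \<tau>)) powr p / (norm (cis \<tau> - w))\<^sup>2) \<partial>circ))"
      proof -
        have "ennreal (2 * (1 - r) powr (\<alpha> - p + 1)) * ennreal (512 * exp S / pi) = ennreal (2 * (1 - r) powr (\<alpha> - p + 1) * (512 * exp S / pi))"
          by (rule ennreal_mult[symmetric]) auto
        also have "2 * (1 - r) powr (\<alpha> - p + 1) * (512 * exp S / pi) = (1024 * exp S / pi) * (1 - r) powr (\<alpha> - p + 1)" by simp
        also have "ennreal \<dots> = ennreal (1024 * exp S / pi) * ennreal ((1 - r) powr (\<alpha> - p + 1))"
          by (rule ennreal_mult) auto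
        finally show ?thesis by (simp only: mult.assoc[symmetric])
      qed
      also have "ennreal ((1 - r) powr (\<alpha> - p + 1)) * (\<integral>\<^sup>+\<tau>. ennreal (norm (H (cis \<tau>)) powr p / (norm (cis \<tau> - w))\<^sup>2) \<partial>circ) =
        (\<integral>\<^sup>+\<tau>. ennreal ((1 - r) powr (\<alpha> - p + 1)) * ennreal (norm (H (cis \<tau>)) powr p / (norm (cis \<tau> - w))\<^sup>2) \<partial>circ)"
        by (rule nn_integral_cmult[symmetric]) measurable
      also have "\<dots> = (\<integral>\<^sup>+\<tau>. ennreal (norm (G k (cis \<tau>) - G k w) powr p * (1 - r) powr (\<alpha> - p + 1) / (norm (cis \<tau> - w))\<^sup>2) \<partial>circ)"
        by (intro nn_integral_cong, subst ennreal_mult[symmetric]) (auto simp: H_def mult_ac)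
      finally show "u k r \<theta> \<le> ennreal (1024 * exp S / pi) *
        (\<integral>\<^sup>+\<tau>. ennreal (norm (G k (cis \<tau>) - G k (of_real r * cis \<theta>)) powr p * (1 - r) powr (\<alpha> - p + 1) / (norm (cis \<tau> - of_real r * cis \<theta>))\<^sup>2) \<partial>circ)"
        unfolding w_def .
    qed
    also have "\<dots> = ennreal (1024 * exp S / pi) * (\<integral>\<^sup>+r. \<integral>\<^sup>+\<theta>.
      (\<integral>\<^sup>+\<tau>. ennreal (norm (G k (cis \<tau>) - G k (of_real r * cis \<theta>)) powr p * (1 - r) powr (\<alpha> - p + 1) / (norm (cis \<tau> - of_real r * cis \<theta>))\<^sup>2) \<partial>circ) \<partial>circ \<partial>rad)"
      by (subst nn_integral_cmult, measurable)+
    also have "\<dots> \<le> ennreal (1024 * exp S / pi) * (ennreal C * Besov_int p \<alpha> f)"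
      unfolding G_def by (intro mult_left_mono dilate_double_integral[OF K p f rho]) simp
    finally show ?thesis .
  qed
  have "(\<integral>\<^sup>+r. \<integral>\<^sup>+\<theta>. ennreal (\<Sum>n\<in>A. sig (z n) (of_real r * cis \<theta>) * norm (f (z n) - zext f (of_real r * cis \<theta>)) powr p * (1 - r) powr (\<alpha> - p)) \<partial>circ \<partial>rad)
    \<le> liminf (\<lambda>k. \<integral>\<^sup>+r. \<integral>\<^sup>+\<theta>. u k r \<theta> \<partial>circ \<partial>rad)"
  proof (rule Fatou_le)
    show "AE r in rad. (\<integral>\<^sup>+\<theta>. ennreal (\<Sum>n\<in>A. sig (z n) (of_real r * cis \<theta>) * norm (f (z n) - zext f (of_real r * cis \<theta>)) powr p * (1 - r) powr (\<alpha> - p)) \<partial>circ) \<le> liminf (\<lambda>k. \<integral>\<^sup>+\<theta>. u k r \<theta> \<partial>circ)"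
      unfolding rad_def AE_lint[OF borel_atLeastLessThan_sets]
    proof (intro AE_I2 impI Fatou_le le_liminf_tendsto)
      fix r \<theta> :: real assume r: "r \<in> {0..<1}"
      have w: "norm (of_real r * cis \<theta>) < 1" using r by (simp add: norm_mult)
      show "(\<lambda>k. u k r \<theta>) \<longlonglongrightarrow> ennreal (\<Sum>n\<in>A. sig (z n) (of_real r * cis \<theta>) * norm (f (z n) - zext f (of_real r * cis \<theta>)) powr p * (1 - r) powr (\<alpha> - p))"
        unfolding u_def
      proof (intro tendsto_ennrealI tendsto_sum tendsto_mult tendsto_const)
        fix n assume n: "n \<in> A"
        have "(\<lambda>k. norm (G k (z n) - G k (of_real r * cis \<theta>))) \<longlonglongrightarrow> norm (f (z n) - zext f (of_real r * cis \<theta>))"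
          unfolding G_def zext_eq[OF w] by (intro tendsto_intros dilate_LIMSEQ f a[OF n] w)
        then show "(\<lambda>k. norm (G k (z n) - G k (of_real r * cis \<theta>)) powr p) \<longlonglongrightarrow> norm (f (z n) - zext f (of_real r * cis \<theta>)) powr p"
          by (rule tendsto_powr') (use p in auto)
      qed
    qed measurable
  qed measurable
  also have "\<dots> \<le> ennreal (1024 * exp S / pi) * (ennreal C * Besov_int p \<alpha> f)"
    by (rule liminf_le_const[OF bound])
  finally show ?thesis .
qed

text \<open>With \<open>c\<close> rotating B(w) to the positive axis, 1 - c B has nonnegative real
  part in the largest disc about w, and real part 1 - |B(w)| at w; the half-plane bound
  applies.\<close>

lemma deriv_norm_le_of_bounded:
  assumes B: "B holomorphic_on ball 0 1" and b: "\<And>w. norm w < 1 \<Longrightarrow> norm (B w) \<le> 1" and w: "norm w < 1"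
  shows "norm (deriv B w) \<le> 4 * (1 - norm (B w)) / (1 - norm w)"
proof -
  define c where "c = (if B w = 0 then 1 else cnj (B w) / of_real (norm (B w)))"
  have c: "norm c = 1" by (simp add: c_def norm_divide)
  have cB: "Re (c * B w) = norm (B w)"
  proof (cases "B w = 0")
    case False
    have "cnj (B w) * B w = of_real (norm (B w)) * of_real (norm (B w))"
      by (metis complex_norm_square mult.commute of_real_mult power2_eq_square)
    then have "c * B w = of_real (norm (B w))" using False by (simp add: c_def)
    then show ?thesis by simp
  qed simp
  have sub: "ball w (1 - norm w) \<subseteq> ball 0 1"
  proof
    fix x assume "x \<in> ball w (1 - norm w)"
    then show "x \<in> ball 0 1" using norm_triangle_ineq[of w "x - w"] by (simp add: dist_norm norm_minus_commute)
  qed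
  have "norm (deriv (\<lambda>x. 1 - c * B x) w) \<le> 4 * Re (1 - c * B w) / (1 - norm w)"
  proof (rule deriv_bound_Re_nonneg)
    show "(\<lambda>x. 1 - c * B x) holomorphic_on ball w (1 - norm w)"
      by (intro holomorphic_intros holomorphic_on_subset[OF B sub])
    show "Re (1 - c * B x) \<ge> 0" if "x \<in> ball w (1 - norm w)" for x
    proof -
      have "norm x < 1" using sub that by auto
      then have "norm (c * B x) \<le> 1" using b c by (simp add: norm_mult)
      then show ?thesis using complex_Re_le_cmod[of "c * B x"] by simp
    qed
  qed (use w in simp)
  moreover have "deriv (\<lambda>x. 1 - c * B x) w = - (c * deriv B w)"
  proof (rule DERIV_imp_deriv)
    have "(B has_field_derivative deriv B w) (at w)" by (rule holomorphic_derivI[OF B open_ball]) (use w in simp)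
    then show "((\<lambda>x. 1 - c * B x) has_field_derivative - (c * deriv B w)) (at w)" by (auto intro!: derivative_eq_intros)
  qed
  moreover have "Re (1 - c * B w) = 1 - norm (B w)" using cB by (simp only: minus_complex.sel one_complex.sel)
  moreover have "norm (- (c * deriv B w)) = norm (deriv B w)" using c by (simp add: norm_mult)
  ultimately show ?thesis by (simp only:)
qed

text \<open>Membership in the Hardy space follows from |B| <= 1. In the derivative, only f B' needs
  work; it is estimated pointwise by the series in \<open>P\<close> and \<open>Q\<close>, which are
  integrated separately.\<close>

lemma Besov_mult_Blaschke:
  assumes p: "1 < p" and \<alpha>: "p - 2 < \<alpha>" "\<alpha> < p - 1" and f: "f \<in> Besov_Hardy_space p \<alpha>"
    and bs: "blaschke_sequence I z"
    and S: "\<And>A w. finite A \<Longrightarrow> A \<subseteq> I \<Longrightarrow> norm w < 1 \<Longrightarrow> (\<Sum>n\<in>A. sig (z n) w) \<le> S"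
    and sm: "(\<lambda>n. norm (f (z n)) powr p * (1 - norm (z n)) powr (\<alpha> + 2 - p)) summable_on I"
  shows "(\<lambda>w. f w * Blaschke I z w) \<in> Besov_Hardy_space p \<alpha>"
proof -
  interpret blaschke_sequence I z by (rule bs)
  define B where "B = Blaschke I z"
  have H: "f \<in> Hardy_space p" and BI: "Besov_int p \<alpha> f < \<infinity>" using f p by (auto simp: Besov_Hardy_space_iff)
  have hol: "f holomorphic_on ball 0 1" using H by (simp add: Hardy_space_def)
  have holB: "B holomorphic_on ball 0 1" unfolding B_def by (rule holomorphic)
  have holg: "(\<lambda>w. f w * B w) holomorphic_on ball 0 1" by (intro holomorphic_intros hol holB)
  have B1: "norm (B w) \<le> 1" if "norm w < 1" for w unfolding B_def by (rule norm_le_1[OF that])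
  note [measurable] = measurable_zext_holomorphic[OF hol] measurable_zext_holomorphic[OF holB]
  obtain C where K: "double_integral_bound p \<alpha> C" using double_integral_bound_exists[OF p \<alpha>] .
  define t where "t = \<alpha> - p + 1"
  have t: "-1 < t" "t < 0" using \<alpha> by (auto simp: t_def)
  obtain M where M: "\<And>r. 0 \<le> r \<Longrightarrow> r < 1 \<Longrightarrow> (\<integral>\<^sup>+\<theta>. ennreal (norm (f (of_real r * cis \<theta>)) powr p) \<partial>circ) \<le> ennreal M"
    using Hardy_spaceD[OF H] p by auto
  have Hg: "(\<lambda>w. f w * B w) \<in> Hardy_space p"
  proof (rule Hardy_spaceI[OF holg])
    fix r :: real assume r: "0 \<le> r" "r < 1"
    have "(\<integral>\<^sup>+\<theta>. ennreal (norm (f (of_real r * cis \<theta>) * B (of_real r * cis \<theta>)) powr p) \<partial>circ) \<le> (\<integral>\<^sup>+\<theta>. ennreal (norm (f (of_real r * cis \<theta>)) powr p) \<partial>circ)"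
    proof (intro nn_integral_circ_mono ennreal_leI powr_mono2)
      fix \<theta> :: real
      have "norm (B (of_real r * cis \<theta>)) \<le> 1" by (rule B1) (use r in \<open>simp add: norm_mult\<close>)
      then show "norm (f (of_real r * cis \<theta>) * B (of_real r * cis \<theta>)) \<le> norm (f (of_real r * cis \<theta>))"
        by (simp add: norm_mult mult_left_le)
    qed (use p in auto)
    also have "\<dots> \<le> ennreal M" by (rule M[OF r])
    finally show "(\<integral>\<^sup>+\<theta>. ennreal (norm (f (of_real r * cis \<theta>) * B (of_real r * cis \<theta>)) powr p) \<partial>circ) \<le> ennreal M" .
  qed (use p in simp)
  \<comment> \<open>\<open>P\<close> carries the value of f at the zero and is summed by hypothesis
    through \<open>sig_weight_integral\<close>; \<open>Q\<close> carries the difference from that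
    value and is summed by \<open>Besov_difference_sum\<close>.\<close>
  define P where "P n r \<theta> = (if n \<in> I then ennreal (norm (f (z n)) powr p) * ennreal (sig (z n) (of_real r * cis \<theta>) * (1 - r) powr (t - 1)) else 0)" for n r \<theta>
  define Q where "Q n r \<theta> = (if n \<in> I then ennreal (sig (z n) (of_real r * cis \<theta>) * norm (f (z n) - zext f (of_real r * cis \<theta>)) powr p * (1 - r) powr (\<alpha> - p)) else 0)" for n r \<theta>
  have mPQ [measurable]: "(\<lambda>x. P n (g x) (h x)) \<in> borel_measurable M" "(\<lambda>x. Q n (g x) (h x)) \<in> borel_measurable M"
    if [measurable]: "g \<in> borel_measurable M" "h \<in> borel_measurable M" for n g h and M :: "'z measure"
    unfolding P_def Q_def by measurable
  have tt: "\<alpha> - p = t - 1" by (simp add: t_def)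
  \<comment> \<open>Each \<open>3 powr p\<close> is a use of the triangle inequality, first for the
    two terms of the product rule, then for the value at w against the value at the zero;
    \<open>4 powr p\<close> comes from the derivative bound for B.\<close>
  have pw: "ennreal (norm (zext (deriv (\<lambda>w. f w * B w)) (of_real r * cis \<theta>)) powr p * (1 - r) powr \<alpha>) \<le>
     ennreal (3 powr p) * ennreal (norm (zext (deriv f) (of_real r * cis \<theta>)) powr p * (1 - r) powr \<alpha>) +
     ennreal (3 powr p * 4 powr p * 3 powr p) * ((\<Sum>n. P n r \<theta>) + (\<Sum>n. Q n r \<theta>))" if r: "0 \<le> r" "r < 1" for r \<theta>
  proof -
    define w where "w = of_real r * cis \<theta>"
    have nw: "norm w = r" using r by (simp add: w_def norm_mult)
    have w: "norm w < 1" using nw r by simp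
    define y where "y = 1 - r"
    have y: "y > 0" using r by (simp add: y_def)
    have "deriv (\<lambda>w. f w * B w) w = f w * deriv B w + deriv f w * B w"
      by (rule DERIV_imp_deriv[OF DERIV_mult']) (use w in \<open>auto intro!: holomorphic_derivI[OF hol] holomorphic_derivI[OF holB]\<close>)
    then have "norm (deriv (\<lambda>w. f w * B w) w) powr p \<le> 3 powr p * (norm (f w * deriv B w) powr p + norm (deriv f w * B w) powr p)"
      using powr_triangle2[of p "f w * deriv B w" "deriv f w * B w"] p by simp
    also have "norm (deriv f w * B w) powr p \<le> norm (deriv f w) powr p"
      using B1[OF w] p by (intro powr_mono2) (auto simp: norm_mult mult_left_le)
    also have "norm (f w * deriv B w) powr p \<le> norm (f w) powr p * (4 powr p * (1 - (norm (B w))\<^sup>2) * y powr (-p))"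
    proof -
      have "norm (deriv B w) \<le> 4 * (1 - norm (B w)) / y"
        using deriv_norm_le_of_bounded[OF holB B1 w] by (simp add: nw y_def)
      then have "norm (deriv B w) powr p \<le> (4 * (1 - norm (B w)) / y) powr p" using p by (intro powr_mono2) auto
      also have "\<dots> = 4 powr p * (1 - norm (B w)) powr p * y powr (-p)"
      proof -
        have "(4 * u / y) powr p = 4 powr p * u powr p * y powr (-p)" if "u \<ge> 0" for u
          using that y by (simp add: powr_divide powr_mult powr_minus_divide)
        from this[of "1 - norm (B w)"] show ?thesis using B1[OF w] by simp
      qed
      \<comment> \<open>The power is lowered to 1 because 1 - |B| lies in [0, 1] and p > 1. The
        first power is then comparable to 1 - |B|^2, which is dominated by the linear sum of
        \<open>sig\<close>.\<close>
      also have "(1 - norm (B w)) powr p \<le> 1 - norm (B w)"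
      proof -
        have "(1 - norm (B w)) powr p \<le> (1 - norm (B w)) powr 1" using p B1[OF w] by (intro powr_mono') auto
        then show ?thesis using B1[OF w] by simp
      qed
      also have "1 - norm (B w) \<le> 1 - (norm (B w))\<^sup>2"
        using B1[OF w] mult_left_mono[of "norm (B w)" 1 "norm (B w)"] by (simp add: power2_eq_square)
      finally have "norm (deriv B w) powr p \<le> 4 powr p * (1 - (norm (B w))\<^sup>2) * y powr (-p)"
        by (simp add: mult_left_mono mult_right_mono)
      then show ?thesis by (simp add: norm_mult powr_mult mult_left_mono)
    qed
    finally have main: "norm (deriv (\<lambda>w. f w * B w) w) powr p \<le> 3 powr p * (norm (f w) powr p * (4 powr p * (1 - (norm (B w))\<^sup>2) * y powr (-p)) + norm (deriv f w) powr p)"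
      by (simp add: mult_left_mono)
    define b where "b = 1 - (norm (B w))\<^sup>2"
    have b: "b \<ge> 0" using B1[OF w] by (simp add: b_def abs_square_le_1)
    have "norm (deriv (\<lambda>w. f w * B w) w) powr p * y powr \<alpha> \<le> 3 powr p * (norm (f w) powr p * (4 powr p * b * y powr (-p)) + norm (deriv f w) powr p) * y powr \<alpha>"
      using main unfolding b_def by (rule mult_right_mono) simp
    also have "\<dots> = 3 powr p * (norm (deriv f w) powr p * y powr \<alpha>) + 3 powr p * 4 powr p * (norm (f w) powr p * b * y powr (\<alpha> - p))"
    proof -
      have "y powr (-p) * y powr \<alpha> = y powr (\<alpha> - p)" by (simp flip: powr_add)
      moreover have "x * (u * (v * b * Y) + g) * Z = x * (g * Z) + x * v * (u * b * (Y * Z))" for x u v g Y Z :: real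
        by (simp add: algebra_simps)
      ultimately show ?thesis by simp
    qed
    finally have "ennreal (norm (deriv (\<lambda>w. f w * B w) w) powr p * y powr \<alpha>) \<le> ennreal (3 powr p * (norm (deriv f w) powr p * y powr \<alpha>) + 3 powr p * 4 powr p * (norm (f w) powr p * b * y powr (\<alpha> - p)))"
      by (rule ennreal_leI)
    also have "\<dots> = ennreal (3 powr p) * ennreal (norm (deriv f w) powr p * y powr \<alpha>) + ennreal (3 powr p * 4 powr p) * ennreal (norm (f w) powr p * b * y powr (\<alpha> - p))"
      using b by (simp add: ennreal_mult[symmetric] ennreal_plus[symmetric] del: ennreal_plus)
    also have "ennreal (norm (f w) powr p * b * y powr (\<alpha> - p)) \<le> ennreal (3 powr p) * ((\<Sum>n. P n r \<theta>) + (\<Sum>n. Q n r \<theta>))"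
    proof -
      define c where "c = norm (f w) powr p * y powr (\<alpha> - p)"
      have c: "c \<ge> 0" by (simp add: c_def)
      have "ennreal (norm (f w) powr p * b * y powr (\<alpha> - p)) = ennreal c * ennreal b"
        using c b by (simp add: ennreal_mult[symmetric] c_def mult_ac)
      also have "\<dots> \<le> ennreal c * (\<Sum>n. if n \<in> I then ennreal (sig (z n) w) else 0)"
        unfolding b_def B_def by (intro mult_left_mono one_minus_norm_le w) simp
      also have "\<dots> = (\<Sum>n. ennreal c * (if n \<in> I then ennreal (sig (z n) w) else 0))" by simp
      also have "\<dots> \<le> (\<Sum>n. ennreal (3 powr p) * (P n r \<theta> + Q n r \<theta>))"
      proof (rule suminf_le)
        fix n
        show "ennreal c * (if n \<in> I then ennreal (sig (z n) w) else 0) \<le> ennreal (3 powr p) * (P n r \<theta> + Q n r \<theta>)"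
        proof (cases "n \<in> I")
          case True
          have s: "sig (z n) w \<ge> 0" using disc[OF True] w by (intro sig_nonneg) auto
          have tri: "norm (f w) powr p \<le> 3 powr p * (norm (f (z n)) powr p + norm (f (z n) - f w) powr p)"
            using powr_triangle2[of p "f (z n)" "f w - f (z n)"] p by (simp add: norm_minus_commute)
          have "c * sig (z n) w \<le> 3 powr p * (norm (f (z n)) powr p + norm (f (z n) - f w) powr p) * (y powr (\<alpha> - p) * sig (z n) w)"
            unfolding c_def using mult_right_mono[OF tri, of "y powr (\<alpha> - p) * sig (z n) w"] s by (simp add: mult_ac)
          also have "\<dots> = 3 powr p * (norm (f (z n)) powr p * (sig (z n) w * y powr (\<alpha> - p)) + sig (z n) w * norm (f (z n) - f w) powr p * y powr (\<alpha> - p))"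
            by (simp add: algebra_simps)
          finally have "ennreal c * ennreal (sig (z n) w) \<le> ennreal (3 powr p * (norm (f (z n)) powr p * (sig (z n) w * y powr (\<alpha> - p)) + sig (z n) w * norm (f (z n) - f w) powr p * y powr (\<alpha> - p)))"
            using c s by (simp add: ennreal_mult[symmetric] ennreal_leI)
          also have "\<dots> = ennreal (3 powr p) * (ennreal (norm (f (z n)) powr p) * ennreal (sig (z n) w * y powr (\<alpha> - p)) + ennreal (sig (z n) w * norm (f (z n) - f w) powr p * y powr (\<alpha> - p)))"
            using s by (simp add: ennreal_mult[symmetric] ennreal_plus[symmetric] del: ennreal_plus)
          finally show ?thesis using True w by (simp add: P_def Q_def w_def[symmetric] y_def tt)
        qed simp
      qed auto
      also have "\<dots> = ennreal (3 powr p) * ((\<Sum>n. P n r \<theta>) + (\<Sum>n. Q n r \<theta>))"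
        by (simp add: suminf_add)
      finally show ?thesis .
    qed
    also have "ennreal (3 powr p * 4 powr p) * (ennreal (3 powr p) * ((\<Sum>n. P n r \<theta>) + (\<Sum>n. Q n r \<theta>))) = ennreal (3 powr p * 4 powr p * 3 powr p) * ((\<Sum>n. P n r \<theta>) + (\<Sum>n. Q n r \<theta>))"
      by (simp add: mult.assoc[symmetric] ennreal_mult)
    finally show ?thesis using w by (simp add: w_def[symmetric] y_def mult_left_mono)
  qed
  have Pfin: "(\<integral>\<^sup>+r. \<integral>\<^sup>+\<theta>. (\<Sum>n. P n r \<theta>) \<partial>circ \<partial>rad) < \<infinity>"
  proof -
    define D where "D = 8 * pi * (1/(t+1) + 1/(-t))"
    define s where "s = (\<lambda>n. norm (f (z n)) powr p * (1 - norm (z n)) powr (\<alpha> + 2 - p))"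
    have "(\<integral>\<^sup>+r. \<integral>\<^sup>+\<theta>. (\<Sum>n. P n r \<theta>) \<partial>circ \<partial>rad) = (\<Sum>n. \<integral>\<^sup>+r. \<integral>\<^sup>+\<theta>. P n r \<theta> \<partial>circ \<partial>rad)"
      by (subst nn_integral_suminf, measurable)+
    also have "\<dots> \<le> ennreal (D * infsum s I)"
    proof (rule suminf_le_const)
      fix N
      have "(\<Sum>n<N. \<integral>\<^sup>+r. \<integral>\<^sup>+\<theta>. P n r \<theta> \<partial>circ \<partial>rad) \<le> (\<Sum>n<N. if n \<in> I then ennreal (D * s n) else 0)"
      proof (rule sum_mono)
        fix n
        show "(\<integral>\<^sup>+r. \<integral>\<^sup>+\<theta>. P n r \<theta> \<partial>circ \<partial>rad) \<le> (if n \<in> I then ennreal (D * s n) else 0)"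
        proof (cases "n \<in> I")
          case True
          have "(\<integral>\<^sup>+r. \<integral>\<^sup>+\<theta>. P n r \<theta> \<partial>circ \<partial>rad) = ennreal (norm (f (z n)) powr p) * (\<integral>\<^sup>+r. \<integral>\<^sup>+\<theta>. ennreal (sig (z n) (of_real r * cis \<theta>) * (1 - r) powr (t - 1)) \<partial>circ \<partial>rad)"
            unfolding P_def using True by (simp only: if_True) (subst nn_integral_cmult, measurable)+
          also have "\<dots> \<le> ennreal (norm (f (z n)) powr p) * ennreal (D * (1 - norm (z n)) powr (t + 1))"
            unfolding D_def by (intro mult_left_mono sig_weight_integral t disc True) simp
          also have "\<dots> = ennreal (norm (f (z n)) powr p * (D * (1 - norm (z n)) powr (t + 1)))" by (rule ennreal_mult'[symmetric]) simp
          also have "norm (f (z n)) powr p * (D * (1 - norm (z n)) powr (t + 1)) = D * s n"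
          proof -
            have e: "t + 1 = \<alpha> + 2 - p" by (simp add: t_def)
            show ?thesis unfolding e s_def by (rule mult.left_commute)
          qed
          finally show ?thesis using True by simp
        qed (simp add: P_def)
      qed
      also have "\<dots> = (\<Sum>n\<in>I \<inter> {..<N}. ennreal (D * s n))" by (subst Int_commute) (simp add: sum.inter_restrict)
      also have "\<dots> = ennreal (D * (\<Sum>n\<in>I \<inter> {..<N}. s n))"
      proof -
        have "0 \<le> 1/(t+1)" "0 \<le> 1/(-t)" using t by (intro divide_nonneg_nonneg; simp)+
        then have "D \<ge> 0" unfolding D_def by (intro mult_nonneg_nonneg add_nonneg_nonneg) auto
        then show ?thesis by (subst sum_ennreal) (auto simp: s_def sum_distrib_left)
      qed
      also have "\<dots> \<le> ennreal (D * infsum s I)"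
      proof (intro ennreal_leI mult_left_mono)
        have "0 \<le> 1/(t+1)" "0 \<le> 1/(-t)" using t by (intro divide_nonneg_nonneg; simp)+
        then show "D \<ge> 0" unfolding D_def by (intro mult_nonneg_nonneg add_nonneg_nonneg) auto
        show "(\<Sum>n\<in>I \<inter> {..<N}. s n) \<le> infsum s I"
          by (rule finite_sum_le_infsum) (use sm in \<open>auto simp: s_def\<close>)
      qed
      finally show "(\<Sum>n<N. \<integral>\<^sup>+r. \<integral>\<^sup>+\<theta>. P n r \<theta> \<partial>circ \<partial>rad) \<le> ennreal (D * infsum s I)" .
    qed simp
    also have "\<dots> < \<infinity>" by simp
    finally show ?thesis .
  qed
  have Qfin: "(\<integral>\<^sup>+r. \<integral>\<^sup>+\<theta>. (\<Sum>n. Q n r \<theta>) \<partial>circ \<partial>rad) < \<infinity>"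
  proof -
    have "(\<integral>\<^sup>+r. \<integral>\<^sup>+\<theta>. (\<Sum>n. Q n r \<theta>) \<partial>circ \<partial>rad) = (\<Sum>n. \<integral>\<^sup>+r. \<integral>\<^sup>+\<theta>. Q n r \<theta> \<partial>circ \<partial>rad)"
      by (subst nn_integral_suminf, measurable)+
    also have "\<dots> \<le> ennreal (1024 * exp S / pi) * (ennreal C * Besov_int p \<alpha> f)"
    proof (rule suminf_le_const)
      fix N
      have "(\<Sum>n<N. \<integral>\<^sup>+r. \<integral>\<^sup>+\<theta>. Q n r \<theta> \<partial>circ \<partial>rad) = (\<integral>\<^sup>+r. \<integral>\<^sup>+\<theta>. (\<Sum>n<N. Q n r \<theta>) \<partial>circ \<partial>rad)"
        by (subst nn_integral_sum, measurable)+
      also have "\<dots> \<le> (\<integral>\<^sup>+r. \<integral>\<^sup>+\<theta>. ennreal (\<Sum>n\<in>I \<inter> {..<N}. sig (z n) (of_real r * cis \<theta>) * norm (f (z n) - zext f (of_real r * cis \<theta>)) powr p * (1 - r) powr (\<alpha> - p)) \<partial>circ \<partial>rad)"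
      proof (intro nn_integral_rad_mono nn_integral_circ_mono)
        fix r \<theta> :: real assume r: "0 \<le> r" "r < 1"
        have w: "norm (of_real r * cis \<theta>) < 1" using r by (simp add: norm_mult)
        have "(\<Sum>n<N. Q n r \<theta>) = (\<Sum>n\<in>I \<inter> {..<N}. ennreal (sig (z n) (of_real r * cis \<theta>) * norm (f (z n) - zext f (of_real r * cis \<theta>)) powr p * (1 - r) powr (\<alpha> - p)))"
          unfolding Q_def by (subst Int_commute) (simp add: sum.inter_restrict)
        also have "\<dots> = ennreal (\<Sum>n\<in>I \<inter> {..<N}. sig (z n) (of_real r * cis \<theta>) * norm (f (z n) - zext f (of_real r * cis \<theta>)) powr p * (1 - r) powr (\<alpha> - p))"
          by (intro sum_ennreal mult_nonneg_nonneg sig_nonneg disc) (use w in auto)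
        finally show "(\<Sum>n<N. Q n r \<theta>) \<le> ennreal (\<Sum>n\<in>I \<inter> {..<N}. sig (z n) (of_real r * cis \<theta>) * norm (f (z n) - zext f (of_real r * cis \<theta>)) powr p * (1 - r) powr (\<alpha> - p))"
          by simp
      qed
      also have "\<dots> \<le> ennreal (1024 * exp S / pi) * (ennreal C * Besov_int p \<alpha> f)"
      proof (rule Besov_difference_sum[OF K p hol])
        show "norm (z n) < 1" if "n \<in> I \<inter> {..<N}" for n using that disc by blast
        show "(\<Sum>n\<in>I \<inter> {..<N}. sig (z n) w) \<le> S" if "norm w < 1" for w by (rule S) (use that in auto)
      qed simp
      finally show "(\<Sum>n<N. \<integral>\<^sup>+r. \<integral>\<^sup>+\<theta>. Q n r \<theta> \<partial>circ \<partial>rad) \<le> ennreal (1024 * exp S / pi) * (ennreal C * Besov_int p \<alpha> f)" .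
    qed simp
    also have "\<dots> < \<infinity>" using BI by (simp add: ennreal_mult_less_top)
    finally show ?thesis .
  qed
  have "Besov_int p \<alpha> (\<lambda>w. f w * B w) \<le> (\<integral>\<^sup>+r. \<integral>\<^sup>+\<theta>. (ennreal (3 powr p) * ennreal (norm (zext (deriv f) (of_real r * cis \<theta>)) powr p * (1 - r) powr \<alpha>) +
     ennreal (3 powr p * 4 powr p * 3 powr p) * ((\<Sum>n. P n r \<theta>) + (\<Sum>n. Q n r \<theta>))) \<partial>circ \<partial>rad)"
    unfolding Besov_int_def by (intro nn_integral_rad_mono nn_integral_circ_mono pw)
  also have "\<dots> = ennreal (3 powr p) * Besov_int p \<alpha> f + ennreal (3 powr p * 4 powr p * 3 powr p) *
     ((\<integral>\<^sup>+r. \<integral>\<^sup>+\<theta>. (\<Sum>n. P n r \<theta>) \<partial>circ \<partial>rad) + (\<integral>\<^sup>+r. \<integral>\<^sup>+\<theta>. (\<Sum>n. Q n r \<theta>) \<partial>circ \<partial>rad))"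
    unfolding Besov_int_def by (subst nn_integral_add nn_integral_cmult, measurable)+
  also have "\<dots> < \<infinity>" using BI Pfin Qfin by (simp add: ennreal_mult_less_top)
  finally show ?thesis using Hg p unfolding B_def by (simp add: Besov_Hardy_space_iff)
qed

section \<open>Boundary values and the logarithm\<close>

text \<open>The split is at the value of \<open>a\<close> where \<open>a powr (p-1) * l = 1\<close>:
  below it the second term suffices, above it the first. It turns a weighted bound on p-th powers
  into integrability, given integrability of the second term.\<close>

lemma powr_Young_weight:
  assumes p: "p > 1" and a: "a \<ge> (0::real)" and l: "l > 0"
  shows "a \<le> a powr p * l + l powr (-1/(p-1))"
proof (cases "a \<le> l powr (-1/(p-1))")
  case True
  then show ?thesis using l by (simp add: add_increasing)
next
  case False
  then have al: "l powr (-1/(p-1)) < a" and apos: "a > 0" using powr_ge_zero[of l "-1/(p-1)"] by linarith+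
  have "(l powr (-1/(p-1))) powr (p-1) \<le> a powr (p-1)" using al p by (intro powr_mono2) auto
  moreover have "(l powr (-1/(p-1))) powr (p-1) = 1 / l"
  proof -
    have "-1/(p-1) * (p-1) = -1" using p by simp
    then have "(l powr (-1/(p-1))) powr (p-1) = l powr (-1)" by (simp only: powr_powr)
    then show ?thesis using l by (simp add: powr_minus_divide)
  qed
  ultimately have "1 / l \<le> a powr (p-1)" by simp
  then have "1 \<le> a powr (p-1) * l" using l by (simp add: field_simps)
  then have "a * 1 \<le> a * (a powr (p-1) * l)" using apos by (intro mult_left_mono) auto
  also have "\<dots> = a powr p * l" using apos by (simp add: powr_mult_base mult.assoc[symmetric])
  finally show ?thesis by (simp add: add_increasing2)
qed

lemma radial_norm_increment:
  assumes f: "f holomorphic_on ball 0 1" and ab: "0 \<le> a" "a \<le> b" "b < 1"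
  shows "ennreal (norm (f (of_real b * cis \<theta>) - f (of_real a * cis \<theta>))) \<le>
    (\<integral>\<^sup>+s. ennreal (norm (zext (deriv f) (of_real s * cis \<theta>))) \<partial>lint {a..b})"
proof -
  note [measurable] = measurable_zext_holomorphic[OF f]
  have hd: "deriv f holomorphic_on ball 0 1" by (intro holomorphic_deriv f) simp
  have inD: "of_real s * cis \<theta> \<in> ball 0 1" if "s \<in> {a..b}" for s using that ab by (simp add: norm_mult)
  have cont: "continuous_on {a..b} (\<lambda>s. deriv f (of_real s * cis \<theta>))"
    by (rule continuous_on_compose2[OF holomorphic_on_imp_continuous_on[OF hd]]) (use inD in \<open>auto intro!: continuous_intros\<close>)
  have contz: "continuous_on {a..b} (\<lambda>s. zext (deriv f) (of_real s * cis \<theta>))"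
    by (rule continuous_on_eq[OF cont]) (use inD in \<open>simp add: zext_def\<close>)
  have hi: "((\<lambda>s. cis \<theta> * deriv f (of_real s * cis \<theta>)) has_integral (f (of_real b * cis \<theta>) - f (of_real a * cis \<theta>))) {a..b}"
  proof (rule fundamental_theorem_of_calculus[OF ab(2)])
    fix s assume s: "s \<in> {a..b}"
    have "(f has_field_derivative deriv f (of_real s * cis \<theta>)) (at (of_real s * cis \<theta>))"
      by (rule holomorphic_derivI[OF f open_ball inD[OF s]])
    moreover have "((\<lambda>s. of_real s * cis \<theta>) has_vector_derivative cis \<theta>) (at s within {a..b})"
      by (auto intro!: derivative_eq_intros simp: has_vector_derivative_def scaleR_conv_of_real)
    ultimately have "((f \<circ> (\<lambda>s. of_real s * cis \<theta>)) has_vector_derivative (cis \<theta> * deriv f (of_real s * cis \<theta>))) (at s within {a..b})"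
      by (intro field_vector_diff_chain_within) (auto intro: DERIV_subset)
    then show "((\<lambda>s. f (of_real s * cis \<theta>)) has_vector_derivative (cis \<theta> * deriv f (of_real s * cis \<theta>))) (at s within {a..b})"
      by (simp add: o_def)
  qed
  define g where "g = (\<lambda>s. norm (zext (deriv f) (of_real s * cis \<theta>)))"
  have contg: "continuous_on {a..b} g" unfolding g_def by (intro continuous_on_norm contz)
  have mg: "g \<in> borel_measurable borel" unfolding g_def by measurable
  have "norm (f (of_real b * cis \<theta>) - f (of_real a * cis \<theta>)) \<le> integral {a..b} g"
    unfolding integral_unique[OF hi, symmetric]
  proof (rule integral_norm_bound_integral)
    show "(\<lambda>s. cis \<theta> * deriv f (of_real s * cis \<theta>)) integrable_on {a..b}" using hi by blast
    show "g integrable_on {a..b}" by (rule integrable_continuous_real[OF contg])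
    show "norm (cis \<theta> * deriv f (of_real s * cis \<theta>)) \<le> g s" if "s \<in> {a..b}" for s
      using inD[OF that] by (simp add: g_def norm_mult zext_def)
  qed
  also have "integral {a..b} g = (\<integral>s. g s \<partial>lint {a..b})"
    by (rule integral_lint_has_integral[symmetric, OF contg mg integrable_integral[OF integrable_continuous_real[OF contg]]])
  finally have "ennreal (norm (f (of_real b * cis \<theta>) - f (of_real a * cis \<theta>))) \<le> ennreal (\<integral>s. g s \<partial>lint {a..b})"
    by (rule ennreal_leI)
  also have "\<dots> = (\<integral>\<^sup>+s. ennreal (g s) \<partial>lint {a..b})"
    by (rule nn_integral_eq_integral[symmetric, OF integrable_lint_continuous[OF contg mg]]) (simp add: g_def)
  finally show ?thesis by (simp add: g_def)
qed

lemma integrable_pk_mult: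
  fixes u :: "real \<Rightarrow> 'b::{banach, second_countable_topology}"
  assumes "norm z < 1" and u: "integrable circ u"
  shows "integrable circ (\<lambda>t. pk z t *\<^sub>R u t)"
proof (rule Bochner_Integration.integrable_bound)
  show "integrable circ (\<lambda>t. 2 / (1 - norm z) * norm (u t))" using u by simp
  have "u \<in> borel_measurable circ" using u by (rule borel_measurable_integrable)
  then have [measurable]: "u \<in> borel_measurable borel" by simp
  show "(\<lambda>t. pk z t *\<^sub>R u t) \<in> borel_measurable circ" by measurable
  show "AE t in circ. norm (pk z t *\<^sub>R u t) \<le> norm (2 / (1 - norm z) * norm (u t))"
  proof (rule AE_I2)
    fix t :: real
    have "pk z t * norm (u t) \<le> 2 / (1 - norm z) * norm (u t)"
      by (intro mult_right_mono pk_le assms) simp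
    moreover have "pk z t \<ge> 0" using assms by (intro pk_nonneg) auto
    ultimately show "norm (pk z t *\<^sub>R u t) \<le> norm (2 / (1 - norm z) * norm (u t))" using assms by simp
  qed
qed

lemma pk_dominated:
  fixes h :: "nat \<Rightarrow> real \<Rightarrow> 'b::{banach, second_countable_topology}"
  assumes z: "norm z < 1" and m: "\<And>k. h k \<in> borel_measurable borel" "h' \<in> borel_measurable borel" and w: "integrable circ w"
    and lim: "AE t in circ. (\<lambda>k. h k t) \<longlonglongrightarrow> h' t" and b: "\<And>k. AE t in circ. norm (h k t) \<le> w t"
  shows "(\<lambda>k. \<integral>t. pk z t *\<^sub>R h k t \<partial>circ) \<longlonglongrightarrow> (\<integral>t. pk z t *\<^sub>R h' t \<partial>circ)"
proof (rule integral_dominated_convergence[where w = "\<lambda>t. pk z t *\<^sub>R w t"])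
  note [measurable] = m
  show "integrable circ (\<lambda>t. pk z t *\<^sub>R w t)" by (rule integrable_pk_mult[OF z w])
  show "(\<lambda>t. pk z t *\<^sub>R h' t) \<in> borel_measurable circ" "(\<lambda>t. pk z t *\<^sub>R h k t) \<in> borel_measurable circ" for k by measurable
  show "AE t in circ. (\<lambda>k. pk z t *\<^sub>R h k t) \<longlonglongrightarrow> pk z t *\<^sub>R h' t"
    using lim by eventually_elim (intro tendsto_intros)
  show "AE t in circ. norm (pk z t *\<^sub>R h k t) \<le> pk z t *\<^sub>R w t" for k
    using b[of k]
  proof eventually_elim
    case (elim t)
    have "pk z t \<ge> 0" using z by (intro pk_nonneg) auto
    then show ?case using elim by (simp add: mult_left_mono)
  qed
qed

lemma abs_ln_add_le:
  assumes "0 \<le> x" "0 < e" "e \<le> (1::real)"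
  shows "\<bar>ln (x + e)\<bar> \<le> \<bar>ln e\<bar> + x + 1"
proof -
  have "ln (x + e) \<le> x + e - 1" using ln_le_minus_one[of "x + e"] assms by simp
  moreover have "ln e \<le> ln (x + e)" using assms by simp
  moreover have "ln e \<le> 0" using assms by simp
  ultimately show ?thesis using assms by linarith
qed

locale besov_fn =
  fixes p \<alpha> :: real and f :: "complex \<Rightarrow> complex"
  assumes p: "1 < p" and \<alpha>: "p - 2 < \<alpha>" "\<alpha> < p - 1" and fB: "f \<in> Besov_Hardy_space p \<alpha>"
begin

lemma fH: "f \<in> Hardy_space p" and BI: "Besov_int p \<alpha> f < \<infinity>"
  using fB p by (auto simp: Besov_Hardy_space_iff)

lemma hol: "f holomorphic_on ball 0 1" using fH by (simp add: Hardy_space_def)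

lemmas meas [measurable] = measurable_zext_holomorphic[OF hol]

definition dil :: "nat \<Rightarrow> complex \<Rightarrow> complex" where "dil k z = zext f (of_real (rho k) * z)"

text \<open>The radial limit along the factors \<open>rho k\<close>. Where the dilates diverge,
  \<open>lim\<close> is an arbitrary value; \<open>AE_bdry\<close> confines this to a null set of
  angles.\<close>

definition bdry :: "complex \<Rightarrow> complex" where "bdry w = lim (\<lambda>k. dil k w)"

lemma measurable_dil [measurable]: "dil k \<in> borel_measurable borel"
  unfolding dil_def[abs_def] by measurable

lemma measurable_bdry [measurable]: "bdry \<in> borel_measurable borel"
  unfolding bdry_def[abs_def] by measurable

definition radial_var :: "real \<Rightarrow> ennreal" where
  "radial_var \<theta> = (\<integral>\<^sup>+s. ennreal (norm (zext (deriv f) (of_real s * cis \<theta>))) \<partial>rad)"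

lemma measurable_radial_var [measurable]: "radial_var \<in> borel_measurable borel"
  unfolding radial_var_def[abs_def] by measurable

text \<open>Young's inequality with weight l = (1 - s)^\<alpha> splits |f'| into the integrand of
  \<open>Besov_int\<close> and the power (1 - s)^b. The latter is integrable because b > -1, which
  is exactly \<alpha> < p - 1.\<close>

lemma radial_var_integral: "(\<integral>\<^sup>+\<theta>. radial_var \<theta> \<partial>circ) < \<infinity>"
proof -
  define b where "b = - \<alpha> / (p - 1)"
  have b: "b > -1" using p \<alpha> by (simp add: b_def field_simps)
  have "(\<integral>\<^sup>+\<theta>. radial_var \<theta> \<partial>circ) = (\<integral>\<^sup>+s. \<integral>\<^sup>+\<theta>. ennreal (norm (zext (deriv f) (of_real s * cis \<theta>))) \<partial>circ \<partial>rad)"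
    unfolding radial_var_def by (rule Fubini_borel[OF sigma_finite_circ sigma_finite_rad]) (simp_all, measurable)
  also have "\<dots> \<le> (\<integral>\<^sup>+s. \<integral>\<^sup>+\<theta>. ennreal (norm (zext (deriv f) (of_real s * cis \<theta>)) powr p * (1 - s) powr \<alpha>) + ennreal ((1 - s) powr b) \<partial>circ \<partial>rad)"
  proof (intro nn_integral_rad_mono nn_integral_circ_mono)
    fix s \<theta> :: real assume s: "0 \<le> s" "s < 1"
    have "norm (zext (deriv f) (of_real s * cis \<theta>)) \<le> norm (zext (deriv f) (of_real s * cis \<theta>)) powr p * (1 - s) powr \<alpha> + ((1 - s) powr \<alpha>) powr (-1/(p-1))"
      by (rule powr_Young_weight) (use p s in auto)
    also have "((1 - s) powr \<alpha>) powr (-1/(p-1)) = (1 - s) powr b" by (simp add: powr_powr b_def)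
    finally show "ennreal (norm (zext (deriv f) (of_real s * cis \<theta>))) \<le> ennreal (norm (zext (deriv f) (of_real s * cis \<theta>)) powr p * (1 - s) powr \<alpha>) + ennreal ((1 - s) powr b)"
      by (simp add: ennreal_plus[symmetric] ennreal_leI del: ennreal_plus)
  qed
  also have "\<dots> = Besov_int p \<alpha> f + (\<integral>\<^sup>+s. ennreal ((1 - s) powr b) * emeasure circ UNIV \<partial>rad)"
    unfolding Besov_int_def by (simp add: nn_integral_add)
  also have "(\<integral>\<^sup>+s. ennreal ((1 - s) powr b) * emeasure circ UNIV \<partial>rad) = (\<integral>\<^sup>+s. ennreal ((1 - s) powr b) \<partial>rad) * emeasure circ UNIV"
    by (rule nn_integral_multc) measurable
  also have "(\<integral>\<^sup>+s. ennreal ((1 - s) powr b) \<partial>rad) = (\<integral>\<^sup>+y. ennreal (y powr b) \<partial>lint {0<..1})"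
    by (rule nn_integral_rad_reflect[where f = "\<lambda>y. ennreal (y powr b)"]) measurable
  also have "\<dots> * emeasure circ UNIV < \<infinity>"
  proof -
    have "(\<integral>\<^sup>+y. ennreal (y powr b) \<partial>lint {0<..1}) \<le> (\<integral>\<^sup>+y. ennreal (y powr b) \<partial>lint {0..1})"
      by (rule nn_integral_lint_mono_set) auto
    also have "\<dots> = ennreal (1 powr (b+1) / (b+1))" by (rule nn_integral_powr_0) (use b in auto)
    also have "\<dots> < \<infinity>" by simp
    finally have "(\<integral>\<^sup>+y. ennreal (y powr b) \<partial>lint {0<..1}) < \<infinity>" .
    moreover have "emeasure circ UNIV < \<infinity>" using finite_measure.emeasure_finite[OF finite_measure_circ, of UNIV] by (simp add: less_top)
    ultimately show ?thesis by (simp add: ennreal_mult_less_top)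
  qed
  finally show ?thesis using BI by simp
qed

lemma rho_mono: "rho k \<le> rho (Suc k)"
  by (simp add: rho_def field_simps)

text \<open>Consecutive dilates at an angle are values of f at adjacent radii, so their increments
  are bounded by the variation over adjoining intervals. The order of the radii is carried along in
  the same induction.\<close>

lemma dil_increments:
  "(\<Sum>k<N. ennreal (norm (dil (Suc k) (cis \<theta>) - dil k (cis \<theta>)))) \<le> (\<integral>\<^sup>+s. ennreal (norm (zext (deriv f) (of_real s * cis \<theta>))) \<partial>lint {rho 0..rho N})"
  and "rho 0 \<le> rho N"
proof (induction N)
  case (Suc N)
  {
    case 1
    have d: "dil k (cis \<theta>) = f (of_real (rho k) * cis \<theta>)" for k
      unfolding dil_def using rho[of k] by (intro zext_eq) (simp add: norm_mult)
    have "ennreal (norm (dil (Suc N) (cis \<theta>) - dil N (cis \<theta>))) \<le> (\<integral>\<^sup>+s. ennreal (norm (zext (deriv f) (of_real s * cis \<theta>))) \<partial>lint {rho N..rho (Suc N)})"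
      unfolding d by (rule radial_norm_increment[OF hol]) (use rho[of N] rho[of "Suc N"] rho_mono[of N] in auto)
    then show ?case using Suc.IH rho_mono[of N]
      by (subst nn_integral_lint_union[of _ "rho 0" "rho N" "rho (Suc N)"]) (auto intro!: add_mono)
  next
    case 2 show ?case using Suc.IH(2) rho_mono[of N] by linarith
  }
qed auto

lemma dil_increments_le: "(\<Sum>k<N. ennreal (norm (dil (Suc k) (cis \<theta>) - dil k (cis \<theta>)))) \<le> radial_var \<theta>"
proof -
  have "(\<integral>\<^sup>+s. ennreal (norm (zext (deriv f) (of_real s * cis \<theta>))) \<partial>lint {rho 0..rho N}) \<le> radial_var \<theta>"
    unfolding radial_var_def rad_def by (rule nn_integral_lint_mono_set) (use rho[of 0] rho[of N] in auto)
  then show ?thesis using dil_increments(1)[where N = N and \<theta> = \<theta>] by (rule order_trans[rotated])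
qed

lemma sum_increments_real:
  assumes "radial_var \<theta> < \<infinity>"
  shows "(\<Sum>k<N. norm (dil (Suc k) (cis \<theta>) - dil k (cis \<theta>))) \<le> enn2real (radial_var \<theta>)"
proof -
  have "ennreal (\<Sum>k<N. norm (dil (Suc k) (cis \<theta>) - dil k (cis \<theta>))) \<le> ennreal (enn2real (radial_var \<theta>))"
    using dil_increments_le[where N = N and \<theta> = \<theta>] assms by (simp add: sum_ennreal)
  then show ?thesis by (subst (asm) ennreal_le_iff) auto
qed

definition bound0 :: real where "bound0 = (SOME B. \<forall>w\<in>cball 0 (rho 0). norm (f w) \<le> B)"

lemma bound0: "norm (dil 0 (cis \<theta>)) \<le> bound0"
proof -
  have sub: "cball 0 (rho 0) \<subseteq> ball (0::complex) 1" using rho[of 0] by auto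
  have "bounded (f ` cball 0 (rho 0))"
    by (intro compact_imp_bounded compact_continuous_image continuous_on_subset[OF holomorphic_on_imp_continuous_on[OF hol] sub]) simp
  then have "\<exists>B. \<forall>w\<in>cball 0 (rho 0). norm (f w) \<le> B" by (auto simp: bounded_iff)
  then have B: "\<forall>w\<in>cball 0 (rho 0). norm (f w) \<le> bound0" unfolding bound0_def by (rule someI_ex)
  have "norm (of_real (rho 0) * cis \<theta>) = rho 0" using rho[of 0] by (simp add: norm_mult)
  then show ?thesis using B rho[of 0] by (simp add: dil_def)
qed

text \<open>Dominates all dilates and the boundary function at almost every angle and is integrable,
  which turns the limits below into dominated convergence.\<close>

definition majorant :: "real \<Rightarrow> real" where "majorant \<theta> = bound0 + enn2real (radial_var \<theta>)"

lemma AE_radial_var: "AE \<theta> in circ. radial_var \<theta> < \<infinity>"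
  using nn_integral_PInf_AE[of radial_var circ] radial_var_integral by (simp add: less_top)

lemma integrable_majorant: "integrable circ majorant"
proof -
  have "integrable circ (\<lambda>\<theta>. enn2real (radial_var \<theta>))"
  proof (rule integrableI_nonneg)
    have "(\<integral>\<^sup>+\<theta>. ennreal (enn2real (radial_var \<theta>)) \<partial>circ) = (\<integral>\<^sup>+\<theta>. radial_var \<theta> \<partial>circ)"
      by (rule nn_integral_cong_AE) (use AE_radial_var in \<open>auto elim: AE_mp\<close>)
    then show "(\<integral>\<^sup>+\<theta>. ennreal (enn2real (radial_var \<theta>)) \<partial>circ) < \<infinity>" using radial_var_integral by simp
  qed auto
  then show ?thesis unfolding majorant_def[abs_def]
    by (intro Bochner_Integration.integrable_add finite_measure.integrable_const finite_measure_circ)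
qed

lemma dil_bound:
  assumes "radial_var \<theta> < \<infinity>" shows "norm (dil k (cis \<theta>)) \<le> majorant \<theta>"
proof -
  have "dil k (cis \<theta>) = dil 0 (cis \<theta>) + (\<Sum>j<k. dil (Suc j) (cis \<theta>) - dil j (cis \<theta>))" by (simp add: sum_lessThan_telescope[of "\<lambda>k. dil k (cis \<theta>)" k])
  then have "norm (dil k (cis \<theta>)) \<le> norm (dil 0 (cis \<theta>)) + norm (\<Sum>j<k. dil (Suc j) (cis \<theta>) - dil j (cis \<theta>))"
    by (metis norm_triangle_ineq)
  also have "norm (\<Sum>j<k. dil (Suc j) (cis \<theta>) - dil j (cis \<theta>)) \<le> (\<Sum>j<k. norm (dil (Suc j) (cis \<theta>) - dil j (cis \<theta>)))" by (rule norm_sum)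
  also have "\<dots> \<le> enn2real (radial_var \<theta>)" by (rule sum_increments_real[OF assms])
  finally show ?thesis using bound0[of \<theta>] by (simp add: majorant_def)
qed

lemma dil_tendsto:
  assumes "radial_var \<theta> < \<infinity>" shows "(\<lambda>k. dil k (cis \<theta>)) \<longlonglongrightarrow> bdry (cis \<theta>)"
proof -
  have "summable (\<lambda>k. norm (dil (Suc k) (cis \<theta>) - dil k (cis \<theta>)))"
    by (rule bounded_imp_summable[where B = "enn2real (radial_var \<theta>)"])
       (use sum_increments_real[OF assms, of "Suc n" for n] in \<open>auto simp: lessThan_Suc_atMost\<close>)
  then have "summable (\<lambda>k. dil (Suc k) (cis \<theta>) - dil k (cis \<theta>))" by (rule summable_norm_cancel)
  then have "convergent (\<lambda>n. \<Sum>k<n. dil (Suc k) (cis \<theta>) - dil k (cis \<theta>))" by (simp add: summable_iff_convergent)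
  then have "convergent (\<lambda>n. dil n (cis \<theta>) - dil 0 (cis \<theta>))" by (simp add: sum_lessThan_telescope[of "\<lambda>k. dil k (cis \<theta>)" for \<theta>])
  then have "convergent (\<lambda>n. dil n (cis \<theta>))" using convergent_diff_const_right_iff by blast
  then show ?thesis unfolding bdry_def by (rule convergent_LIMSEQ_iff[THEN iffD1])
qed

lemma bdry_bound:
  assumes "radial_var \<theta> < \<infinity>" shows "norm (bdry (cis \<theta>)) \<le> majorant \<theta>"
  by (rule LIMSEQ_le_const2[OF tendsto_norm[OF dil_tendsto[OF assms]]]) (use dil_bound[OF assms] in blast)

lemma AE_bdry: "AE \<theta> in circ. (\<lambda>k. dil k (cis \<theta>)) \<longlonglongrightarrow> bdry (cis \<theta>) \<and> norm (bdry (cis \<theta>)) \<le> majorant \<theta> \<and> (\<forall>k. norm (dil k (cis \<theta>)) \<le> majorant \<theta>)"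
  using AE_radial_var by eventually_elim (auto intro: dil_tendsto bdry_bound dil_bound)

lemma integrable_bdry: "integrable circ (\<lambda>\<theta>. bdry (cis \<theta>))"
  by (rule Bochner_Integration.integrable_bound[OF integrable_majorant]) (use AE_bdry in \<open>auto elim: AE_mp intro: order_trans[OF _ abs_ge_self]\<close>)

lemma dil_pair: "disc_pair (dil k) (\<lambda>z. of_real (rho k) * zext (deriv f) (of_real (rho k) * z)) (1 / rho k)"
  unfolding dil_def[abs_def] by (rule dilate_disc_pair[OF hol rho])

lemma cont_dil: "continuous_on (cball 0 1) (dil k)" and hol_dil: "dil k holomorphic_on ball 0 1"
proof -
  interpret disc_pair "dil k" "\<lambda>z. of_real (rho k) * zext (deriv f) (of_real (rho k) * z)" "1 / rho k" by (rule dil_pair)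
  show "continuous_on (cball 0 1) (dil k)" by (rule contF)
  show "dil k holomorphic_on ball 0 1" by (rule holomorphic_on_subset[OF holF]) (use R in auto)
qed

text \<open>The Poisson formula for dilates passes to the limit on both sides, by
  \<open>majorant\<close> on the circle and by continuity of f inside.\<close>

lemma Poisson_bdry:
  assumes z: "norm z < 1"
  shows "(\<integral>t. pk z t *\<^sub>R bdry (cis t) \<partial>circ) = 2 * pi * f z"
proof (rule LIMSEQ_unique)
  show "(\<lambda>k. \<integral>t. pk z t *\<^sub>R dil k (cis t) \<partial>circ) \<longlonglongrightarrow> (\<integral>t. pk z t *\<^sub>R bdry (cis t) \<partial>circ)"
    by (rule pk_dominated[OF z _ _ integrable_majorant]) (use AE_bdry in \<open>auto elim: AE_mp\<close>)
  have "(\<integral>t. pk z t *\<^sub>R dil k (cis t) \<partial>circ) = 2 * pi * dil k z" for k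
    using Poisson_integral(2)[OF cont_dil hol_dil z, of k] by (simp add: scaleR_conv_of_real)
  moreover have "(\<lambda>k. 2 * pi * dil k z) \<longlonglongrightarrow> 2 * pi * f z"
    unfolding dil_def by (intro tendsto_intros dilate_LIMSEQ[OF hol z])
  ultimately show "(\<lambda>k. \<integral>t. pk z t *\<^sub>R dil k (cis t) \<partial>circ) \<longlonglongrightarrow> 2 * pi * f z" by simp
qed

text \<open>For a dilate, \<open>exp_majorant\<close> supplies a harmonic function above the log
  modulus inside and below ln(|.| + e) + e on the circle. Adding \<open>e\<close> bounds the
  logarithm below by \<open>ln e\<close>, so the limit over the dilates is dominated.\<close>

lemma log_subharmonic_eps:
  assumes z: "norm z < 1" and fz: "f z \<noteq> 0" and e: "0 < e" "e \<le> 1"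
  shows "2 * pi * (ln (norm (f z)) - e) \<le> (\<integral>t. pk z t * ln (norm (bdry (cis t)) + e) \<partial>circ)"
proof -
  have "(\<lambda>k. \<integral>t. pk z t *\<^sub>R ln (norm (dil k (cis t)) + e) \<partial>circ) \<longlonglongrightarrow> (\<integral>t. pk z t *\<^sub>R ln (norm (bdry (cis t)) + e) \<partial>circ)"
  proof (rule pk_dominated[OF z, where w = "\<lambda>t. \<bar>ln e\<bar> + majorant t + 1"])
    show "integrable circ (\<lambda>t. \<bar>ln e\<bar> + majorant t + 1)"
      by (intro Bochner_Integration.integrable_add integrable_majorant finite_measure.integrable_const finite_measure_circ)
    show "AE t in circ. (\<lambda>k. ln (norm (dil k (cis t)) + e)) \<longlonglongrightarrow> ln (norm (bdry (cis t)) + e)"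
      using AE_bdry
    proof eventually_elim
      case (elim t)
      have "norm (bdry (cis t)) + e \<noteq> 0" using e norm_ge_zero[of "bdry (cis t)"] by linarith
      then show ?case using elim by (intro tendsto_intros) auto
    qed
    show "AE t in circ. norm (ln (norm (dil k (cis t)) + e)) \<le> \<bar>ln e\<bar> + majorant t + 1" for k
      using AE_bdry
    proof eventually_elim
      case (elim t)
      then have "norm (dil k (cis t)) \<le> majorant t" by blast
      then show ?case using abs_ln_add_le[of "norm (dil k (cis t))" e] e by simp
    qed
  qed measurable
  then have L: "(\<lambda>k. \<integral>t. pk z t * ln (norm (dil k (cis t)) + e) \<partial>circ) \<longlonglongrightarrow> (\<integral>t. pk z t * ln (norm (bdry (cis t)) + e) \<partial>circ)" by simp
  have R: "(\<lambda>k. 2 * pi * (ln (norm (dil k z)) - e)) \<longlonglongrightarrow> 2 * pi * (ln (norm (f z)) - e)"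
    unfolding dil_def by (intro tendsto_intros dilate_LIMSEQ[OF hol z]) (use fz in auto)
  have "\<forall>\<^sub>F k in sequentially. dil k z \<noteq> 0"
    unfolding dil_def using dilate_LIMSEQ[OF hol z] fz by (rule tendsto_imp_eventually_ne)
  then have "\<forall>\<^sub>F k in sequentially. 2 * pi * (ln (norm (dil k z)) - e) \<le> (\<integral>t. pk z t * ln (norm (dil k (cis t)) + e) \<partial>circ)"
  proof eventually_elim
    case (elim k)
    obtain q where q: "q holomorphic_on UNIV" "\<And>w. norm w \<le> 1 \<Longrightarrow> norm (dil k w) \<le> exp (Re (q w))"
      "\<And>w. norm w = 1 \<Longrightarrow> Re (q w) \<le> ln (norm (dil k w) + e) + e"
      using exp_majorant[OF cont_dil hol_dil e(1), of k] by metis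
    have cq: "continuous_on (cball 0 1) q" and hq: "q holomorphic_on ball 0 1"
      using q(1) by (auto intro: continuous_on_subset[OF holomorphic_on_imp_continuous_on] holomorphic_on_subset)
    note PI = Poisson_integral[OF cq hq z]
    have "2 * pi * Re (q z) = Re (2 * pi * q z)" by simp
    also have "\<dots> = (\<integral>t. Re (of_real (pk z t) * q (cis t)) \<partial>circ)"
      unfolding PI(2)[symmetric] by (rule integral_Re[symmetric, OF PI(1)])
    also have "\<dots> \<le> (\<integral>t. pk z t * (ln (norm (dil k (cis t)) + e) + e) \<partial>circ)"
    proof (rule integral_mono)
      show "integrable circ (\<lambda>t. Re (of_real (pk z t) * q (cis t)))" by (rule integrable_Re[OF PI(1)])
      have "continuous_on UNIV (\<lambda>t. dil k (cis t))"
        by (rule continuous_on_compose2[OF cont_dil]) (auto intro!: continuous_intros)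
      moreover have "norm x + e \<noteq> 0" for x :: complex using e norm_ge_zero[of x] by linarith
      ultimately show "integrable circ (\<lambda>t. pk z t * (ln (norm (dil k (cis t)) + e) + e))"
        by (intro circ_integrable_continuous continuous_intros continuous_pk z) auto
      fix t :: real
      have "pk z t * Re (q (cis t)) \<le> pk z t * (ln (norm (dil k (cis t)) + e) + e)"
        by (intro mult_left_mono q(3) pk_nonneg) (use z in auto)
      then show "Re (of_real (pk z t) * q (cis t)) \<le> pk z t * (ln (norm (dil k (cis t)) + e) + e)" by simp
    qed
    also have "\<dots> = (\<integral>t. pk z t * ln (norm (dil k (cis t)) + e) + pk z t * e \<partial>circ)" by (simp add: distrib_left)
    also have "\<dots> = (\<integral>t. pk z t * ln (norm (dil k (cis t)) + e) \<partial>circ) + (\<integral>t. pk z t * e \<partial>circ)"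
    proof (rule Bochner_Integration.integral_add)
      have "continuous_on UNIV (\<lambda>t. dil k (cis t))"
        by (rule continuous_on_compose2[OF cont_dil]) (auto intro!: continuous_intros)
      moreover have "norm x + e \<noteq> 0" for x :: complex using e norm_ge_zero[of x] by linarith
      ultimately show "integrable circ (\<lambda>t. pk z t * ln (norm (dil k (cis t)) + e))"
        by (intro circ_integrable_continuous continuous_intros continuous_pk z) auto
      show "integrable circ (\<lambda>t. pk z t * e)" using pk_integral(1)[OF z] by simp
    qed
    also have "(\<integral>t. pk z t * e \<partial>circ) = 2 * pi * e" using pk_integral[OF z] by simp
    finally have up: "2 * pi * Re (q z) \<le> (\<integral>t. pk z t * ln (norm (dil k (cis t)) + e) \<partial>circ) + 2 * pi * e" .
    have "ln (norm (dil k z)) \<le> Re (q z)"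
      using q(2)[of z] z elim by (metis exp_le_cancel_iff exp_ln less_imp_le zero_less_norm_iff)
    then have "2 * pi * ln (norm (dil k z)) \<le> 2 * pi * Re (q z)" by (intro mult_left_mono) auto
    then show ?case using up unfolding right_diff_distrib by linarith
  qed
  from tendsto_le[OF _ L R this] show ?thesis by simp
qed

text \<open>As e tends to 0 the logarithm loses its lower bound, so Fatou is applied to the
  nonnegative function |bdry| + 1 - ln(|bdry| + e). Finiteness of the limit excludes zeros of the
  boundary function on a set of positive measure, since there the integrand grows without
  bound.\<close>

lemma log_integral_bound:
  assumes z: "norm z < 1" and fz: "f z \<noteq> 0"
  shows "AE t in circ. bdry (cis t) \<noteq> 0" (is ?A)
    and "(\<integral>\<^sup>+t. ennreal (pk z t * (norm (bdry (cis t)) + 1 - ln (norm (bdry (cis t))))) \<partial>circ)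
      \<le> ennreal ((\<integral>t. pk z t * (norm (bdry (cis t)) + 1) \<partial>circ) - 2 * pi * ln (norm (f z)))" (is ?B)
proof -
  define e where "e k = 1 / real (Suc k)" for k
  have e: "e k > 0" "e k \<le> 1" for k by (auto simp: e_def)
  have e0: "e \<longlonglongrightarrow> 0" unfolding e_def by (rule LIMSEQ_Suc[OF lim_1_over_n])
  define W where "W t = norm (bdry (cis t)) + 1" for t
  define v where "v k t = ln (norm (bdry (cis t)) + e k)" for k t
  have [measurable]: "W \<in> borel_measurable borel" "v k \<in> borel_measurable borel" for k
    unfolding W_def[abs_def] v_def[abs_def] by measurable
  have iW: "integrable circ W" unfolding W_def[abs_def]
    by (intro Bochner_Integration.integrable_add integrable_norm integrable_bdry finite_measure.integrable_const finite_measure_circ)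
  have iv: "integrable circ (v k)" for k
  proof (rule Bochner_Integration.integrable_bound[where f = "\<lambda>t. \<bar>ln (e k)\<bar> + norm (bdry (cis t)) + 1"])
    show "integrable circ (\<lambda>t. \<bar>ln (e k)\<bar> + norm (bdry (cis t)) + 1)"
      by (intro Bochner_Integration.integrable_add integrable_norm integrable_bdry finite_measure.integrable_const finite_measure_circ)
    show "AE t in circ. norm (v k t) \<le> norm (\<bar>ln (e k)\<bar> + norm (bdry (cis t)) + 1)"
      using abs_ln_add_le[OF norm_ge_zero e] by (auto simp: v_def intro!: AE_I2)
  qed measurable
  have vW: "v k t \<le> W t" for k t
    using ln_le_minus_one[of "norm (bdry (cis t)) + e k"] e[of k] by (simp add: v_def W_def add_nonneg_pos)
  have pk0: "pk z t \<ge> 0" for t using z by (intro pk_nonneg) auto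
  define X where "X = (\<integral>t. pk z t * W t \<partial>circ)"
  have step: "(\<integral>\<^sup>+t. ennreal (pk z t * (W t - v k t)) \<partial>circ) \<le> ennreal (X - 2 * pi * (ln (norm (f z)) - e k))" for k
  proof -
    have i1: "integrable circ (\<lambda>t. pk z t * W t)" using integrable_pk_mult[OF z iW] by simp
    have i2: "integrable circ (\<lambda>t. pk z t * v k t)" using integrable_pk_mult[OF z iv] by simp
    have i: "integrable circ (\<lambda>t. pk z t * (W t - v k t))" using Bochner_Integration.integrable_diff[OF i1 i2] by (simp add: right_diff_distrib)
    have "(\<integral>\<^sup>+t. ennreal (pk z t * (W t - v k t)) \<partial>circ) = ennreal (\<integral>t. pk z t * (W t - v k t) \<partial>circ)"
      by (rule nn_integral_eq_integral[OF i]) (use pk0 vW in auto)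
    also have "(\<integral>t. pk z t * (W t - v k t) \<partial>circ) = X - (\<integral>t. pk z t * v k t \<partial>circ)"
      unfolding X_def using Bochner_Integration.integral_diff[OF i1 i2] by (simp add: right_diff_distrib)
    also have "ennreal \<dots> \<le> ennreal (X - 2 * pi * (ln (norm (f z)) - e k))"
      using log_subharmonic_eps[OF z fz e, of k] by (intro ennreal_leI) (simp add: v_def)
    finally show ?thesis .
  qed
  have lim: "liminf (\<lambda>k. \<integral>\<^sup>+t. ennreal (pk z t * (W t - v k t)) \<partial>circ) \<le> ennreal (X - 2 * pi * ln (norm (f z)))"
  proof -
    have "liminf (\<lambda>k. \<integral>\<^sup>+t. ennreal (pk z t * (W t - v k t)) \<partial>circ) \<le> liminf (\<lambda>k. ennreal (X - 2 * pi * (ln (norm (f z)) - e k)))"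
      by (rule Liminf_mono) (use step in auto)
    also have "(\<lambda>k. ennreal (X - 2 * pi * (ln (norm (f z)) - e k))) \<longlonglongrightarrow> ennreal (X - 2 * pi * (ln (norm (f z)) - 0))"
      by (intro tendsto_intros tendsto_ennrealI e0)
    then have "liminf (\<lambda>k. ennreal (X - 2 * pi * (ln (norm (f z)) - e k))) = ennreal (X - 2 * pi * ln (norm (f z)))"
      by (subst lim_imp_Liminf) auto
    finally show ?thesis .
  qed
  have Fat: "(\<integral>\<^sup>+t. liminf (\<lambda>k. ennreal (pk z t * (W t - v k t))) \<partial>circ) \<le> ennreal (X - 2 * pi * ln (norm (f z)))"
    by (rule order_trans[OF nn_integral_liminf lim]) measurable
  then have fin: "(\<integral>\<^sup>+t. liminf (\<lambda>k. ennreal (pk z t * (W t - v k t))) \<partial>circ) \<noteq> \<infinity>"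
    by (metis ennreal_neq_top infinity_ennreal_def neq_top_trans)
  have "AE t in circ. liminf (\<lambda>k. ennreal (pk z t * (W t - v k t))) \<noteq> \<infinity>"
    by (rule nn_integral_PInf_AE[OF _ fin]) measurable
  then show ?A
  proof eventually_elim
    case (elim t)
    show "bdry (cis t) \<noteq> 0"
    proof
      assume b0: "bdry (cis t) = 0"
      \<comment> \<open>At a boundary zero \<open>v k t\<close> is ln of 1 / (k+1), and the kernel
        is strictly positive, so the integrands diverge.\<close>
      have "filterlim (\<lambda>k. pk z t * (W t - v k t)) at_top sequentially"
      proof (rule filterlim_tendsto_pos_mult_at_top[OF tendsto_const pk_pos[OF z]])
        have "filterlim (\<lambda>k. ln (real (Suc k))) at_top sequentially"
          by (rule filterlim_compose[OF ln_at_top]) (rule filterlim_compose[OF filterlim_real_sequentially filterlim_Suc])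
        then show "filterlim (\<lambda>k. W t - v k t) at_top sequentially"
        proof (rule filterlim_at_top_mono)
          show "\<forall>\<^sub>F k in sequentially. ln (real (Suc k)) \<le> W t - v k t"
            by (intro always_eventually allI) (simp add: W_def v_def b0 e_def ln_div)
        qed
      qed
      then have "((\<lambda>k. ennreal (pk z t * (W t - v k t))) \<longlongrightarrow> \<infinity>) sequentially"
        by (simp add: ennreal_tendsto_top_eq_at_top)
      then have "liminf (\<lambda>k. ennreal (pk z t * (W t - v k t))) = \<infinity>" by (intro lim_imp_Liminf) auto
      then show False using elim by simp
    qed
  qed
  then have "(\<integral>\<^sup>+t. ennreal (pk z t * (norm (bdry (cis t)) + 1 - ln (norm (bdry (cis t))))) \<partial>circ) \<le> (\<integral>\<^sup>+t. liminf (\<lambda>k. ennreal (pk z t * (W t - v k t))) \<partial>circ)"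
  proof (intro nn_integral_mono_AE, eventually_elim)
    case (elim t)
    have "(\<lambda>k. norm (bdry (cis t)) + e k) \<longlonglongrightarrow> norm (bdry (cis t)) + 0" by (intro tendsto_intros e0)
    then have "(\<lambda>k. v k t) \<longlonglongrightarrow> ln (norm (bdry (cis t)))" unfolding v_def using elim by (intro tendsto_ln) auto
    then have "(\<lambda>k. ennreal (pk z t * (W t - v k t))) \<longlonglongrightarrow> ennreal (pk z t * (W t - ln (norm (bdry (cis t)))))"
      by (intro tendsto_ennrealI tendsto_intros)
    then show ?case using le_liminf_tendsto by (fastforce simp: W_def)
  qed
  then show ?B using Fat by (simp add: X_def W_def)
qed

end

section \<open>The outer part\<close>

lemma pk_lower:
  assumes "norm z < 1" shows "(1 - norm z) / 4 \<le> pk z t"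
proof -
  have "norm (cis t - z) \<le> 2" using norm_triangle_ineq4[of "cis t" z] assms by simp
  then have "(norm (cis t - z))\<^sup>2 \<le> 2\<^sup>2" by (intro power_mono) auto
  moreover have "norm (cis t - z) > 0" using cis_neq[OF assms, of t] by simp
  moreover have "1 - norm z \<le> 1 - (norm z)\<^sup>2" using assms by (simp add: power2_eq_square mult_left_le)
  ultimately show ?thesis unfolding pk_def using assms by (intro frac_le) auto
qed

text \<open>The Herglotz transform: its real part is the Poisson integral of \<open>u\<close>, and
  an outer function is its exponential for u the logarithm of the weight.\<close>

definition herg :: "(real \<Rightarrow> real) \<Rightarrow> complex \<Rightarrow> complex" where
  "herg u z = 1 / (2 * of_real pi) * (\<integral>t. (cis t + z) / (cis t - z) * of_real (u t) \<partial>circ)"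

lemma integrable_herg_kernel:
  assumes z: "norm z < 1" and u: "integrable circ u" and [measurable]: "g \<in> borel_measurable borel" and g: "\<And>t. norm (g t) \<le> B"
  shows "integrable circ (\<lambda>t. (g t :: complex) * of_real (u t))"
proof (rule Bochner_Integration.integrable_bound)
  show "integrable circ (\<lambda>t. B * u t)" using u by simp
  have "u \<in> borel_measurable circ" using u by (rule borel_measurable_integrable)
  then have [measurable]: "u \<in> borel_measurable borel" by simp
  show "(\<lambda>t. g t * of_real (u t)) \<in> borel_measurable circ" by measurable
  show "AE t in circ. norm (g t * of_real (u t)) \<le> norm (B * u t)"
    using order_trans[OF norm_ge_zero g] by (intro AE_I2) (simp add: norm_mult abs_mult mult_right_mono g)
qed

text \<open>The difference quotient of the kernel minus its derivative has the closed form 2 cis t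
  (w - z) / ((cis t - w)(cis t - z)^2). The error is therefore an integral of size O(|w -
  z|).\<close>

lemma herg_deriv:
  assumes z: "norm z < 1" and u: "integrable circ u"
  shows "(herg u has_field_derivative 1 / (2 * of_real pi) * (\<integral>t. 2 * cis t / (cis t - z)\<^sup>2 * of_real (u t) \<partial>circ)) (at z)"
proof -
  define J where "J w = (\<integral>t. (cis t + w) / (cis t - w) * of_real (u t) \<partial>circ)" for w
  define D where "D = (\<integral>t. 2 * cis t / (cis t - z)\<^sup>2 * of_real (u t) \<partial>circ)"
  \<comment> \<open>Half the distance of \<open>z\<close> to the circle: for w within
    \<open>d\<close> of \<open>z\<close> the two denominators stay at least \<open>d\<close> and
    \<open>2 * d\<close>.\<close>
  define d where "d = (1 - norm z) / 2"
  have d: "d > 0" using z by (simp add: d_def)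
  have iJ: "integrable circ (\<lambda>t. (cis t + w) / (cis t - w) * of_real (u t))" if w: "norm w < 1" for w
  proof (rule integrable_herg_kernel[OF w u, where B = "2 / (1 - norm w)"])
    show "norm ((cis t + w) / (cis t - w)) \<le> 2 / (1 - norm w)" for t
      unfolding norm_divide using norm_triangle_ineq[of "cis t" w] norm_cis_diff_ge[of w t] w by (intro frac_le) auto
  qed measurable
  have lower: "norm (cis t - z) \<ge> 2 * d" for t using norm_cis_diff_ge[of z t] by (simp add: d_def)
  have iD: "integrable circ (\<lambda>t. 2 * cis t / (cis t - z)\<^sup>2 * of_real (u t))"
  proof (rule integrable_herg_kernel[OF z u, where B = "2 / (2 * d)\<^sup>2"])
    show "norm (2 * cis t / (cis t - z)\<^sup>2) \<le> 2 / (2 * d)\<^sup>2" for t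
      unfolding norm_divide norm_mult norm_power using lower[of t] d by (intro frac_le power_mono) auto
  qed measurable
  define B where "B = 2 / (d * (2 * d)\<^sup>2) * (\<integral>t. \<bar>u t\<bar> \<partial>circ)"
  have est: "norm ((J w - J z) / (w - z) - D) \<le> B * norm (w - z)" if w: "w \<noteq> z" "norm (w - z) < d" for w
  proof -
    have w1: "norm w < 1" using w norm_triangle_ineq2[of w z] z by (simp add: d_def)
    have lw: "norm (cis t - w) \<ge> d" for t
      using norm_triangle_ineq4[of "cis t - w" "z - w"] lower[of t] w by (simp add: norm_minus_commute)
    have id: "(((cis t + w) / (cis t - w) - (cis t + z) / (cis t - z)) / (w - z) - 2 * cis t / (cis t - z)\<^sup>2)
      = 2 * cis t * (w - z) / ((cis t - w) * (cis t - z)\<^sup>2)" for t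
    proof -
      have alg: "((c + w) / a - (c + z) / b) / (w - z) - 2 * c / b\<^sup>2 = 2 * c * (w - z) / (a * b\<^sup>2)"
        if "a = c - w" "b = c - z" "a \<noteq> 0" "b \<noteq> 0" for a b c :: complex
      proof -
        have "(c + w) / a - (c + z) / b = 2 * c * (w - z) / (a * b)"
          using that(3,4) by (simp add: field_simps) (simp add: that(1,2) algebra_simps)
        then have "((c + w) / a - (c + z) / b) / (w - z) = 2 * c / (a * b)" using w by simp
        moreover have "2 * c / (a * b) - 2 * c / b\<^sup>2 = 2 * c * (b - a) / (a * b\<^sup>2)"
          using that(3,4) by (simp add: field_simps power2_eq_square)
        moreover have "b - a = w - z" using that by simp
        ultimately show ?thesis by simp
      qed
      show ?thesis by (rule alg) (use cis_neq[OF w1] cis_neq[OF z] in auto)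
    qed
    have e1: "(J w - J z) / (w - z) - D = (\<integral>t. 2 * cis t * (w - z) / ((cis t - w) * (cis t - z)\<^sup>2) * of_real (u t) \<partial>circ)"
    proof -
      define A where "A = (\<lambda>w t. (cis t + w) / (cis t - w) * of_real (u t))"
      define D' where "D' = (\<lambda>t. 2 * cis t / (cis t - z)\<^sup>2 * of_real (u t))"
      have iA: "integrable circ (A w)" "integrable circ (A z)" and iD': "integrable circ D'"
        unfolding A_def D'_def by (rule iJ[OF w1] iJ[OF z] iD)+
      have alg: "e * x = (a * x - b * x) / q - c * x" if h: "(a - b) / q - c = e" for a b c e q x :: complex
        unfolding h[symmetric] left_diff_distrib[symmetric] by (simp add: left_diff_distrib)
      have "(\<integral>t. 2 * cis t * (w - z) / ((cis t - w) * (cis t - z)\<^sup>2) * of_real (u t) \<partial>circ) = (\<integral>t. (A w t - A z t) / (w - z) - D' t \<partial>circ)"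
        unfolding A_def D'_def by (rule Bochner_Integration.integral_cong[OF refl alg[OF id]])
      also have "\<dots> = (\<integral>t. (A w t - A z t) / (w - z) \<partial>circ) - (\<integral>t. D' t \<partial>circ)"
        by (intro Bochner_Integration.integral_diff integrable_divide_zero Bochner_Integration.integrable_diff iA iD')
      also have "(\<integral>t. (A w t - A z t) / (w - z) \<partial>circ) = (\<integral>t. A w t - A z t \<partial>circ) / (w - z)" by simp
      also have "(\<integral>t. A w t - A z t \<partial>circ) = (\<integral>t. A w t \<partial>circ) - (\<integral>t. A z t \<partial>circ)"
        by (intro Bochner_Integration.integral_diff iA)
      finally show ?thesis by (simp add: J_def D_def A_def D'_def)
    qed
    have "norm (\<integral>t. 2 * cis t * (w - z) / ((cis t - w) * (cis t - z)\<^sup>2) * of_real (u t) \<partial>circ) \<le> (\<integral>t. 2 / (d * (2 * d)\<^sup>2) * norm (w - z) * \<bar>u t\<bar> \<partial>circ)"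
    proof (rule Bochner_Integration.integral_norm_bound_integral)
      have b: "norm (2 * cis t * (w - z) / ((cis t - w) * (cis t - z)\<^sup>2)) \<le> 2 / (d * (2 * d)\<^sup>2) * norm (w - z)" for t
      proof -
        have "d * (2 * d)\<^sup>2 \<le> norm (cis t - w) * (norm (cis t - z))\<^sup>2"
          using lower[of t] lw[of t] d by (intro mult_mono power_mono) auto
        then have "2 * norm (w - z) / (norm (cis t - w) * (norm (cis t - z))\<^sup>2) \<le> 2 * norm (w - z) / (d * (2 * d)\<^sup>2)"
          using d cis_neq[OF w1, of t] cis_neq[OF z, of t] by (intro divide_left_mono mult_pos_pos zero_less_power) simp_all
        then show ?thesis by (simp add: norm_divide norm_mult norm_power)
      qed
      show "integrable circ (\<lambda>t. 2 * cis t * (w - z) / ((cis t - w) * (cis t - z)\<^sup>2) * of_real (u t))"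
        by (rule integrable_herg_kernel[OF z u _ b]) measurable
      show "integrable circ (\<lambda>t. 2 / (d * (2 * d)\<^sup>2) * norm (w - z) * \<bar>u t\<bar>)" using u by simp
      show "norm (2 * cis t * (w - z) / ((cis t - w) * (cis t - z)\<^sup>2) * of_real (u t)) \<le> 2 / (d * (2 * d)\<^sup>2) * norm (w - z) * \<bar>u t\<bar>" for t
        unfolding norm_mult[of _ "of_real (u t)"] norm_of_real by (intro mult_right_mono b) simp
    qed
    then show ?thesis unfolding e1 B_def by (simp add: mult_ac)
  qed
  have "((\<lambda>w. (J w - J z) / (w - z) - D) \<longlongrightarrow> 0) (at z)"
  proof (rule Lim_null_comparison)
    show "\<forall>\<^sub>F w in at z. norm ((J w - J z) / (w - z) - D) \<le> B * norm (w - z)"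
      unfolding eventually_at using d est by (intro exI[of _ d]) (auto simp: dist_norm)
    have "((\<lambda>w. B * norm (w - z)) \<longlongrightarrow> B * norm (z - z)) (at z)" by (intro tendsto_intros)
    then show "((\<lambda>w. B * norm (w - z)) \<longlongrightarrow> 0) (at z)" by simp
  qed
  then have "(J has_field_derivative D) (at z)"
    unfolding has_field_derivative_iff by (rule LIM_zero_cancel)
  then have "((\<lambda>w. 1 / (2 * of_real pi) * J w) has_field_derivative 1 / (2 * of_real pi) * D) (at z)" by (rule DERIV_cmult)
  then show ?thesis unfolding herg_def[abs_def] J_def D_def .
qed

lemma herg_holomorphic:
  assumes "integrable circ u" shows "herg u holomorphic_on ball 0 1"
  unfolding holomorphic_on_open[OF open_ball]
proof (intro ballI)
  fix z :: complex assume "z \<in> ball 0 1"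
  then have "norm z < 1" by simp
  from herg_deriv[OF this assms] show "\<exists>f'. (herg u has_field_derivative f') (at z)" by (rule exI)
qed

lemma Re_herg:
  assumes z: "norm z < 1" and u: "integrable circ u"
  shows "Re (herg u z) = (\<integral>t. pk z t * u t \<partial>circ) / (2 * pi)"
proof -
  have Re_kernel: "Re ((cis t + z) / (cis t - z)) = pk z t" for t
  proof -
    have "Re ((cis t + z) / (cis t - z)) = Re ((cis t + z) * cnj (cis t - z)) / (norm (cis t - z))\<^sup>2"
      by (subst complex_div_cnj) (simp only: of_real_power[symmetric] Re_divide_of_real)
    also have "Re ((cis t + z) * cnj (cis t - z)) = ((cos t)\<^sup>2 + (sin t)\<^sup>2) - ((Re z)\<^sup>2 + (Im z)\<^sup>2)"
      by (simp add: algebra_simps power2_eq_square)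
    also have "\<dots> = 1 - (norm z)\<^sup>2" unfolding cmod_power2 sin_cos_squared_add2 ..
    finally show ?thesis by (simp add: pk_def)
  qed
  have "integrable circ (\<lambda>t. (cis t + z) / (cis t - z) * of_real (u t))"
  proof (rule integrable_herg_kernel[OF z u, where B = "2 / (1 - norm z)"])
    show "norm ((cis t + z) / (cis t - z)) \<le> 2 / (1 - norm z)" for t
      unfolding norm_divide using norm_triangle_ineq[of "cis t" z] norm_cis_diff_ge[of z t] z by (intro frac_le) auto
  qed measurable
  then have "Re (\<integral>t. (cis t + z) / (cis t - z) * of_real (u t) \<partial>circ) = (\<integral>t. Re ((cis t + z) / (cis t - z) * of_real (u t)) \<partial>circ)"
    by (rule integral_Re[symmetric])
  also have "\<dots> = (\<integral>t. pk z t * u t \<partial>circ)"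
    by (intro Bochner_Integration.integral_cong refl)
       (simp only: times_complex.sel Re_complex_of_real Im_complex_of_real Re_kernel mult_zero_right diff_zero)
  finally have "Re (\<integral>t. (cis t + z) / (cis t - z) * of_real (u t) \<partial>circ) = (\<integral>t. pk z t * u t \<partial>circ)" .
  moreover have "1 / (2 * of_real pi) * x = x / of_real (2 * pi)" for x :: complex by simp
  ultimately show ?thesis unfolding herg_def by (simp del: of_real_mult)
qed

text \<open>Integrate the tangent line of \<open>exp\<close> at the Poisson mean of \<open>u\<close>, which lies below \<open>exp\<close>.\<close>
lemma exp_Poisson_le:
  assumes z: "norm z < 1" and u: "integrable circ u" and g: "integrable circ g" and le: "AE t in circ. exp (u t) \<le> g t"
  shows "exp ((\<integral>t. pk z t * u t \<partial>circ) / (2 * pi)) \<le> (\<integral>t. pk z t * g t \<partial>circ) / (2 * pi)"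
proof -
  define c where "c = (\<integral>t. pk z t * u t \<partial>circ) / (2 * pi)"
  have iu: "integrable circ (\<lambda>t. pk z t * u t)" and ig: "integrable circ (\<lambda>t. pk z t * g t)"
    using integrable_pk_mult[OF z u] integrable_pk_mult[OF z g] by simp_all
  note ip = pk_integral[OF z]
  have split: "exp c * (pk z t * u t) + exp c * (1 - c) * pk z t = pk z t * (exp c * (1 + u t - c))" for t by (simp add: algebra_simps)
  have "2 * pi * exp c = exp c * (2 * pi * c) + exp c * (1 - c) * (2 * pi)" by (simp add: algebra_simps)
  also have "\<dots> = (\<integral>t. exp c * (pk z t * u t) + exp c * (1 - c) * pk z t \<partial>circ)"
    using iu ip by (simp add: c_def)
  also have "\<dots> = (\<integral>t. pk z t * (exp c * (1 + u t - c)) \<partial>circ)" unfolding split ..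
  also have "\<dots> \<le> (\<integral>t. pk z t * g t \<partial>circ)"
  proof (rule integral_mono_AE[OF _ ig])
    show "integrable circ (\<lambda>t. pk z t * (exp c * (1 + u t - c)))" unfolding split[symmetric] using iu ip by simp
    show "AE t in circ. pk z t * (exp c * (1 + u t - c)) \<le> pk z t * g t"
      using le
    proof eventually_elim
      case (elim t)
      have "exp c * (1 + (u t - c)) \<le> exp c * exp (u t - c)" by (intro mult_left_mono exp_ge_add_one_self) simp
      also have "\<dots> = exp (u t)" by (simp add: exp_diff)
      finally have "exp c * (1 + u t - c) \<le> g t" using elim by (simp add: algebra_simps)
      then show ?case using z by (intro mult_left_mono pk_nonneg) auto
    qed
  qed
  finally show ?thesis unfolding c_def[symmetric] by (simp add: field_simps)
qed

context besov_fn begin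

text \<open>The double integral estimate for dilates passes to the limit by Fatou in each of the
  three variables, almost everywhere convergence being needed only in the boundary angle.\<close>

lemma bdry_double_integral:
  "(\<integral>\<^sup>+r. \<integral>\<^sup>+\<theta>. \<integral>\<^sup>+\<tau>. ennreal (norm (bdry (cis \<tau>) - zext f (of_real r * cis \<theta>)) powr p * (1 - r) powr (\<alpha> - p + 1) / (norm (cis \<tau> - of_real r * cis \<theta>))\<^sup>2)
          \<partial>circ \<partial>circ \<partial>rad) < \<infinity>"
proof -
  obtain C where C: "double_integral_bound p \<alpha> C" using double_integral_bound_exists[OF p \<alpha>] .
  define U where "U k r \<theta> \<tau> = ennreal (norm (dil k (cis \<tau>) - dil k (of_real r * cis \<theta>)) powr p * (1 - r) powr (\<alpha> - p + 1) / (norm (cis \<tau> - of_real r * cis \<theta>))\<^sup>2)" for k and r \<theta> \<tau> :: real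
  define V where "V r \<theta> \<tau> = ennreal (norm (bdry (cis \<tau>) - zext f (of_real r * cis \<theta>)) powr p * (1 - r) powr (\<alpha> - p + 1) / (norm (cis \<tau> - of_real r * cis \<theta>))\<^sup>2)" for r \<theta> \<tau> :: real
  have [measurable]: "(\<lambda>\<tau>. U k r \<theta> \<tau>) \<in> borel_measurable borel"
     "(\<lambda>\<theta>. \<integral>\<^sup>+\<tau>. U k r \<theta> \<tau> \<partial>circ) \<in> borel_measurable borel"
     "(\<lambda>r. \<integral>\<^sup>+\<theta>. \<integral>\<^sup>+\<tau>. U k r \<theta> \<tau> \<partial>circ \<partial>circ) \<in> borel_measurable borel" for k r \<theta>
    unfolding U_def by measurable
  have b: "(\<integral>\<^sup>+r. \<integral>\<^sup>+\<theta>. \<integral>\<^sup>+\<tau>. U k r \<theta> \<tau> \<partial>circ \<partial>circ \<partial>rad) \<le> ennreal C * Besov_int p \<alpha> f" for k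
    unfolding U_def dil_def by (rule dilate_double_integral[OF C p hol rho])
  have V3: "V r \<theta> \<tau> \<le> liminf (\<lambda>k. U k r \<theta> \<tau>)" if r: "0 \<le> r" "r < 1" and lim: "(\<lambda>k. dil k (cis \<tau>)) \<longlonglongrightarrow> bdry (cis \<tau>)" for r \<theta> \<tau>
  proof -
    have n: "norm (of_real r * cis \<theta>) < 1" using r by (simp add: norm_mult)
    have "(\<lambda>k. dil k (of_real r * cis \<theta>)) \<longlonglongrightarrow> zext f (of_real r * cis \<theta>)"
      unfolding dil_def zext_eq[OF n] by (rule dilate_LIMSEQ[OF hol n])
    then have "(\<lambda>k. U k r \<theta> \<tau>) \<longlonglongrightarrow> V r \<theta> \<tau>"
      unfolding U_def V_def using p cis_neq[OF n, of \<tau>] lim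
      by (intro tendsto_ennrealI tendsto_intros tendsto_powr') auto
    then show ?thesis by (rule le_liminf_tendsto)
  qed
  have "(\<integral>\<^sup>+r. \<integral>\<^sup>+\<theta>. \<integral>\<^sup>+\<tau>. V r \<theta> \<tau> \<partial>circ \<partial>circ \<partial>rad) \<le> liminf (\<lambda>k. \<integral>\<^sup>+r. \<integral>\<^sup>+\<theta>. \<integral>\<^sup>+\<tau>. U k r \<theta> \<tau> \<partial>circ \<partial>circ \<partial>rad)"
  proof (rule Fatou_le)
    have "(\<integral>\<^sup>+\<theta>. \<integral>\<^sup>+\<tau>. V r \<theta> \<tau> \<partial>circ \<partial>circ) \<le> liminf (\<lambda>k. \<integral>\<^sup>+\<theta>. \<integral>\<^sup>+\<tau>. U k r \<theta> \<tau> \<partial>circ \<partial>circ)" if r: "0 \<le> r" "r < 1" for r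
    proof (rule Fatou_le)
      have "(\<integral>\<^sup>+\<tau>. V r \<theta> \<tau> \<partial>circ) \<le> liminf (\<lambda>k. \<integral>\<^sup>+\<tau>. U k r \<theta> \<tau> \<partial>circ)" for \<theta>
        by (rule Fatou_le) (measurable, use AE_bdry V3[OF r] in \<open>auto elim: AE_mp\<close>)
      then show "AE \<theta> in circ. (\<integral>\<^sup>+\<tau>. V r \<theta> \<tau> \<partial>circ) \<le> liminf (\<lambda>k. \<integral>\<^sup>+\<tau>. U k r \<theta> \<tau> \<partial>circ)" by simp
    qed measurable
    then show "AE r in rad. (\<integral>\<^sup>+\<theta>. \<integral>\<^sup>+\<tau>. V r \<theta> \<tau> \<partial>circ \<partial>circ) \<le> liminf (\<lambda>k. \<integral>\<^sup>+\<theta>. \<integral>\<^sup>+\<tau>. U k r \<theta> \<tau> \<partial>circ \<partial>circ)"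
      unfolding rad_def by (simp add: AE_lint)
  qed (simp add: rad_def)
  also have "\<dots> \<le> ennreal C * Besov_int p \<alpha> f" by (rule liminf_le_const[OF b])
  also have "\<dots> < \<infinity>" using BI by (simp add: ennreal_mult_less_top)
  finally show ?thesis unfolding V_def .
qed

lemma bdry_powr_integral: "(\<integral>\<^sup>+t. ennreal (norm (bdry (cis t)) powr p) \<partial>circ) < \<infinity>"
proof -
  obtain M where M: "M \<ge> 0" "\<And>r. 0 \<le> r \<Longrightarrow> r < 1 \<Longrightarrow> (\<integral>\<^sup>+\<theta>. ennreal (norm (f (of_real r * cis \<theta>)) powr p) \<partial>circ) \<le> ennreal M"
    using Hardy_spaceD[OF fH] p by auto
  have "(\<integral>\<^sup>+t. ennreal (norm (bdry (cis t)) powr p) \<partial>circ) \<le> liminf (\<lambda>k. \<integral>\<^sup>+t. ennreal (norm (dil k (cis t)) powr p) \<partial>circ)"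
  proof (rule Fatou_le)
    show "AE t in circ. ennreal (norm (bdry (cis t)) powr p) \<le> liminf (\<lambda>k. ennreal (norm (dil k (cis t)) powr p))"
      using AE_bdry
    proof eventually_elim
      case (elim t)
      show ?case by (rule le_liminf_tendsto, intro tendsto_ennrealI tendsto_powr' tendsto_norm tendsto_const) (use elim p in auto)
    qed
  qed measurable
  also have "\<dots> \<le> ennreal M"
  proof (rule liminf_le_const)
    fix k
    have "dil k (cis t) = f (of_real (rho k) * cis t)" for t
      unfolding dil_def using rho[of k] by (intro zext_eq) (simp add: norm_mult)
    then show "(\<integral>\<^sup>+t. ennreal (norm (dil k (cis t)) powr p) \<partial>circ) \<le> ennreal M" using M(2)[of "rho k"] rho[of k] by simp
  qed
  also have "\<dots> < \<infinity>" by simp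
  finally show ?thesis .
qed

end

locale besov_fn_nonzero = besov_fn +
  fixes z0 :: complex
  assumes z0: "norm z0 < 1" and fz0: "f z0 \<noteq> 0"
begin

definition u :: "real \<Rightarrow> real" where "u t = ln (norm (bdry (cis t)))"

lemma measurable_u [measurable]: "u \<in> borel_measurable borel" unfolding u_def[abs_def] by measurable

lemma AE_bdry_nonzero: "AE t in circ. bdry (cis t) \<noteq> 0" by (rule log_integral_bound(1)[OF z0 fz0])

text \<open>From ln x <= x - 1; at a zero of the boundary function \<open>ln 0 = 0\<close> gives the
  value 1 exactly, so the bound holds at every angle.\<close>

lemma defect_ge_1: "1 \<le> norm (bdry (cis t)) + 1 - u t"
  using ln_le_minus_one[of "norm (bdry (cis t))"] unfolding u_def by (cases "bdry (cis t) = 0") auto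

lemma integrable_norm_bdry: "integrable circ (\<lambda>t. norm (bdry (cis t)))" by (rule integrable_norm[OF integrable_bdry])

text \<open>A nonzero value of f at \<open>z0\<close> makes the defect integrable against the
  Poisson kernel at \<open>z0\<close>, and this kernel is bounded below by a positive
  constant.\<close>

lemma integrable_u: "integrable circ u"
proof -
  define h where "h t = norm (bdry (cis t)) + 1 - u t" for t
  have [measurable]: "h \<in> borel_measurable borel" unfolding h_def[abs_def] by measurable
  have h: "h t \<ge> 1" for t unfolding h_def by (rule defect_ge_1)
  have pk0: "pk z0 t \<ge> 0" for t using z0 by (intro pk_nonneg) auto
  have "integrable circ (\<lambda>t. pk z0 t * h t)"
  proof (rule integrableI_nonneg)
    show "(\<integral>\<^sup>+t. ennreal (pk z0 t * h t) \<partial>circ) < \<infinity>"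
      using log_integral_bound(2)[OF z0 fz0] unfolding h_def u_def by (rule order_le_less_trans) simp
    show "AE t in circ. 0 \<le> pk z0 t * h t" using pk0 h order_trans[OF zero_le_one h] by auto
  qed measurable
  then have "integrable circ (\<lambda>t. 4 / (1 - norm z0) * (pk z0 t * h t))" by simp
  then have "integrable circ h"
  proof (rule Bochner_Integration.integrable_bound)
    show "AE t in circ. norm (h t) \<le> norm (4 / (1 - norm z0) * (pk z0 t * h t))"
    proof (rule AE_I2)
      fix t
      have "h t = 4 / (1 - norm z0) * ((1 - norm z0) / 4 * h t)" using z0 by simp
      also have "\<dots> \<le> 4 / (1 - norm z0) * (pk z0 t * h t)"
        using z0 h[of t] by (intro mult_left_mono mult_right_mono pk_lower) auto
      finally show "norm (h t) \<le> norm (4 / (1 - norm z0) * (pk z0 t * h t))" using h[of t] unfolding real_norm_def by linarith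
    qed
  qed measurable
  then have "integrable circ (\<lambda>t. norm (bdry (cis t)) + 1 - h t)"
    by (intro Bochner_Integration.integrable_diff Bochner_Integration.integrable_add integrable_norm_bdry finite_measure.integrable_const finite_measure_circ)
  then show ?thesis by (simp add: h_def)
qed

definition out :: "complex \<Rightarrow> complex" where "out z = exp (herg u z)"

lemma out_holomorphic: "out holomorphic_on ball 0 1"
  unfolding out_def[abs_def] by (intro holomorphic_intros herg_holomorphic integrable_u)

lemma norm_out: "norm z < 1 \<Longrightarrow> norm (out z) = exp ((\<integral>t. pk z t * u t \<partial>circ) / (2 * pi))"
  by (simp add: out_def Re_herg integrable_u)

text \<open>This is the limit inequality of \<open>log_integral_bound\<close>: the term |bdry| + 1
  cancels, leaving ln |f(z)| below the Poisson mean of \<open>u\<close>.\<close>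

lemma norm_le_out:
  assumes z: "norm z < 1" shows "norm (f z) \<le> norm (out z)"
proof (cases "f z = 0")
  case False
  define h where "h t = norm (bdry (cis t)) + 1 - u t" for t
  have h: "h t \<ge> 1" for t unfolding h_def by (rule defect_ge_1)
  have pk0: "pk z t \<ge> 0" for t using z by (intro pk_nonneg) auto
  have i1: "integrable circ (\<lambda>t. norm (bdry (cis t)) + 1)"
    by (intro Bochner_Integration.integrable_add integrable_norm_bdry finite_measure.integrable_const finite_measure_circ)
  have ib: "integrable circ (\<lambda>t. pk z t * (norm (bdry (cis t)) + 1))" and iu: "integrable circ (\<lambda>t. pk z t * u t)"
    using integrable_pk_mult[OF z i1] integrable_pk_mult[OF z integrable_u] by simp_all
  have he: "pk z t * h t = pk z t * (norm (bdry (cis t)) + 1) - pk z t * u t" for t by (simp add: h_def algebra_simps)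
  have ih: "integrable circ (\<lambda>t. pk z t * h t)" unfolding he using ib iu by simp
  define X where "X = (\<integral>t. pk z t * (norm (bdry (cis t)) + 1) \<partial>circ)"
  define Y where "Y = (\<integral>t. pk z t * u t \<partial>circ)"
  have hXY: "(\<integral>t. pk z t * h t \<partial>circ) = X - Y" unfolding he X_def Y_def using ib iu by simp
  have "ennreal (X - Y) = (\<integral>\<^sup>+t. ennreal (pk z t * h t) \<partial>circ)" unfolding hXY[symmetric]
    by (rule nn_integral_eq_integral[symmetric, OF ih]) (use pk0 order_trans[OF zero_le_one h] in auto)
  also have "\<dots> \<le> ennreal (X - 2 * pi * ln (norm (f z)))"
    using log_integral_bound(2)[OF z False] by (simp add: h_def u_def X_def)
  finally have le: "ennreal (X - Y) \<le> ennreal (X - 2 * pi * ln (norm (f z)))" .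
  \<comment> \<open>\<open>ennreal\<close> sends negative numbers to 0, so the inequality just
    obtained yields one between reals only because its left side X - Y is positive.\<close>
  have "0 < 2 * pi" by simp
  also have "2 * pi = (\<integral>t. pk z t \<partial>circ)" by (rule pk_integral(2)[OF z, symmetric])
  also have "\<dots> \<le> (\<integral>t. pk z t * h t \<partial>circ)"
    by (rule integral_mono[OF pk_integral(1)[OF z] ih]) (use mult_left_mono[OF h pk0] in simp)
  finally have "0 < X - Y" unfolding hXY .
  then have "X - Y \<le> X - 2 * pi * ln (norm (f z))" using le by (auto simp: ennreal_le_iff2)
  then have "ln (norm (f z)) \<le> Y / (2 * pi)" by (simp add: field_simps)
  then have "exp (ln (norm (f z))) \<le> exp (Y / (2 * pi))" by simp
  then show ?thesis using False by (simp add: norm_out[OF z] Y_def)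
qed (simp add: out_def)

lemma norm_out_le: "norm z < 1 \<Longrightarrow> norm (out z) \<le> (\<integral>t. pk z t * norm (bdry (cis t)) \<partial>circ) / (2 * pi)"
  unfolding norm_out by (rule exp_Poisson_le[OF _ integrable_u integrable_norm_bdry])
     (use AE_bdry_nonzero in \<open>auto elim!: AE_mp simp: u_def\<close>)

lemma out_Hardy: "out \<in> Hardy_space p"
proof -
  define N where "N = (\<integral>\<^sup>+t. ennreal (norm (bdry (cis t)) powr p) \<partial>circ)"
  have N: "N < \<infinity>" unfolding N_def by (rule bdry_powr_integral)
  show ?thesis
  proof (rule Hardy_spaceI[OF out_holomorphic, where M = "enn2real N"])
    fix r :: real assume r: "0 \<le> r" "r < 1"
    have n: "norm (of_real r * cis \<theta>) < 1" for \<theta> using r by (simp add: norm_mult)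
    have "(\<integral>\<^sup>+\<theta>. ennreal (norm (out (of_real r * cis \<theta>)) powr p) \<partial>circ)
       \<le> (\<integral>\<^sup>+\<theta>. ennreal (1/(2*pi)) * (\<integral>\<^sup>+t. ennreal (pk (of_real r * cis \<theta>) t * norm (bdry (cis t)) powr p) \<partial>circ) \<partial>circ)"
    proof (rule nn_integral_circ_mono)
      fix \<theta> :: real
      have "ennreal (norm (out (of_real r * cis \<theta>)) powr p) \<le> ennreal (((\<integral>t. pk (of_real r * cis \<theta>) t * norm (bdry (cis t)) \<partial>circ) / (2 * pi)) powr p)"
        using p by (intro ennreal_leI powr_mono2 norm_out_le n) auto
      also have "\<dots> \<le> ennreal (1/(2*pi)) * (\<integral>\<^sup>+t. ennreal (pk (of_real r * cis \<theta>) t * norm (bdry (cis t)) powr p) \<partial>circ)"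
        by (rule Poisson_power_mean) (use p n in auto)
      finally show "ennreal (norm (out (of_real r * cis \<theta>)) powr p) \<le> ennreal (1/(2*pi)) * (\<integral>\<^sup>+t. ennreal (pk (of_real r * cis \<theta>) t * norm (bdry (cis t)) powr p) \<partial>circ)" .
    qed
    also have "\<dots> = ennreal (1/(2*pi)) * (\<integral>\<^sup>+\<theta>. \<integral>\<^sup>+t. ennreal (pk (of_real r * cis \<theta>) t * norm (bdry (cis t)) powr p) \<partial>circ \<partial>circ)"
      by (rule nn_integral_cmult) measurable
    also have "(\<integral>\<^sup>+\<theta>. \<integral>\<^sup>+t. ennreal (pk (of_real r * cis \<theta>) t * norm (bdry (cis t)) powr p) \<partial>circ \<partial>circ)
      = (\<integral>\<^sup>+t. \<integral>\<^sup>+\<theta>. ennreal (pk (of_real r * cis \<theta>) t * norm (bdry (cis t)) powr p) \<partial>circ \<partial>circ)"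
      by (rule Fubini_circ) measurable
    also have "\<dots> = (\<integral>\<^sup>+t. ennreal (2*pi) * ennreal (norm (bdry (cis t)) powr p) \<partial>circ)"
      by (simp add: ennreal_mult'' nn_integral_multc pk_nn_integral_center[OF r])
    also have "\<dots> = ennreal (2*pi) * N" unfolding N_def by (rule nn_integral_cmult) measurable
    also have "ennreal (1/(2*pi)) * (ennreal (2*pi) * N) = N"
      by (simp add: mult.assoc[symmetric] ennreal_mult[symmetric])
    also have "N = ennreal (enn2real N)" using N by simp
    finally show "(\<integral>\<^sup>+\<theta>. ennreal (norm (out (of_real r * cis \<theta>)) powr p) \<partial>circ) \<le> ennreal (enn2real N)" .
  qed (use p in simp)
qed

text \<open>Let v be the distance of |bdry| from m = |f(z)| and P its Poisson integral. Since |out|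
  <= P + m, the function K has nonnegative real part, and at z this part is at most P(z) because
  |out(z)| >= m. The half-plane bound, for K and for the Herglotz transform of v, gives 4 P(z) / d
  each, and their difference contains the derivative of \<open>out\<close>.\<close>

lemma norm_deriv_out:
  assumes z: "norm z < 1"
  shows "norm (deriv out z) \<le> 8 / (1 - norm z) * ((\<integral>t. pk z t * norm (bdry (cis t) - f z) \<partial>circ) / (2 * pi))"
proof -
  define m where "m = norm (f z)"
  define v where "v t = \<bar>norm (bdry (cis t)) - m\<bar>" for t
  have iv: "integrable circ v" unfolding v_def[abs_def]
    by (intro integrable_abs Bochner_Integration.integrable_diff integrable_norm_bdry finite_measure.integrable_const finite_measure_circ)
  have v0: "v t \<ge> 0" for t by (simp add: v_def)
  define P where "P w = (\<integral>t. pk w t * v t \<partial>circ) / (2 * pi)" for w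
  have P0: "P w \<ge> 0" if "norm w < 1" for w unfolding P_def
    using that v0 by (intro divide_nonneg_nonneg integral_nonneg_AE AE_I2 mult_nonneg_nonneg pk_nonneg) auto
  have hv: "herg v holomorphic_on ball 0 1" by (rule herg_holomorphic[OF iv])
  have Rv: "Re (herg v w) = P w" if "norm w < 1" for w unfolding P_def by (rule Re_herg[OF that iv])
  \<comment> \<open>Rotates \<open>out z\<close> to the positive axis, so that the real part of
    \<open>K\<close> at \<open>z\<close> involves the full modulus of \<open>out z\<close>.\<close>
  define c0 where "c0 = cnj (out z) / of_real (norm (out z))"
  have oz: "out z \<noteq> 0" by (simp add: out_def)
  have c0: "norm c0 = 1" using oz by (simp add: c0_def norm_divide)
  have c0z: "c0 * out z = of_real (norm (out z))"
    using oz complex_norm_square[of "out z"] by (simp add: c0_def field_simps power2_eq_square)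
  define K where "K w = herg v w + of_real m - c0 * out w" for w
  have hK: "K holomorphic_on ball 0 1" unfolding K_def[abs_def] by (intro holomorphic_intros hv out_holomorphic)
  define d where "d = 1 - norm z"
  have d: "d > 0" using z by (simp add: d_def)
  have sub: "ball z d \<subseteq> ball 0 1" unfolding d_def using z by (simp add: ball_subset_ball_iff)
  have out_le: "norm (out w) \<le> P w + m" if w: "norm w < 1" for w
  proof -
    have i: "integrable circ (\<lambda>t. pk w t * v t)" using integrable_pk_mult[OF w iv] by simp
    have ib: "integrable circ (\<lambda>t. pk w t * norm (bdry (cis t)))" using integrable_pk_mult[OF w integrable_norm_bdry] by simp
    have "(\<integral>t. pk w t * norm (bdry (cis t)) \<partial>circ) \<le> (\<integral>t. pk w t * v t + pk w t * m \<partial>circ)"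
    proof (rule integral_mono[OF ib])
      show "integrable circ (\<lambda>t. pk w t * v t + pk w t * m)" using i pk_integral(1)[OF w] by simp
      fix t
      have "pk w t * norm (bdry (cis t)) \<le> pk w t * (v t + m)" using w by (intro mult_left_mono pk_nonneg) (auto simp: v_def)
      then show "pk w t * norm (bdry (cis t)) \<le> pk w t * v t + pk w t * m" by (simp add: distrib_left)
    qed
    also have "\<dots> = (\<integral>t. pk w t * v t \<partial>circ) + 2 * pi * m" using i pk_integral[OF w] by simp
    finally have "(\<integral>t. pk w t * norm (bdry (cis t)) \<partial>circ) / (2 * pi) \<le> P w + m"
      unfolding P_def by (simp add: field_simps)
    then show ?thesis using norm_out_le[OF w] by linarith
  qed
  have ReK: "Re (K w) \<ge> 0" if "w \<in> ball z d" for w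
  proof -
    have w: "norm w < 1" using that sub by auto
    have "Re (c0 * out w) \<le> norm (out w)" using complex_Re_le_cmod[of "c0 * out w"] by (simp add: norm_mult c0)
    then show ?thesis using out_le[OF w] by (simp add: K_def Rv[OF w])
  qed
  have "norm (deriv K z) \<le> 4 * Re (K z) / d"
    by (rule deriv_bound_Re_nonneg[OF holomorphic_on_subset[OF hK sub] d ReK])
  also have "Re (K z) = P z + m - norm (out z)" by (simp add: K_def Rv[OF z] c0z)
  also have "4 * (P z + m - norm (out z)) / d \<le> 4 * P z / d"
    using norm_le_out[OF z] d by (intro divide_right_mono) (auto simp: m_def)
  finally have dK: "norm (deriv K z) \<le> 4 * P z / d" .
  have "norm (deriv (herg v) z) \<le> 4 * Re (herg v z) / d"
    by (rule deriv_bound_Re_nonneg[OF holomorphic_on_subset[OF hv sub] d]) (use sub Rv P0 in \<open>auto simp: subset_iff\<close>)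
  then have dH: "norm (deriv (herg v) z) \<le> 4 * P z / d" by (simp add: Rv[OF z])
  have zb: "z \<in> ball 0 1" using z by simp
  have "(K has_field_derivative deriv (herg v) z + 0 - c0 * deriv out z) (at z)" unfolding K_def[abs_def]
    by (intro DERIV_diff DERIV_add DERIV_const DERIV_cmult holomorphic_derivI[OF hv open_ball zb] holomorphic_derivI[OF out_holomorphic open_ball zb])
  then have "c0 * deriv out z = deriv (herg v) z - deriv K z" by (simp add: DERIV_imp_deriv)
  then have "norm (deriv out z) = norm (deriv (herg v) z - deriv K z)" using c0 by (metis mult_1 norm_mult)
  also have "\<dots> \<le> 8 * P z / d" using norm_triangle_ineq4[of "deriv (herg v) z" "deriv K z"] dK dH by simp
  also have "P z \<le> (\<integral>t. pk z t * norm (bdry (cis t) - f z) \<partial>circ) / (2 * pi)" unfolding P_def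
  proof (intro divide_right_mono integral_mono)
    show "integrable circ (\<lambda>t. pk z t * v t)" using integrable_pk_mult[OF z iv] by simp
    have "integrable circ (\<lambda>t. norm (bdry (cis t) - f z))"
      by (intro integrable_norm Bochner_Integration.integrable_diff integrable_bdry finite_measure.integrable_const finite_measure_circ)
    from integrable_pk_mult[OF z this] show "integrable circ (\<lambda>t. pk z t * norm (bdry (cis t) - f z))" by simp
    show "pk z t * v t \<le> pk z t * norm (bdry (cis t) - f z)" for t
      using z norm_triangle_ineq3[of "bdry (cis t)" "f z"] by (intro mult_left_mono pk_nonneg) (auto simp: v_def m_def)
  qed simp
  finally show ?thesis using d by (simp add: d_def divide_right_mono)
qed

end

section \<open>Local estimates at a zero\<close>

lemma norm_cis_diff_le: "norm (cis a - cis b) \<le> \<bar>a - b\<bar>"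
proof -
  have "(norm (cis a - cis b))\<^sup>2 = 2 - 2 * cos (a - b)"
    unfolding cmod_power2 using sin_cos_squared_add[of a] sin_cos_squared_add[of b]
    by (simp add: cos_diff power2_eq_square algebra_simps)
  also have "\<dots> = (2 * sin ((a - b) / 2))\<^sup>2"
  proof -
    have half: "2 * ((a - b) / 2) = a - b" by simp
    show ?thesis using cos_double_sin[of "(a - b) / 2"] unfolding half by (simp add: power_mult_distrib)
  qed
  finally have "norm (cis a - cis b) = 2 * sin ((a - b) / 2) \<or> norm (cis a - cis b) = - (2 * sin ((a - b) / 2))"
    by (simp only: power2_eq_iff)
  then have "norm (cis a - cis b) \<le> \<bar>2 * sin ((a - b) / 2)\<bar>" by linarith
  also have "\<dots> \<le> \<bar>a - b\<bar>" using abs_sin_x_le_abs_x[of "(a - b) / 2"] by simp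
  finally show ?thesis .
qed

text \<open>Supplies a rectangle in polar coordinates near \<open>z\<close>, on the outer side of
  its radius, whose angles stay in \<open>{0..2*pi}\<close>, where \<open>circ\<close> has its mass.
  The side d/8 makes both the radial and the angular displacement at most d/8.\<close>

lemma polar_box:
  fixes z :: complex
  assumes z: "norm z < 1"
  defines "d \<equiv> 1 - norm z"
  obtains a where "0 \<le> a" "a + d / 8 \<le> 2 * pi"
    "\<And>r \<theta>. norm z \<le> r \<Longrightarrow> r \<le> norm z + d / 8 \<Longrightarrow> a \<le> \<theta> \<Longrightarrow> \<theta> \<le> a + d / 8 \<Longrightarrow> norm (of_real r * cis \<theta> - z) \<le> d / 4"
proof -
  define b where "b = Arg2pi z"
  have b: "0 \<le> b" "b < 2 * pi" unfolding b_def by (rule Arg2pi_ge_0 Arg2pi_lt_2pi)+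
  have zb: "z = of_real (norm z) * cis b" unfolding b_def cis_conv_exp by (rule Arg2pi_eq)
  have d: "0 < d" "d \<le> 1" using z by (auto simp: d_def)
  have near: "norm (of_real r * cis \<theta> - z) \<le> d / 4"
    if h: "norm z \<le> r" "r \<le> norm z + d / 8" "\<bar>\<theta> - b\<bar> \<le> d / 8" for r \<theta>
  proof -
    have "of_real r * cis \<theta> - z = of_real (r - norm z) * cis \<theta> + of_real (norm z) * (cis \<theta> - cis b)"
      by (subst (1) zb) (simp add: algebra_simps)
    also have "norm \<dots> \<le> \<bar>r - norm z\<bar> + norm z * norm (cis \<theta> - cis b)"
      by (rule order_trans[OF norm_triangle_ineq]) (simp add: norm_mult del: of_real_diff)
    also have "norm z * norm (cis \<theta> - cis b) \<le> 1 * (d / 8)"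
      using z order_trans[OF norm_cis_diff_le h(3)] d by (intro mult_mono) auto
    finally show ?thesis using h by simp
  qed
  show ?thesis
  \<comment> \<open>The angular interval extends to the right or to the left of the argument,
    whichever stays inside the window.\<close>
  proof (cases "b \<le> pi")
    case True
    show ?thesis by (rule that[of b]) (use b d True pi_ge_two near in \<open>auto simp: abs_le_iff\<close>)
  next
    case False
    show ?thesis by (rule that[of "b - d / 8"]) (use b d False pi_ge_two near in \<open>auto simp: abs_le_iff\<close>)
  qed
qed

text \<open>For \<open>w\<close> in the box of \<open>polar_box\<close>, 1 - |w| is at least 7/8 of
  d = 1 - |z|, and |cis t - w| is at most 5/4 of |cis t - z|; the kernels compare with 8/7 * 25/16 =
  25/14 < 2. For the second claim, |w - z|^2 <= d^2/16 is below the product of the two factors 1 -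
  |.|^2.\<close>

lemma
  assumes z: "norm z < 1" and w: "norm (w - z) \<le> (1 - norm z) / 4" "norm z \<le> norm w" "norm w \<le> norm z + (1 - norm z) / 8"
  shows pk_Harnack: "pk z t \<le> 2 * pk w t" and sig_near: "1 / 2 \<le> sig z w"
proof -
  define d where "d = 1 - norm z"
  have d: "d > 0" using z by (simp add: d_def)
  have w1: "norm w < 1" using w z by (simp add: field_simps)
  have fac: "1 - (norm y)\<^sup>2 = (1 - norm y) * (1 + norm y)" for y :: complex by (simp add: power2_eq_square algebra_simps)
  have dw: "7 / 8 * d \<le> 1 - norm w" using w by (simp add: d_def field_simps)
  have "7 / 8 * d * (1 + norm z) \<le> (1 - norm w) * (1 + norm w)" using dw w d w1 by (intro mult_mono) auto
  then have N: "7 / 8 * (1 - (norm z)\<^sup>2) \<le> 1 - (norm w)\<^sup>2" by (simp only: fac d_def mult.assoc)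
  have zp: "1 - (norm z)\<^sup>2 \<ge> d" using z by (simp add: d_def power2_eq_square mult_left_le)
  have "7 / 8 * d \<le> 7 / 8 * (1 - (norm z)\<^sup>2)" by (intro mult_left_mono zp) simp
  then have wp: "7 / 8 * d \<le> 1 - (norm w)\<^sup>2" using N by (rule order_trans)
  define x where "x = norm (cis t - z)"
  define y where "y = norm (cis t - w)"
  have x: "x \<ge> d" unfolding x_def d_def by (rule norm_cis_diff_ge)
  have y0: "y > 0" using cis_neq[OF w1, of t] by (simp add: y_def)
  have "y \<le> x + norm (w - z)" unfolding x_def y_def using norm_triangle_ineq4[of "cis t - z" "w - z"] by simp
  then have "y \<le> 5 / 4 * x" using w x unfolding d_def by simp
  then have "y\<^sup>2 \<le> (5 / 4 * x)\<^sup>2" using y0 by (intro power_mono) auto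
  then have yx: "16 / 25 * y\<^sup>2 \<le> x\<^sup>2" by (simp add: power_mult_distrib power_divide)
  have "pk z t = (1 - (norm z)\<^sup>2) / x\<^sup>2" by (simp add: pk_def x_def)
  also have "\<dots> \<le> (8 / 7 * (1 - (norm w)\<^sup>2)) / (16 / 25 * y\<^sup>2)"
    using N yx y0 zp d by (intro frac_le) auto
  also have "\<dots> = 25 / 14 * ((1 - (norm w)\<^sup>2) / y\<^sup>2)"
  proof -
    have "(8 / 7 * X) / (16 / 25 * Y) = 25 / 14 * (X / Y)" for X Y :: real by simp
    then show ?thesis .
  qed
  also have "\<dots> \<le> 2 * ((1 - (norm w)\<^sup>2) / y\<^sup>2)" using wp d by (intro mult_right_mono divide_nonneg_nonneg) auto
  finally show "pk z t \<le> 2 * pk w t" by (simp add: pk_def y_def)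
  define A where "A = (1 - (norm z)\<^sup>2) * (1 - (norm w)\<^sup>2)"
  have "d * (7 / 8 * d) \<le> A" unfolding A_def using zp wp d by (intro mult_mono) auto
  moreover have "(norm (w - z))\<^sup>2 \<le> (d / 4)\<^sup>2" using w by (intro power_mono) (auto simp: d_def)
  moreover have "d * d > 0" using d by simp
  ultimately have A: "(norm (w - z))\<^sup>2 \<le> A" "A > 0" by (auto simp: power2_eq_square)
  have "sig z w = A / ((norm (w - z))\<^sup>2 + A)" unfolding sig_def norm_one_minus_cnj_mult_sq A_def ..
  moreover have pos: "(norm (w - z))\<^sup>2 + A > 0" using A by (intro add_nonneg_pos) auto
  ultimately show "1 / 2 \<le> sig z w" using A by (simp add: pos_le_divide_eq[OF pos])
qed

context besov_fn_nonzero begin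

text \<open>The innermost integral of \<open>bdry_double_integral\<close>. By \<open>pk_osc\<close>
  it controls the Poisson mean of |bdry - f(w)|^p, which is how both the norm of \<open>out\<close>
  and its values at the zeros are bounded.\<close>

definition osc :: "real \<Rightarrow> real \<Rightarrow> ennreal" where
  "osc r \<theta> = (\<integral>\<^sup>+\<tau>. ennreal (norm (bdry (cis \<tau>) - zext f (of_real r * cis \<theta>)) powr p * (1 - r) powr (\<alpha> - p + 1) / (norm (cis \<tau> - of_real r * cis \<theta>))\<^sup>2) \<partial>circ)"

lemma measurable_osc [measurable]: "(\<lambda>(r, \<theta>). osc r \<theta>) \<in> borel_measurable (borel \<Otimes>\<^sub>M borel)"
  unfolding osc_def by measurable

lemma osc_integral: "(\<integral>\<^sup>+r. \<integral>\<^sup>+\<theta>. osc r \<theta> \<partial>circ \<partial>rad) < \<infinity>"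
  unfolding osc_def by (rule bdry_double_integral)

lemma pk_osc:
  fixes r \<theta> :: real
  assumes r: "0 \<le> r" "r < 1"
  defines "w \<equiv> of_real r * cis \<theta>"
  shows "(\<integral>\<^sup>+t. ennreal (pk w t * norm (bdry (cis t) - f w) powr p) \<partial>circ) * ennreal ((1 - r) powr (\<alpha> - p)) \<le> ennreal 2 * osc r \<theta>"
proof -
  have n: "norm w < 1" using r by (simp add: w_def norm_mult)
  have nr: "norm w = r" using r by (simp add: w_def norm_mult)
  have "(\<integral>\<^sup>+t. ennreal (pk w t * norm (bdry (cis t) - f w) powr p) \<partial>circ) * ennreal ((1 - r) powr (\<alpha> - p))
     = (\<integral>\<^sup>+t. ennreal (pk w t * norm (bdry (cis t) - f w) powr p) * ennreal ((1 - r) powr (\<alpha> - p)) \<partial>circ)"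
    by (rule nn_integral_multc[symmetric]) measurable
  also have "\<dots> \<le> (\<integral>\<^sup>+t. ennreal 2 * ennreal (norm (bdry (cis t) - zext f w) powr p * (1 - r) powr (\<alpha> - p + 1) / (norm (cis t - w))\<^sup>2) \<partial>circ)"
  proof (rule nn_integral_circ_mono)
    fix t :: real
    define X where "X = norm (bdry (cis t) - f w) powr p"
    define D where "D = (norm (cis t - w))\<^sup>2"
    have "1 - r\<^sup>2 = (1 - r) * (1 + r)" by (simp add: power2_eq_square algebra_simps)
    also have "\<dots> \<le> (1 - r) * 2" using r by (intro mult_left_mono) auto
    finally have "pk w t \<le> 2 * (1 - r) / D" unfolding pk_def nr D_def by (intro divide_right_mono) auto
    then have "pk w t * (X * (1 - r) powr (\<alpha> - p)) \<le> 2 * (1 - r) / D * (X * (1 - r) powr (\<alpha> - p))"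
      by (rule mult_right_mono) (simp add: X_def)
    also have "\<dots> = 2 * (X * ((1 - r) powr (\<alpha> - p) * (1 - r)) / D)" by simp
    also have "(1 - r) powr (\<alpha> - p) * (1 - r) = (1 - r) powr (\<alpha> - p + 1)"
      using r by (simp add: powr_add)
    finally have "ennreal (pk w t * X * (1 - r) powr (\<alpha> - p)) \<le> ennreal (2 * (X * (1 - r) powr (\<alpha> - p + 1) / D))"
      by (intro ennreal_leI) (simp add: mult.assoc)
    then show "ennreal (pk w t * norm (bdry (cis t) - f w) powr p) * ennreal ((1 - r) powr (\<alpha> - p))
      \<le> ennreal 2 * ennreal (norm (bdry (cis t) - zext f w) powr p * (1 - r) powr (\<alpha> - p + 1) / (norm (cis t - w))\<^sup>2)"
      unfolding X_def D_def zext_eq[OF n] by (simp only: ennreal_mult'' ennreal_mult' powr_ge_zero zero_le_numeral)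
  qed
  also have "\<dots> = ennreal 2 * osc r \<theta>" unfolding osc_def w_def by (rule nn_integral_cmult) measurable
  finally show ?thesis .
qed

lemma out_Besov: "out \<in> Besov_Hardy_space p \<alpha>"
proof -
  \<comment> \<open>The 8 is that of \<open>norm_deriv_out\<close>, the \<open>2 * pi\<close>
    normalises the Poisson mean, and the last 2 comes from \<open>pk_osc\<close>.\<close>
  define k where "k = 8 powr p / (2 * pi) * 2"
  have "Besov_int p \<alpha> out \<le> (\<integral>\<^sup>+r. \<integral>\<^sup>+\<theta>. ennreal k * osc r \<theta> \<partial>circ \<partial>rad)"
    unfolding Besov_int_def
  proof (intro nn_integral_rad_mono nn_integral_circ_mono)
    fix r \<theta> :: real assume r: "0 \<le> r" "r < 1"
    define w where "w = of_real r * cis \<theta>"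
    have n: "norm w < 1" and nr: "norm w = r" using r by (simp_all add: w_def norm_mult)
    define Q where "Q = (\<integral>t. pk w t * norm (bdry (cis t) - f w) \<partial>circ) / (2 * pi)"
    have Q0: "Q \<ge> 0" unfolding Q_def using n
      by (intro divide_nonneg_nonneg integral_nonneg_AE AE_I2 mult_nonneg_nonneg pk_nonneg) auto
    have "norm (deriv out w) powr p * (1 - r) powr \<alpha> \<le> (8 / (1 - r) * Q) powr p * (1 - r) powr \<alpha>"
      using norm_deriv_out[OF n] p unfolding Q_def[symmetric] nr by (intro mult_right_mono powr_mono2) auto
    also have "\<dots> = 8 powr p * Q powr p * ((1 - r) powr \<alpha> / (1 - r) powr p)"
      using r Q0 by (simp add: powr_mult powr_divide)
    also have "(1 - r) powr \<alpha> / (1 - r) powr p = (1 - r) powr (\<alpha> - p)" using r by (simp add: powr_diff)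
    finally have "ennreal (norm (deriv out w) powr p * (1 - r) powr \<alpha>) \<le> ennreal (8 powr p) * ennreal (Q powr p) * ennreal ((1 - r) powr (\<alpha> - p))"
      by (simp only: ennreal_mult[symmetric] powr_ge_zero mult_nonneg_nonneg ennreal_leI)
    also have "\<dots> \<le> ennreal (8 powr p) * (ennreal (1/(2*pi)) * (\<integral>\<^sup>+t. ennreal (pk w t * norm (bdry (cis t) - f w) powr p) \<partial>circ)) * ennreal ((1 - r) powr (\<alpha> - p))"
      unfolding Q_def by (intro mult_left_mono mult_right_mono Poisson_power_mean) (use p n in auto)
    also have "ennreal (8 powr p) * (ennreal (1/(2*pi)) * (\<integral>\<^sup>+t. ennreal (pk w t * norm (bdry (cis t) - f w) powr p) \<partial>circ)) * ennreal ((1 - r) powr (\<alpha> - p))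
      = ennreal (8 powr p / (2 * pi)) * ((\<integral>\<^sup>+t. ennreal (pk w t * norm (bdry (cis t) - f w) powr p) \<partial>circ) * ennreal ((1 - r) powr (\<alpha> - p)))"
      by (simp add: mult.assoc[symmetric] ennreal_mult[symmetric])
    also have "\<dots> \<le> ennreal (8 powr p / (2 * pi)) * (ennreal 2 * osc r \<theta>)"
      unfolding w_def by (intro mult_left_mono pk_osc r) simp
    also have "\<dots> = ennreal k * osc r \<theta>" unfolding k_def mult.assoc[symmetric] by (subst ennreal_mult) auto
    finally show "ennreal (norm (zext (deriv out) (of_real r * cis \<theta>)) powr p * (1 - r) powr \<alpha>) \<le> ennreal k * osc r \<theta>"
      unfolding w_def[symmetric] zext_eq[OF n] .
  qed
  also have "\<dots> = ennreal k * (\<integral>\<^sup>+r. \<integral>\<^sup>+\<theta>. osc r \<theta> \<partial>circ \<partial>rad)"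
    by (simp add: nn_integral_cmult)
  also have "\<dots> < \<infinity>" using osc_integral by (simp add: ennreal_mult_less_top)
  finally show ?thesis using out_Hardy p by (simp add: Besov_Hardy_space_iff)
qed

text \<open>Put c = f(w) and let Q be the Poisson mean at z of |bdry - c|. As f(z) = 0, the mean of
  bdry - c at z is -c, so |c| <= Q; hence the mean of |bdry|, which bounds |out(z)|, is at most 2 Q.
  Jensen and the comparison of kernels then move the mean from z to w.\<close>

lemma out_le_mean:
  assumes z: "norm z < 1" and w: "norm w < 1" and fz: "f z = 0" and pkle: "\<And>t. pk z t \<le> 2 * pk w t"
  shows "ennreal (norm (out z) powr p) \<le> ennreal (2 powr p / pi) * (\<integral>\<^sup>+t. ennreal (pk w t * norm (bdry (cis t) - f w) powr p) \<partial>circ)"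
proof -
  define c where "c = f w"
  define Q where "Q = (\<integral>t. pk z t * norm (bdry (cis t) - c) \<partial>circ) / (2 * pi)"
  have ib: "integrable circ (\<lambda>t. bdry (cis t) - c)"
    by (intro Bochner_Integration.integrable_diff integrable_bdry finite_measure.integrable_const finite_measure_circ)
  have ip: "integrable circ (\<lambda>t. pk z t * norm (bdry (cis t) - c))" using integrable_pk_mult[OF z integrable_norm[OF ib]] by simp
  have Q0: "Q \<ge> 0" unfolding Q_def using z
    by (intro divide_nonneg_nonneg integral_nonneg_AE AE_I2 mult_nonneg_nonneg pk_nonneg) auto
  have i1: "integrable circ (\<lambda>t. pk z t *\<^sub>R bdry (cis t))" and i2: "integrable circ (\<lambda>t. pk z t *\<^sub>R c)"
    using integrable_pk_mult[OF z integrable_bdry] pk_integral(1)[OF z] by simp_all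
  have "(\<integral>t. pk z t *\<^sub>R (bdry (cis t) - c) \<partial>circ) = (\<integral>t. pk z t *\<^sub>R bdry (cis t) \<partial>circ) - (\<integral>t. pk z t *\<^sub>R c \<partial>circ)"
    unfolding scaleR_diff_right by (rule Bochner_Integration.integral_diff[OF i1 i2])
  also have "\<dots> = - ((2 * pi) *\<^sub>R c)" using Poisson_bdry[OF z] pk_integral[OF z] fz by simp
  finally have "2 * pi * norm c = norm (\<integral>t. pk z t *\<^sub>R (bdry (cis t) - c) \<partial>circ)" by simp
  also have "\<dots> \<le> (\<integral>t. norm (pk z t *\<^sub>R (bdry (cis t) - c)) \<partial>circ)" by (rule integral_norm_bound)
  also have "\<dots> = (\<integral>t. pk z t * norm (bdry (cis t) - c) \<partial>circ)"
    using z by (intro Bochner_Integration.integral_cong refl) (simp add: pk_nonneg)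
  finally have cQ: "norm c \<le> Q" unfolding Q_def by (simp add: field_simps)
  have ipc: "integrable circ (\<lambda>t. pk z t * norm c)" using pk_integral(1)[OF z] by simp
  have "(\<integral>t. pk z t * norm (bdry (cis t)) \<partial>circ) \<le> (\<integral>t. pk z t * norm (bdry (cis t) - c) + pk z t * norm c \<partial>circ)"
  proof (rule integral_mono)
    show "integrable circ (\<lambda>t. pk z t * norm (bdry (cis t)))" using integrable_pk_mult[OF z integrable_norm_bdry] by simp
    show "integrable circ (\<lambda>t. pk z t * norm (bdry (cis t) - c) + pk z t * norm c)" by (intro Bochner_Integration.integrable_add ip ipc)
    show "pk z t * norm (bdry (cis t)) \<le> pk z t * norm (bdry (cis t) - c) + pk z t * norm c" for t
      unfolding distrib_left[symmetric] using z norm_triangle_sub[of "bdry (cis t)" c] by (intro mult_left_mono pk_nonneg) auto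
  qed
  also have "\<dots> = (\<integral>t. pk z t * norm (bdry (cis t) - c) \<partial>circ) + 2 * pi * norm c"
    using ip ipc pk_integral[OF z] by simp
  finally have "norm (out z) \<le> 2 * Q" using norm_out_le[OF z] cQ unfolding Q_def by (simp add: field_simps)
  then have "norm (out z) powr p \<le> (2 * Q) powr p" using p by (intro powr_mono2) auto
  also have "\<dots> = 2 powr p * Q powr p" using Q0 by (simp add: powr_mult)
  finally have "ennreal (norm (out z) powr p) \<le> ennreal (2 powr p) * ennreal (Q powr p)"
    by (simp add: ennreal_leI flip: ennreal_mult)
  also have "ennreal (Q powr p) \<le> ennreal (1/(2*pi)) * (\<integral>\<^sup>+t. ennreal (pk z t * norm (bdry (cis t) - c) powr p) \<partial>circ)"
    unfolding Q_def by (rule Poisson_power_mean) (use p z in auto)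
  also have "(\<integral>\<^sup>+t. ennreal (pk z t * norm (bdry (cis t) - c) powr p) \<partial>circ) \<le> (\<integral>\<^sup>+t. ennreal 2 * ennreal (pk w t * norm (bdry (cis t) - c) powr p) \<partial>circ)"
  proof (rule nn_integral_circ_mono)
    fix t
    have "pk z t * norm (bdry (cis t) - c) powr p \<le> 2 * pk w t * norm (bdry (cis t) - c) powr p" by (intro mult_right_mono pkle) simp
    then have "ennreal (pk z t * norm (bdry (cis t) - c) powr p) \<le> ennreal (2 * (pk w t * norm (bdry (cis t) - c) powr p))"
      by (intro ennreal_leI) (simp add: mult.assoc)
    then show "ennreal (pk z t * norm (bdry (cis t) - c) powr p) \<le> ennreal 2 * ennreal (pk w t * norm (bdry (cis t) - c) powr p)"
      by (simp only: ennreal_mult' zero_le_numeral)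
  qed
  also have "\<dots> = ennreal 2 * (\<integral>\<^sup>+t. ennreal (pk w t * norm (bdry (cis t) - c) powr p) \<partial>circ)" by (rule nn_integral_cmult) measurable
  also have "ennreal (2 powr p) * (ennreal (1 / (2 * pi)) * \<dots>) = ennreal (2 powr p / pi) * (\<integral>\<^sup>+t. ennreal (pk w t * norm (bdry (cis t) - c) powr p) \<partial>circ)"
  proof -
    have "2 powr p / pi = 2 powr p * (1 / (2 * pi)) * 2" by simp
    then have "ennreal (2 powr p / pi) = ennreal (2 powr p) * ennreal (1 / (2 * pi)) * ennreal 2"
      by (simp only: ennreal_mult' ennreal_mult'' powr_ge_zero zero_le_numeral)
    then show ?thesis by (simp only: mult.assoc)
  qed
  finally show ?thesis by (simp add: c_def mult_left_mono)
qed

text \<open>The bound of \<open>out_le_mean\<close> is averaged over the box of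
  \<open>polar_box\<close>. Its measure (d/8)^2 raises the exponent \<alpha> - p to \<alpha> + 2 -
  p. The constant 256 is 64 for the measure, 2 from \<open>pk_osc\<close> and 2 from
  \<open>sig_near\<close>.\<close>

lemma out_at_zero:
  assumes z: "norm z < 1" and fz: "f z = 0"
  shows "ennreal (norm (out z) powr p * (1 - norm z) powr (\<alpha> + 2 - p))
    \<le> ennreal (256 * 2 powr p / pi) * (\<integral>\<^sup>+r. \<integral>\<^sup>+\<theta>. ennreal (sig z (of_real r * cis \<theta>)) * osc r \<theta> \<partial>circ \<partial>rad)"
proof -
  define d where "d = 1 - norm z"
  have d: "0 < d" "d \<le> 1" using z by (auto simp: d_def)
  obtain a where a: "0 \<le> a" "a + d / 8 \<le> 2 * pi"
    and near: "\<And>r \<theta>. norm z \<le> r \<Longrightarrow> r \<le> norm z + d / 8 \<Longrightarrow> a \<le> \<theta> \<Longrightarrow> \<theta> \<le> a + d / 8 \<Longrightarrow> norm (of_real r * cis \<theta> - z) \<le> d / 4"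
    unfolding d_def using polar_box[OF z] by blast
  define Ir where "Ir = {norm z..norm z + d / 8}"
  define It where "It = {a..a + d / 8}"
  have [measurable]: "Ir \<in> sets borel" "It \<in> sets borel" by (auto simp: Ir_def It_def)
  have mr: "emeasure rad Ir = ennreal (d / 8)"
  proof -
    have "x \<in> {0..<1}" if "x \<in> Ir" for x
    proof -
      have "norm z \<le> x" "x \<le> norm z + d / 8" using that by (auto simp: Ir_def)
      then have h: "norm z \<le> x" "8 * x \<le> 8 * norm z + d" by auto
      have "0 \<le> x" using h(1) norm_ge_zero[of z] by linarith
      moreover have "x < 1" using h(2) d z by (simp add: d_def)
      ultimately show ?thesis by simp
    qed
    then have "{0..<1} \<inter> Ir = Ir" by blast
    then show ?thesis unfolding rad_def by (subst emeasure_lint) (use d in \<open>auto simp: Ir_def\<close>)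
  qed
  have mt: "emeasure circ It = ennreal (d / 8)"
  proof -
    have "{0..2*pi} \<inter> It = It" using a by (auto simp: It_def)
    then show ?thesis unfolding circ_def by (subst emeasure_lint) (use d in \<open>auto simp: It_def\<close>)
  qed
  \<comment> \<open>The 64 cancels the two factors 1/8 of the box, so that integrating
    \<open>c\<close> over it gives precisely the left side.\<close>
  define c where "c = 64 * (norm (out z) powr p * d powr (\<alpha> - p))"
  have "d powr (\<alpha> - p) * d\<^sup>2 = d powr (\<alpha> + 2 - p)"
  proof -
    have "d powr (\<alpha> + 2 - p) = d powr ((\<alpha> - p) + 2)" by (simp add: algebra_simps)
    also have "\<dots> = d powr (\<alpha> - p) * d powr 2" by (rule powr_add)
    finally show ?thesis using d by simp
  qed
  then have ceq: "c * (d / 8) * (d / 8) = norm (out z) powr p * d powr (\<alpha> + 2 - p)"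
    by (simp add: c_def power2_eq_square mult_ac)
  have c0: "c \<ge> 0" by (simp add: c_def)
  have "(\<integral>\<^sup>+r. \<integral>\<^sup>+\<theta>. ennreal c * indicator It \<theta> * indicator Ir r \<partial>circ \<partial>rad) = (\<integral>\<^sup>+r. ennreal c * ennreal (d / 8) * indicator Ir r \<partial>rad)"
    by (simp add: nn_integral_multc nn_integral_cmult mt)
  also have "\<dots> = ennreal c * ennreal (d / 8) * ennreal (d / 8)" by (simp add: nn_integral_cmult mr)
  also have "\<dots> = ennreal (norm (out z) powr p * d powr (\<alpha> + 2 - p))"
    unfolding ceq[symmetric] using d c0 by (simp only: ennreal_mult' ennreal_mult'' mult_nonneg_nonneg)
  finally have "ennreal (norm (out z) powr p * d powr (\<alpha> + 2 - p)) = (\<integral>\<^sup>+r. \<integral>\<^sup>+\<theta>. ennreal c * indicator It \<theta> * indicator Ir r \<partial>circ \<partial>rad)" ..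
  also have "\<dots> \<le> (\<integral>\<^sup>+r. \<integral>\<^sup>+\<theta>. ennreal (256 * 2 powr p / pi) * (ennreal (sig z (of_real r * cis \<theta>)) * osc r \<theta>) \<partial>circ \<partial>rad)"
  proof (intro nn_integral_rad_mono nn_integral_circ_mono)
    fix r \<theta> :: real assume r: "0 \<le> r" "r < 1"
    define w where "w = of_real r * cis \<theta>"
    have n: "norm w < 1" and nr: "norm w = r" using r by (simp_all add: w_def norm_mult)
    show "ennreal c * indicator It \<theta> * indicator Ir r \<le> ennreal (256 * 2 powr p / pi) * (ennreal (sig z (of_real r * cis \<theta>)) * osc r \<theta>)"
    proof (cases "\<theta> \<in> It \<and> r \<in> Ir")
      case True
      have cond: "norm (w - z) \<le> (1 - norm z) / 4" "norm z \<le> norm w" "norm w \<le> norm z + (1 - norm z) / 8"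
        using near[of r \<theta>] True unfolding w_def[symmetric] by (auto simp: It_def Ir_def nr d_def)
      note H = pk_Harnack[OF z cond] and s = sig_near[OF z cond]
      define J where "J = (\<integral>\<^sup>+t. ennreal (pk w t * norm (bdry (cis t) - f w) powr p) \<partial>circ)"
      \<comment> \<open>The exponent is negative and 1 - r is at most d, since the box lies on the
        outer side of \<open>z\<close>.\<close>
      have "d powr (\<alpha> - p) \<le> (1 - r) powr (\<alpha> - p)" using True r \<alpha> by (intro powr_mono2') (auto simp: Ir_def d_def)
      then have "ennreal c \<le> ennreal 64 * (ennreal (norm (out z) powr p) * ennreal ((1 - r) powr (\<alpha> - p)))"
        unfolding c_def by (simp only: ennreal_mult[symmetric] powr_ge_zero zero_le_numeral mult_nonneg_nonneg ennreal_leI mult_left_mono)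
      also have "\<dots> \<le> ennreal 64 * ((ennreal (2 powr p / pi) * J) * ennreal ((1 - r) powr (\<alpha> - p)))"
        unfolding J_def by (intro mult_left_mono mult_right_mono out_le_mean[OF z n fz H]) auto
      also have "\<dots> = ennreal 64 * ennreal (2 powr p / pi) * (J * ennreal ((1 - r) powr (\<alpha> - p)))" by (simp only: mult.assoc)
      also have "\<dots> \<le> ennreal 64 * ennreal (2 powr p / pi) * (ennreal 2 * osc r \<theta>)"
        unfolding J_def w_def by (intro mult_left_mono pk_osc r) auto
      also have "\<dots> = ennreal (128 * 2 powr p / pi) * (1 * osc r \<theta>)"
      proof -
        have "128 * 2 powr p / pi = 64 * (2 powr p / pi) * 2" by simp
        then have "ennreal (128 * 2 powr p / pi) = ennreal 64 * ennreal (2 powr p / pi) * ennreal 2"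
          by (simp only: ennreal_mult' ennreal_mult'' zero_le_numeral)
        then show ?thesis by (simp only: mult.assoc mult_1)
      qed
      also have "\<dots> \<le> ennreal (128 * 2 powr p / pi) * (ennreal (2 * sig z w) * osc r \<theta>)"
        using s by (intro mult_left_mono mult_right_mono) (auto simp flip: ennreal_1 intro!: ennreal_leI)
      also have "\<dots> = ennreal (256 * 2 powr p / pi) * (ennreal (sig z w) * osc r \<theta>)"
      proof -
        have "ennreal (2 * sig z w) = ennreal 2 * ennreal (sig z w)" using s by (intro ennreal_mult) auto
        moreover have "ennreal (256 * 2 powr p / pi) = ennreal (128 * 2 powr p / pi) * ennreal 2"
          by (subst ennreal_mult[symmetric]) auto
        ultimately show ?thesis by (simp only: mult.assoc)
      qed
      finally show ?thesis using True by (simp add: w_def)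
    qed auto
  qed
  also have "\<dots> = ennreal (256 * 2 powr p / pi) * (\<integral>\<^sup>+r. \<integral>\<^sup>+\<theta>. ennreal (sig z (of_real r * cis \<theta>)) * osc r \<theta> \<partial>circ \<partial>rad)"
    by (simp add: nn_integral_cmult)
  finally show ?thesis by (simp add: d_def)
qed

text \<open>Summing \<open>out_at_zero\<close> puts the sum of \<open>sig\<close> under the
  integral, where it is at most \<open>S\<close> at every point; what remains is the finite integral
  of \<open>osc\<close>, independent of the finite set of indices.\<close>

lemma out_summable:
  assumes S: "\<And>A w. finite A \<Longrightarrow> A \<subseteq> I \<Longrightarrow> norm w < 1 \<Longrightarrow> (\<Sum>n\<in>A. sig (z n) w) \<le> S"
    and z: "\<And>n. n \<in> I \<Longrightarrow> norm (z n) < 1" and fz: "\<And>n. n \<in> I \<Longrightarrow> f (z n) = 0"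
  shows "(\<lambda>n. norm (out (z n)) powr p * (1 - norm (z n)) powr (\<alpha> + 2 - p)) summable_on I"
proof (rule nonneg_bdd_above_summable_on)
  define T where "T n = norm (out (z n)) powr p * (1 - norm (z n)) powr (\<alpha> + 2 - p)" for n
  define k where "k = 256 * 2 powr p / pi"
  define B where "B = ennreal k * (ennreal S * (\<integral>\<^sup>+r. \<integral>\<^sup>+\<theta>. osc r \<theta> \<partial>circ \<partial>rad))"
  have B: "B < \<infinity>" unfolding B_def using osc_integral by (simp add: ennreal_mult_less_top)
  have "sum T A \<le> enn2real B" if A: "A \<subseteq> I" "finite A" for A
  proof -
    have "ennreal (sum T A) = (\<Sum>n\<in>A. ennreal (T n))" by (rule sum_ennreal[symmetric]) (simp add: T_def)
    also have "\<dots> \<le> (\<Sum>n\<in>A. ennreal k * (\<integral>\<^sup>+r. \<integral>\<^sup>+\<theta>. ennreal (sig (z n) (of_real r * cis \<theta>)) * osc r \<theta> \<partial>circ \<partial>rad))"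
      unfolding T_def k_def using A z fz by (intro sum_mono out_at_zero) auto
    also have "\<dots> = ennreal k * (\<integral>\<^sup>+r. \<integral>\<^sup>+\<theta>. (\<Sum>n\<in>A. ennreal (sig (z n) (of_real r * cis \<theta>)) * osc r \<theta>) \<partial>circ \<partial>rad)"
      by (simp add: sum_distrib_left[symmetric] nn_integral_sum)
    also have "\<dots> \<le> ennreal k * (\<integral>\<^sup>+r. \<integral>\<^sup>+\<theta>. ennreal S * osc r \<theta> \<partial>circ \<partial>rad)"
    proof (intro mult_left_mono nn_integral_rad_mono nn_integral_circ_mono)
      fix r \<theta> :: real assume r: "0 \<le> r" "r < 1"
      have n: "norm (of_real r * cis \<theta>) < 1" using r by (simp add: norm_mult)
      have "(\<Sum>n\<in>A. ennreal (sig (z n) (of_real r * cis \<theta>))) = ennreal (\<Sum>n\<in>A. sig (z n) (of_real r * cis \<theta>))"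
        using A z n by (intro sum_ennreal sig_nonneg) auto
      also have "\<dots> \<le> ennreal S" by (intro ennreal_leI S A n)
      finally have "(\<Sum>n\<in>A. ennreal (sig (z n) (of_real r * cis \<theta>))) * osc r \<theta> \<le> ennreal S * osc r \<theta>" by (rule mult_right_mono) simp
      then show "(\<Sum>n\<in>A. ennreal (sig (z n) (of_real r * cis \<theta>)) * osc r \<theta>) \<le> ennreal S * osc r \<theta>" by (simp only: sum_distrib_right)
    qed simp
    also have "\<dots> = B" unfolding B_def by (simp add: nn_integral_cmult)
    also have "\<dots> = ennreal (enn2real B)" using B by simp
    finally show ?thesis by (subst (asm) ennreal_le_iff) auto
  qed
  then show "bdd_above (sum (\<lambda>n. norm (out (z n)) powr p * (1 - norm (z n)) powr (\<alpha> + 2 - p)) ` {F. F \<subseteq> I \<and> finite F})"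
    unfolding T_def[abs_def] by (intro bdd_aboveI2) auto
qed simp

text \<open>Passing from the completed Lebesgue measure to the Borel one does not change the
  integral, because the integrand is Borel.\<close>

lemma out_eq_outer_fun: "out = outer_fun (\<lambda>w. norm (bdry w))"
proof
  fix z
  define g where "g t = (cis t + z) / (cis t - z) * of_real (u t)" for t
  have [measurable]: "g \<in> borel_measurable borel" unfolding g_def[abs_def] by measurable
  have "(LINT t:{0..2*pi}|lebesgue. g t) = (LINT t:{0..2*pi}|lborel. g t)"
    unfolding set_lebesgue_integral_def by (rule integral_completion) measurable
  also have "\<dots> = integral\<^sup>L circ g" unfolding circ_def by (rule integral_lint[symmetric]) auto
  finally show "out z = outer_fun (\<lambda>w. norm (bdry w)) z" by (simp add: out_def herg_def outer_fun_def g_def[abs_def] u_def)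
qed

lemma outer_weight_bdry: "outer_weight p (\<lambda>w. norm (bdry w))"
proof -
  have integ: "set_integrable lebesgue {0..2*pi} g" if "integrable circ g" for g :: "real \<Rightarrow> real"
  proof -
    have "g \<in> borel_measurable circ" using that by (rule borel_measurable_integrable)
    then have [measurable]: "g \<in> borel_measurable borel" by simp
    have "set_integrable lborel {0..2*pi} g" using that unfolding circ_def by (subst (asm) integrable_lint) auto
    then show ?thesis unfolding set_integrable_def by (subst integrable_completion) auto
  qed
  have "integrable circ (\<lambda>t. norm (bdry (cis t)) powr p)"
    by (rule integrableI_nonneg) (use bdry_powr_integral in auto)
  note this [THEN integ]
  moreover have "set_integrable lebesgue {0..2*pi} (\<lambda>t. ln (norm (bdry (cis t))))"
    using integ[OF integrable_u] by (simp add: u_def[abs_def])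
  moreover have "AE t in lebesgue. t \<in> {0..2*pi} \<longrightarrow> 0 < norm (bdry (cis t))"
  proof (rule AE_completion)
    have "AE t in lborel. t \<in> {0..2*pi} \<longrightarrow> bdry (cis t) \<noteq> 0"
      using AE_bdry_nonzero unfolding circ_def by (subst (asm) AE_lint) auto
    then show "AE t in lborel. t \<in> {0..2*pi} \<longrightarrow> 0 < norm (bdry (cis t))" by simp
  qed
  moreover have "set_borel_measurable lebesgue {0..2*pi} (\<lambda>t. norm (bdry (cis t)))"
    unfolding set_borel_measurable_def by (rule measurable_completion) measurable
  ultimately show ?thesis by (simp add: outer_weight_def)
qed

end

theorem corollary9:
  fixes p \<alpha> :: real and I :: "nat set" and z :: "nat \<Rightarrow> complex"
  assumes "1 < p" and "p - 2 < \<alpha>" and "\<alpha> < p - 1"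
    and "Carleson_Newman I z"
  shows "zero_set_of_space (Besov_Hardy_space p \<alpha>) I z \<longleftrightarrow>
    (\<exists>\<phi>. outer_weight p \<phi> \<and> outer_fun \<phi> \<in> Besov_Hardy_space p \<alpha> \<and>
      (\<lambda>n. norm (outer_fun \<phi> (z n)) powr p * (1 - norm (z n)) powr (\<alpha> + 2 - p)) summable_on I)"
proof -
  obtain S where "S \<ge> 0"
    and S: "\<And>A w. finite A \<Longrightarrow> A \<subseteq> I \<Longrightarrow> norm w < 1 \<Longrightarrow> (\<Sum>n\<in>A. sig (z n) w) \<le> S"
    and z: "\<And>n. n \<in> I \<Longrightarrow> norm (z n) < 1"
    by (rule Carleson_Newman_sig_bound[OF assms(4)], rule that)
  show ?thesis
  proof
    assume "zero_set_of_space (Besov_Hardy_space p \<alpha>) I z"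
    then obtain f z0 where f: "f \<in> Besov_Hardy_space p \<alpha>" and z0: "z0 \<in> unit_disc" "f z0 \<noteq> 0" and zs: "zero_sequence_of I z f"
      unfolding zero_set_of_space_def by blast
    have fz: "f (z n) = 0" if "n \<in> I" for n using zs that unfolding zero_sequence_of_def by blast
    \<comment> \<open>The point \<open>z0\<close> outside the zero set makes ln |bdry| integrable,
      so that |bdry| is an admissible weight.\<close>
    interpret besov_fn_nonzero p \<alpha> f z0 by unfold_locales (use assms f z0 in auto)
    show "\<exists>\<phi>. outer_weight p \<phi> \<and> outer_fun \<phi> \<in> Besov_Hardy_space p \<alpha> \<and>
      (\<lambda>n. norm (outer_fun \<phi> (z n)) powr p * (1 - norm (z n)) powr (\<alpha> + 2 - p)) summable_on I"
      by (intro exI[of _ "\<lambda>w. norm (bdry w)"] conjI outer_weight_bdry)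
         (unfold out_eq_outer_fun[symmetric], rule out_Besov, rule out_summable[OF S z fz])
  next
    assume "\<exists>\<phi>. outer_weight p \<phi> \<and> outer_fun \<phi> \<in> Besov_Hardy_space p \<alpha> \<and>
      (\<lambda>n. norm (outer_fun \<phi> (z n)) powr p * (1 - norm (z n)) powr (\<alpha> + 2 - p)) summable_on I"
    then obtain \<phi> where O: "outer_fun \<phi> \<in> Besov_Hardy_space p \<alpha>"
      and sm: "(\<lambda>n. norm (outer_fun \<phi> (z n)) powr p * (1 - norm (z n)) powr (\<alpha> + 2 - p)) summable_on I" by blast
    have bs: "blaschke_sequence I z"
    proof
      show "norm (z n) < 1" if "n \<in> I" for n by (rule z[OF that])
      \<comment> \<open>The Blaschke condition is the bound on the sums of \<open>sig\<close> at the
        origin: there \<open>sig (z n) 0\<close> is 1 - |z_n|^2, which is at least 1 -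
        |z_n|.\<close>
      show "summable (\<lambda>n. if n \<in> I then 1 - norm (z n) else 0)"
      proof (rule summableI_nonneg_bounded)
        show "0 \<le> (if n \<in> I then 1 - norm (z n) else 0)" for n using z[of n] by auto
        fix N
        have "(\<Sum>n<N. if n \<in> I then 1 - norm (z n) else 0) = (\<Sum>n\<in>{..<N} \<inter> I. 1 - norm (z n))"
          by (rule sum.inter_restrict[symmetric]) simp
        also have "\<dots> \<le> (\<Sum>n\<in>{..<N} \<inter> I. sig (z n) 0)"
        proof (rule sum_mono)
          fix n assume "n \<in> {..<N} \<inter> I"
          then have "norm (z n) < 1" using z by blast
          then show "1 - norm (z n) \<le> sig (z n) 0" by (simp add: sig_def power2_eq_square mult_left_le)
        qed
        also have "\<dots> \<le> S" by (rule S) auto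
        finally show "(\<Sum>n<N. if n \<in> I then 1 - norm (z n) else 0) \<le> S" .
      qed
    qed
    interpret blaschke_sequence I z by (rule bs)
    have hO: "outer_fun \<phi> holomorphic_on ball 0 1" using O by (simp add: Besov_Hardy_space_def Hardy_space_def)
    have nzO: "outer_fun \<phi> w \<noteq> 0" for w by (simp add: outer_fun_def)
    \<comment> \<open>A countable set of zeros cannot fill the disc, which provides a point where
      the product with the zero-free outer function does not vanish.\<close>
    have "uncountable (ball (0::complex) 1)" by (rule uncountable_ball) simp
    moreover have "countable (z ` I)" by simp
    ultimately have "\<not> ball 0 1 \<subseteq> z ` I" using countable_subset by blast
    then obtain w where w: "w \<in> unit_disc" "w \<notin> z ` I" by blast
    have "zero_sequence_of I z (\<lambda>w. outer_fun \<phi> w * Blaschke I z w)" by (rule zero_sequence_mult[OF hO nzO])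
    moreover have "(\<lambda>w. outer_fun \<phi> w * Blaschke I z w) \<in> Besov_Hardy_space p \<alpha>"
      by (rule Besov_mult_Blaschke[OF assms(1-3) O bs S sm])
    moreover have "outer_fun \<phi> w * Blaschke I z w \<noteq> 0" using w nzO zero_iff[of w] by simp
    ultimately show "zero_set_of_space (Besov_Hardy_space p \<alpha>) I z"
      unfolding zero_set_of_space_def using w(1)
      by (intro bexI[of _ "\<lambda>w. outer_fun \<phi> w * Blaschke I z w"] conjI bexI[of _ w])
  qed
qed

end
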